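(* Let $R=\bigoplus_{\sigma\in\mathbb{Z}^2}R_\sigma$ be a strongly $\mathbb{Z}^2$-graded ring, and let $C$ be a bounded chain complex of finitely generated free (right) $R$-modules. The complex $C$ is $R_{(0,0)}$-finitely dominated if and only if all of the following eight complexes have vanishing homology in all degrees: $$C\otimes_R R_*[x,x^{-1}]((y)),\quad C\otimes_R R_*[x,x^{-1}]((y^{-1})),\quad C\otimes_R R_*[y,y^{-1}]((x)),\quad C\otimes_R R_*[y,y^{-1}]((x^{-1})),$$ $$C\otimes_R R_*((x,y)),\quad C\otimes_R R_*((x^{-1},y^{-1})),\quad C\otimes_R R_*((x,y^{-1})),\quad C\otimes_R R_*((x^{-1},y)).$$
   Context: Rings are unital; modules are right modules. A $\mathbb{Z}^2$-graded ring is a ring $R$ with a decomposition $R=\bigoplus_{\sigma\in\mathbb{Z}^2}R_\sigma$ into additive subgroups with $R_\kappa R_\lambda\subseteq R_{\kappa+\lambda}$, where $R_\kappa R_\lambda$ denotes the set of finite sums of products $ab$ with $a\in R_\kappa$, $b\in R_\lambda$. It is strongly graded if $R_\kappa R_\lambda=R_{\kappa+\lambda}$ for all $\kappa,\lambda\in\mathbb{Z}^2$. For a subring $K$ of a ring $L$, a bounded chain complex of $L$-modules is $K$-finitely dominated if, considered as a complex of $K$-modules, it is a retract up to homotopy of a bounded complex of finitely generated free $K$-modules; equivalently, if it is chain homotopy equivalent, as a complex of $K$-modules, to a bounded complex of finitely generated projective $K$-modules. The Novikov-type rings are (with multiplication extending that of $R$, as for formal Laurent series; the symbols $x,y$ are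 purely notational in the names of the rings, and $a,b$ below denote integers): $R_*[x,x^{-1}]((y))=\bigcup_{n\ge0}\prod_{b\ge-n}\bigoplus_{a\in\mathbb{Z}}R_{(a,b)}$, $R_*[x,x^{-1}]((y^{-1}))=\bigcup_{n\ge0}\prod_{b\ge-n}\bigoplus_{a\in\mathbb{Z}}R_{(a,-b)}$, $R_*[y,y^{-1}]((x))=\bigcup_{n\ge0}\prod_{a\ge-n}\bigoplus_{b\in\mathbb{Z}}R_{(a,b)}$, $R_*[y,y^{-1}]((x^{-1}))=\bigcup_{n\ge0}\prod_{a\ge-n}\bigoplus_{b\in\mathbb{Z}}R_{(-a,b)}$, $R_*((x,y))=\bigcup_{n\ge0}\prod_{a,b\ge-n}R_{(a,b)}$, $R_*((x,y^{-1}))=\bigcup_{n\ge0}\prod_{a,b\ge-n}R_{(a,-b)}$, $R_*((x^{-1},y^{-1}))=\bigcup_{n\ge0}\prod_{a,b\ge-n}R_{(-a,-b)}$, $R_*((x^{-1},y))=\bigcup_{n\ge0}\prod_{a,b\ge-n}R_{(-a,b)}$. Each contains $R$ as a subring. *)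

theory Defs
  imports "HOL-Algebra.Free_Abelian_Groups" "HOL-Algebra.Ideal_Product" "HOL-Library.Product_Plus"
begin

subsection \<open>Strongly \<open>\<int>\<^sup>2\<close>-graded rings\<close>

definition graded_families ::
    "('a, 'm) ring_scheme \<Rightarrow> (int \<times> int \<Rightarrow> 'a set) \<Rightarrow> (int \<times> int \<Rightarrow> 'a) set" where
  "graded_families R Rg =
     {f. (\<forall>\<sigma>. f \<sigma> \<in> Rg \<sigma>) \<and> finite {\<sigma>. f \<sigma> \<noteq> \<zero>\<^bsub>R\<^esub>}}"

definition graded_sum :: "('a, 'm) ring_scheme \<Rightarrow> (int \<times> int \<Rightarrow> 'a) \<Rightarrow> 'a" where
  "graded_sum R f = (\<Oplus>\<^bsub>R\<^esub>\<sigma>\<in>{\<sigma>. f \<sigma> \<noteq> \<zero>\<^bsub>R\<^esub>}. f \<sigma>)"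

text \<open>For arbitrary subsets \<open>I\<close>, \<open>J\<close>, the library constant \<^const>\<open>ideal_prod\<close> yields the set of all
  finite nonempty sums of products \<open>i \<otimes> j\<close> with \<open>i \<in> I\<close> and \<open>j \<in> J\<close>; it is used here for
  additive subgroups, which need not be ideals.\<close>

locale graded_ring = ring R for R (structure) +
  fixes Rg :: "int \<times> int \<Rightarrow> 'a set"
  assumes component_subgroup: "additive_subgroup (Rg \<sigma>) R"
    and direct_sum: "bij_betw (graded_sum R) (graded_families R Rg) (carrier R)"
    and component_prod: "ideal_prod R (Rg \<kappa>) (Rg \<mu>) \<subseteq> Rg (\<kappa> + \<mu>)"

locale strongly_graded_ring = graded_ring +
  assumes strong: "ideal_prod R (Rg \<kappa>) (Rg \<mu>) = Rg (\<kappa> + \<mu>)"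

definition graded_components ::
    "('a, 'm) ring_scheme \<Rightarrow> (int \<times> int \<Rightarrow> 'a set) \<Rightarrow> 'a \<Rightarrow> int \<times> int \<Rightarrow> 'a" where
  "graded_components R Rg = the_inv_into (graded_families R Rg) (graded_sum R)"


subsection \<open>Novikov-type rings\<close>

text \<open>The elements are families of homogeneous elements whose support belongs to a prescribed
  collection \<open>\<S>\<close> of subsets of \<open>\<int>\<^sup>2\<close>. For the collections below the sum defining a component of a
  product has only finitely many nonzero terms. The ring \<open>R\<close> is embedded by
  \<^const>\<open>graded_components\<close>.\<close>

definition novikov_ring ::
    "('a, 'm) ring_scheme \<Rightarrow> (int \<times> int \<Rightarrow> 'a set) \<Rightarrow> (int \<times> int) set set \<Rightarrow> (int \<times> int \<Rightarrow> 'a) ring" where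
  "novikov_ring R Rg \<S> =
     \<lparr>carrier = {f. (\<forall>\<sigma>. f \<sigma> \<in> Rg \<sigma>) \<and> {\<sigma>. f \<sigma> \<noteq> \<zero>\<^bsub>R\<^esub>} \<in> \<S>},
      monoid.mult = (\<lambda>f g \<sigma>.
        \<Oplus>\<^bsub>R\<^esub>\<kappa>\<in>{\<kappa>. f \<kappa> \<otimes>\<^bsub>R\<^esub> g (\<sigma> - \<kappa>) \<noteq> \<zero>\<^bsub>R\<^esub>}. f \<kappa> \<otimes>\<^bsub>R\<^esub> g (\<sigma> - \<kappa>)),
      one = (\<lambda>\<sigma>. if \<sigma> = (0, 0) then \<one>\<^bsub>R\<^esub> else \<zero>\<^bsub>R\<^esub>),
      zero = (\<lambda>\<sigma>. \<zero>\<^bsub>R\<^esub>),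
      add = (\<lambda>f g \<sigma>. f \<sigma> \<oplus>\<^bsub>R\<^esub> g \<sigma>)\<rparr>"

text \<open>The parameters \<open>\<epsilon>\<close> and \<open>\<delta>\<close> are the exponents \<open>\<plusminus>1\<close> carried by the formal symbols:
  \<open>supports_y \<epsilon>\<close> is for \<open>R\<^sub>*[x,x\<^sup>-\<^sup>1]((y\<^sup>\<epsilon>))\<close>, \<open>supports_x \<epsilon>\<close> for \<open>R\<^sub>*[y,y\<^sup>-\<^sup>1]((x\<^sup>\<epsilon>))\<close>, and
  \<open>supports_xy \<epsilon> \<delta>\<close> for \<open>R\<^sub>*((x\<^sup>\<epsilon>,y\<^sup>\<delta>))\<close>.\<close>

definition supports_y :: "int \<Rightarrow> (int \<times> int) set set" where
  "supports_y \<epsilon> = {T. \<exists>n::nat. T \<subseteq> {(a, \<epsilon> * b) | a b. b \<ge> - int n} \<and> (\<forall>b. finite {a. (a, b) \<in> T})}"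

definition supports_x :: "int \<Rightarrow> (int \<times> int) set set" where
  "supports_x \<epsilon> = {T. \<exists>n::nat. T \<subseteq> {(\<epsilon> * a, b) | a b. a \<ge> - int n} \<and> (\<forall>a. finite {b. (a, b) \<in> T})}"

definition supports_xy :: "int \<Rightarrow> int \<Rightarrow> (int \<times> int) set set" where
  "supports_xy \<epsilon> \<delta> =
     {T. \<exists>n::nat. T \<subseteq> {(\<epsilon> * a, \<delta> * b) | a b. a \<ge> - int n \<and> b \<ge> - int n}}"


subsection \<open>Right modules\<close>

text \<open>As for the modules of the library, the fields \<open>mult\<close> and \<open>one\<close> inherited from the ring record
  are ignored. Restriction of scalars to a subring with carrier \<open>K\<close> leaves the module record
  unchanged and only replaces the ring \<open>R\<close> by \<open>R\<lparr>carrier := K\<rparr>\<close>.\<close>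

record ('a, 'b) rmodule = "'b ring" +
  rsmult :: "'b \<Rightarrow> 'a \<Rightarrow> 'b" (infixl \<open>\<odot>\<^sub>r\<index>\<close> 70)

locale right_module = R: ring R + M: abelian_group M
  for R :: "('a, 'm) ring_scheme" and M :: "('a, 'b, 'n) rmodule_scheme" +
  assumes rsmult_closed:
      "\<lbrakk>x \<in> carrier M; r \<in> carrier R\<rbrakk> \<Longrightarrow> x \<odot>\<^sub>r\<^bsub>M\<^esub> r \<in> carrier M"
    and rsmult_add_left:
      "\<lbrakk>x \<in> carrier M; y \<in> carrier M; r \<in> carrier R\<rbrakk>
        \<Longrightarrow> (x \<oplus>\<^bsub>M\<^esub> y) \<odot>\<^sub>r\<^bsub>M\<^esub> r = x \<odot>\<^sub>r\<^bsub>M\<^esub> r \<oplus>\<^bsub>M\<^esub> y \<odot>\<^sub>r\<^bsub>M\<^esub> r"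
    and rsmult_add_right:
      "\<lbrakk>x \<in> carrier M; r \<in> carrier R; s \<in> carrier R\<rbrakk>
        \<Longrightarrow> x \<odot>\<^sub>r\<^bsub>M\<^esub> (r \<oplus>\<^bsub>R\<^esub> s) = x \<odot>\<^sub>r\<^bsub>M\<^esub> r \<oplus>\<^bsub>M\<^esub> x \<odot>\<^sub>r\<^bsub>M\<^esub> s"
    and rsmult_assoc:
      "\<lbrakk>x \<in> carrier M; r \<in> carrier R; s \<in> carrier R\<rbrakk>
        \<Longrightarrow> x \<odot>\<^sub>r\<^bsub>M\<^esub> (r \<otimes>\<^bsub>R\<^esub> s) = (x \<odot>\<^sub>r\<^bsub>M\<^esub> r) \<odot>\<^sub>r\<^bsub>M\<^esub> s"
    and rsmult_one:
      "x \<in> carrier M \<Longrightarrow> x \<odot>\<^sub>r\<^bsub>M\<^esub> \<one>\<^bsub>R\<^esub> = x"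

definition rmodule_hom ::
    "('a, 'm) ring_scheme \<Rightarrow> ('a, 'b, 'n) rmodule_scheme \<Rightarrow> ('a, 'c, 'k) rmodule_scheme \<Rightarrow> ('b \<Rightarrow> 'c) set" where
  "rmodule_hom R M N =
     {f \<in> carrier M \<rightarrow> carrier N.
        (\<forall>x\<in>carrier M. \<forall>y\<in>carrier M. f (x \<oplus>\<^bsub>M\<^esub> y) = f x \<oplus>\<^bsub>N\<^esub> f y) \<and>
        (\<forall>x\<in>carrier M. \<forall>r\<in>carrier R. f (x \<odot>\<^sub>r\<^bsub>M\<^esub> r) = f x \<odot>\<^sub>r\<^bsub>N\<^esub> r)}"

definition fg_free :: "('a, 'm) ring_scheme \<Rightarrow> ('a, 'b, 'n) rmodule_scheme \<Rightarrow> bool" where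
  "fg_free R M \<longleftrightarrow>
     (\<exists>B. finite B \<and> B \<subseteq> carrier M \<and>
        bij_betw (\<lambda>c. \<Oplus>\<^bsub>M\<^esub>b\<in>B. b \<odot>\<^sub>r\<^bsub>M\<^esub> c b) (B \<rightarrow>\<^sub>E carrier R) (carrier M))"


subsection \<open>Chain complexes and finite domination\<close>

definition chain_complex ::
    "('a, 'm) ring_scheme \<Rightarrow> (int \<Rightarrow> ('a, 'b, 'n) rmodule_scheme) \<Rightarrow> (int \<Rightarrow> 'b \<Rightarrow> 'b) \<Rightarrow> bool" where
  "chain_complex R C d \<longleftrightarrow>
     (\<forall>n. right_module R (C n)) \<and>
     (\<forall>n. d n \<in> rmodule_hom R (C n) (C (n - 1))) \<and>
     (\<forall>n. \<forall>x\<in>carrier (C n). d (n - 1) (d n x) = \<zero>\<^bsub>C (n - 2)\<^esub>)"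

definition bounded_complex :: "(int \<Rightarrow> ('a, 'b, 'n) rmodule_scheme) \<Rightarrow> bool" where
  "bounded_complex C \<longleftrightarrow> finite {n. carrier (C n) \<noteq> {\<zero>\<^bsub>C n\<^esub>}}"

definition chain_map ::
    "('a, 'm) ring_scheme \<Rightarrow> (int \<Rightarrow> ('a, 'b, 'n) rmodule_scheme) \<Rightarrow> (int \<Rightarrow> 'b \<Rightarrow> 'b) \<Rightarrow>
     (int \<Rightarrow> ('a, 'c, 'k) rmodule_scheme) \<Rightarrow> (int \<Rightarrow> 'c \<Rightarrow> 'c) \<Rightarrow> (int \<Rightarrow> 'b \<Rightarrow> 'c) \<Rightarrow> bool" where
  "chain_map R C d D e f \<longleftrightarrow>
     (\<forall>n. f n \<in> rmodule_hom R (C n) (D n)) \<and>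
     (\<forall>n. \<forall>x\<in>carrier (C n). f (n - 1) (d n x) = e n (f n x))"

definition chain_homotopic ::
    "('a, 'm) ring_scheme \<Rightarrow> (int \<Rightarrow> ('a, 'b, 'n) rmodule_scheme) \<Rightarrow> (int \<Rightarrow> 'b \<Rightarrow> 'b) \<Rightarrow>
     (int \<Rightarrow> ('a, 'c, 'k) rmodule_scheme) \<Rightarrow> (int \<Rightarrow> 'c \<Rightarrow> 'c) \<Rightarrow>
     (int \<Rightarrow> 'b \<Rightarrow> 'c) \<Rightarrow> (int \<Rightarrow> 'b \<Rightarrow> 'c) \<Rightarrow> bool" where
  "chain_homotopic R C d D e f g \<longleftrightarrow>
     (\<exists>h. (\<forall>n. h n \<in> rmodule_hom R (C n) (D (n + 1))) \<and>
          (\<forall>n. \<forall>x\<in>carrier (C n).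
             f n x \<ominus>\<^bsub>D n\<^esub> g n x = e (n + 1) (h n x) \<oplus>\<^bsub>D n\<^esub> h (n - 1) (d n x)))"

text \<open>The dominating complex \<open>D\<close> is sought among modules with elements of type \<open>nat \<Rightarrow> 'a\<close>. This is
  no restriction: every finitely generated free \<open>K\<close>-module is isomorphic to one with carrier
  \<open>{..<n} \<rightarrow>\<^sub>E carrier K\<close>.\<close>

definition finitely_dominated ::
    "('a, 'm) ring_scheme \<Rightarrow> (int \<Rightarrow> ('a, 'b, 'n) rmodule_scheme) \<Rightarrow> (int \<Rightarrow> 'b \<Rightarrow> 'b) \<Rightarrow> bool" where
  "finitely_dominated K C d \<longleftrightarrow>
     (\<exists>(D :: int \<Rightarrow> ('a, nat \<Rightarrow> 'a) rmodule) e f g.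
        chain_complex K D e \<and> bounded_complex D \<and> (\<forall>n. fg_free K (D n)) \<and>
        chain_map K C d D e f \<and> chain_map K D e C d g \<and>
        chain_homotopic K C d C d (\<lambda>n x. g n (f n x)) (\<lambda>n x. x))"


subsection \<open>Tensor products and homology\<close>

text \<open>For a right \<open>R\<close>-module \<open>M\<close> and a ring homomorphism \<open>\<iota>\<close> from \<open>R\<close> to \<open>S\<close>, the group underlying
  \<open>M \<otimes>\<^sub>R S\<close> is the free abelian group on pairs modulo the usual relations. Its \<open>S\<close>-module structure is
  not needed to express vanishing of homology.\<close>

definition tensor_free ::
    "('a, 'b, 'n) rmodule_scheme \<Rightarrow> ('s, 'k) ring_scheme \<Rightarrow> ('b \<times> 's \<Rightarrow>\<^sub>0 int) monoid" where
  "tensor_free M S = free_Abelian_group (carrier M \<times> carrier S)"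

definition tensor_relations ::
    "('a, 'm) ring_scheme \<Rightarrow> ('a, 'b, 'n) rmodule_scheme \<Rightarrow> ('s, 'k) ring_scheme \<Rightarrow> ('a \<Rightarrow> 's) \<Rightarrow>
     ('b \<times> 's \<Rightarrow>\<^sub>0 int) set" where
  "tensor_relations R M S \<iota> = generate (tensor_free M S)
     ({frag_of (x \<oplus>\<^bsub>M\<^esub> y, s) - frag_of (x, s) - frag_of (y, s) | x y s.
         x \<in> carrier M \<and> y \<in> carrier M \<and> s \<in> carrier S} \<union>
      {frag_of (x, s \<oplus>\<^bsub>S\<^esub> t) - frag_of (x, s) - frag_of (x, t) | x s t.
         x \<in> carrier M \<and> s \<in> carrier S \<and> t \<in> carrier S} \<union>
      {frag_of (x \<odot>\<^sub>r\<^bsub>M\<^esub> r, s) - frag_of (x, \<iota> r \<otimes>\<^bsub>S\<^esub> s) | x r s.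
         x \<in> carrier M \<and> r \<in> carrier R \<and> s \<in> carrier S})"

definition tensor_group ::
    "('a, 'm) ring_scheme \<Rightarrow> ('a, 'b, 'n) rmodule_scheme \<Rightarrow> ('s, 'k) ring_scheme \<Rightarrow> ('a \<Rightarrow> 's) \<Rightarrow>
     ('b \<times> 's \<Rightarrow>\<^sub>0 int) set monoid" where
  "tensor_group R M S \<iota> = tensor_free M S Mod tensor_relations R M S \<iota>"

text \<open>The map \<open>f \<otimes> id\<close> from \<open>M \<otimes>\<^sub>R S\<close> to \<open>N \<otimes>\<^sub>R S\<close>, on cosets.\<close>

definition tensor_map ::
    "('a, 'm) ring_scheme \<Rightarrow> ('a, 'c, 'n) rmodule_scheme \<Rightarrow> ('s, 'k) ring_scheme \<Rightarrow> ('a \<Rightarrow> 's) \<Rightarrow>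
     ('b \<Rightarrow> 'c) \<Rightarrow> ('b \<times> 's \<Rightarrow>\<^sub>0 int) set \<Rightarrow> ('c \<times> 's \<Rightarrow>\<^sub>0 int) set" where
  "tensor_map R N S \<iota> f X =
     the_elem ((\<lambda>z. tensor_relations R N S \<iota> #>\<^bsub>tensor_free N S\<^esub>
                      frag_extend (\<lambda>(x, s). frag_of (f x, s)) z) ` X)"

definition homology_group ::
    "(int \<Rightarrow> 'g monoid) \<Rightarrow> (int \<Rightarrow> 'g \<Rightarrow> 'g) \<Rightarrow> int \<Rightarrow> 'g set monoid" where
  "homology_group G \<delta> n =
     (G n)\<lparr>carrier := kernel (G n) (G (n - 1)) (\<delta> n)\<rparr> Mod (\<delta> (n + 1) ` carrier (G (n + 1)))"

definition tensor_acyclic ::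
    "('a, 'm) ring_scheme \<Rightarrow> (int \<Rightarrow> ('a, 'b, 'n) rmodule_scheme) \<Rightarrow> (int \<Rightarrow> 'b \<Rightarrow> 'b) \<Rightarrow>
     ('s, 'k) ring_scheme \<Rightarrow> ('a \<Rightarrow> 's) \<Rightarrow> bool" where
  "tensor_acyclic R C d S \<iota> \<longleftrightarrow>
     (\<forall>n. trivial_group (homology_group (\<lambda>k. tensor_group R (C k) S \<iota>)
            (\<lambda>k. tensor_map R (C (k - 1)) S \<iota> (d k)) n))"

definition novikov_acyclic ::
    "('a, 'm) ring_scheme \<Rightarrow> (int \<times> int \<Rightarrow> 'a set) \<Rightarrow>
     (int \<Rightarrow> ('a, 'b, 'n) rmodule_scheme) \<Rightarrow> (int \<Rightarrow> 'b \<Rightarrow> 'b) \<Rightarrow> (int \<times> int) set set \<Rightarrow> bool" where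
  "novikov_acyclic R Rg C d \<S> \<longleftrightarrow>
     tensor_acyclic R C d (novikov_ring R Rg \<S>) (graded_components R Rg)"

end

(* The components of the elements of C with respect to a homogeneous basis turn a complex over R into
   families indexed by basis elements and degrees in Z^2, and the tensor product with a Novikov-type
   ring into the families whose supports are of the prescribed shape; the differential and the module
   maps become translation invariant kernels.

   If the eight complexes are acyclic, they are contractible by kernels with supports of these shapes.
   The contractions over the rings for y and y^-1 agree, up to a boundary given by products with the
   contractions over the other six rings, outside a strip around the x-axis and a bounded set. Cutting
   along half planes and gluing gives an R_0-linear homotopy on C from the identity to a map with
   values in degrees in a finite window, and a window in C is a finitely generated projective
   R_0-module, because R is strongly graded.

   Conversely, finite domination gives an R_0-linear homotopy from the identity to a map with values in
   a finite window. Translating it by tau and correcting it on basis elements by induction on the chain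
   degree gives R-linear maps G with 1 - dG - Gd of degrees in E + tau, where the finite set E does not
   depend on tau. For a suitable tau the geometric series of 1 - dG - Gd converges over a given
   Novikov-type ring, and composed with G it exhibits every cycle as a boundary. *)

theory Submission
  imports Defs
begin

subsection \<open>Finitely supported sums\<close>

text \<open>The contractions over the rings for y and y^-1 cannot be multiplied: a degree may be a
  sum of one degree from each support in infinitely many ways. Hence the detour through (x^e, y),
  x^e and (x^e, y^-1). These directions run around half of a circle, and for neighbours the product
  of the contractions makes sense and is a homotopy between them. There are two ways around, e = 1
  and e = -1; each yields a homotopy known to be finite only in one half of the strip around the
  x-axis. They are glued along the y-axis, and their difference survives there as an error. Since
  the differential has finitely many degrees, this error lies near both axes, in a box that is the
  same for all elements. Cutting commutes with multiplication by R_0 but not by R, so only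
  R_0-linearity is left. Strong grading enters through equations 1 = \<Sum> u v with u in R_\<sigma>
  and v in R_-\<sigma>: they make windows projective and move a homotopy to other degrees. In the
  converse, one translate of E lies in an open quadrant, so a single G serves the three rings
  attached to that quadrant.\<close>

definition fsum :: "('a, 'm) ring_scheme \<Rightarrow> ('i \<Rightarrow> 'a) \<Rightarrow> 'a" where
  "fsum G f = finsum G f {i. f i \<noteq> \<zero>\<^bsub>G\<^esub>}"

context abelian_monoid
begin

lemma fsum_eq_finsum:
  assumes "finite A" "\<And>i. f i \<in> carrier G" "\<And>i. i \<notin> A \<Longrightarrow> f i = \<zero>"
  shows "fsum G f = finsum G f A"
  unfolding fsum_def
  by (rule add.finprod_mono_neutral_cong_left) (use assms in \<open>auto simp: Pi_def\<close>)

lemma fsum_closed [simp, intro]: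
  "(\<And>i. f i \<in> carrier G) \<Longrightarrow> fsum G f \<in> carrier G"
  unfolding fsum_def by (rule finsum_closed) auto

lemma fsum_zero [simp]: "fsum G (\<lambda>i. \<zero>) = \<zero>"
  by (simp add: fsum_def)

lemma fsum_single:
  assumes "f i \<in> carrier G" "\<And>j. j \<noteq> i \<Longrightarrow> f j = \<zero>"
  shows "fsum G f = f i"
proof -
  have *: "f j \<in> carrier G" for j
    using assms by (cases "j = i") auto
  have "fsum G f = finsum G f {i}"
    by (rule fsum_eq_finsum) (use * assms in auto)
  also have "\<dots> = f i"
    using * by simp
  finally show ?thesis .
qed

text \<open>Over an infinite support \<open>finsum\<close>, and hence \<open>fsum\<close>, is zero
  by convention. This value is closed and invariant under bijections, so closure and reindexing hold
  without finiteness, but additivity does not.\<close>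

lemma fsum_add:
  assumes "\<And>i. f i \<in> carrier G" "\<And>i. g i \<in> carrier G"
    and "finite {i. f i \<noteq> \<zero>}" "finite {i. g i \<noteq> \<zero>}"
  shows "fsum G (\<lambda>i. f i \<oplus> g i) = fsum G f \<oplus> fsum G g"
proof -
  let ?A = "{i. f i \<noteq> \<zero>} \<union> {i. g i \<noteq> \<zero>}"
  have "fsum G (\<lambda>i. f i \<oplus> g i) = finsum G (\<lambda>i. f i \<oplus> g i) ?A"
    by (rule fsum_eq_finsum) (use assms in auto)
  also have "\<dots> = finsum G f ?A \<oplus> finsum G g ?A"
    by (rule finsum_addf) (use assms in auto)
  also have "finsum G f ?A = fsum G f"
    by (rule fsum_eq_finsum [symmetric]) (use assms in auto)
  also have "finsum G g ?A = fsum G g"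
    by (rule fsum_eq_finsum [symmetric]) (use assms in auto)
  finally show ?thesis .
qed

lemma fsum_reindex:
  assumes "bij h" "\<And>i. f i \<in> carrier G"
  shows "fsum G (\<lambda>i. f (h i)) = fsum G f"
proof -
  have "{i. f i \<noteq> \<zero>} = h ` {i. f (h i) \<noteq> \<zero>}"
    using assms(1) by (auto simp: bij_def image_iff surj_def)
  moreover have "inj_on h {i. f (h i) \<noteq> \<zero>}"
    using assms(1) by (auto simp: bij_def inj_on_def)
  ultimately show ?thesis
    unfolding fsum_def using assms(2) by (simp add: add.finprod_reindex)
qed

lemma finsum_Times:
  assumes "finite A" "finite B" "\<And>p. f p \<in> carrier G"
  shows "finsum G f (A \<times> B) = finsum G (\<lambda>i. finsum G (\<lambda>j. f (i, j)) B) A"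
  using assms(1)
proof (induction A)
  case empty
  then show ?case by simp
next
  case (insert a A)
  have "insert a A \<times> B = Pair a ` B \<union> A \<times> B" by auto
  moreover have "Pair a ` B \<inter> A \<times> B = {}" using insert by auto
  moreover have "finsum G f (Pair a ` B) = finsum G (\<lambda>j. f (a, j)) B"
    by (rule add.finprod_reindex) (auto simp: inj_on_def assms)
  ultimately show ?case
    using insert assms by (simp add: add.finprod_Un_disjoint Pi_def)
qed

text \<open>The two projections of the support span a finite rectangle \<open>A \<times> B\<close>;
  on it the claim is the one about iterated finite sums.\<close>

lemma fsum_Pair:
  assumes "\<And>i j. f i j \<in> carrier G" "finite {(i, j). f i j \<noteq> \<zero>}"
  shows "fsum G (\<lambda>i. fsum G (f i)) = fsum G (\<lambda>(i, j). f i j)"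
proof -
  define A where "A = fst ` {(i, j). f i j \<noteq> \<zero>}"
  define B where "B = snd ` {(i, j). f i j \<noteq> \<zero>}"
  have fin: "finite A" "finite B" using assms(2) by (auto simp: A_def B_def)
  have zA: "f i j = \<zero>" if "i \<notin> A" for i j
    using that unfolding A_def by force
  have zB: "f i j = \<zero>" if "j \<notin> B" for i j
    using that unfolding B_def by force
  have "fsum G (\<lambda>(i, j). f i j) = finsum G (\<lambda>(i, j). f i j) (A \<times> B)"
    by (rule fsum_eq_finsum) (use fin zA zB assms(1) in auto)
  also have "\<dots> = finsum G (\<lambda>i. finsum G (f i) B) A"
    using finsum_Times [OF fin, of "\<lambda>(i, j). f i j"] assms(1) by auto
  also have "(\<lambda>i. finsum G (f i) B) = (\<lambda>i. fsum G (f i))"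
    by (intro ext fsum_eq_finsum [symmetric]) (use fin zB assms(1) in auto)
  also have "finsum G (\<lambda>i. fsum G (f i)) A = fsum G (\<lambda>i. fsum G (f i))"
  proof (rule fsum_eq_finsum [symmetric])
    fix i assume "i \<notin> A"
    then have "f i = (\<lambda>j. \<zero>)" using zA by auto
    then show "fsum G (f i) = \<zero>" by simp
  qed (use fin assms(1) in auto)
  finally show ?thesis ..
qed

lemma fsum_swap:
  assumes "\<And>i j. f i j \<in> carrier G" "finite {(i, j). f i j \<noteq> \<zero>}"
  shows "fsum G (\<lambda>i. fsum G (f i)) = fsum G (\<lambda>j. fsum G (\<lambda>i. f i j))"
proof -
  have "{(j, i). f i j \<noteq> \<zero>} = prod.swap ` {(i, j). f i j \<noteq> \<zero>}" by force
  then have fin: "finite {(j, i). f i j \<noteq> \<zero>}" using assms(2) by simp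
  have "fsum G (\<lambda>i. fsum G (f i)) = fsum G (\<lambda>(i, j). f i j)"
    by (rule fsum_Pair [OF assms])
  also have "\<dots> = fsum G (\<lambda>p. (\<lambda>(i, j). f i j) (prod.swap p))"
    by (rule fsum_reindex [symmetric]) (use assms in auto)
  also have "\<dots> = fsum G (\<lambda>(j, i). f i j)"
    by (rule arg_cong [where f = "fsum G"]) auto

  also have "\<dots> = fsum G (\<lambda>j. fsum G (\<lambda>i. f i j))"
    by (rule fsum_Pair [symmetric]) (use assms fin in auto)
  finally show ?thesis .
qed

lemma finsum_nonzeroE:
  assumes "finsum G f A \<noteq> \<zero>"
  obtains i where "i \<in> A" "f i \<noteq> \<zero>"
proof -
  have "\<not> (\<forall>i\<in>A. f i = \<zero>)"
    using assms add.finprod_one_eqI [of A f] by auto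
  then show ?thesis using that by auto
qed

lemma fsum_nonzeroE:
  assumes "fsum G f \<noteq> \<zero>"
  obtains i where "f i \<noteq> \<zero>"
  using assms unfolding fsum_def by (rule finsum_nonzeroE) auto

lemma finsum_in:
  assumes "\<zero> \<in> H" "\<And>x y. x \<in> H \<Longrightarrow> y \<in> H \<Longrightarrow> x \<oplus> y \<in> H" "H \<subseteq> carrier G" "\<And>i. i \<in> A \<Longrightarrow> f i \<in> H"
  shows "finsum G f A \<in> H"
proof (cases "finite A")
  case True
  then show ?thesis
    using assms(4)
  proof (induction A)
    case (insert a A)
    moreover have "f \<in> A \<rightarrow> carrier G" "f a \<in> carrier G"
      using insert assms by auto
    ultimately show ?case using assms by simp
  qed (use assms in auto)
qed (use assms in auto)

lemma fsum_in:
  assumes "\<zero> \<in> H" "\<And>x y. x \<in> H \<Longrightarrow> y \<in> H \<Longrightarrow> x \<oplus> y \<in> H" "H \<subseteq> carrier G" "\<And>i. f i \<in> H"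
  shows "fsum G f \<in> H"
  unfolding fsum_def by (rule finsum_in) (use assms in auto)

end

subsection \<open>Infinite matrices\<close>

definition mv :: "('a, 'm) ring_scheme \<Rightarrow> ('i \<Rightarrow> 'j \<Rightarrow> 'a) \<Rightarrow> ('j \<Rightarrow> 'a) \<Rightarrow> 'i \<Rightarrow> 'a" where
  "mv R k z i = fsum R (\<lambda>m. k i m \<otimes>\<^bsub>R\<^esub> z m)"

context ring
begin

lemma fsum_ldistr:
  assumes "a \<in> carrier R" "\<And>i. f i \<in> carrier R" "finite {i. f i \<noteq> \<zero>}"
  shows "fsum R f \<otimes> a = fsum R (\<lambda>i. f i \<otimes> a)"
proof -
  let ?A = "{i. f i \<noteq> \<zero>}"
  have "fsum R f \<otimes> a = finsum R (\<lambda>i. f i \<otimes> a) ?A"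
    unfolding fsum_def by (rule finsum_ldistr) (use assms in auto)
  also have "\<dots> = fsum R (\<lambda>i. f i \<otimes> a)"
    by (rule fsum_eq_finsum [symmetric]) (use assms in auto)
  finally show ?thesis .
qed

lemma fsum_rdistr:
  assumes "a \<in> carrier R" "\<And>i. f i \<in> carrier R" "finite {i. f i \<noteq> \<zero>}"
  shows "a \<otimes> fsum R f = fsum R (\<lambda>i. a \<otimes> f i)"
proof -
  let ?A = "{i. f i \<noteq> \<zero>}"
  have "a \<otimes> fsum R f = finsum R (\<lambda>i. a \<otimes> f i) ?A"
    unfolding fsum_def by (rule finsum_rdistr) (use assms in auto)
  also have "\<dots> = fsum R (\<lambda>i. a \<otimes> f i)"
    by (rule fsum_eq_finsum [symmetric]) (use assms in auto)
  finally show ?thesis .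
qed

lemma mv_closed:
  assumes "\<And>i m. k i m \<in> carrier R" "\<And>m. z m \<in> carrier R"
  shows "mv R k z i \<in> carrier R"
  unfolding mv_def using assms by auto

lemma mv_nonzeroE:
  assumes "mv R k z i \<noteq> \<zero>" "\<And>i m. k i m \<in> carrier R" "\<And>m. z m \<in> carrier R"
  obtains m where "k i m \<noteq> \<zero>" "z m \<noteq> \<zero>"
proof -
  obtain m where "k i m \<otimes> z m \<noteq> \<zero>"
    using assms(1) unfolding mv_def by (rule fsum_nonzeroE)
  moreover have "k i m \<noteq> \<zero> \<and> z m \<noteq> \<zero>"
    using calculation assms(2) [of i m] assms(3) [of m] by auto
  ultimately show ?thesis using that by blast
qed

text \<open>The rows of either matrix may be infinite. What permits the exchange of summation is
  that only finitely many nonzero chains lead from \<open>i\<close> through \<open>m\<close> to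
  \<open>m'\<close> in the support of \<open>z\<close>.\<close>

lemma mv_assoc:
  fixes k :: "'i \<Rightarrow> 'j \<Rightarrow> 'a" and l :: "'j \<Rightarrow> 'k \<Rightarrow> 'a"
  assumes k: "\<And>i m. k i m \<in> carrier R" and l: "\<And>i m. l i m \<in> carrier R" and z: "\<And>m. z m \<in> carrier R"
    and fin: "finite {(m, m'). k i m \<noteq> \<zero> \<and> l m m' \<noteq> \<zero> \<and> z m' \<noteq> \<zero>}"
  shows "mv R k (mv R l z) i = mv R (\<lambda>i m'. mv R k (\<lambda>m. l m m') i) z i"
proof -
  let ?P = "{(m, m'). k i m \<noteq> \<zero> \<and> l m m' \<noteq> \<zero> \<and> z m' \<noteq> \<zero>}"
  have finP: "finite {(m, m'). k i m \<otimes> l m m' \<otimes> z m' \<noteq> \<zero>}"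
    by (rule finite_subset [OF _ fin]) (use k l z in auto)
  have "mv R k (mv R l z) i = fsum R (\<lambda>m. fsum R (\<lambda>m'. k i m \<otimes> l m m' \<otimes> z m'))"
    unfolding mv_def
  proof (rule arg_cong [where f = "fsum R"], rule ext)
    fix m
    show "k i m \<otimes> fsum R (\<lambda>m'. l m m' \<otimes> z m') = fsum R (\<lambda>m'. k i m \<otimes> l m m' \<otimes> z m')"
    proof (cases "k i m = \<zero>")
      case True
      then show ?thesis using l z by simp
    next
      case False
      have "finite {m'. l m m' \<otimes> z m' \<noteq> \<zero>}"
        by (rule finite_subset [OF _ finite_vimageI [OF fin, of "Pair m"]])
          (use False l [of m] z in \<open>auto simp: inj_on_def\<close>)
      then show ?thesis
        using k l z by (subst fsum_rdistr) (auto simp: m_assoc)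
    qed
  qed
  also have "\<dots> = fsum R (\<lambda>m'. fsum R (\<lambda>m. k i m \<otimes> l m m' \<otimes> z m'))"
    by (rule fsum_swap) (use k l z finP in auto)
  also have "\<dots> = mv R (\<lambda>i m'. mv R k (\<lambda>m. l m m') i) z i"
    unfolding mv_def
  proof (rule arg_cong [where f = "fsum R"], rule ext)
    fix m'
    show "fsum R (\<lambda>m. k i m \<otimes> l m m' \<otimes> z m') = fsum R (\<lambda>m. k i m \<otimes> l m m') \<otimes> z m'"
    proof (cases "z m' = \<zero>")
      case True
      then show ?thesis using k l by simp
    next
      case False
      have "finite {m. k i m \<otimes> l m m' \<noteq> \<zero>}"
        by (rule finite_subset [OF _ finite_vimageI [OF fin, of "\<lambda>m. (m, m')"]])
          (use False k [of i] l in \<open>auto simp: inj_on_def\<close>)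
      then show ?thesis
        using k l z by (subst fsum_ldistr) auto
    qed
  qed
  finally show ?thesis .
qed

lemma mv_add:
  assumes "\<And>i m. k i m \<in> carrier R" "\<And>m. z m \<in> carrier R" "\<And>m. w m \<in> carrier R"
    and "finite {m. k i m \<noteq> \<zero> \<and> z m \<noteq> \<zero>}" "finite {m. k i m \<noteq> \<zero> \<and> w m \<noteq> \<zero>}"
  shows "mv R k (\<lambda>m. z m \<oplus> w m) i = mv R k z i \<oplus> mv R k w i"
proof -
  have "mv R k (\<lambda>m. z m \<oplus> w m) i = fsum R (\<lambda>m. k i m \<otimes> z m \<oplus> k i m \<otimes> w m)"
    unfolding mv_def using assms by (simp add: r_distr)
  also have "\<dots> = mv R k z i \<oplus> mv R k w i"
    unfolding mv_def
  proof (rule fsum_add)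
    show "finite {m. k i m \<otimes> z m \<noteq> \<zero>}"
      by (rule finite_subset [OF _ assms(4)]) (use assms in auto)
    show "finite {m. k i m \<otimes> w m \<noteq> \<zero>}"
      by (rule finite_subset [OF _ assms(5)]) (use assms in auto)
  qed (use assms in auto)
  finally show ?thesis .
qed

lemma mv_add_left:
  assumes "\<And>i m. k i m \<in> carrier R" "\<And>i m. l i m \<in> carrier R" "\<And>m. z m \<in> carrier R"
    and "finite {m. k i m \<noteq> \<zero> \<and> z m \<noteq> \<zero>}" "finite {m. l i m \<noteq> \<zero> \<and> z m \<noteq> \<zero>}"
  shows "mv R (\<lambda>i m. k i m \<oplus> l i m) z i = mv R k z i \<oplus> mv R l z i"
proof -
  have "mv R (\<lambda>i m. k i m \<oplus> l i m) z i = fsum R (\<lambda>m. k i m \<otimes> z m \<oplus> l i m \<otimes> z m)"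
    unfolding mv_def using assms by (simp add: l_distr)
  also have "\<dots> = mv R k z i \<oplus> mv R l z i"
    unfolding mv_def
  proof (rule fsum_add)
    show "finite {m. k i m \<otimes> z m \<noteq> \<zero>}"
      by (rule finite_subset [OF _ assms(4)]) (use assms in auto)
    show "finite {m. l i m \<otimes> z m \<noteq> \<zero>}"
      by (rule finite_subset [OF _ assms(5)]) (use assms in auto)
  qed (use assms in auto)
  finally show ?thesis .
qed

lemma mv_rmult:
  assumes "\<And>i m. k i m \<in> carrier R" "\<And>m. z m \<in> carrier R" "a \<in> carrier R"
    and "finite {m. k i m \<noteq> \<zero> \<and> z m \<noteq> \<zero>}"
  shows "mv R k (\<lambda>m. z m \<otimes> a) i = mv R k z i \<otimes> a"
proof -
  have "finite {m. k i m \<otimes> z m \<noteq> \<zero>}"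
    by (rule finite_subset [OF _ assms(4)]) (use assms in auto)
  then show ?thesis
    unfolding mv_def using assms by (subst fsum_ldistr) (auto simp: m_assoc)
qed

end

text \<open>The indices in \<open>J \<times> \<int>\<^sup>2\<close> are handled without splitting them into triples.\<close>

declare split_paired_All [simp del] split_paired_Ex [simp del]

subsection \<open>Homogeneous components\<close>

lemma bij_shift: "bij (\<lambda>m::'g::ab_group_add. m + a)" "bij (\<lambda>m::'g::ab_group_add. m - a)"
  "bij (\<lambda>m::'g::ab_group_add. a - m)"
proof -
  show "bij (\<lambda>m::'g. m + a)" by (rule o_bij [where g = "\<lambda>m. m - a"]) auto
  show "bij (\<lambda>m::'g. m - a)" by (rule o_bij [where g = "\<lambda>m. m + a"]) auto
  show "bij (\<lambda>m::'g. a - m)" by (rule o_bij [where g = "\<lambda>m. a - m"]) auto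
qed

definition conv ::
    "('a, 'm) ring_scheme \<Rightarrow> (int \<times> int \<Rightarrow> 'a) \<Rightarrow> (int \<times> int \<Rightarrow> 'a) \<Rightarrow> int \<times> int \<Rightarrow> 'a" where
  "conv R f g \<sigma> = fsum R (\<lambda>\<kappa>. f \<kappa> \<otimes>\<^bsub>R\<^esub> g (\<sigma> - \<kappa>))"

lemma graded_sum_eq_fsum: "graded_sum R f = fsum R f"
  by (simp add: graded_sum_def fsum_def)

text \<open>Sums over initial segments of the naturals are concatenated. The factors are total
  functions with all their values in \<open>I\<close> and \<open>J\<close>, so later uses need no
  bounds on the index.\<close>

lemma (in ring) ideal_prod_sumE:
  assumes "x \<in> ideal_prod R I J" "I \<subseteq> carrier R" "J \<subseteq> carrier R"
  shows "\<exists>(l::nat) u v. (\<forall>i. u i \<in> I) \<and> (\<forall>i. v i \<in> J) \<and> x = (\<Oplus>i\<in>{..<l}. u i \<otimes> v i)"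
  using assms(1)
proof induction
  case (prod i j)
  then have "i \<otimes> j \<in> carrier R"
    using assms by auto
  then have "i \<otimes> j = (\<Oplus>n\<in>{..<1::nat}. i \<otimes> j)"
    by (simp add: lessThan_Suc)
  with prod show ?case
    by (intro exI [of _ 1] exI [of _ "\<lambda>_. i"] exI [of _ "\<lambda>_. j"]) auto
next
  case (sum s1 s2)
  then obtain l1 l2 :: nat and u1 v1 u2 v2
    where 1: "\<forall>i. u1 i \<in> I" "\<forall>i. v1 i \<in> J" "s1 = (\<Oplus>i\<in>{..<l1}. u1 i \<otimes> v1 i)"
      and 2: "\<forall>i. u2 i \<in> I" "\<forall>i. v2 i \<in> J" "s2 = (\<Oplus>i\<in>{..<l2}. u2 i \<otimes> v2 i)"
    by blast
  define u where "u i = (if i < l1 then u1 i else u2 (i - l1))" for i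
  define v where "v i = (if i < l1 then v1 i else v2 (i - l1))" for i
  have uv: "u i \<in> carrier R" "v i \<in> carrier R" "u1 i \<in> carrier R" "v1 i \<in> carrier R"
      "u2 i \<in> carrier R" "v2 i \<in> carrier R" for i
    using 1 2 assms by (auto simp: u_def v_def)
  have split: "{..<l1 + l2} = {..<l1} \<union> (\<lambda>i. i + l1) ` {..<l2}"
  proof -
    have "x \<in> (\<lambda>i. i + l1) ` {..<l2}" if "x < l1 + l2" "\<not> x < l1" for x
      using that by (intro image_eqI [of _ _ "x - l1"]) auto
    then show ?thesis by auto
  qed
  have "(\<Oplus>i\<in>{..<l1 + l2}. u i \<otimes> v i) =
      (\<Oplus>i\<in>{..<l1}. u i \<otimes> v i) \<oplus> (\<Oplus>i\<in>(\<lambda>i. i + l1) ` {..<l2}. u i \<otimes> v i)"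
    unfolding split by (rule finsum_Un_disjoint) (use uv in auto)
  also have "(\<Oplus>i\<in>{..<l1}. u i \<otimes> v i) = s1"
    unfolding 1(3) by (rule finsum_cong') (use uv in \<open>auto simp: u_def v_def\<close>)
  also have "(\<Oplus>i\<in>(\<lambda>i. i + l1) ` {..<l2}. u i \<otimes> v i) = (\<Oplus>i\<in>{..<l2}. u (i + l1) \<otimes> v (i + l1))"
    by (rule finsum_reindex) (use uv in \<open>auto simp: inj_on_def\<close>)
  also have "\<dots> = s2"
    unfolding 2(3) by (rule finsum_cong') (use uv in \<open>auto simp: u_def v_def\<close>)
  finally have "s1 \<oplus> s2 = (\<Oplus>i\<in>{..<l1 + l2}. u i \<otimes> v i)" ..
  moreover have "\<forall>i. u i \<in> I" "\<forall>i. v i \<in> J"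
    using 1 2 by (auto simp: u_def v_def)
  ultimately show ?case by blast
qed

context graded_ring
begin

abbreviation comp :: "'a \<Rightarrow> int \<times> int \<Rightarrow> 'a" where
  "comp \<equiv> graded_components R Rg"

lemma Rg_carrier [simp, intro]: "x \<in> Rg \<sigma> \<Longrightarrow> x \<in> carrier R"
  using additive_subgroup.a_Hcarr [OF component_subgroup] .

lemma Rg_zero [simp, intro]: "\<zero> \<in> Rg \<sigma>"
  using additive_subgroup.zero_closed [OF component_subgroup] .

lemma Rg_add [simp, intro]: "x \<in> Rg \<sigma> \<Longrightarrow> y \<in> Rg \<sigma> \<Longrightarrow> x \<oplus> y \<in> Rg \<sigma>"
  using additive_subgroup.a_closed [OF component_subgroup] .

lemma Rg_minus [simp, intro]: "x \<in> Rg \<sigma> \<Longrightarrow> \<ominus> x \<in> Rg \<sigma>"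
  using additive_subgroup.a_inv_closed [OF component_subgroup] .

lemma Rg_mult: "x \<in> Rg \<kappa> \<Longrightarrow> y \<in> Rg \<mu> \<Longrightarrow> x \<otimes> y \<in> Rg (\<kappa> + \<mu>)"
  using component_prod ideal_prod.prod by (metis (no_types) subsetD)

lemma Rg_mult': "x \<in> Rg \<kappa> \<Longrightarrow> y \<in> Rg \<mu> \<Longrightarrow> \<kappa> + \<mu> = \<sigma> \<Longrightarrow> x \<otimes> y \<in> Rg \<sigma>"
  using Rg_mult by blast

lemma Rg_fsum: "(\<And>i. f i \<in> Rg \<sigma>) \<Longrightarrow> fsum R f \<in> Rg \<sigma>"
  by (rule fsum_in) auto

lemma comp_families:
  assumes "r \<in> carrier R"
  shows "comp r \<in> graded_families R Rg"
  unfolding graded_components_def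
  by (rule the_inv_into_into [OF _ _ subset_refl]) (use direct_sum assms in \<open>auto simp: bij_betw_def\<close>)

lemma comp_in [simp, intro]: "r \<in> carrier R \<Longrightarrow> comp r \<sigma> \<in> Rg \<sigma>"
  using comp_families [of r] by (auto simp: graded_families_def)

lemma comp_finite [simp, intro]: "r \<in> carrier R \<Longrightarrow> finite {\<sigma>. comp r \<sigma> \<noteq> \<zero>}"
  using comp_families [of r] by (auto simp: graded_families_def)

lemma fsum_comp: "r \<in> carrier R \<Longrightarrow> fsum R (comp r) = r"
  unfolding graded_components_def graded_sum_eq_fsum [symmetric]
  by (rule f_the_inv_into_f [of "graded_sum R" "graded_families R Rg"]) (use direct_sum in \<open>simp_all add: bij_betw_def\<close>)

lemma comp_fsum:
  assumes "\<And>\<sigma>. f \<sigma> \<in> Rg \<sigma>" "finite {\<sigma>. f \<sigma> \<noteq> \<zero>}"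
  shows "comp (fsum R f) = f"
  unfolding graded_components_def graded_sum_eq_fsum [symmetric]
  by (rule the_inv_into_f_f) (use direct_sum assms in \<open>auto simp: bij_betw_def graded_families_def\<close>)

lemma comp_homogeneous:
  assumes "r \<in> Rg \<mu>"
  shows "comp r = (\<lambda>\<sigma>. if \<sigma> = \<mu> then r else \<zero>)"
proof -
  have "fsum R (\<lambda>\<sigma>. if \<sigma> = \<mu> then r else \<zero>) = r"
    using fsum_single [of "\<lambda>\<sigma>. if \<sigma> = \<mu> then r else \<zero>" \<mu>] assms by auto
  moreover have "comp (fsum R (\<lambda>\<sigma>. if \<sigma> = \<mu> then r else \<zero>)) = (\<lambda>\<sigma>. if \<sigma> = \<mu> then r else \<zero>)"
    by (rule comp_fsum) (use assms in auto)
  ultimately show ?thesis by simp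
qed

lemma comp_zero [simp]: "comp \<zero> = (\<lambda>\<sigma>. \<zero>)"
  using comp_homogeneous [of \<zero> 0] by auto

lemma comp_add:
  assumes "r \<in> carrier R" "s \<in> carrier R"
  shows "comp (r \<oplus> s) \<sigma> = comp r \<sigma> \<oplus> comp s \<sigma>"
proof -
  have "fsum R (\<lambda>\<sigma>. comp r \<sigma> \<oplus> comp s \<sigma>) = r \<oplus> s"
    using fsum_add [of "comp r" "comp s"] assms by (auto simp: fsum_comp)
  moreover have "finite {\<sigma>. comp r \<sigma> \<oplus> comp s \<sigma> \<noteq> \<zero>}"
    by (rule finite_subset [of _ "{\<sigma>. comp r \<sigma> \<noteq> \<zero>} \<union> {\<sigma>. comp s \<sigma> \<noteq> \<zero>}"]) (use assms in auto)
  ultimately show ?thesis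
    using comp_fsum [of "\<lambda>\<sigma>. comp r \<sigma> \<oplus> comp s \<sigma>"] assms by auto
qed

text \<open>Expanding both factors writes the product as a finite sum of homogeneous elements, one
  for each degree, and such a decomposition is unique.\<close>

lemma comp_mult:
  assumes r: "r \<in> carrier R" and s: "s \<in> carrier R"
  shows "comp (r \<otimes> s) = conv R (comp r) (comp s)"
proof -
  let ?S = "\<lambda>r. {\<sigma>. comp r \<sigma> \<noteq> \<zero>}"
  have c: "comp r \<kappa> \<otimes> comp s \<mu> \<in> Rg (\<kappa> + \<mu>)" for \<kappa> \<mu>
    using r s by (auto intro: Rg_mult)
  have cc: "comp r \<kappa> \<in> carrier R" "comp s \<mu> \<in> carrier R" for \<kappa> \<mu>
    using r s by auto
  have fin: "finite {(\<kappa>, \<sigma>). comp r \<kappa> \<otimes> comp s (\<sigma> - \<kappa>) \<noteq> \<zero>}"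
  proof (rule finite_subset)
    show "{(\<kappa>, \<sigma>). comp r \<kappa> \<otimes> comp s (\<sigma> - \<kappa>) \<noteq> \<zero>} \<subseteq>
        (\<lambda>(\<kappa>, \<mu>). (\<kappa>, \<mu> + \<kappa>)) ` (?S r \<times> ?S s)"
    proof clarify
      fix a b c d
      assume "comp r (a, b) \<otimes> comp s ((c, d) - (a, b)) \<noteq> \<zero>"
      then have "comp r (a, b) \<noteq> \<zero>" "comp s ((c, d) - (a, b)) \<noteq> \<zero>"
        using cc by (auto simp: r_null l_null)
      then show "((a, b), c, d) \<in> (\<lambda>(\<kappa>, \<mu>). (\<kappa>, \<mu> + \<kappa>)) ` (?S r \<times> ?S s)"
        by (intro image_eqI [of _ _ "((a, b), (c, d) - (a, b))"]) auto
    qed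
  qed (use r s in auto)
  have "r \<otimes> s = fsum R (\<lambda>\<kappa>. comp r \<kappa> \<otimes> s)"
    using fsum_ldistr [of s "comp r"] r s by (auto simp: fsum_comp)
  also have "\<dots> = fsum R (\<lambda>\<kappa>. fsum R (\<lambda>\<sigma>. comp r \<kappa> \<otimes> comp s (\<sigma> - \<kappa>)))"
  proof (rule arg_cong [where f = "fsum R"], rule ext)
    fix \<kappa>
    have "comp r \<kappa> \<otimes> s = fsum R (\<lambda>\<mu>. comp r \<kappa> \<otimes> comp s \<mu>)"
      using fsum_rdistr [of "comp r \<kappa>" "comp s"] r s by (auto simp: fsum_comp)
    also have "\<dots> = fsum R (\<lambda>\<sigma>. comp r \<kappa> \<otimes> comp s (\<sigma> - \<kappa>))"
      using fsum_reindex [OF bij_shift(2) [of \<kappa>], of "\<lambda>\<mu>. comp r \<kappa> \<otimes> comp s \<mu>"] cc by simp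
    finally show "comp r \<kappa> \<otimes> s = fsum R (\<lambda>\<sigma>. comp r \<kappa> \<otimes> comp s (\<sigma> - \<kappa>))" .
  qed
  also have "\<dots> = fsum R (conv R (comp r) (comp s))"
    unfolding conv_def by (rule fsum_swap) (use cc fin in auto)
  finally have eq: "r \<otimes> s = fsum R (conv R (comp r) (comp s))" .
  show ?thesis
    unfolding eq
  proof (rule comp_fsum)
    fix \<sigma>
    show "conv R (comp r) (comp s) \<sigma> \<in> Rg \<sigma>"
      unfolding conv_def by (rule Rg_fsum) (metis c add.commute diff_add_cancel)
    have "{\<sigma>. conv R (comp r) (comp s) \<sigma> \<noteq> \<zero>} \<subseteq> snd ` {(\<kappa>, \<sigma>). comp r \<kappa> \<otimes> comp s (\<sigma> - \<kappa>) \<noteq> \<zero>}"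
      unfolding conv_def by (force elim!: fsum_nonzeroE)
    then show "finite {\<sigma>. conv R (comp r) (comp s) \<sigma> \<noteq> \<zero>}"
      using fin finite_surj by blast
  qed
qed

text \<open>Let e be the component of degree 0 of the unit. Comparing the components of degree
  \<open>\<mu>\<close> in \<open>comp \<one> \<mu> \<otimes> \<one>\<close> shows that e is a right
  unit for every component of the unit; summing over \<open>\<mu>\<close> gives e = 1.\<close>

lemma one_Rg: "\<one> \<in> Rg 0"
proof -
  have *: "comp \<one> \<mu> \<otimes> comp \<one> 0 = comp \<one> \<mu>" for \<mu>
  proof -
    have "comp \<one> \<mu> = comp (comp \<one> \<mu> \<otimes> \<one>) \<mu>"
      using comp_homogeneous [of "comp \<one> \<mu>" \<mu>] by (simp add: Rg_carrier [of _ \<mu>])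
    also have "\<dots> = fsum R (\<lambda>\<kappa>. comp (comp \<one> \<mu>) \<kappa> \<otimes> comp \<one> (\<mu> - \<kappa>))"
      by (subst comp_mult) (auto simp: conv_def Rg_carrier [of _ \<mu>])
    also have "\<dots> = comp (comp \<one> \<mu>) \<mu> \<otimes> comp \<one> (\<mu> - \<mu>)"
      by (rule fsum_single)
        (use comp_homogeneous [of "comp \<one> \<mu>" \<mu>] in \<open>auto intro!: m_closed simp: Rg_carrier [OF comp_in]\<close>)
    also have "\<dots> = comp \<one> \<mu> \<otimes> comp \<one> 0"
      using comp_homogeneous [of "comp \<one> \<mu>" \<mu>] by simp
    finally show ?thesis ..
  qed
  have "comp \<one> 0 = fsum R (comp \<one>) \<otimes> comp \<one> 0"
    by (simp add: fsum_comp Rg_carrier [OF comp_in])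
  also have "\<dots> = fsum R (\<lambda>\<mu>. comp \<one> \<mu> \<otimes> comp \<one> 0)"
    by (rule fsum_ldistr) (auto simp: Rg_carrier [OF comp_in])
  also have "\<dots> = \<one>"
    by (simp add: * fsum_comp)
  finally show ?thesis
    using comp_in [of \<one> 0] by simp
qed

lemma comp_one: "comp \<one> = (\<lambda>\<sigma>. if \<sigma> = 0 then \<one> else \<zero>)"
  by (rule comp_homogeneous [OF one_Rg])

end

text \<open>The form in which strong grading is used. It supplies dual bases of windows and the
  conjugation of a homotopy by elements of degree \<open>\<sigma>\<close> and
  \<open>- \<sigma>\<close>.\<close>

lemma (in strongly_graded_ring) unit_decomposition:
  obtains l :: nat and u v where "\<And>i. u i \<in> Rg \<sigma>" "\<And>i. v i \<in> Rg (- \<sigma>)" "(\<Oplus>i\<in>{..<l}. u i \<otimes> v i) = \<one>"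
proof -
  have "\<one> \<in> ideal_prod R (Rg \<sigma>) (Rg (- \<sigma>))"
    using one_Rg strong [of \<sigma> "- \<sigma>"] by simp
  then show ?thesis
    using ideal_prod_sumE [of \<one> "Rg \<sigma>" "Rg (- \<sigma>)"] that
    by (metis Rg_carrier subsetI)
qed

subsection \<open>Right modules with a finite basis\<close>

context right_module
begin

lemma rsmult_zero_left [simp]:
  assumes "r \<in> carrier R"
  shows "\<zero>\<^bsub>M\<^esub> \<odot>\<^sub>r\<^bsub>M\<^esub> r = \<zero>\<^bsub>M\<^esub>"
proof -
  have "\<zero>\<^bsub>M\<^esub> \<odot>\<^sub>r\<^bsub>M\<^esub> r \<oplus>\<^bsub>M\<^esub> \<zero>\<^bsub>M\<^esub> \<odot>\<^sub>r\<^bsub>M\<^esub> r = \<zero>\<^bsub>M\<^esub> \<odot>\<^sub>r\<^bsub>M\<^esub> r"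
    using rsmult_add_left [of "\<zero>\<^bsub>M\<^esub>" "\<zero>\<^bsub>M\<^esub>" r] assms by simp
  then show ?thesis
    using M.add.l_cancel_one' [of "\<zero>\<^bsub>M\<^esub> \<odot>\<^sub>r\<^bsub>M\<^esub> r" "\<zero>\<^bsub>M\<^esub> \<odot>\<^sub>r\<^bsub>M\<^esub> r"] assms rsmult_closed by auto
qed

lemma rsmult_zero_right [simp]:
  assumes "x \<in> carrier M"
  shows "x \<odot>\<^sub>r\<^bsub>M\<^esub> \<zero>\<^bsub>R\<^esub> = \<zero>\<^bsub>M\<^esub>"
proof -
  have "x \<odot>\<^sub>r\<^bsub>M\<^esub> \<zero>\<^bsub>R\<^esub> \<oplus>\<^bsub>M\<^esub> x \<odot>\<^sub>r\<^bsub>M\<^esub> \<zero>\<^bsub>R\<^esub> = x \<odot>\<^sub>r\<^bsub>M\<^esub> \<zero>\<^bsub>R\<^esub>"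
    using rsmult_add_right [of x "\<zero>\<^bsub>R\<^esub>" "\<zero>\<^bsub>R\<^esub>"] assms by simp
  then show ?thesis
    using M.add.l_cancel_one' [of "x \<odot>\<^sub>r\<^bsub>M\<^esub> \<zero>\<^bsub>R\<^esub>" "x \<odot>\<^sub>r\<^bsub>M\<^esub> \<zero>\<^bsub>R\<^esub>"] assms rsmult_closed by auto
qed

lemma finsum_rsmult:
  assumes "r \<in> carrier R" "\<And>a. a \<in> A \<Longrightarrow> f a \<in> carrier M"
  shows "finsum M f A \<odot>\<^sub>r\<^bsub>M\<^esub> r = (\<Oplus>\<^bsub>M\<^esub>a\<in>A. f a \<odot>\<^sub>r\<^bsub>M\<^esub> r)"
  using assms(2)
proof (induction A rule: infinite_finite_induct)
  case (insert a A)
  then show ?case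
    using assms(1) by (simp add: Pi_def rsmult_closed rsmult_add_left)
qed (use assms in auto)

lemma rsmult_finsum:
  assumes "x \<in> carrier M" "\<And>a. a \<in> A \<Longrightarrow> f a \<in> carrier R"
  shows "x \<odot>\<^sub>r\<^bsub>M\<^esub> finsum R f A = (\<Oplus>\<^bsub>M\<^esub>a\<in>A. x \<odot>\<^sub>r\<^bsub>M\<^esub> f a)"
  using assms(2)
proof (induction A rule: infinite_finite_induct)
  case (insert a A)
  then show ?case
    using assms(1) by (simp add: Pi_def rsmult_closed rsmult_add_right)
qed (use assms in auto)

end

text \<open>Stated for additive maps between groups, so that it applies alike to maps linear over R,
  to maps linear over R_0, to single coordinates and to operators on families.\<close>

lemma additive_finsum:
  assumes "abelian_group M" "abelian_group N" "f \<in> carrier M \<rightarrow> carrier N"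
    and add: "\<And>x y. x \<in> carrier M \<Longrightarrow> y \<in> carrier M \<Longrightarrow> f (x \<oplus>\<^bsub>M\<^esub> y) = f x \<oplus>\<^bsub>N\<^esub> f y"
  shows additive_zero: "f \<zero>\<^bsub>M\<^esub> = \<zero>\<^bsub>N\<^esub>"
    and "\<And>g A. (\<And>a. a \<in> A \<Longrightarrow> g a \<in> carrier M) \<Longrightarrow> f (finsum M g A) = (\<Oplus>\<^bsub>N\<^esub>a\<in>A. f (g a))"
    and additive_minus: "\<And>x. x \<in> carrier M \<Longrightarrow> f (\<ominus>\<^bsub>M\<^esub> x) = \<ominus>\<^bsub>N\<^esub> f x"
    and additive_diff: "\<And>x y. x \<in> carrier M \<Longrightarrow> y \<in> carrier M \<Longrightarrow> f (x \<ominus>\<^bsub>M\<^esub> y) = f x \<ominus>\<^bsub>N\<^esub> f y"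
proof -
  interpret M: abelian_group M by fact
  interpret N: abelian_group N by fact
  have f: "f x \<in> carrier N" if "x \<in> carrier M" for x
    using assms(3) that by auto
  have "f \<zero>\<^bsub>M\<^esub> \<oplus>\<^bsub>N\<^esub> f \<zero>\<^bsub>M\<^esub> = f \<zero>\<^bsub>M\<^esub>"
    using add [of "\<zero>\<^bsub>M\<^esub>" "\<zero>\<^bsub>M\<^esub>"] by simp
  then show z: "f \<zero>\<^bsub>M\<^esub> = \<zero>\<^bsub>N\<^esub>"
    using N.add.l_cancel_one' [of "f \<zero>\<^bsub>M\<^esub>" "f \<zero>\<^bsub>M\<^esub>"] f by auto
  show "f (finsum M g A) = (\<Oplus>\<^bsub>N\<^esub>a\<in>A. f (g a))" if "\<And>a. a \<in> A \<Longrightarrow> g a \<in> carrier M" for g A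
    using that
  proof (induction A rule: infinite_finite_induct)
    case (insert a A)
    then show ?case
      by (simp add: Pi_def f add)
  qed (use z in auto)
  show m: "f (\<ominus>\<^bsub>M\<^esub> x) = \<ominus>\<^bsub>N\<^esub> f x" if x: "x \<in> carrier M" for x
  proof -
    have "f (\<ominus>\<^bsub>M\<^esub> x) \<oplus>\<^bsub>N\<^esub> f x = \<zero>\<^bsub>N\<^esub>"
      using add [of "\<ominus>\<^bsub>M\<^esub> x" x] x z by (simp add: M.l_neg)
    then show ?thesis
      using N.minus_equality f x by simp
  qed
  show "f (x \<ominus>\<^bsub>M\<^esub> y) = f x \<ominus>\<^bsub>N\<^esub> f y" if "x \<in> carrier M" "y \<in> carrier M" for x y
    using add [of x "\<ominus>\<^bsub>M\<^esub> y"] m that by (simp add: a_minus_def)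
qed

definition is_basis :: "('a, 'm) ring_scheme \<Rightarrow> ('a, 'b, 'n) rmodule_scheme \<Rightarrow> 'b set \<Rightarrow> bool" where
  "is_basis R M B \<longleftrightarrow> finite B \<and> B \<subseteq> carrier M \<and>
     bij_betw (\<lambda>c. \<Oplus>\<^bsub>M\<^esub>b\<in>B. b \<odot>\<^sub>r\<^bsub>M\<^esub> c b) (B \<rightarrow>\<^sub>E carrier R) (carrier M)"

text \<open>With the value zero off the basis, the coordinates are additive and compatible with
  scalars at every index.\<close>

definition coord ::
    "('a, 'm) ring_scheme \<Rightarrow> ('a, 'b, 'n) rmodule_scheme \<Rightarrow> 'b set \<Rightarrow> 'b \<Rightarrow> 'b \<Rightarrow> 'a" where
  "coord R M B x b = (if b \<in> B
     then the_inv_into (B \<rightarrow>\<^sub>E carrier R) (\<lambda>c. \<Oplus>\<^bsub>M\<^esub>b\<in>B. b \<odot>\<^sub>r\<^bsub>M\<^esub> c b) x b else \<zero>\<^bsub>R\<^esub>)"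

locale based_module = right_module R M
  for R :: "('a, 'm) ring_scheme" and M :: "('a, 'b, 'n) rmodule_scheme" +
  fixes B :: "'b set"
  assumes basis: "is_basis R M B"
begin

abbreviation "co \<equiv> coord R M B"

lemma finite_basis [simp]: "finite B"
  and basis_carrier: "b \<in> B \<Longrightarrow> b \<in> carrier M"
  using basis by (auto simp: is_basis_def)

lemma co_closed [simp]:
  assumes "x \<in> carrier M" shows "co x b \<in> carrier R"
proof (cases "b \<in> B")
  case True
  have "the_inv_into (B \<rightarrow>\<^sub>E carrier R) (\<lambda>c. \<Oplus>\<^bsub>M\<^esub>b\<in>B. b \<odot>\<^sub>r\<^bsub>M\<^esub> c b) x \<in> B \<rightarrow>\<^sub>E carrier R"
    by (rule the_inv_into_into [OF _ _ subset_refl])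
      (use basis assms in \<open>simp_all add: is_basis_def bij_betw_def\<close>)
  then show ?thesis using True by (auto simp: coord_def)
qed (simp add: coord_def)

lemma co_outside [simp]: "b \<notin> B \<Longrightarrow> co x b = \<zero>\<^bsub>R\<^esub>"
  by (simp add: coord_def)

lemma co_expand:
  assumes "x \<in> carrier M" shows "(\<Oplus>\<^bsub>M\<^esub>b\<in>B. b \<odot>\<^sub>r\<^bsub>M\<^esub> co x b) = x"
proof -
  let ?F = "\<lambda>c. \<Oplus>\<^bsub>M\<^esub>b\<in>B. b \<odot>\<^sub>r\<^bsub>M\<^esub> c b"
  have "(\<Oplus>\<^bsub>M\<^esub>b\<in>B. b \<odot>\<^sub>r\<^bsub>M\<^esub> co x b) = ?F (the_inv_into (B \<rightarrow>\<^sub>E carrier R) ?F x)"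
  proof (rule M.finsum_cong' [OF refl])
    fix b assume b: "b \<in> B"
    show "b \<odot>\<^sub>r\<^bsub>M\<^esub> co x b = b \<odot>\<^sub>r\<^bsub>M\<^esub> the_inv_into (B \<rightarrow>\<^sub>E carrier R) ?F x b"
      using b by (simp add: coord_def)
  next
    have "b \<odot>\<^sub>r\<^bsub>M\<^esub> co x b \<in> carrier M" if "b \<in> B" for b
      using that assms by (auto intro: rsmult_closed basis_carrier)
    then show "(\<lambda>b. b \<odot>\<^sub>r\<^bsub>M\<^esub> the_inv_into (B \<rightarrow>\<^sub>E carrier R) ?F x b) \<in> B \<rightarrow> carrier M"
      by (auto simp: coord_def)
  qed
  also have "\<dots> = x"
    by (rule f_the_inv_into_f [of ?F "B \<rightarrow>\<^sub>E carrier R"])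
      (use basis assms in \<open>simp_all add: is_basis_def bij_betw_def\<close>)
  finally show ?thesis .
qed

lemma co_lincomb:
  assumes "\<And>b. b \<in> B \<Longrightarrow> f b \<in> carrier R" "b \<in> B"
  shows "co (\<Oplus>\<^bsub>M\<^esub>b\<in>B. b \<odot>\<^sub>r\<^bsub>M\<^esub> f b) b = f b"
proof -
  let ?F = "\<lambda>c. \<Oplus>\<^bsub>M\<^esub>b\<in>B. b \<odot>\<^sub>r\<^bsub>M\<^esub> c b"
  have "?F f = ?F (restrict f B)"
    by (rule M.finsum_cong' [OF refl]) (use assms in \<open>auto intro: rsmult_closed basis_carrier\<close>)
  moreover have "the_inv_into (B \<rightarrow>\<^sub>E carrier R) ?F (?F (restrict f B)) = restrict f B"
    by (rule the_inv_into_f_f) (use basis assms in \<open>auto simp: is_basis_def bij_betw_def\<close>)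
  ultimately show ?thesis
    using assms by (simp add: coord_def)
qed

lemma co_eqI:
  assumes "x \<in> carrier M" "\<And>b. b \<in> B \<Longrightarrow> f b \<in> carrier R" "x = (\<Oplus>\<^bsub>M\<^esub>b\<in>B. b \<odot>\<^sub>r\<^bsub>M\<^esub> f b)"
  shows "b \<in> B \<Longrightarrow> co x b = f b"
  using assms co_lincomb by blast

lemma lincomb_closed: "(\<And>b. b \<in> B \<Longrightarrow> f b \<in> carrier R) \<Longrightarrow> (\<Oplus>\<^bsub>M\<^esub>b\<in>B. b \<odot>\<^sub>r\<^bsub>M\<^esub> f b) \<in> carrier M"
  by (intro M.finsum_closed) (auto intro: rsmult_closed basis_carrier)

lemma co_add:
  assumes "x \<in> carrier M" "y \<in> carrier M"
  shows "co (x \<oplus>\<^bsub>M\<^esub> y) b = co x b \<oplus>\<^bsub>R\<^esub> co y b"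
proof (cases "b \<in> B")
  case True
  have "x \<oplus>\<^bsub>M\<^esub> y = (\<Oplus>\<^bsub>M\<^esub>b\<in>B. b \<odot>\<^sub>r\<^bsub>M\<^esub> co x b) \<oplus>\<^bsub>M\<^esub> (\<Oplus>\<^bsub>M\<^esub>b\<in>B. b \<odot>\<^sub>r\<^bsub>M\<^esub> co y b)"
    using assms by (simp add: co_expand)
  also have "\<dots> = (\<Oplus>\<^bsub>M\<^esub>b\<in>B. b \<odot>\<^sub>r\<^bsub>M\<^esub> co x b \<oplus>\<^bsub>M\<^esub> b \<odot>\<^sub>r\<^bsub>M\<^esub> co y b)"
    by (rule M.finsum_addf [symmetric]) (use assms in \<open>auto intro: rsmult_closed basis_carrier\<close>)
  also have "\<dots> = (\<Oplus>\<^bsub>M\<^esub>b\<in>B. b \<odot>\<^sub>r\<^bsub>M\<^esub> (co x b \<oplus>\<^bsub>R\<^esub> co y b))"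
    by (rule M.finsum_cong' [OF refl])
      (use assms in \<open>auto intro: rsmult_closed basis_carrier simp: rsmult_add_right basis_carrier\<close>)
  finally show ?thesis
    using co_lincomb [of "\<lambda>b. co x b \<oplus>\<^bsub>R\<^esub> co y b" b] True assms by simp
qed simp

lemma co_rsmult:
  assumes "x \<in> carrier M" "r \<in> carrier R"
  shows "co (x \<odot>\<^sub>r\<^bsub>M\<^esub> r) b = co x b \<otimes>\<^bsub>R\<^esub> r"
proof (cases "b \<in> B")
  case True
  have "x \<odot>\<^sub>r\<^bsub>M\<^esub> r = (\<Oplus>\<^bsub>M\<^esub>b\<in>B. b \<odot>\<^sub>r\<^bsub>M\<^esub> co x b) \<odot>\<^sub>r\<^bsub>M\<^esub> r"
    using assms by (simp add: co_expand)
  also have "\<dots> = (\<Oplus>\<^bsub>M\<^esub>b\<in>B. b \<odot>\<^sub>r\<^bsub>M\<^esub> co x b \<odot>\<^sub>r\<^bsub>M\<^esub> r)"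
    by (rule finsum_rsmult) (use assms in \<open>auto intro: rsmult_closed basis_carrier\<close>)
  also have "\<dots> = (\<Oplus>\<^bsub>M\<^esub>b\<in>B. b \<odot>\<^sub>r\<^bsub>M\<^esub> (co x b \<otimes>\<^bsub>R\<^esub> r))"
    by (rule M.finsum_cong' [OF refl])
      (use assms in \<open>auto intro: rsmult_closed basis_carrier simp: rsmult_assoc basis_carrier\<close>)
  finally show ?thesis
    using co_lincomb [of "\<lambda>b. co x b \<otimes>\<^bsub>R\<^esub> r" b] True assms by simp
qed (use assms in simp)

lemma co_zero [simp]: "co \<zero>\<^bsub>M\<^esub> b = \<zero>\<^bsub>R\<^esub>"
  using co_rsmult [of "\<zero>\<^bsub>M\<^esub>" "\<zero>\<^bsub>R\<^esub>" b] by simp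

lemma co_basis:
  assumes "b \<in> B"
  shows "co b b' = (if b' = b then \<one>\<^bsub>R\<^esub> else \<zero>\<^bsub>R\<^esub>)"
proof (cases "b' \<in> B")
  case True
  let ?f = "\<lambda>b'. if b' = b then \<one>\<^bsub>R\<^esub> else \<zero>\<^bsub>R\<^esub>"
  have "(\<Oplus>\<^bsub>M\<^esub>b'\<in>B. b' \<odot>\<^sub>r\<^bsub>M\<^esub> ?f b') = (\<Oplus>\<^bsub>M\<^esub>b'\<in>B. if b = b' then b' else \<zero>\<^bsub>M\<^esub>)"
    by (rule M.finsum_cong' [OF refl]) (use assms in \<open>auto simp: basis_carrier rsmult_one\<close>)
  also have "\<dots> = b"
    using M.finsum_singleton [of b B "\<lambda>b. b"] assms basis_carrier by auto
  finally show ?thesis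
    using co_eqI [of b ?f b'] True assms basis_carrier by simp
qed (use assms in auto)

end

subsection \<open>Translation invariant kernels\<close>

text \<open>A family \<open>z\<close> on \<open>J \<times> \<int>\<^sup>2\<close> with \<open>z (j, \<sigma>) \<in> R\<^sub>\<sigma>\<close> stands for the formal sum of the \<open>j \<odot> z (j, \<sigma>)\<close>,
  where \<open>j\<close> runs through a basis of degree \<open>0\<close>. An \<open>R\<close>-linear map is then left multiplication by
  the matrix \<open>tker a\<close>, where \<open>a j' j \<tau>\<close> is the component of degree \<open>\<tau>\<close> of its \<open>(j', j)\<close> entry.\<close>

definition tker :: "('j \<Rightarrow> 'j \<Rightarrow> int \<times> int \<Rightarrow> 'a) \<Rightarrow> 'j \<times> (int \<times> int) \<Rightarrow> 'j \<times> (int \<times> int) \<Rightarrow> 'a" where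
  "tker a i m = a (fst i) (fst m) (snd i - snd m)"

definition col :: "('j \<Rightarrow> 'j \<Rightarrow> int \<times> int \<Rightarrow> 'a) \<Rightarrow> 'j \<Rightarrow> 'j \<times> (int \<times> int) \<Rightarrow> 'a" where
  "col a j i = a (fst i) j (snd i)"

lemma finite_pairs:
  assumes "finite A" "\<And>x. x \<in> A \<Longrightarrow> finite (F x)"
  shows "finite {(x, y). x \<in> A \<and> y \<in> F x}"
proof -
  have "{(x, y). x \<in> A \<and> y \<in> F x} = Sigma A F" by auto
  then show ?thesis using assms by simp
qed

context graded_ring
begin

definition kernel_on :: "'j set \<Rightarrow> (int \<times> int) set \<Rightarrow> ('j \<Rightarrow> 'j \<Rightarrow> int \<times> int \<Rightarrow> 'a) \<Rightarrow> bool" where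
  "kernel_on J T a \<longleftrightarrow> finite J \<and> (\<forall>j' j \<tau>. a j' j \<tau> \<in> Rg \<tau>) \<and>
     (\<forall>j' j \<tau>. a j' j \<tau> \<noteq> \<zero> \<longrightarrow> j' \<in> J \<and> j \<in> J \<and> \<tau> \<in> T)"

definition hvec :: "'j set \<Rightarrow> ('j \<times> (int \<times> int) \<Rightarrow> 'a) \<Rightarrow> bool" where
  "hvec J z \<longleftrightarrow> (\<forall>i. z i \<in> Rg (snd i)) \<and> (\<forall>i. z i \<noteq> \<zero> \<longrightarrow> fst i \<in> J)"

definition degs :: "('j \<times> (int \<times> int) \<Rightarrow> 'a) \<Rightarrow> (int \<times> int) set" where
  "degs z = snd ` {i. z i \<noteq> \<zero>}"

text \<open>Every row of a kernel with degrees in \<open>T\<close> then meets the support of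
  \<open>z\<close> in a finite set, so that applying the kernel to \<open>z\<close> involves finite
  sums only.\<close>

definition loc_finite :: "(int \<times> int) set \<Rightarrow> ('j \<times> (int \<times> int) \<Rightarrow> 'a) \<Rightarrow> bool" where
  "loc_finite T z \<longleftrightarrow> (\<forall>\<sigma>. finite {\<kappa> \<in> degs z. \<sigma> - \<kappa> \<in> T})"

text \<open>By translation invariance a composite is determined by its columns at degree 0, and
  these are the images under \<open>a\<close> of the columns of \<open>c\<close>.\<close>

definition kernel_comp where
  "kernel_comp a c j' j \<tau> = mv R (tker a) (col c j) (j', \<tau>)"

lemma degsI: "z i \<noteq> \<zero> \<Longrightarrow> snd i \<in> degs z"
  by (simp add: degs_def)

lemma degsE:
  assumes "\<sigma> \<in> degs z" obtains j where "z (j, \<sigma>) \<noteq> \<zero>"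
  using assms by (auto simp: degs_def)

lemma hvec_carrier: "hvec J z \<Longrightarrow> z i \<in> carrier R"
  by (auto simp: hvec_def intro: Rg_carrier)

lemma kernel_on_carrier: "kernel_on J T a \<Longrightarrow> a j' j \<tau> \<in> carrier R"
  by (auto simp: kernel_on_def intro: Rg_carrier)

lemma tker_carrier: "kernel_on J T a \<Longrightarrow> tker a i m \<in> carrier R"
  by (simp add: tker_def kernel_on_carrier)

lemma kernel_on_nonzeroD: "kernel_on J T a \<Longrightarrow> tker a i m \<noteq> \<zero> \<Longrightarrow> fst i \<in> J \<and> fst m \<in> J \<and> snd i - snd m \<in> T"
  by (auto simp: kernel_on_def tker_def)

lemma hvec_col: "kernel_on J T a \<Longrightarrow> hvec J (col a j)"
  by (auto simp: kernel_on_def hvec_def col_def)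

lemma kernel_on_finite: "kernel_on J T a \<Longrightarrow> finite J"
  by (simp add: kernel_on_def)

lemma tker_nonzeroD:
  assumes a: "kernel_on J T a" and z: "hvec J' z" and nz: "mv R (tker a) z i \<noteq> \<zero>"
  shows "\<exists>m. tker a i m \<noteq> \<zero> \<and> z m \<noteq> \<zero> \<and> fst i \<in> J \<and> fst m \<in> J \<and> snd i - snd m \<in> T \<and> snd m \<in> degs z"
proof (rule mv_nonzeroE [OF nz])
  fix m assume "tker a i m \<noteq> \<zero>" "z m \<noteq> \<zero>"
  then show ?thesis
    using kernel_on_nonzeroD [OF a, of i m] degsI [of z m] by (intro exI [of _ m]) simp
qed (rule tker_carrier [OF a], rule hvec_carrier [OF z])

lemma hvec_mv:
  assumes a: "kernel_on J T a" and z: "hvec J z"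
  shows "hvec J (mv R (tker a) z)"
  unfolding hvec_def
proof (intro conjI allI impI)
  fix i
  have "tker a i m \<otimes> z m \<in> Rg (snd i)" for m
    by (rule Rg_mult' [of _ "snd i - snd m" _ "snd m"])
      (use a z in \<open>auto simp: kernel_on_def hvec_def tker_def\<close>)
  then show "mv R (tker a) z i \<in> Rg (snd i)"
    unfolding mv_def by (rule Rg_fsum)
  assume "mv R (tker a) z i \<noteq> \<zero>"
  then show "fst i \<in> J"
    using tker_nonzeroD [OF a z, of i] by auto
qed

lemma degs_mv:
  assumes a: "kernel_on J T a" and z: "hvec J z" and "\<sigma> \<in> degs (mv R (tker a) z)"
  obtains \<kappa> where "\<kappa> \<in> degs z" "\<sigma> - \<kappa> \<in> T"
proof -
  obtain j where "mv R (tker a) z (j, \<sigma>) \<noteq> \<zero>"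
    using assms(3) by (rule degsE)
  then have "\<exists>\<kappa>. \<kappa> \<in> degs z \<and> \<sigma> - \<kappa> \<in> T"
    using tker_nonzeroD [OF a z, of "(j, \<sigma>)"] by auto
  then show ?thesis using that by auto
qed

lemma loc_finiteD: "loc_finite T z \<Longrightarrow> finite {\<kappa> \<in> degs z. \<sigma> - \<kappa> \<in> T}"
  by (simp add: loc_finite_def)

lemma loc_finite_finite: "finite T \<Longrightarrow> loc_finite T z"
  unfolding loc_finite_def
proof
  fix \<sigma> assume "finite T"
  then have "finite ((\<lambda>\<tau>. \<sigma> - \<tau>) ` T)" by simp
  moreover have "{\<kappa> \<in> degs z. \<sigma> - \<kappa> \<in> T} \<subseteq> (\<lambda>\<tau>. \<sigma> - \<tau>) ` T"
    by (auto intro!: image_eqI [of _ _ "\<sigma> - _"])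
  ultimately show "finite {\<kappa> \<in> degs z. \<sigma> - \<kappa> \<in> T}" by (rule finite_subset [rotated])
qed

lemma loc_finite_finite_degs: "finite (degs z) \<Longrightarrow> loc_finite T z"
  by (auto simp: loc_finite_def)

lemma row_finite:
  assumes a: "kernel_on J T a" and z: "loc_finite T z"
  shows "finite {m. tker a i m \<noteq> \<zero> \<and> z m \<noteq> \<zero>}"
proof (rule finite_subset)
  show "{m. tker a i m \<noteq> \<zero> \<and> z m \<noteq> \<zero>} \<subseteq> J \<times> {\<kappa> \<in> degs z. snd i - \<kappa> \<in> T}"
  proof
    fix m assume "m \<in> {m. tker a i m \<noteq> \<zero> \<and> z m \<noteq> \<zero>}"
    then have "tker a i m \<noteq> \<zero>" "z m \<noteq> \<zero>" by simp_all
    then show "m \<in> J \<times> {\<kappa> \<in> degs z. snd i - \<kappa> \<in> T}"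
      using kernel_on_nonzeroD [OF a, of i m] degsI [of z m] by (simp add: mem_Times_iff)
  qed
  show "finite (J \<times> {\<kappa> \<in> degs z. snd i - \<kappa> \<in> T})"
    using loc_finiteD [OF z] kernel_on_finite [OF a] by blast
qed

lemma kernel_on_kernel_comp:
  assumes a: "kernel_on J T a" and c: "kernel_on J T' c"
  shows "kernel_on J {\<alpha> + \<beta> | \<alpha> \<beta>. \<alpha> \<in> T \<and> \<beta> \<in> T'} (kernel_comp a c)"
  unfolding kernel_on_def
proof (intro conjI allI impI)
  show "finite J" using a by (rule kernel_on_finite)
  fix j' j \<tau>
  have hvec: "hvec J (mv R (tker a) (col c j))"
    by (rule hvec_mv [OF a hvec_col [OF c]])
  have hv1: "mv R (tker a) (col c j) i \<in> Rg (snd i)"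
    and hv2: "mv R (tker a) (col c j) i \<noteq> \<zero> \<Longrightarrow> fst i \<in> J" for i
    using hvec by (simp_all add: hvec_def)
  show "kernel_comp a c j' j \<tau> \<in> Rg \<tau>"
    using hv1 [of "(j', \<tau>)"] by (simp add: kernel_comp_def)
  assume nz: "kernel_comp a c j' j \<tau> \<noteq> \<zero>"
  then show "j' \<in> J"
    using hv2 [of "(j', \<tau>)"] by (simp add: kernel_comp_def)
  obtain m where m: "tker a (j', \<tau>) m \<noteq> \<zero>" "col c j m \<noteq> \<zero>"
    using nz tker_nonzeroD [OF a hvec_col [OF c, of j], of "(j', \<tau>)"] unfolding kernel_comp_def by auto
  show "j \<in> J"
    using m(2) c by (auto simp: col_def kernel_on_def)
  have "\<tau> - snd m \<in> T" "snd m \<in> T'"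
    using kernel_on_nonzeroD [OF a m(1)] m(2) c by (auto simp: col_def kernel_on_def)
  then show "\<tau> \<in> {\<alpha> + \<beta> | \<alpha> \<beta>. \<alpha> \<in> T \<and> \<beta> \<in> T'}"
    by (intro CollectI exI [of _ "\<tau> - snd m"] exI [of _ "snd m"]) simp
qed

text \<open>An instance of \<open>mv_assoc\<close>: the hypothesis counts the paths from a degree
  \<open>\<kappa>\<close> of \<open>z\<close> through \<open>\<mu>\<close> to the degree of
  \<open>i\<close>.\<close>

lemma tker_mv_mv:
  assumes a: "kernel_on J T a" and c: "kernel_on J T' c" and z: "hvec J z"
    and fin: "finite {(\<mu>, \<kappa>). \<kappa> \<in> degs z \<and> \<mu> - \<kappa> \<in> T' \<and> snd i - \<mu> \<in> T}"
  shows "mv R (tker a) (mv R (tker c) z) i = mv R (tker (kernel_comp a c)) z i"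
proof -
  let ?P = "{(\<mu>, \<kappa>). \<kappa> \<in> degs z \<and> \<mu> - \<kappa> \<in> T' \<and> snd i - \<mu> \<in> T}"
  have "mv R (tker a) (mv R (tker c) z) i = mv R (\<lambda>i m'. mv R (tker a) (\<lambda>m. tker c m m') i) z i"
  proof (rule mv_assoc)
    have "finite ((\<lambda>((x, y), (\<mu>, \<kappa>)). ((x, \<mu>), (y, \<kappa>))) ` ((J \<times> J) \<times> ?P))"
      using fin kernel_on_finite [OF a] by blast
    moreover have "{(m, m'). tker a i m \<noteq> \<zero> \<and> tker c m m' \<noteq> \<zero> \<and> z m' \<noteq> \<zero>}
      \<subseteq> (\<lambda>((x, y), (\<mu>, \<kappa>)). ((x, \<mu>), (y, \<kappa>))) ` ((J \<times> J) \<times> ?P)"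
    proof
      fix p assume "p \<in> {(m, m'). tker a i m \<noteq> \<zero> \<and> tker c m m' \<noteq> \<zero> \<and> z m' \<noteq> \<zero>}"
      then obtain m m' where p: "p = (m, m')" and nz: "tker a i m \<noteq> \<zero>" "tker c m m' \<noteq> \<zero>" "z m' \<noteq> \<zero>"
        by auto
      then have "((fst m, fst m'), (snd m, snd m')) \<in> (J \<times> J) \<times> ?P"
        using kernel_on_nonzeroD [OF a nz(1)] kernel_on_nonzeroD [OF c nz(2)] degsI [of z m'] by auto
      then show "p \<in> (\<lambda>((x, y), (\<mu>, \<kappa>)). ((x, \<mu>), (y, \<kappa>))) ` ((J \<times> J) \<times> ?P)"
        unfolding p by (rule rev_image_eqI) simp
    qed
    ultimately show "finite {(m, m'). tker a i m \<noteq> \<zero> \<and> tker c m m' \<noteq> \<zero> \<and> z m' \<noteq> \<zero>}"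
      by (rule finite_subset [rotated])
  qed (use tker_carrier [OF a] tker_carrier [OF c] hvec_carrier [OF z] in auto)
  \<comment> \<open>Subtracting the degree of \<open>m'\<close> from the summation index moves the
    column at \<open>m'\<close> to degree 0.\<close>
  also have "(\<lambda>i m'. mv R (tker a) (\<lambda>m. tker c m m') i) = tker (kernel_comp a c)"
  proof (intro ext)
    fix i m' :: "'c \<times> (int \<times> int)"
    define h where "h m = (fst m, snd m - snd m')" for m :: "'c \<times> (int \<times> int)"
    have h: "bij h"
      by (rule o_bij [where g = "\<lambda>m. (fst m, snd m + snd m')"]) (auto simp: h_def)
    let ?f = "\<lambda>m. tker a (fst i, snd i - snd m') m \<otimes> col c (fst m') m"
    have "fsum R (\<lambda>m. ?f (h m)) = fsum R ?f"
      by (rule fsum_reindex [OF h])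
        (use tker_carrier [OF a] hvec_carrier [OF hvec_col [OF c]] in auto)
    moreover have "?f (h m) = tker a i m \<otimes> tker c m m'" for m
      by (simp add: h_def tker_def col_def)
    ultimately show "mv R (tker a) (\<lambda>m. tker c m m') i = tker (kernel_comp a c) i m'"
      by (simp add: mv_def tker_def kernel_comp_def)
  qed
  finally show ?thesis .
qed

text \<open>For an outer kernel with finitely many degrees: only finitely many \<open>\<mu>\<close>
  can reach \<open>\<sigma>\<close>. The next lemma is the mirror image, with the finite set of
  degrees in the inner kernel. Together they allow composing the differential on either side with a
  kernel of infinite support.\<close>

lemma pairs_finite_left:
  assumes "finite T" "loc_finite T' z"
  shows "finite {(\<mu>, \<kappa>). \<kappa> \<in> degs z \<and> \<mu> - \<kappa> \<in> T' \<and> \<sigma> - \<mu> \<in> T}"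
proof -
  have "finite {(\<mu>, \<kappa>). \<mu> \<in> (\<lambda>\<tau>. \<sigma> - \<tau>) ` T \<and> \<kappa> \<in> {\<kappa> \<in> degs z. \<mu> - \<kappa> \<in> T'}}"
    by (rule finite_pairs) (simp_all add: assms loc_finiteD)
  moreover have "\<mu> \<in> (\<lambda>\<tau>. \<sigma> - \<tau>) ` T" if "\<sigma> - \<mu> \<in> T" for \<mu>
    using that by (intro image_eqI [of _ _ "\<sigma> - \<mu>"]) auto
  ultimately show ?thesis
    by (elim finite_subset [rotated]) auto
qed

lemma pairs_finite_right:
  assumes "finite T'" "loc_finite T z"
  shows "finite {(\<mu>, \<kappa>). \<kappa> \<in> degs z \<and> \<mu> - \<kappa> \<in> T' \<and> \<sigma> - \<mu> \<in> T}"
proof -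
  have "finite {(\<nu>, \<kappa>). \<nu> \<in> T' \<and> \<kappa> \<in> {\<kappa> \<in> degs z. (\<sigma> - \<nu>) - \<kappa> \<in> T}}"
    by (rule finite_pairs) (simp_all add: assms loc_finiteD)
  then have "finite ((\<lambda>(\<nu>, \<kappa>). (\<nu> + \<kappa>, \<kappa>)) ` {(\<nu>, \<kappa>). \<nu> \<in> T' \<and> \<kappa> \<in> {\<kappa> \<in> degs z. (\<sigma> - \<nu>) - \<kappa> \<in> T}})"
    by blast
  moreover have "(\<mu>, \<kappa>) \<in> (\<lambda>(\<nu>, \<kappa>). (\<nu> + \<kappa>, \<kappa>)) ` {(\<nu>, \<kappa>). \<nu> \<in> T' \<and> \<kappa> \<in> {\<kappa> \<in> degs z. (\<sigma> - \<nu>) - \<kappa> \<in> T}}"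
    if "\<kappa> \<in> degs z" "\<mu> - \<kappa> \<in> T'" "\<sigma> - \<mu> \<in> T" for \<mu> \<kappa>
    using that by (intro image_eqI [of _ _ "(\<mu> - \<kappa>, \<kappa>)"]) (auto simp: algebra_simps)
  ultimately show ?thesis
    by (elim finite_subset [rotated]) auto
qed

lemma loc_finite_plus_left:
  assumes "finite N" "loc_finite T z"
  shows "loc_finite {\<alpha> + \<beta> | \<alpha> \<beta>. \<alpha> \<in> N \<and> \<beta> \<in> T} z"
  unfolding loc_finite_def
proof
  fix \<sigma>
  have "{\<kappa> \<in> degs z. \<sigma> - \<kappa> \<in> {\<alpha> + \<beta> | \<alpha> \<beta>. \<alpha> \<in> N \<and> \<beta> \<in> T}} \<subseteq> (\<Union>\<alpha>\<in>N. {\<kappa> \<in> degs z. (\<sigma> - \<alpha>) - \<kappa> \<in> T})"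
  proof clarify
    fix \<kappa> \<alpha> \<beta> assume "\<kappa> \<in> degs z" "\<sigma> - \<kappa> = \<alpha> + \<beta>" "\<alpha> \<in> N" "\<beta> \<in> T"
    moreover from this have "(\<sigma> - \<alpha>) - \<kappa> = \<beta>" by (simp add: algebra_simps)
    ultimately show "\<kappa> \<in> (\<Union>\<alpha>\<in>N. {\<kappa> \<in> degs z. (\<sigma> - \<alpha>) - \<kappa> \<in> T})" by auto
  qed
  then show "finite {\<kappa> \<in> degs z. \<sigma> - \<kappa> \<in> {\<alpha> + \<beta> | \<alpha> \<beta>. \<alpha> \<in> N \<and> \<beta> \<in> T}}"
    by (rule finite_subset) (intro finite_UN_I assms loc_finiteD)
qed

lemma plus_sets_commute:
  "{\<alpha> + \<beta> | \<alpha> \<beta>. \<alpha> \<in> N \<and> \<beta> \<in> T} = {\<alpha> + \<beta> | \<alpha> \<beta> :: int \<times> int. \<alpha> \<in> T \<and> \<beta> \<in> N}"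
proof -
  have "{\<alpha> + \<beta> | \<alpha> \<beta>. \<alpha> \<in> X \<and> \<beta> \<in> Y} \<subseteq> {\<alpha> + \<beta> | \<alpha> \<beta> :: int \<times> int. \<alpha> \<in> Y \<and> \<beta> \<in> X}" for X Y
  proof
    fix v assume "v \<in> {\<alpha> + \<beta> | \<alpha> \<beta>. \<alpha> \<in> X \<and> \<beta> \<in> Y}"
    then obtain \<alpha> \<beta> where "v = \<alpha> + \<beta>" "\<alpha> \<in> X" "\<beta> \<in> Y" by blast
    then show "v \<in> {\<alpha> + \<beta> | \<alpha> \<beta>. \<alpha> \<in> Y \<and> \<beta> \<in> X}"
      by (intro CollectI exI [of _ \<beta>] exI [of _ \<alpha>]) (simp add: add.commute)
  qed
  then show ?thesis by (intro equalityI)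
qed

text \<open>An identity between translation invariant kernels holds everywhere as soon as it holds
  on the columns at degree 0. The error term \<open>t\<close> and the index subset \<open>J'\<close>
  serve three situations: a true contraction, a contraction known in one chain degree only, and a
  contraction up to an error.\<close>

lemma contraction_lift:
  assumes D: "kernel_on J N D" "finite N" and g: "kernel_on J T g" and t: "kernel_on J N' t" "finite N'"
    and J': "J' \<subseteq> J"
    and col: "\<And>j i. j \<in> J' \<Longrightarrow> mv R (tker D) (col g j) i \<oplus> mv R (tker g) (col D j) i \<oplus> col t j i
        = (if i = (j, 0) then \<one> else \<zero>)"
    and z': "hvec J' z" "loc_finite T z"
  shows "mv R (tker D) (mv R (tker g) z) i \<oplus> mv R (tker g) (mv R (tker D) z) i \<oplus> mv R (tker t) z i = z i"
proof -
  have z: "hvec J z" "loc_finite T z"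
    using z' J' unfolding hvec_def by blast+
  let ?k1 = "tker (kernel_comp D g)" and ?k2 = "tker (kernel_comp g D)" and ?k3 = "tker t"
  let ?NT = "{\<alpha> + \<beta> | \<alpha> \<beta>. \<alpha> \<in> N \<and> \<beta> \<in> T}" and ?TN = "{\<alpha> + \<beta> | \<alpha> \<beta>. \<alpha> \<in> T \<and> \<beta> \<in> N}"
  have k: "?k1 i m \<in> carrier R" "?k2 i m \<in> carrier R" "?k3 i m \<in> carrier R" for i m
    using tker_carrier [OF kernel_on_kernel_comp [OF D(1) g]] tker_carrier [OF kernel_on_kernel_comp [OF g D(1)]]
      tker_carrier [OF t(1)] by auto
  have zc: "z m \<in> carrier R" for m using z(1) by (rule hvec_carrier)
  have ok: "loc_finite ?NT z" "loc_finite ?TN z" "loc_finite N' z"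
    using loc_finite_plus_left [OF D(2) z(2)] loc_finite_finite [OF t(2)] plus_sets_commute [of N T] by auto
  have f1: "finite {m. ?k1 i m \<noteq> \<zero> \<and> z m \<noteq> \<zero>}"
    by (rule row_finite [OF kernel_on_kernel_comp [OF D(1) g] ok(1)])
  have f2: "finite {m. ?k2 i m \<noteq> \<zero> \<and> z m \<noteq> \<zero>}"
    by (rule row_finite [OF kernel_on_kernel_comp [OF g D(1)] ok(2)])
  have f3: "finite {m. ?k3 i m \<noteq> \<zero> \<and> z m \<noteq> \<zero>}"
    by (rule row_finite [OF t(1) ok(3)])
  have f12: "finite {m. ?k1 i m \<oplus> ?k2 i m \<noteq> \<zero> \<and> z m \<noteq> \<zero>}"
    by (rule finite_subset [OF _ finite_UnI [OF f1 f2]]) auto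
  have "mv R (tker D) (mv R (tker g) z) i = mv R ?k1 z i"
    by (rule tker_mv_mv [OF D(1) g z(1) pairs_finite_left [OF D(2) z(2)]])
  moreover have "mv R (tker g) (mv R (tker D) z) i = mv R ?k2 z i"
    by (rule tker_mv_mv [OF g D(1) z(1) pairs_finite_right [OF D(2) z(2)]])
  moreover have "mv R ?k1 z i \<oplus> mv R ?k2 z i = mv R (\<lambda>i m. ?k1 i m \<oplus> ?k2 i m) z i"
    by (rule mv_add_left [symmetric]) (use k zc f1 f2 in auto)
  moreover have "mv R (\<lambda>i m. ?k1 i m \<oplus> ?k2 i m) z i \<oplus> mv R ?k3 z i
      = mv R (\<lambda>i m. ?k1 i m \<oplus> ?k2 i m \<oplus> ?k3 i m) z i"
    by (rule mv_add_left [symmetric]) (use k zc f12 f3 in auto)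
  moreover have "mv R (\<lambda>i m. ?k1 i m \<oplus> ?k2 i m \<oplus> ?k3 i m) z i = fsum R (\<lambda>m. if m = i then z m else \<zero>)"
    unfolding mv_def
  proof (rule arg_cong [where f = "fsum R"], rule ext)
    fix m
    show "(?k1 i m \<oplus> ?k2 i m \<oplus> ?k3 i m) \<otimes> z m = (if m = i then z m else \<zero>)"
    proof (cases "z m = \<zero>")
      case True
      then show ?thesis using k by auto
    next
      case False
      then have "fst m \<in> J'" using z'(1) by (simp add: hvec_def)
      then have "?k1 i m \<oplus> ?k2 i m \<oplus> ?k3 i m = (if (fst i, snd i - snd m) = (fst m, 0) then \<one> else \<zero>)"
        using col [of "fst m" "(fst i, snd i - snd m)"] by (simp add: tker_def kernel_comp_def col_def)
      moreover have "(fst i, snd i - snd m) = (fst m, 0) \<longleftrightarrow> m = i"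
        by (auto simp: prod_eq_iff)
      ultimately show ?thesis using zc by simp
    qed
  qed
  moreover have "fsum R (\<lambda>m. if m = i then z m else \<zero>) = z i"
    using fsum_single [of "\<lambda>m. if m = i then z m else \<zero>" i] zc by simp
  ultimately show ?thesis by simp
qed

end

subsection \<open>Complexes with finite bases in coordinates\<close>

text \<open>If \<open>z\<close> holds the coordinates of a module element x, these are the
  coordinates of x tensored with \<open>s\<close>.\<close>

definition star ::
    "('a, 'm) ring_scheme \<Rightarrow> ('j \<times> (int \<times> int) \<Rightarrow> 'a) \<Rightarrow> (int \<times> int \<Rightarrow> 'a) \<Rightarrow> 'j \<times> (int \<times> int) \<Rightarrow> 'a" where
  "star R z s = mv R (\<lambda>i \<kappa>. z (fst i, snd i - \<kappa>)) s"

lemma (in graded_ring) comp_mult_homogeneous: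
  assumes "a \<in> carrier R" "r \<in> Rg \<mu>"
  shows "comp (a \<otimes> r) \<sigma> = comp a (\<sigma> - \<mu>) \<otimes> r"
proof -
  have "comp (a \<otimes> r) \<sigma> = fsum R (\<lambda>\<kappa>. comp a \<kappa> \<otimes> comp r (\<sigma> - \<kappa>))"
    using comp_mult [of a r] assms by (simp add: conv_def Rg_carrier [OF assms(2)])
  also have "\<dots> = comp a (\<sigma> - \<mu>) \<otimes> comp r (\<sigma> - (\<sigma> - \<mu>))"
  proof (rule fsum_single)
    fix \<kappa> assume "\<kappa> \<noteq> \<sigma> - \<mu>"
    then have "\<sigma> - \<kappa> \<noteq> \<mu>" by (auto simp: algebra_simps)
    then have "comp r (\<sigma> - \<kappa>) = \<zero>"
      using comp_homogeneous [OF assms(2)] by simp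
    then show "comp a \<kappa> \<otimes> comp r (\<sigma> - \<kappa>) = \<zero>"
      using assms(1) by (simp add: Rg_carrier [OF comp_in])
  qed (use assms in \<open>simp add: Rg_carrier [OF comp_in] Rg_carrier [OF assms(2)]\<close>)
  finally show ?thesis
    using comp_homogeneous [OF assms(2)] by simp
qed

context graded_ring
begin

lemma star_closed: "hvec J z \<Longrightarrow> (\<And>\<kappa>. s \<kappa> \<in> carrier R) \<Longrightarrow> star R z s i \<in> carrier R"
  unfolding star_def by (rule mv_closed) (auto intro: hvec_carrier)

lemma star_fin:
  assumes "finite (degs z)"
  shows "finite {\<kappa>. z (fst i, snd i - \<kappa>) \<noteq> \<zero> \<and> s \<kappa> \<noteq> \<zero>}"
proof (rule finite_subset)
  show "{\<kappa>. z (fst i, snd i - \<kappa>) \<noteq> \<zero> \<and> s \<kappa> \<noteq> \<zero>} \<subseteq> (\<lambda>\<mu>. snd i - \<mu>) ` degs z"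
  proof
    fix \<kappa> assume "\<kappa> \<in> {\<kappa>. z (fst i, snd i - \<kappa>) \<noteq> \<zero> \<and> s \<kappa> \<noteq> \<zero>}"
    then have "snd i - \<kappa> \<in> degs z" using degsI [of z "(fst i, snd i - \<kappa>)"] by simp
    then show "\<kappa> \<in> (\<lambda>\<mu>. snd i - \<mu>) ` degs z"
      by (rule rev_image_eqI) simp
  qed
qed (use assms in simp)

lemma star_add_left:
  assumes "hvec J z" "hvec J w" "\<And>\<kappa>. s \<kappa> \<in> carrier R" "finite (degs z)" "finite (degs w)"
  shows "star R (\<lambda>i. z i \<oplus> w i) s i = star R z s i \<oplus> star R w s i"
  unfolding star_def
  by (rule mv_add_left)
    (simp_all add: assms star_fin hvec_carrier [OF assms(1)] hvec_carrier [OF assms(2)])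

lemma star_add_right:
  assumes "hvec J z" "\<And>\<kappa>. s \<kappa> \<in> carrier R" "\<And>\<kappa>. t \<kappa> \<in> carrier R" "finite (degs z)"
  shows "star R z (\<lambda>\<kappa>. s \<kappa> \<oplus> t \<kappa>) i = star R z s i \<oplus> star R z t i"
  unfolding star_def
  by (rule mv_add) (simp_all add: assms star_fin hvec_carrier [OF assms(1)])

text \<open>In coordinates this is the relation that moves a ring element across the tensor
  sign.\<close>

lemma star_star:
  assumes z: "hvec J z" "finite (degs z)" and f: "\<And>\<kappa>. f \<kappa> \<in> carrier R" "finite {\<kappa>. f \<kappa> \<noteq> \<zero>}"
    and s: "\<And>\<kappa>. s \<kappa> \<in> carrier R"
  shows "star R (star R z f) s = star R z (conv R f s)"
proof
  fix i
  let ?k = "\<lambda>i \<kappa>. z (fst i, snd i - \<kappa>)" and ?l = "\<lambda>\<sigma> \<kappa>. f (\<sigma> - \<kappa>)"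
  have c: "conv R f s = mv R ?l s"
  proof
    fix \<sigma>
    have "fsum R (\<lambda>\<kappa>. f (\<sigma> - \<kappa>) \<otimes> s (\<sigma> - (\<sigma> - \<kappa>))) = fsum R (\<lambda>\<kappa>. f \<kappa> \<otimes> s (\<sigma> - \<kappa>))"
      by (rule fsum_reindex [OF bij_shift(3) [of \<sigma>]]) (use f s in auto)
    then show "conv R f s \<sigma> = mv R ?l s \<sigma>"
      by (simp add: conv_def mv_def)
  qed
  have "mv R ?k (mv R ?l s) i = mv R (\<lambda>i \<kappa>. mv R ?k (\<lambda>m. ?l m \<kappa>) i) s i"
  proof (rule mv_assoc)
    have "{(m, m'). ?k i m \<noteq> \<zero> \<and> ?l m m' \<noteq> \<zero> \<and> s m' \<noteq> \<zero>}
        \<subseteq> (\<lambda>(\<mu>, \<nu>). (snd i - \<mu>, snd i - \<mu> - \<nu>)) ` (degs z \<times> {\<kappa>. f \<kappa> \<noteq> \<zero>})"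
    proof
      fix p assume "p \<in> {(m, m'). ?k i m \<noteq> \<zero> \<and> ?l m m' \<noteq> \<zero> \<and> s m' \<noteq> \<zero>}"
      then obtain m m' where p: "p = (m, m')" and nz: "?k i m \<noteq> \<zero>" "?l m m' \<noteq> \<zero>"
        by auto
      have "(snd i - m, m - m') \<in> degs z \<times> {\<kappa>. f \<kappa> \<noteq> \<zero>}"
        using nz degsI [of z "(fst i, snd i - m)"] by simp
      then show "p \<in> (\<lambda>(\<mu>, \<nu>). (snd i - \<mu>, snd i - \<mu> - \<nu>)) ` (degs z \<times> {\<kappa>. f \<kappa> \<noteq> \<zero>})"
        unfolding p by (rule rev_image_eqI) simp
    qed
    then show "finite {(m, m'). ?k i m \<noteq> \<zero> \<and> ?l m m' \<noteq> \<zero> \<and> s m' \<noteq> \<zero>}"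
      by (rule finite_subset) (use z f in blast)
  qed (use z f s in \<open>auto intro: hvec_carrier\<close>)
  also have "(\<lambda>i \<kappa>. mv R ?k (\<lambda>m. ?l m \<kappa>) i) = (\<lambda>i \<kappa>. star R z f (fst i, snd i - \<kappa>))"
  proof (intro ext)
    fix i :: "'c \<times> (int \<times> int)" and \<kappa>
    have "fsum R (\<lambda>m. z (fst i, snd i - \<kappa> - (m - \<kappa>)) \<otimes> f (m - \<kappa>)) = fsum R (\<lambda>m. z (fst i, snd i - \<kappa> - m) \<otimes> f m)"
      by (rule fsum_reindex [OF bij_shift(2) [of \<kappa>]]) (use f z in \<open>auto intro: hvec_carrier\<close>)
    then show "mv R ?k (\<lambda>m. ?l m \<kappa>) i = star R z f (fst i, snd i - \<kappa>)"
      by (simp add: star_def mv_def)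
  qed
  finally show "star R (star R z f) s i = star R z (conv R f s) i"
    by (simp add: star_def c)
qed

text \<open>Kernels act from the left and coefficients from the right. Consequently the differential
  of the tensored complex is given by the same kernel as that of the complex itself.\<close>

lemma mv_star:
  assumes a: "kernel_on J N a" "finite N" and z: "hvec J z" "finite (degs z)" and s: "\<And>\<kappa>. s \<kappa> \<in> carrier R"
  shows "mv R (tker a) (star R z s) = star R (mv R (tker a) z) s"
proof
  fix i
  let ?l = "\<lambda>i \<kappa>. z (fst i, snd i - \<kappa>)"
  have "mv R (tker a) (mv R ?l s) i = mv R (\<lambda>i \<kappa>. mv R (tker a) (\<lambda>m. ?l m \<kappa>) i) s i"
  proof (rule mv_assoc)
    have "{(m, m'). tker a i m \<noteq> \<zero> \<and> ?l m m' \<noteq> \<zero> \<and> s m' \<noteq> \<zero>}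
        \<subseteq> (\<lambda>((j, \<tau>), \<mu>). ((j, snd i - \<tau>), snd i - \<tau> - \<mu>)) ` ((J \<times> N) \<times> degs z)"
    proof
      fix p assume "p \<in> {(m, m'). tker a i m \<noteq> \<zero> \<and> ?l m m' \<noteq> \<zero> \<and> s m' \<noteq> \<zero>}"
      then obtain m m' where p: "p = (m, m')" and nz: "tker a i m \<noteq> \<zero>" "?l m m' \<noteq> \<zero>"
        by auto
      have "((fst m, snd i - snd m), snd m - m') \<in> (J \<times> N) \<times> degs z"
        using kernel_on_nonzeroD [OF a(1) nz(1)] nz degsI [of z "(fst m, snd m - m')"] by simp
      then show "p \<in> (\<lambda>((j, \<tau>), \<mu>). ((j, snd i - \<tau>), snd i - \<tau> - \<mu>)) ` ((J \<times> N) \<times> degs z)"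
        unfolding p by (rule rev_image_eqI) simp
    qed
    then show "finite {(m, m'). tker a i m \<noteq> \<zero> \<and> ?l m m' \<noteq> \<zero> \<and> s m' \<noteq> \<zero>}"
      by (rule finite_subset) (use z a kernel_on_finite [OF a(1)] in blast)
  qed (use z s tker_carrier [OF a(1)] in \<open>auto intro: hvec_carrier\<close>)
  also have "(\<lambda>i \<kappa>. mv R (tker a) (\<lambda>m. ?l m \<kappa>) i) = (\<lambda>i \<kappa>. mv R (tker a) z (fst i, snd i - \<kappa>))"
  proof (intro ext)
    fix i :: "'c \<times> (int \<times> int)" and \<kappa>
    define h where "h m = (fst m, snd m - \<kappa>)" for m :: "'c \<times> (int \<times> int)"
    have h: "bij h"
      by (rule o_bij [where g = "\<lambda>m. (fst m, snd m + \<kappa>)"]) (auto simp: h_def)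
    let ?f = "\<lambda>m. tker a (fst i, snd i - \<kappa>) m \<otimes> z m"
    have "fsum R (\<lambda>m. ?f (h m)) = fsum R ?f"
      by (rule fsum_reindex [OF h])
        (use tker_carrier [OF a(1)] hvec_carrier [OF z(1)] in auto)
    then show "mv R (tker a) (\<lambda>m. ?l m \<kappa>) i = mv R (tker a) z (fst i, snd i - \<kappa>)"
      by (simp add: mv_def h_def tker_def)
  qed
  finally show "mv R (tker a) (star R z s) i = star R (mv R (tker a) z) s i"
    by (simp add: star_def)
qed

end

locale based_complex = strongly_graded_ring R Rg for R :: "('a, 'm) ring_scheme" (structure) and Rg +
  fixes C :: "int \<Rightarrow> ('a, 'b, 'n) rmodule_scheme" and d :: "int \<Rightarrow> 'b \<Rightarrow> 'b"
    and B :: "int \<Rightarrow> 'b set"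
  assumes complex: "chain_complex R C d"
    and bases: "\<And>n. is_basis R (C n) (B n)"
    and finite_degrees: "finite {n. B n \<noteq> {}}"

sublocale based_complex \<subseteq> C: based_module R "C n" "B n" for n
proof -
  interpret right_module R "C n"
    using complex by (auto simp: chain_complex_def)
  show "based_module R (C n) (B n)"
    by unfold_locales (rule bases)
qed

context based_complex
begin

text \<open>All chain degrees are collected in one finite index set, so that the differential and
  each homotopy is a single kernel.\<close>

definition J :: "(int \<times> 'b) set" where
  "J = (SIGMA n:{n. B n \<noteq> {}}. B n)"

lemma in_J: "(n, b) \<in> J \<longleftrightarrow> b \<in> B n"
  by (auto simp: J_def)

lemma finite_J: "finite J"
  unfolding J_def using finite_degrees by simp

definition vec :: "int \<Rightarrow> 'b \<Rightarrow> (int \<times> 'b) \<times> (int \<times> int) \<Rightarrow> 'a" where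
  "vec n x i = (if fst (fst i) = n then comp (coord R (C n) (B n) x (snd (fst i))) (snd i) else \<zero>)"

text \<open>The inverse of \<open>vec n\<close> on families with finitely many degrees; see
  \<open>tot_vec\<close> and \<open>vec_tot\<close>.\<close>

definition tot :: "int \<Rightarrow> ((int \<times> 'b) \<times> (int \<times> int) \<Rightarrow> 'a) \<Rightarrow> 'b" where
  "tot n z = (\<Oplus>\<^bsub>C n\<^esub>b\<in>B n. b \<odot>\<^sub>r\<^bsub>C n\<^esub> fsum R (\<lambda>\<sigma>. z ((n, b), \<sigma>)))"

definition rhom :: "int \<Rightarrow> (int \<Rightarrow> 'b \<Rightarrow> 'b) \<Rightarrow> bool" where
  "rhom k \<phi> \<longleftrightarrow> (\<forall>n. \<phi> n \<in> rmodule_hom R (C n) (C (n + k)))"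

definition kern :: "int \<Rightarrow> (int \<Rightarrow> 'b \<Rightarrow> 'b) \<Rightarrow> int \<times> 'b \<Rightarrow> int \<times> 'b \<Rightarrow> int \<times> int \<Rightarrow> 'a" where
  "kern k \<phi> j' j \<tau> = (if snd j \<in> B (fst j) then vec (fst j + k) (\<phi> (fst j) (snd j)) (j', \<tau>) else \<zero>)"

abbreviation hvec_at where "hvec_at n \<equiv> hvec ({n} \<times> B n)"

lemma hvec_at_hvec: "hvec_at n z \<Longrightarrow> hvec J z"
  by (auto simp: hvec_def in_J)

lemma hvec_at_vec:
  assumes "x \<in> carrier (C n)" shows "hvec_at n (vec n x)"
  unfolding hvec_def
proof (intro conjI allI impI)
  fix i
  show "vec n x i \<in> Rg (snd i)"
    using assms by (auto simp: vec_def)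
  show "fst i \<in> {n} \<times> B n" if "vec n x i \<noteq> \<zero>"
    using that by (cases "snd (fst i) \<in> B n") (auto simp: vec_def mem_Times_iff split: if_splits)
qed

lemma vec_carrier [simp]: "x \<in> carrier (C n) \<Longrightarrow> vec n x i \<in> carrier R"
  using hvec_carrier [OF hvec_at_vec] .

lemma finite_degs_vec [simp]:
  assumes "x \<in> carrier (C n)" shows "finite (degs (vec n x))"
proof (rule finite_subset)
  show "degs (vec n x) \<subseteq> (\<Union>b\<in>B n. {\<sigma>. comp (coord R (C n) (B n) x b) \<sigma> \<noteq> \<zero>})"
  proof
    fix \<sigma> assume "\<sigma> \<in> degs (vec n x)"
    then obtain j where "vec n x (j, \<sigma>) \<noteq> \<zero>" by (rule degsE)
    moreover from this have "fst (j, \<sigma>) \<in> {n} \<times> B n"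
      using hvec_at_vec [OF assms] unfolding hvec_def by blast
    ultimately have "snd j \<in> B n" "comp (coord R (C n) (B n) x (snd j)) \<sigma> \<noteq> \<zero>"
      by (auto simp: vec_def)
    then show "\<sigma> \<in> (\<Union>b\<in>B n. {\<sigma>. comp (coord R (C n) (B n) x b) \<sigma> \<noteq> \<zero>})" by blast
  qed
qed (use assms in auto)

lemma vec_add:
  assumes "x \<in> carrier (C n)" "y \<in> carrier (C n)"
  shows "vec n (x \<oplus>\<^bsub>C n\<^esub> y) i = vec n x i \<oplus> vec n y i"
  using assms by (simp add: vec_def C.co_add comp_add)

lemma vec_zero [simp]: "vec n \<zero>\<^bsub>C n\<^esub> i = \<zero>"
  by (simp add: vec_def)

lemma
  shows vec_finsum: "(\<And>a. a \<in> A \<Longrightarrow> f a \<in> carrier (C n)) \<Longrightarrow>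
      vec n (finsum (C n) f A) i = (\<Oplus>a\<in>A. vec n (f a) i)"
    and vec_minus: "x \<in> carrier (C n) \<Longrightarrow> vec n (\<ominus>\<^bsub>C n\<^esub> x) i = \<ominus> vec n x i"
    and vec_diff: "x \<in> carrier (C n) \<Longrightarrow> y \<in> carrier (C n) \<Longrightarrow>
      vec n (x \<ominus>\<^bsub>C n\<^esub> y) i = vec n x i \<ominus> vec n y i"
  by (rule additive_finsum [of "C n" R "\<lambda>x. vec n x i"];
      auto simp: vec_add C.M.abelian_group_axioms is_abelian_group)+

lemma vec_rsmult:
  assumes "x \<in> carrier (C n)" "r \<in> carrier R"
  shows "vec n (x \<odot>\<^sub>r\<^bsub>C n\<^esub> r) = star R (vec n x) (comp r)"
proof
  fix i
  show "vec n (x \<odot>\<^sub>r\<^bsub>C n\<^esub> r) i = star R (vec n x) (comp r) i"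
  proof (cases "fst (fst i) = n")
    case True
    let ?c = "coord R (C n) (B n) x (snd (fst i))"
    have c: "?c \<in> carrier R" using assms by simp
    have "comp (?c \<otimes> r) (snd i) = fsum R (\<lambda>\<kappa>. comp ?c \<kappa> \<otimes> comp r (snd i - \<kappa>))"
      using comp_mult [OF c assms(2)] by (simp add: conv_def)
    also have "\<dots> = fsum R (\<lambda>\<kappa>. comp ?c (snd i - \<kappa>) \<otimes> comp r (snd i - (snd i - \<kappa>)))"
      by (rule fsum_reindex [OF bij_shift(3) [of "snd i"], symmetric])
        (use c assms in \<open>auto simp: Rg_carrier [OF comp_in]\<close>)
    finally show ?thesis
      using True assms by (simp add: vec_def star_def mv_def C.co_rsmult)
  next
    case False
    then show ?thesis
      using assms by (simp add: vec_def star_def mv_def Rg_carrier [OF comp_in])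
  qed
qed

lemma vec_rsmult_homogeneous:
  assumes "x \<in> carrier (C n)" "r \<in> Rg \<mu>"
  shows "vec n (x \<odot>\<^sub>r\<^bsub>C n\<^esub> r) i = vec n x (fst i, snd i - \<mu>) \<otimes> r"
  using assms comp_mult_homogeneous [OF C.co_closed [OF assms(1)] assms(2)]
  by (simp add: vec_def C.co_rsmult Rg_carrier [OF assms(2)])

lemma tot_closed: "(\<And>i. z i \<in> carrier R) \<Longrightarrow> tot n z \<in> carrier (C n)"
  unfolding tot_def by (rule C.lincomb_closed) auto

lemma tot_vec: "x \<in> carrier (C n) \<Longrightarrow> tot n (vec n x) = x"
  unfolding tot_def by (simp add: vec_def fsum_comp C.co_expand)

lemma vec_eq_iff: "x \<in> carrier (C n) \<Longrightarrow> y \<in> carrier (C n) \<Longrightarrow> vec n x = vec n y \<longleftrightarrow> x = y"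
  by (metis tot_vec)

lemma vec_tot:
  assumes z: "hvec_at n z" "finite (degs z)"
  shows "vec n (tot n z) = z"
proof
  fix i
  have zc: "z m \<in> carrier R" for m using hvec_carrier [OF z(1)] .
  show "vec n (tot n z) i = z i"
  proof (cases "fst i \<in> {n} \<times> B n")
    case True
    then obtain b where b: "fst i = (n, b)" "b \<in> B n" by auto
    have "coord R (C n) (B n) (tot n z) b = fsum R (\<lambda>\<sigma>. z ((n, b), \<sigma>))"
      unfolding tot_def by (rule C.co_lincomb) (use b zc in auto)
    moreover have "comp (fsum R (\<lambda>\<sigma>. z ((n, b), \<sigma>))) = (\<lambda>\<sigma>. z ((n, b), \<sigma>))"
    proof (rule comp_fsum)
      fix \<sigma>
      have "\<forall>m. z m \<in> Rg (snd m)" using z(1) by (simp add: hvec_def)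
      from spec [OF this, of "((n, b), \<sigma>)"] show "z ((n, b), \<sigma>) \<in> Rg \<sigma>" by simp
      have "{\<sigma>. z ((n, b), \<sigma>) \<noteq> \<zero>} \<subseteq> degs z" using degsI [of z] by force
      then show "finite {\<sigma>. z ((n, b), \<sigma>) \<noteq> \<zero>}" using z(2) finite_subset by blast
    qed
    ultimately show ?thesis
      using b by (simp add: vec_def) (metis prod.collapse)
  next
    case False
    have "vec n (tot n z) i = \<zero>" "z i = \<zero>"
      using False hvec_at_vec [OF tot_closed [of z n]] zc z(1) unfolding hvec_def by blast+
    then show ?thesis by simp
  qed
qed

lemma rhomD:
  assumes "rhom k \<phi>" "x \<in> carrier (C n)"
  shows rhom_closed: "\<phi> n x \<in> carrier (C (n + k))"
    and rhom_add: "y \<in> carrier (C n) \<Longrightarrow> \<phi> n (x \<oplus>\<^bsub>C n\<^esub> y) = \<phi> n x \<oplus>\<^bsub>C (n + k)\<^esub> \<phi> n y"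
    and rhom_rsmult: "r \<in> carrier R \<Longrightarrow> \<phi> n (x \<odot>\<^sub>r\<^bsub>C n\<^esub> r) = \<phi> n x \<odot>\<^sub>r\<^bsub>C (n + k)\<^esub> r"
  using assms by (auto simp: rhom_def rmodule_hom_def Pi_iff)

lemma rhom_finsum:
  assumes "rhom k \<phi>" "\<And>a. a \<in> A \<Longrightarrow> f a \<in> carrier (C n)"
  shows "\<phi> n (finsum (C n) f A) = (\<Oplus>\<^bsub>C (n + k)\<^esub>a\<in>A. \<phi> n (f a))"
  by (rule additive_finsum(2) [of "C n" "C (n + k)" "\<phi> n"])
    (use assms in \<open>auto simp: C.M.abelian_group_axioms rhom_closed rhom_add\<close>)

lemma rhom_d: "rhom (-1) d"
  using complex by (simp add: rhom_def chain_complex_def)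

lemma kernel_on_kern:
  assumes "rhom k \<phi>"
  obtains N where "finite N" "kernel_on J N (kern k \<phi>)"
proof
  let ?N = "\<Union>j\<in>J. degs (vec (fst j + k) (\<phi> (fst j) (snd j)))"
  have c: "\<phi> (fst j) (snd j) \<in> carrier (C (fst j + k))" if "snd j \<in> B (fst j)" for j
    using that rhom_closed [OF assms] C.basis_carrier by blast
  show "finite ?N"
    using finite_J c by (intro finite_UN_I) (auto simp: J_def)
  show "kernel_on J ?N (kern k \<phi>)"
    unfolding kernel_on_def
  proof (intro conjI allI impI)
    show "finite J" by (rule finite_J)
    fix j' j \<tau>
    let ?v = "vec (fst j + k) (\<phi> (fst j) (snd j))"
    have hvec: "?v (j', \<tau>) \<in> Rg \<tau>" "?v (j', \<tau>) \<noteq> \<zero> \<Longrightarrow> j' \<in> J" if "snd j \<in> B (fst j)"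
      using hvec_at_hvec [OF hvec_at_vec [OF c [OF that]]] unfolding hvec_def by (metis fst_conv snd_conv)+
    show "kern k \<phi> j' j \<tau> \<in> Rg \<tau>"
      using hvec by (simp add: kern_def)
    assume nz: "kern k \<phi> j' j \<tau> \<noteq> \<zero>"
    then have j: "snd j \<in> B (fst j)" and v: "?v (j', \<tau>) \<noteq> \<zero>"
      by (auto simp: kern_def split: if_splits)
    show "j' \<in> J" using hvec(2) j v .
    show "j \<in> J" using j in_J [of "fst j" "snd j"] by simp
    then show "\<tau> \<in> ?N" using degsI [of ?v, OF v] by auto
  qed
qed

lemma col_kern: "b \<in> B n \<Longrightarrow> col (kern k \<phi>) (n, b) = vec (n + k) (\<phi> n b)"
  by (simp add: col_def kern_def fun_eq_iff vec_def)

text \<open>The row sum is split over basis elements b. The part belonging to b is a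
  \<open>star\<close>, hence the coordinate of \<open>\<phi> n b\<close> times the coefficient of
  \<open>x\<close> at b; linearity of \<open>\<phi>\<close> adds these up to the value at
  \<open>x\<close>.\<close>

lemma kern_vec:
  assumes \<phi>: "rhom k \<phi>" and x: "x \<in> carrier (C n)"
  shows "mv R (tker (kern k \<phi>)) (vec n x) = vec (n + k) (\<phi> n x)"
proof
  fix i
  obtain N where N: "finite N" "kernel_on J N (kern k \<phi>)" using kernel_on_kern [OF \<phi>] .
  let ?c = "coord R (C n) (B n) x"
  let ?f = "\<lambda>j \<kappa>. tker (kern k \<phi>) i (j, \<kappa>) \<otimes> vec n x (j, \<kappa>)"
  have fc: "?f j \<kappa> \<in> carrier R" for j \<kappa>
    using tker_carrier [OF N(2)] x by simp
  have fin: "finite {(j, \<kappa>). ?f j \<kappa> \<noteq> \<zero>}"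
  proof (rule finite_subset)
    show "{(j, \<kappa>). ?f j \<kappa> \<noteq> \<zero>} \<subseteq> {m. tker (kern k \<phi>) i m \<noteq> \<zero> \<and> vec n x m \<noteq> \<zero>}"
    proof (rule subsetI, clarify)
      fix j \<kappa> assume "?f j \<kappa> \<noteq> \<zero>"
      then show "tker (kern k \<phi>) i (j, \<kappa>) \<noteq> \<zero> \<and> vec n x (j, \<kappa>) \<noteq> \<zero>"
        using tker_carrier [OF N(2), of i "(j, \<kappa>)"] vec_carrier [OF x, of "(j, \<kappa>)"]
        by (metis l_null r_null)
    qed
    show "finite {m. tker (kern k \<phi>) i m \<noteq> \<zero> \<and> vec n x m \<noteq> \<zero>}"
      by (rule row_finite [OF N(2) loc_finite_finite_degs]) (use x in simp)
  qed
  have bc: "\<phi> n b \<in> carrier (C (n + k))" if "b \<in> B n" for b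
    using rhom_closed [OF \<phi> C.basis_carrier [OF that]] .
  have z: "?f j \<kappa> = \<zero>" if "j \<notin> {n} \<times> B n" for j \<kappa>
  proof -
    have "vec n x (j, \<kappa>) = \<zero>"
      using hvec_at_vec [OF x] that unfolding hvec_def by (metis fst_conv)
    then show ?thesis using tker_carrier [OF N(2)] by simp
  qed
  have "mv R (tker (kern k \<phi>)) (vec n x) i = fsum R (\<lambda>(j, \<kappa>). ?f j \<kappa>)"
    unfolding mv_def by (rule arg_cong [where f = "fsum R"]) auto
  also have "\<dots> = fsum R (\<lambda>j. fsum R (?f j))"
    by (rule fsum_Pair [symmetric]) (use fc fin in auto)
  also have "\<dots> = finsum R (\<lambda>j. fsum R (?f j)) (Pair n ` B n)"
  proof (rule fsum_eq_finsum)
    fix j assume "j \<notin> Pair n ` B n"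
    then have "j \<notin> {n} \<times> B n" by (auto simp: image_iff)
    then have "?f j = (\<lambda>\<kappa>. \<zero>)" using z by simp
    then show "fsum R (?f j) = \<zero>" by simp
  qed (simp_all add: fc fsum_closed)
  also have "\<dots> = (\<Oplus>b\<in>B n. fsum R (?f (n, b)))"
    by (rule finsum_reindex) (use fc in \<open>auto simp: inj_on_def\<close>)
  also have "\<dots> = (\<Oplus>b\<in>B n. vec (n + k) (\<phi> n b \<odot>\<^sub>r\<^bsub>C (n + k)\<^esub> ?c b) i)"
  proof (rule finsum_cong' [OF refl])
    fix b assume b: "b \<in> B n"
    show "fsum R (?f (n, b)) = vec (n + k) (\<phi> n b \<odot>\<^sub>r\<^bsub>C (n + k)\<^esub> ?c b) i"
      using b x bc by (subst vec_rsmult) (simp_all add: star_def mv_def tker_def kern_def vec_def)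
  qed (simp add: Pi_iff C.rsmult_closed bc x)
  also have "\<dots> = vec (n + k) (\<Oplus>\<^bsub>C (n + k)\<^esub>b\<in>B n. \<phi> n b \<odot>\<^sub>r\<^bsub>C (n + k)\<^esub> ?c b) i"
    by (rule vec_finsum [symmetric]) (simp add: C.rsmult_closed bc x)
  also have "(\<Oplus>\<^bsub>C (n + k)\<^esub>b\<in>B n. \<phi> n b \<odot>\<^sub>r\<^bsub>C (n + k)\<^esub> ?c b)
      = (\<Oplus>\<^bsub>C (n + k)\<^esub>b\<in>B n. \<phi> n (b \<odot>\<^sub>r\<^bsub>C n\<^esub> ?c b))"
    by (rule C.M.finsum_cong' [OF refl])
      (simp_all add: Pi_iff C.rsmult_closed bc x rhom_rsmult [OF \<phi>] C.basis_carrier)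
  also have "\<dots> = \<phi> n (\<Oplus>\<^bsub>C n\<^esub>b\<in>B n. b \<odot>\<^sub>r\<^bsub>C n\<^esub> ?c b)"
    by (rule rhom_finsum [OF \<phi>, symmetric]) (simp add: C.rsmult_closed C.basis_carrier x)
  also have "\<dots> = \<phi> n x"
    using x by (simp add: C.co_expand)
  finally show "mv R (tker (kern k \<phi>)) (vec n x) i = vec (n + k) (\<phi> n x) i" .
qed

abbreviation Dk where "Dk \<equiv> kern (-1) d"

abbreviation Dm where "Dm \<equiv> mv R (tker Dk)"

lemma D_vec: "x \<in> carrier (C n) \<Longrightarrow> Dm (vec n x) = vec (n - 1) (d n x)"
  using kern_vec [OF rhom_d, of x n] by simp

lemma d_closed: "x \<in> carrier (C n) \<Longrightarrow> d n x \<in> carrier (C (n - 1))"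
  using rhom_closed [OF rhom_d, of x n] by simp

lemma D_add:
  assumes "\<And>i. z i \<in> carrier R" "\<And>i. w i \<in> carrier R"
  shows "Dm (\<lambda>i. z i \<oplus> w i) i = Dm z i \<oplus> Dm w i"
proof -
  obtain N where N: "finite N" "kernel_on J N Dk" using kernel_on_kern [OF rhom_d] .
  show ?thesis
    by (rule mv_add) (simp_all add: tker_carrier [OF N(2)] assms row_finite [OF N(2) loc_finite_finite [OF N(1)]])
qed

lemma D_closed: "(\<And>i. z i \<in> carrier R) \<Longrightarrow> Dm z i \<in> carrier R"
  using kernel_on_kern [OF rhom_d] tker_carrier mv_closed by metis

end

subsection \<open>Novikov homology in coordinates\<close>

text \<open>Tensor products over R only require multiplying elements of the Novikov-type ring by
  elements of R, which have finite support. This is why closure under translation by finite sets is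
  demanded, and not closure under sums of two members.\<close>

definition good_supports :: "(int \<times> int) set set \<Rightarrow> bool" where
  "good_supports \<S> \<longleftrightarrow> {} \<in> \<S> \<and> (\<forall>T\<in>\<S>. \<forall>T'. T' \<subseteq> T \<longrightarrow> T' \<in> \<S>) \<and>
     (\<forall>T\<in>\<S>. \<forall>T'\<in>\<S>. T \<union> T' \<in> \<S>) \<and>
     (\<forall>T\<in>\<S>. \<forall>N. finite N \<longrightarrow> {\<alpha> + \<beta> | \<alpha> \<beta>. \<alpha> \<in> N \<and> \<beta> \<in> T} \<in> \<S>)"

text \<open>The multiplicative fields are placeholders; the record is a ring so that the additive
  notation and the theory of \<open>abelian_group\<close> apply to families.\<close>

definition vec_group :: "('a, 'm) ring_scheme \<Rightarrow> ('i \<Rightarrow> 'a) ring" where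
  "vec_group R = \<lparr>carrier = {z. \<forall>i. z i \<in> carrier R}, monoid.mult = (\<lambda>z w i. \<zero>\<^bsub>R\<^esub>), one = (\<lambda>i. \<zero>\<^bsub>R\<^esub>),
     zero = (\<lambda>i. \<zero>\<^bsub>R\<^esub>), add = (\<lambda>z w i. z i \<oplus>\<^bsub>R\<^esub> w i)\<rparr>"

lemma vec_group_simps [simp]:
  "z \<in> carrier (vec_group R) \<longleftrightarrow> (\<forall>i. z i \<in> carrier R)"
  "zero (vec_group R) = (\<lambda>i. \<zero>\<^bsub>R\<^esub>)" "z \<oplus>\<^bsub>vec_group R\<^esub> w = (\<lambda>i. z i \<oplus>\<^bsub>R\<^esub> w i)"
  by (simp_all add: vec_group_def)

lemma (in ring) vec_group_group: "abelian_group (vec_group R :: ('i \<Rightarrow> 'a) ring)"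
proof (rule abelian_groupI)
  fix z assume z: "z \<in> carrier (vec_group R)"
  show "\<exists>w\<in>carrier (vec_group R). w \<oplus>\<^bsub>vec_group R\<^esub> z = \<zero>\<^bsub>vec_group R\<^esub>"
    by (rule bexI [of _ "\<lambda>i. \<ominus> z i"]) (use z in \<open>auto simp: l_neg\<close>)
next
  fix x y z :: "'i \<Rightarrow> 'a"
  assume "x \<in> carrier (vec_group R)" "y \<in> carrier (vec_group R)" "z \<in> carrier (vec_group R)"
  then show "x \<oplus>\<^bsub>vec_group R\<^esub> y \<oplus>\<^bsub>vec_group R\<^esub> z = x \<oplus>\<^bsub>vec_group R\<^esub> (y \<oplus>\<^bsub>vec_group R\<^esub> z)"
    by (simp add: fun_eq_iff a_assoc)
qed (simp_all add: fun_eq_iff a_comm)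

lemma (in ring) vec_group_minus:
  assumes "\<And>i. z i \<in> carrier R"
  shows "\<ominus>\<^bsub>vec_group R\<^esub> z = (\<lambda>i. \<ominus> z i)"
  by (rule abelian_group.minus_equality [OF vec_group_group]) (use assms in \<open>simp_all add: l_neg\<close>)

lemma (in ring) vec_group_diff:
  assumes "\<And>i. w i \<in> carrier R"
  shows "z \<ominus>\<^bsub>vec_group R\<^esub> w = (\<lambda>i. z i \<ominus> w i)"
  using vec_group_minus [of w] assms by (simp add: a_minus_def)

lemma trivial_factor_iff:
  assumes "comm_group G" "subgroup K G" "subgroup I G" "I \<subseteq> K"
  shows "trivial_group (G\<lparr>carrier := K\<rparr> Mod I) \<longleftrightarrow> K \<subseteq> I"
proof -
  interpret G: comm_group G by fact
  let ?P = "G\<lparr>carrier := K\<rparr>"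
  interpret P: group ?P
    using subgroup.subgroup_is_group [OF assms(2) G.is_group] .
  interpret P: comm_group ?P
    by (rule P.group_comm_groupI) (use subgroup.mem_carrier [OF assms(2)] G.m_comm in auto)
  have I: "subgroup I ?P"
    using G.subgroup_incl [OF assms(3,2,4)] .
  interpret N: normal I ?P
    by (rule P.subgroup_imp_normal [OF I])
  have carr: "carrier (?P Mod I) = (\<lambda>a. I #>\<^bsub>?P\<^esub> a) ` K"
    by (auto simp: FactGroup_def RCOSETS_def)
  have one: "one (?P Mod I) = I"
    by (simp add: FactGroup_def)
  have "trivial_group (?P Mod I) \<longleftrightarrow> carrier (?P Mod I) = {I}"
    unfolding trivial_group_def one using N.factorgroup_is_group by simp
  also have "\<dots> \<longleftrightarrow> K \<subseteq> I"
  proof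
    assume *: "carrier (?P Mod I) = {I}"
    show "K \<subseteq> I"
    proof
      fix x assume x: "x \<in> K"
      then have "I #>\<^bsub>?P\<^esub> x = I" using * carr by auto
      then show "x \<in> I" using P.rcos_self [OF _ I, of x] x by simp
    qed
  next
    assume "K \<subseteq> I"
    then have "I #>\<^bsub>?P\<^esub> x = I" if "x \<in> K" for x
      using P.coset_join2 [OF _ I, of x] that by auto
    moreover have "K \<noteq> {}" using subgroup.one_closed [OF assms(2)] by auto
    ultimately show "carrier (?P Mod I) = {I}"
      unfolding carr by auto
  qed
  finally show ?thesis .
qed

context graded_ring
begin

lemma hvec_zero: "hvec J (\<lambda>i. \<zero>)"
  by (simp add: hvec_def)

lemma hvec_add:
  assumes "hvec J z" "hvec J w" shows "hvec J (\<lambda>i. z i \<oplus> w i)"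
  unfolding hvec_def
proof (intro conjI allI impI)
  fix i
  show "z i \<oplus> w i \<in> Rg (snd i)"
    using assms by (simp add: hvec_def)
  assume "z i \<oplus> w i \<noteq> \<zero>"
  then have "z i \<noteq> \<zero> \<or> w i \<noteq> \<zero>" by auto
  then show "fst i \<in> J" using assms unfolding hvec_def by blast
qed

lemma hvec_minus:
  assumes "hvec J z" shows "hvec J (\<lambda>i. \<ominus> z i)"
  unfolding hvec_def
proof (intro conjI allI impI)
  fix i
  show "\<ominus> z i \<in> Rg (snd i)"
    using assms by (simp add: hvec_def)
  assume "\<ominus> z i \<noteq> \<zero>"
  then have "z i \<noteq> \<zero>" by auto
  then show "fst i \<in> J" using assms unfolding hvec_def by blast
qed

end

locale novikov_coefficients = based_complex R Rg C d B
  for R :: "('a, 'm) ring_scheme" (structure) and Rg and C :: "int \<Rightarrow> ('a, 'b, 'n) rmodule_scheme" and d and B +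
  fixes \<S> :: "(int \<times> int) set set"
  assumes good: "good_supports \<S>"
begin

abbreviation S where "S \<equiv> novikov_ring R Rg \<S>"

text \<open>The coordinate model of \<open>C n\<close> tensored with \<open>S\<close>: each
  coordinate of a family is an element of \<open>S\<close>.\<close>

definition V :: "int \<Rightarrow> ((int \<times> 'b) \<times> (int \<times> int) \<Rightarrow> 'a) set" where
  "V n = {z. hvec_at n z \<and> (\<forall>j. {\<sigma>. z (j, \<sigma>) \<noteq> \<zero>} \<in> \<S>)}"

lemma carrier_S: "s \<in> carrier S \<longleftrightarrow> (\<forall>\<sigma>. s \<sigma> \<in> Rg \<sigma>) \<and> {\<sigma>. s \<sigma> \<noteq> \<zero>} \<in> \<S>"
  by (simp add: novikov_ring_def)

lemma mult_S: "f \<otimes>\<^bsub>S\<^esub> g = conv R f g"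
  by (simp add: novikov_ring_def conv_def fun_eq_iff fsum_def)

lemma add_S: "f \<oplus>\<^bsub>S\<^esub> g = (\<lambda>\<sigma>. f \<sigma> \<oplus> g \<sigma>)"
  by (simp add: novikov_ring_def)

lemma S_carrier: "s \<in> carrier S \<Longrightarrow> s \<kappa> \<in> carrier R"
  unfolding carrier_S using Rg_carrier by blast

lemma subset_S: "T \<in> \<S> \<Longrightarrow> T' \<subseteq> T \<Longrightarrow> T' \<in> \<S>"
  using good unfolding good_supports_def by blast

lemma union_S: "T \<in> \<S> \<Longrightarrow> T' \<in> \<S> \<Longrightarrow> T \<union> T' \<in> \<S>"
  using good unfolding good_supports_def by blast

lemma shift_S: "T \<in> \<S> \<Longrightarrow> finite N \<Longrightarrow> {\<alpha> + \<beta> | \<alpha> \<beta>. \<alpha> \<in> N \<and> \<beta> \<in> T} \<in> \<S>"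
  using good unfolding good_supports_def by blast

lemma zero_in_S: "(\<lambda>\<sigma>. \<zero>) \<in> carrier S"
  unfolding carrier_S using good by (simp add: good_supports_def)

lemma add_in_S:
  assumes "s \<in> carrier S" "t \<in> carrier S"
  shows "(\<lambda>\<sigma>. s \<sigma> \<oplus> t \<sigma>) \<in> carrier S"
  unfolding carrier_S
proof
  show "{\<sigma>. s \<sigma> \<oplus> t \<sigma> \<noteq> \<zero>} \<in> \<S>"
    by (rule subset_S [OF union_S [of "{\<sigma>. s \<sigma> \<noteq> \<zero>}" "{\<sigma>. t \<sigma> \<noteq> \<zero>}"]])
      (use assms in \<open>auto simp: carrier_S\<close>)
qed (use assms in \<open>simp add: carrier_S\<close>)

lemma minus_in_S:
  assumes "s \<in> carrier S" shows "(\<lambda>\<sigma>. \<ominus> s \<sigma>) \<in> carrier S"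
  unfolding carrier_S
proof
  show "{\<sigma>. \<ominus> s \<sigma> \<noteq> \<zero>} \<in> \<S>"
    by (rule subset_S [of "{\<sigma>. s \<sigma> \<noteq> \<zero>}"]) (use assms in \<open>auto simp: carrier_S\<close>)
qed (use assms in \<open>simp add: carrier_S\<close>)

lemma conv_in_S:
  assumes r: "r \<in> carrier R" and s: "s \<in> carrier S"
  shows "conv R (comp r) s \<in> carrier S"
  unfolding carrier_S
proof
  show "\<forall>\<sigma>. conv R (comp r) s \<sigma> \<in> Rg \<sigma>"
  proof
    fix \<sigma>
    show "conv R (comp r) s \<sigma> \<in> Rg \<sigma>"
      unfolding conv_def
    proof (rule Rg_fsum)
      fix \<kappa>
      show "comp r \<kappa> \<otimes> s (\<sigma> - \<kappa>) \<in> Rg \<sigma>"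
        by (rule Rg_mult' [of _ \<kappa> _ "\<sigma> - \<kappa>"]) (use r s in \<open>simp_all add: carrier_S comp_in\<close>)
    qed
  qed
  let ?T = "{\<sigma>. s \<sigma> \<noteq> \<zero>}" and ?N = "{\<sigma>. comp r \<sigma> \<noteq> \<zero>}"
  have "{\<sigma>. conv R (comp r) s \<sigma> \<noteq> \<zero>} \<subseteq> {\<alpha> + \<beta> | \<alpha> \<beta>. \<alpha> \<in> ?N \<and> \<beta> \<in> ?T}"
  proof
    fix \<sigma> assume "\<sigma> \<in> {\<sigma>. conv R (comp r) s \<sigma> \<noteq> \<zero>}"
    then have "fsum R (\<lambda>\<kappa>. comp r \<kappa> \<otimes> s (\<sigma> - \<kappa>)) \<noteq> \<zero>" by (simp add: conv_def)
    then obtain \<kappa> where "comp r \<kappa> \<otimes> s (\<sigma> - \<kappa>) \<noteq> \<zero>" by (rule fsum_nonzeroE)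
    then have "comp r \<kappa> \<noteq> \<zero>" "s (\<sigma> - \<kappa>) \<noteq> \<zero>"
      using Rg_carrier [OF comp_in [OF r, of \<kappa>]] S_carrier [OF s, of "\<sigma> - \<kappa>"] by auto
    then show "\<sigma> \<in> {\<alpha> + \<beta> | \<alpha> \<beta>. \<alpha> \<in> ?N \<and> \<beta> \<in> ?T}"
      by (intro CollectI exI [of _ \<kappa>] exI [of _ "\<sigma> - \<kappa>"]) simp
  qed
  then show "{\<sigma>. conv R (comp r) s \<sigma> \<noteq> \<zero>} \<in> \<S>"
    by (rule subset_S [rotated]) (rule shift_S, use r s in \<open>auto simp: carrier_S\<close>)
qed

lemma V_hvec_at: "z \<in> V n \<Longrightarrow> hvec_at n z"
  by (simp add: V_def)

lemma V_add:
  assumes "z \<in> V n" "w \<in> V n" shows "(\<lambda>i. z i \<oplus> w i) \<in> V n"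
proof -
  have "hvec_at n (\<lambda>i. z i \<oplus> w i)"
    using assms by (intro hvec_add) (simp_all add: V_def)
  moreover have "{\<sigma>. z (j, \<sigma>) \<oplus> w (j, \<sigma>) \<noteq> \<zero>} \<in> \<S>" for j
    by (rule subset_S [OF union_S [of "{\<sigma>. z (j, \<sigma>) \<noteq> \<zero>}" "{\<sigma>. w (j, \<sigma>) \<noteq> \<zero>}"]])
      (use assms in \<open>auto simp: V_def\<close>)
  ultimately show ?thesis by (simp add: V_def)
qed

lemma V_minus:
  assumes "z \<in> V n" shows "(\<lambda>i. \<ominus> z i) \<in> V n"
proof -
  have "hvec_at n (\<lambda>i. \<ominus> z i)"
    using assms by (intro hvec_minus) (simp add: V_def)
  moreover have "{\<sigma>. \<ominus> z (j, \<sigma>) \<noteq> \<zero>} \<in> \<S>" for j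
    by (rule subset_S [of "{\<sigma>. z (j, \<sigma>) \<noteq> \<zero>}"]) (use assms in \<open>auto simp: V_def\<close>)
  ultimately show ?thesis by (simp add: V_def)
qed

lemma V_zero: "(\<lambda>i. \<zero>) \<in> V n"
  using zero_in_S by (simp add: V_def hvec_def carrier_S)

lemma star_in_V:
  assumes x: "x \<in> carrier (C n)" and s: "s \<in> carrier S"
  shows "star R (vec n x) s \<in> V n"
proof -
  have nz: "\<exists>\<kappa>. vec n x (fst i, snd i - \<kappa>) \<noteq> \<zero> \<and> s \<kappa> \<noteq> \<zero>" if "star R (vec n x) s i \<noteq> \<zero>" for i
  proof (rule mv_nonzeroE [OF that [unfolded star_def]])
    fix \<kappa> assume "vec n x (fst i, snd i - \<kappa>) \<noteq> \<zero>" "s \<kappa> \<noteq> \<zero>"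
    then show ?thesis by blast
  qed (use x S_carrier [OF s] in simp_all)
  have hvec: "\<forall>i. vec n x i \<in> Rg (snd i)" "\<forall>i. vec n x i \<noteq> \<zero> \<longrightarrow> fst i \<in> {n} \<times> B n"
    using hvec_at_vec [OF x] by (simp_all add: hvec_def)
  have "hvec_at n (star R (vec n x) s)"
    unfolding hvec_def
  proof (intro conjI allI impI)
    fix i
    show "star R (vec n x) s i \<in> Rg (snd i)"
      unfolding star_def mv_def
    proof (rule Rg_fsum)
      fix \<kappa>
      show "vec n x (fst i, snd i - \<kappa>) \<otimes> s \<kappa> \<in> Rg (snd i)"
        by (rule Rg_mult' [of _ "snd i - \<kappa>" _ \<kappa>])
          (use spec [OF hvec(1), of "(fst i, snd i - \<kappa>)"] s in \<open>simp_all add: carrier_S\<close>)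
    qed
    assume "star R (vec n x) s i \<noteq> \<zero>"
    then obtain \<kappa> where "vec n x (fst i, snd i - \<kappa>) \<noteq> \<zero>" using nz by blast
    then show "fst i \<in> {n} \<times> B n"
      using spec [OF hvec(2), of "(fst i, snd i - \<kappa>)"] by simp
  qed
  moreover have "{\<sigma>. star R (vec n x) s (j, \<sigma>) \<noteq> \<zero>} \<in> \<S>" for j
  proof (rule subset_S [OF shift_S [of "{\<sigma>. s \<sigma> \<noteq> \<zero>}" "degs (vec n x)"]])
    show "{\<sigma>. star R (vec n x) s (j, \<sigma>) \<noteq> \<zero>} \<subseteq> {\<alpha> + \<beta> | \<alpha> \<beta>. \<alpha> \<in> degs (vec n x) \<and> \<beta> \<in> {\<sigma>. s \<sigma> \<noteq> \<zero>}}"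
    proof
      fix \<sigma> assume "\<sigma> \<in> {\<sigma>. star R (vec n x) s (j, \<sigma>) \<noteq> \<zero>}"
      then obtain \<kappa> where \<kappa>: "vec n x (j, \<sigma> - \<kappa>) \<noteq> \<zero>" "s \<kappa> \<noteq> \<zero>"
        using nz [of "(j, \<sigma>)"] by auto
      then show "\<sigma> \<in> {\<alpha> + \<beta> | \<alpha> \<beta>. \<alpha> \<in> degs (vec n x) \<and> \<beta> \<in> {\<sigma>. s \<sigma> \<noteq> \<zero>}}"
        using degsI [of "vec n x", OF \<kappa>(1)]
        by (intro CollectI exI [of _ "\<sigma> - \<kappa>"] exI [of _ \<kappa>]) simp
    qed
  qed (use x s in \<open>auto simp: carrier_S\<close>)
  ultimately show ?thesis by (simp add: V_def)
qed

lemma star_basis: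
  assumes b: "b \<in> B n" and s: "s \<in> carrier S"
  shows "star R (vec n b) s i = (if fst i = (n, b) then s (snd i) else \<zero>)"
proof -
  have v: "vec n b m = (if m = ((n, b), 0) then \<one> else \<zero>)" for m
    using b by (cases m) (auto simp: vec_def C.co_basis comp_one)
  have "star R (vec n b) s i = fsum R (\<lambda>\<kappa>. if \<kappa> = snd i then (if fst i = (n, b) then s (snd i) else \<zero>) else \<zero>)"
    unfolding star_def mv_def
    by (rule arg_cong [where f = "fsum R"]) (use S_carrier [OF s] in \<open>simp add: v fun_eq_iff\<close>)
  also have "\<dots> = (if fst i = (n, b) then s (snd i) else \<zero>)"
    by (subst fsum_single [of _ "snd i"]) (use S_carrier [OF s] in auto)
  finally show ?thesis .
qed

lemma D_finite: obtains N where "finite N" "kernel_on J N (Dk)"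
  using kernel_on_kern [OF rhom_d] .

lemma D_star:
  assumes "x \<in> carrier (C n)" "s \<in> carrier S"
  shows "Dm (star R (vec n x) s) = star R (vec (n - 1) (d n x)) s"
proof -
  obtain N where N: "finite N" "kernel_on J N (Dk)" by (rule D_finite)
  have "Dm (star R (vec n x) s) = star R (Dm (vec n x)) s"
    by (rule mv_star [OF N(2,1) hvec_at_hvec [OF hvec_at_vec [OF assms(1)]]]) (use assms S_carrier in auto)
  then show ?thesis using D_vec [OF assms(1)] by simp
qed

end

section \<open>Tensor products as groups of coordinate families\<close>

context novikov_coefficients
begin

abbreviation \<iota> where "\<iota> \<equiv> graded_components R Rg"

abbreviation TF where "TF n \<equiv> tensor_free (C n) S"
abbreviation Rel where "Rel n \<equiv> tensor_relations R (C n) S \<iota>"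
abbreviation TG where "TG n \<equiv> tensor_group R (C n) S \<iota>"
abbreviation TD where "TD n \<equiv> tensor_map R (C (n - 1)) S \<iota> (d n)"
abbreviation TE where "TE n \<equiv> frag_extend (\<lambda>(x, s). frag_of (d n x, s))"

lemma TF_simps [simp]:
  "w \<in> carrier (TF n) \<longleftrightarrow> Poly_Mapping.keys w \<subseteq> carrier (C n) \<times> carrier S"
  "w \<otimes>\<^bsub>TF n\<^esub> w' = w + w'" "\<one>\<^bsub>TF n\<^esub> = 0"
  by (simp_all add: tensor_free_def)

lemma TF_comm_group: "comm_group (TF n)"
  unfolding tensor_free_def by (rule abelian_free_Abelian_group)

lemma TF_inv: "w \<in> carrier (TF n) \<Longrightarrow> inv\<^bsub>TF n\<^esub> w = - w"
  by (simp add: tensor_free_def)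

lemma Rel_gens:
  shows "x \<in> carrier (C n) \<Longrightarrow> y \<in> carrier (C n) \<Longrightarrow> s \<in> carrier S \<Longrightarrow>
      frag_of (x \<oplus>\<^bsub>C n\<^esub> y, s) - frag_of (x, s) - frag_of (y, s) \<in> Rel n"
    and "x \<in> carrier (C n) \<Longrightarrow> s \<in> carrier S \<Longrightarrow> t \<in> carrier S \<Longrightarrow>
      frag_of (x, \<lambda>\<sigma>. s \<sigma> \<oplus> t \<sigma>) - frag_of (x, s) - frag_of (x, t) \<in> Rel n"
    and "x \<in> carrier (C n) \<Longrightarrow> r \<in> carrier R \<Longrightarrow> s \<in> carrier S \<Longrightarrow>
      frag_of (x \<odot>\<^sub>r\<^bsub>C n\<^esub> r, s) - frag_of (x, conv R (\<iota> r) s) \<in> Rel n"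
  unfolding tensor_relations_def add_S [symmetric] mult_S [symmetric]
  by (rule generate.incl, blast)+

lemma frag3_in_TF:
  assumes "p \<in> carrier (C n) \<times> carrier S" "q \<in> carrier (C n) \<times> carrier S" "r \<in> carrier (C n) \<times> carrier S"
  shows "frag_of p - frag_of q - frag_of r \<in> carrier (TF n)"
  using assms keys_diff [of "frag_of p - frag_of q" "frag_of r"] keys_diff [of "frag_of p" "frag_of q"]
  by auto

lemma frag2_in_TF:
  assumes "p \<in> carrier (C n) \<times> carrier S" "q \<in> carrier (C n) \<times> carrier S"
  shows "frag_of p - frag_of q \<in> carrier (TF n)"
  using assms keys_diff [of "frag_of p" "frag_of q"] by auto

lemma Rel_subgroup: "subgroup (Rel n) (TF n)"
proof -
  interpret comm_group "TF n" by (rule TF_comm_group)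
  show ?thesis
    unfolding tensor_relations_def
  proof (rule generate_is_subgroup, intro Un_least)
    show "{frag_of (x \<oplus>\<^bsub>C n\<^esub> y, s) - frag_of (x, s) - frag_of (y, s) | x y s.
         x \<in> carrier (C n) \<and> y \<in> carrier (C n) \<and> s \<in> carrier S} \<subseteq> carrier (TF n)"
      by clarify (rule frag3_in_TF, simp_all)
    show "{frag_of (x, s \<oplus>\<^bsub>S\<^esub> t) - frag_of (x, s) - frag_of (x, t) | x s t.
         x \<in> carrier (C n) \<and> s \<in> carrier S \<and> t \<in> carrier S} \<subseteq> carrier (TF n)"
      by clarify (rule frag3_in_TF, simp_all add: add_S add_in_S)
    show "{frag_of (x \<odot>\<^sub>r\<^bsub>C n\<^esub> r, s) - frag_of (x, \<iota> r \<otimes>\<^bsub>S\<^esub> s) | x r s.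
         x \<in> carrier (C n) \<and> r \<in> carrier R \<and> s \<in> carrier S} \<subseteq> carrier (TF n)"
      by clarify (rule frag2_in_TF, simp_all add: mult_S conv_in_S C.rsmult_closed)
  qed
qed

lemma Rel_zero: "0 \<in> Rel n"
  using subgroup.one_closed [OF Rel_subgroup] by simp

lemma Rel_TF: "w \<in> Rel n \<Longrightarrow> w \<in> carrier (TF n)"
  using subgroup.mem_carrier [OF Rel_subgroup] .

lemma Rel_add: "w \<in> Rel n \<Longrightarrow> w' \<in> Rel n \<Longrightarrow> w + w' \<in> Rel n"
  using subgroup.m_closed [OF Rel_subgroup] by simp

lemma Rel_minus: "w \<in> Rel n \<Longrightarrow> - w \<in> Rel n"
  using subgroup.m_inv_closed [OF Rel_subgroup] TF_inv [OF Rel_TF] by metis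

lemma Rel_diff: "w \<in> Rel n \<Longrightarrow> w' \<in> Rel n \<Longrightarrow> w - w' \<in> Rel n"
  using Rel_add [of w n "- w'"] Rel_minus by simp

text \<open>The universal property of the free abelian group, applied to the map that sends a pair
  to the coordinates of the corresponding pure tensor.\<close>

lemma tensor_eval:
  obtains ev where
    "\<And>w w'. w \<in> carrier (TF n) \<Longrightarrow> w' \<in> carrier (TF n) \<Longrightarrow> ev (w + w') = (\<lambda>i. ev w i \<oplus> ev w' i)"
    "\<And>w w'. w \<in> carrier (TF n) \<Longrightarrow> w' \<in> carrier (TF n) \<Longrightarrow> ev (w - w') = (\<lambda>i. ev w i \<ominus> ev w' i)"
    "ev 0 = (\<lambda>i. \<zero>)"
    "\<And>w i. w \<in> carrier (TF n) \<Longrightarrow> ev w i \<in> carrier R"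
    "\<And>x s. x \<in> carrier (C n) \<Longrightarrow> s \<in> carrier S \<Longrightarrow> ev (frag_of (x, s)) = star R (vec n x) s"
proof -
  interpret vec_group: abelian_group "vec_group R :: ((int \<times> 'b) \<times> (int \<times> int) \<Rightarrow> 'a) ring" by (rule vec_group_group)
  interpret T: comm_group "TF n" by (rule TF_comm_group)
  let ?f = "\<lambda>(x, s). star R (vec n x) s"
  have "?f ` (carrier (C n) \<times> carrier S) \<subseteq> carrier (add_monoid (vec_group R))"
    using star_closed [OF hvec_at_vec] S_carrier by auto
  then obtain h where h: "h \<in> hom (TF n) (add_monoid (vec_group R))"
      "\<And>p. p \<in> carrier (C n) \<times> carrier S \<Longrightarrow> h (frag_of p) = ?f p"
    using comm_group.free_Abelian_group_universal [OF vec_group.a_comm_group] unfolding tensor_free_def by metis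
  interpret h: group_hom "TF n" "add_monoid (vec_group R)" h
    by (intro group_hom.intro group_hom_axioms.intro T.is_group vec_group.a_group h(1))
  have add: "h (w + w') = (\<lambda>i. h w i \<oplus> h w' i)" if "w \<in> carrier (TF n)" "w' \<in> carrier (TF n)" for w w'
    using h.hom_mult [OF that] by simp
  have cl: "h w i \<in> carrier R" if "w \<in> carrier (TF n)" for w i
    using h.hom_closed [OF that] by simp
  have mi: "h (- w) = (\<lambda>i. \<ominus> h w i)" if w: "w \<in> carrier (TF n)" for w
    using h.hom_inv [OF w] vec_group_minus [of "h w"] cl [OF w] TF_inv [OF w] by (simp add: a_inv_def)
  show ?thesis
  proof
    show "h (w - w') = (\<lambda>i. h w i \<ominus> h w' i)" if "w \<in> carrier (TF n)" "w' \<in> carrier (TF n)" for w w'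
      using add [of w "- w'"] mi [of w'] that by (simp add: a_minus_def keys_minus)
    show "h 0 = (\<lambda>i. \<zero>)" using h.hom_one by simp
    show "h (frag_of (x, s)) = star R (vec n x) s" if "x \<in> carrier (C n)" "s \<in> carrier S" for x s
      using h(2) [of "(x, s)"] that by simp
  qed (use add cl in auto)
qed

definition ev :: "int \<Rightarrow> ('b \<times> (int \<times> int \<Rightarrow> 'a) \<Rightarrow>\<^sub>0 int) \<Rightarrow> (int \<times> 'b) \<times> (int \<times> int) \<Rightarrow> 'a" where
  "ev n = (SOME ev.
    (\<forall>w w'. w \<in> carrier (TF n) \<longrightarrow> w' \<in> carrier (TF n) \<longrightarrow> ev (w + w') = (\<lambda>i. ev w i \<oplus> ev w' i)) \<and>
    (\<forall>w w'. w \<in> carrier (TF n) \<longrightarrow> w' \<in> carrier (TF n) \<longrightarrow> ev (w - w') = (\<lambda>i. ev w i \<ominus> ev w' i)) \<and>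
    ev 0 = (\<lambda>i. \<zero>) \<and> (\<forall>w i. w \<in> carrier (TF n) \<longrightarrow> ev w i \<in> carrier R) \<and>
    (\<forall>x s. x \<in> carrier (C n) \<longrightarrow> s \<in> carrier S \<longrightarrow> ev (frag_of (x, s)) = star R (vec n x) s))"

lemma
  shows ev_add: "w \<in> carrier (TF n) \<Longrightarrow> w' \<in> carrier (TF n) \<Longrightarrow> ev n (w + w') = (\<lambda>i. ev n w i \<oplus> ev n w' i)"
    and ev_diff: "w \<in> carrier (TF n) \<Longrightarrow> w' \<in> carrier (TF n) \<Longrightarrow> ev n (w - w') = (\<lambda>i. ev n w i \<ominus> ev n w' i)"
    and ev_zero: "ev n 0 = (\<lambda>i. \<zero>)"
    and ev_closed: "w \<in> carrier (TF n) \<Longrightarrow> ev n w i \<in> carrier R"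
    and ev_frag: "x \<in> carrier (C n) \<Longrightarrow> s \<in> carrier S \<Longrightarrow> ev n (frag_of (x, s)) = star R (vec n x) s"
proof -
  let ?P = "\<lambda>ev. (\<forall>w w'. w \<in> carrier (TF n) \<longrightarrow> w' \<in> carrier (TF n) \<longrightarrow> ev (w + w') = (\<lambda>i. ev w i \<oplus> ev w' i)) \<and>
    (\<forall>w w'. w \<in> carrier (TF n) \<longrightarrow> w' \<in> carrier (TF n) \<longrightarrow> ev (w - w') = (\<lambda>i. ev w i \<ominus> ev w' i)) \<and>
    ev 0 = (\<lambda>i. \<zero>) \<and> (\<forall>w i. w \<in> carrier (TF n) \<longrightarrow> ev w i \<in> carrier R) \<and>
    (\<forall>x s. x \<in> carrier (C n) \<longrightarrow> s \<in> carrier S \<longrightarrow> ev (frag_of (x, s)) = star R (vec n x) s)"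
  have "\<exists>ev. ?P ev"
    by (rule tensor_eval [of n], rule exI) (intro conjI allI impI; assumption)
  then have *: "?P (ev n)" unfolding ev_def by (rule someI_ex)
  then show "w \<in> carrier (TF n) \<Longrightarrow> w' \<in> carrier (TF n) \<Longrightarrow> ev n (w + w') = (\<lambda>i. ev n w i \<oplus> ev n w' i)"
    "w \<in> carrier (TF n) \<Longrightarrow> w' \<in> carrier (TF n) \<Longrightarrow> ev n (w - w') = (\<lambda>i. ev n w i \<ominus> ev n w' i)"
    "ev n 0 = (\<lambda>i. \<zero>)"
    "w \<in> carrier (TF n) \<Longrightarrow> ev n w i \<in> carrier R"
    "x \<in> carrier (C n) \<Longrightarrow> s \<in> carrier S \<Longrightarrow> ev n (frag_of (x, s)) = star R (vec n x) s"
    by (blast, blast, blast, blast, blast)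
qed

lemma TF_induct [consumes 1, case_names zero diff gen]:
  assumes "w \<in> carrier (TF n)" "P 0"
    and "\<And>w w'. w \<in> carrier (TF n) \<Longrightarrow> w' \<in> carrier (TF n) \<Longrightarrow> P w \<Longrightarrow> P w' \<Longrightarrow> P (w - w')"
    and "\<And>x s. x \<in> carrier (C n) \<Longrightarrow> s \<in> carrier S \<Longrightarrow> P (frag_of (x, s))"
  shows "P w"
  by (rule free_Abelian_group_induct [of w "carrier (C n) \<times> carrier S"]) (use assms in auto)

lemma ev_in_V: "w \<in> carrier (TF n) \<Longrightarrow> ev n w \<in> V n"
proof (induction rule: TF_induct)
  case zero
  then show ?case by (simp add: ev_zero V_zero)
next
  case (diff w w')
  then show ?case
    using V_add [OF diff(3) V_minus [OF diff(4)]] by (simp add: ev_diff [OF diff(1,2)] a_minus_def)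
next
  case (gen x s)
  then show ?case by (simp add: ev_frag star_in_V)
qed

lemma TE_in_TF: "w \<in> carrier (TF n) \<Longrightarrow> TE n w \<in> carrier (TF (n - 1))"
proof (induction rule: TF_induct)
  case (diff w w')
  then show ?case
    using keys_diff [of "TE n w" "TE n w'"] by (auto simp: frag_extend_diff)
qed (auto simp: d_closed)

lemma D_zero: "Dm (\<lambda>i. \<zero>) = (\<lambda>i. \<zero>)"
proof -
  obtain N where N: "finite N" "kernel_on J N (Dk)" by (rule D_finite)
  then show ?thesis
    using tker_carrier [OF N(2)] by (simp add: mv_def fun_eq_iff)
qed

lemma ev_TE: "w \<in> carrier (TF n) \<Longrightarrow> ev (n - 1) (TE n w) = Dm (ev n w)"
proof (induction rule: TF_induct)
  case zero
  then show ?case by (simp add: ev_zero D_zero)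
next
  case (diff w w')
  obtain N where N: "finite N" "kernel_on J N (Dk)" by (rule D_finite)
  have hvec: "hvec J (ev n w)" "hvec J (ev n w')" "hvec J (\<lambda>i. \<ominus> ev n w' i)"
    using ev_in_V [OF diff(1)] V_minus [OF ev_in_V [OF diff(2)]] ev_in_V [OF diff(2)]
    by (auto intro: hvec_at_hvec V_hvec_at)
  have m: "Dm (\<lambda>i. \<ominus> ev n w' i) = (\<lambda>i. \<ominus> Dm (ev n w') i)"
  proof
    fix i
    have "Dm (\<lambda>i. ev n w' i \<oplus> \<ominus> ev n w' i) i = Dm (ev n w') i \<oplus> Dm (\<lambda>i. \<ominus> ev n w' i) i"
      by (rule D_add [OF hvec_carrier [OF hvec(2)] hvec_carrier [OF hvec(3)]])
    moreover have "(\<lambda>i. ev n w' i \<oplus> \<ominus> ev n w' i) = (\<lambda>i. \<zero>)"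
      using hvec_carrier [OF hvec(2)] by (simp add: r_neg)
    moreover have "Dm (\<lambda>i. \<zero>) i = \<zero>"
      using tker_carrier [OF N(2)] by (simp add: mv_def)
    moreover have cl: "Dm (ev n w') i \<in> carrier R" "Dm (\<lambda>i. \<ominus> ev n w' i) i \<in> carrier R"
      using hvec_carrier [OF hvec_mv [OF N(2) hvec(2)]] hvec_carrier [OF hvec_mv [OF N(2) hvec(3)]] by auto
    ultimately have "Dm (\<lambda>i. \<ominus> ev n w' i) i \<oplus> Dm (ev n w') i = \<zero>"
      by (simp add: a_comm)
    then show "Dm (\<lambda>i. \<ominus> ev n w' i) i = \<ominus> Dm (ev n w') i"
      using minus_equality cl by simp
  qed
  have "ev (n - 1) (TE n (w - w')) = (\<lambda>i. Dm (ev n w) i \<ominus> Dm (ev n w') i)"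
    using ev_diff [OF TE_in_TF [OF diff(1)] TE_in_TF [OF diff(2)]] diff by (simp add: frag_extend_diff)
  also have "\<dots> = Dm (ev n (w - w'))"
    using D_add [OF hvec_carrier [OF hvec(1)] hvec_carrier [OF hvec(3)]] m by (simp add: ev_diff [OF diff(1,2)] a_minus_def fun_eq_iff)
  finally show ?case .
next
  case (gen x s)
  then show ?case by (simp add: ev_frag d_closed D_star)
qed

text \<open>The generators of the relations are killed by biadditivity of \<open>star\<close> and by
  \<open>star_star\<close>, and the elements with zero evaluation form a subgroup.\<close>

lemma ev_Rel: "w \<in> Rel n \<Longrightarrow> ev n w = (\<lambda>i. \<zero>)"
proof -
  let ?H = "{frag_of (x \<oplus>\<^bsub>C n\<^esub> y, s) - frag_of (x, s) - frag_of (y, s) | x y s.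
         x \<in> carrier (C n) \<and> y \<in> carrier (C n) \<and> s \<in> carrier S} \<union>
      {frag_of (x, s \<oplus>\<^bsub>S\<^esub> t) - frag_of (x, s) - frag_of (x, t) | x s t.
         x \<in> carrier (C n) \<and> s \<in> carrier S \<and> t \<in> carrier S} \<union>
      {frag_of (x \<odot>\<^sub>r\<^bsub>C n\<^esub> r, s) - frag_of (x, \<iota> r \<otimes>\<^bsub>S\<^esub> s) | x r s.
         x \<in> carrier (C n) \<and> r \<in> carrier R \<and> s \<in> carrier S}"
  have d3: "ev n (frag_of (x, s) - frag_of (y, t) - frag_of (z, u)) =
      (\<lambda>i. star R (vec n x) s i \<ominus> star R (vec n y) t i \<ominus> star R (vec n z) u i)"
    if "x \<in> carrier (C n)" "y \<in> carrier (C n)" "z \<in> carrier (C n)" "s \<in> carrier S" "t \<in> carrier S" "u \<in> carrier S"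
    for x y z s t u
    using that frag2_in_TF [of "(x, s)" n "(y, t)"] by (subst ev_diff) (simp_all add: ev_diff ev_frag)
  have st: "star R (vec n x) s i \<in> carrier R" if "x \<in> carrier (C n)" "s \<in> carrier S" for x s i
    using star_closed [OF hvec_at_vec [OF that(1)] S_carrier [OF that(2)]] .
  have H: "w \<in> carrier (TF n) \<and> ev n w = (\<lambda>i. \<zero>)" if "w \<in> ?H" for w
    using that
  proof (elim UnE CollectE exE conjE)
    fix x y s assume w: "w = frag_of (x \<oplus>\<^bsub>C n\<^esub> y, s) - frag_of (x, s) - frag_of (y, s)"
      and xy: "x \<in> carrier (C n)" "y \<in> carrier (C n)" "s \<in> carrier S"
    have "vec n (x \<oplus>\<^bsub>C n\<^esub> y) = (\<lambda>i. vec n x i \<oplus> vec n y i)"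
      using vec_add [OF xy(1,2)] by auto
    then have "star R (vec n (x \<oplus>\<^bsub>C n\<^esub> y)) s i = star R (vec n x) s i \<oplus> star R (vec n y) s i" for i
      using star_add_left [OF hvec_at_vec [OF xy(1)] hvec_at_vec [OF xy(2)] S_carrier [OF xy(3)]] xy by simp
    moreover have "star R (vec n x) s i \<oplus> star R (vec n y) s i \<ominus> star R (vec n x) s i \<ominus> star R (vec n y) s i = \<zero>" for i
      using st [OF xy(1,3), of i] st [OF xy(2,3), of i] by algebra
    ultimately show ?thesis
      unfolding w using d3 xy by (auto intro!: frag3_in_TF simp del: TF_simps)
  next
    fix x s t assume w: "w = frag_of (x, s \<oplus>\<^bsub>S\<^esub> t) - frag_of (x, s) - frag_of (x, t)"
      and xy: "x \<in> carrier (C n)" "s \<in> carrier S" "t \<in> carrier S"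
    have "star R (vec n x) (s \<oplus>\<^bsub>S\<^esub> t) i = star R (vec n x) s i \<oplus> star R (vec n x) t i" for i
      unfolding add_S
      using star_add_right [OF hvec_at_vec [OF xy(1)] S_carrier [OF xy(2)] S_carrier [OF xy(3)]] xy by simp
    moreover have "star R (vec n x) s i \<oplus> star R (vec n x) t i \<ominus> star R (vec n x) s i \<ominus> star R (vec n x) t i = \<zero>" for i
      using st [OF xy(1,2), of i] st [OF xy(1,3), of i] by algebra
    moreover have "s \<oplus>\<^bsub>S\<^esub> t \<in> carrier S"
      unfolding add_S using xy by (intro add_in_S)
    ultimately show ?thesis
      unfolding w using d3 xy by (auto intro!: frag3_in_TF simp del: TF_simps)
  next
    fix x r s assume w: "w = frag_of (x \<odot>\<^sub>r\<^bsub>C n\<^esub> r, s) - frag_of (x, \<iota> r \<otimes>\<^bsub>S\<^esub> s)"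
      and xy: "x \<in> carrier (C n)" "r \<in> carrier R" "s \<in> carrier S"
    have "star R (vec n (x \<odot>\<^sub>r\<^bsub>C n\<^esub> r)) s = star R (vec n x) (conv R (\<iota> r) s)"
      unfolding vec_rsmult [OF xy(1,2)]
      by (rule star_star [OF hvec_at_vec [OF xy(1)]])
        (use xy S_carrier in \<open>simp_all add: Rg_carrier [OF comp_in] comp_finite\<close>)
    moreover have "x \<odot>\<^sub>r\<^bsub>C n\<^esub> r \<in> carrier (C n)" "conv R (\<iota> r) s \<in> carrier S"
      using xy by (auto intro: C.rsmult_closed conv_in_S)
    ultimately show ?thesis
      unfolding w mult_S using xy frag2_in_TF [of "(x \<odot>\<^sub>r\<^bsub>C n\<^esub> r, s)" n "(x, conv R (\<iota> r) s)"] st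
      by (simp add: ev_diff ev_frag r_neg a_minus_def)
  qed
  have "w \<in> carrier (TF n) \<and> ev n w = (\<lambda>i. \<zero>)" if "w \<in> Rel n"
    using that unfolding tensor_relations_def
  proof induction
    case one
    then show ?case by (simp add: ev_zero)
  next
    case (incl w)
    then show ?case by (rule H)
  next
    case (inv w)
    note w = H [OF inv]
    then have "ev n (0 - w) = (\<lambda>i. \<zero>)"
      using ev_diff [of 0 n w] by (simp add: ev_zero a_minus_def)
    then show ?case
      using w TF_inv [of w n] by (simp add: keys_minus)
  next
    case (eng w w')
    then show ?case
      using ev_add [of w n w'] keys_add [of w w'] by auto
  qed
  then show "ev n w = (\<lambda>i. \<zero>)" if "w \<in> Rel n" using that by blast
qed

end

lemma (in abelian_group) diff_eq_zero_iff:
  assumes "x \<in> carrier G" "y \<in> carrier G"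
  shows "x \<ominus> y = \<zero> \<longleftrightarrow> x = y"
proof
  assume "x \<ominus> y = \<zero>"
  then have "x \<oplus> \<ominus> y = \<zero>" by (simp add: a_minus_def)
  then have "\<ominus> (\<ominus> y) = x"
    using assms by (intro minus_equality) auto
  then show "x = y" using assms by simp
qed (use assms in \<open>simp add: a_minus_def r_neg\<close>)

section \<open>Normal forms of tensors and the criterion for acyclicity\<close>

context novikov_coefficients
begin

lemma Rel_trans: "u - v \<in> Rel n \<Longrightarrow> v - w \<in> Rel n \<Longrightarrow> u - w \<in> Rel n"
  using Rel_add [of "u - v" n "v - w"] by simp

lemma Rel_frag_zero_left:
  assumes "s \<in> carrier S" shows "frag_of (\<zero>\<^bsub>C n\<^esub>, s) \<in> Rel n"
proof -
  have "frag_of (\<zero>\<^bsub>C n\<^esub>, s) - frag_of (\<zero>\<^bsub>C n\<^esub>, s) - frag_of (\<zero>\<^bsub>C n\<^esub>, s) \<in> Rel n"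
    using Rel_gens(1) [of "\<zero>\<^bsub>C n\<^esub>" n "\<zero>\<^bsub>C n\<^esub>" s] assms by simp
  from Rel_minus [OF this] show ?thesis by simp
qed

lemma Rel_frag_zero_right:
  assumes "x \<in> carrier (C n)" shows "frag_of (x, \<lambda>\<sigma>. \<zero>) \<in> Rel n"
proof -
  have "frag_of (x, \<lambda>\<sigma>. \<zero>) - frag_of (x, \<lambda>\<sigma>. \<zero>) - frag_of (x, \<lambda>\<sigma>. \<zero>) \<in> Rel n"
    using Rel_gens(2) [of x n "\<lambda>\<sigma>. \<zero>" "\<lambda>\<sigma>. \<zero>"] assms zero_in_S by simp
  from Rel_minus [OF this] show ?thesis by simp
qed

lemma Rel_frag_diff:
  assumes x: "x \<in> carrier (C n)" and s: "s \<in> carrier S" and t: "t \<in> carrier S"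
  shows "frag_of (x, s) - frag_of (x, t) - frag_of (x, \<lambda>\<sigma>. s \<sigma> \<oplus> \<ominus> t \<sigma>) \<in> Rel n"
proof -
  let ?u = "\<lambda>\<sigma>. s \<sigma> \<oplus> \<ominus> t \<sigma>"
  have u: "?u \<in> carrier S" using add_in_S [OF s minus_in_S [OF t]] .
  have "(\<lambda>\<sigma>. ?u \<sigma> \<oplus> t \<sigma>) = s"
    using S_carrier [OF s] S_carrier [OF t] by (simp add: a_assoc l_neg)
  then have "frag_of (x, s) - frag_of (x, ?u) - frag_of (x, t) \<in> Rel n"
    using Rel_gens(2) [OF x u t] by simp
  then show ?thesis by (simp add: algebra_simps)
qed

lemma Rel_frag_finsum:
  assumes "finite A" "\<And>a. a \<in> A \<Longrightarrow> f a \<in> carrier (C n)" "s \<in> carrier S"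
  shows "frag_of (finsum (C n) f A, s) - (\<Sum>a\<in>A. frag_of (f a, s)) \<in> Rel n"
  using assms(1,2)
proof (induction A)
  case empty
  then show ?case using Rel_frag_zero_left [OF assms(3)] by simp
next
  case (insert a A)
  have fA: "finsum (C n) f A \<in> carrier (C n)" using insert by auto
  have "frag_of (f a \<oplus>\<^bsub>C n\<^esub> finsum (C n) f A, s) - frag_of (f a, s) - frag_of (finsum (C n) f A, s) \<in> Rel n"
    using Rel_gens(1) [OF _ fA assms(3), of "f a"] insert by simp
  moreover have "frag_of (finsum (C n) f A, s) - (\<Sum>a\<in>A. frag_of (f a, s)) \<in> Rel n"
    using insert by simp
  ultimately have "frag_of (f a \<oplus>\<^bsub>C n\<^esub> finsum (C n) f A, s) - frag_of (f a, s) - (\<Sum>a\<in>A. frag_of (f a, s)) \<in> Rel n"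
    by (rule Rel_trans)
  then show ?case
    using insert by (simp add: Pi_iff algebra_simps)
qed

lemma Rel_sum: "(\<And>a. a \<in> A \<Longrightarrow> f a \<in> Rel n) \<Longrightarrow> sum f A \<in> Rel n"
  by (induction A rule: infinite_finite_induct) (auto intro: Rel_zero Rel_add)

text \<open>For a pure tensor the first entry is expanded in the basis and the coefficients are
  moved to the second entry; differences are handled in each summand separately.\<close>

lemma tensor_normal_form:
  assumes "w \<in> carrier (TF n)"
  shows "\<exists>s. (\<forall>b\<in>B n. s b \<in> carrier S) \<and> w - (\<Sum>b\<in>B n. frag_of (b, s b)) \<in> Rel n"
  using assms
proof (induction rule: TF_induct)
  case zero
  have "- (\<Sum>b\<in>B n. frag_of (b, \<lambda>\<sigma>. \<zero>)) \<in> Rel n"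
    by (intro Rel_minus Rel_sum Rel_frag_zero_right C.basis_carrier)
  then show ?case
    by (intro exI [of _ "\<lambda>b \<sigma>. \<zero>"]) (simp add: zero_in_S)
next
  case (diff w w')
  then obtain s s' where s: "\<forall>b\<in>B n. s b \<in> carrier S" "w - (\<Sum>b\<in>B n. frag_of (b, s b)) \<in> Rel n"
    and s': "\<forall>b\<in>B n. s' b \<in> carrier S" "w' - (\<Sum>b\<in>B n. frag_of (b, s' b)) \<in> Rel n"
    by blast
  let ?u = "\<lambda>b \<sigma>. s b \<sigma> \<oplus> \<ominus> s' b \<sigma>"
  have "(\<Sum>b\<in>B n. frag_of (b, s b) - frag_of (b, s' b) - frag_of (b, ?u b)) \<in> Rel n"
    by (intro Rel_sum Rel_frag_diff C.basis_carrier) (use s s' in auto)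
  moreover have "(w - (\<Sum>b\<in>B n. frag_of (b, s b))) - (w' - (\<Sum>b\<in>B n. frag_of (b, s' b))) \<in> Rel n"
    by (rule Rel_diff [OF s(2) s'(2)])
  ultimately have "(w - (\<Sum>b\<in>B n. frag_of (b, s b))) - (w' - (\<Sum>b\<in>B n. frag_of (b, s' b)))
      + (\<Sum>b\<in>B n. frag_of (b, s b) - frag_of (b, s' b) - frag_of (b, ?u b)) \<in> Rel n"
    by (rule Rel_add [rotated])
  then have "(w - w') - (\<Sum>b\<in>B n. frag_of (b, ?u b)) \<in> Rel n"
    by (simp add: sum_subtractf sum.distrib algebra_simps)
  moreover have "\<forall>b\<in>B n. ?u b \<in> carrier S"
    using s s' add_in_S minus_in_S by blast
  ultimately show ?case by (intro exI [of _ ?u] conjI)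
next
  case (gen x s)
  let ?c = "coord R (C n) (B n) x"
  let ?s = "\<lambda>b. conv R (\<iota> (?c b)) s"
  have c: "?c b \<in> carrier R" for b using gen by simp
  have "frag_of ((\<Oplus>\<^bsub>C n\<^esub>b\<in>B n. b \<odot>\<^sub>r\<^bsub>C n\<^esub> ?c b), s) - (\<Sum>b\<in>B n. frag_of (b \<odot>\<^sub>r\<^bsub>C n\<^esub> ?c b, s)) \<in> Rel n"
    by (rule Rel_frag_finsum) (use gen c in \<open>simp_all add: C.rsmult_closed C.basis_carrier\<close>)
  then have "frag_of (x, s) - (\<Sum>b\<in>B n. frag_of (b \<odot>\<^sub>r\<^bsub>C n\<^esub> ?c b, s)) \<in> Rel n"
    using C.co_expand [OF gen(1)] by simp
  moreover have "(\<Sum>b\<in>B n. frag_of (b \<odot>\<^sub>r\<^bsub>C n\<^esub> ?c b, s) - frag_of (b, ?s b)) \<in> Rel n"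
    by (intro Rel_sum Rel_gens(3) C.basis_carrier c gen(2))
  then have "(\<Sum>b\<in>B n. frag_of (b \<odot>\<^sub>r\<^bsub>C n\<^esub> ?c b, s)) - (\<Sum>b\<in>B n. frag_of (b, ?s b)) \<in> Rel n"
    by (simp add: sum_subtractf)
  ultimately have "frag_of (x, s) - (\<Sum>b\<in>B n. frag_of (b, ?s b)) \<in> Rel n"
    by (rule Rel_trans)
  moreover have "\<forall>b\<in>B n. ?s b \<in> carrier S"
    using conv_in_S [OF c gen(2)] by blast
  ultimately show ?case by (intro exI [of _ ?s] conjI)
qed

lemma TF_sum:
  assumes "\<And>b. b \<in> A \<Longrightarrow> f b \<in> carrier (TF n)" shows "sum f A \<in> carrier (TF n)"
  using assms
proof (induction A rule: infinite_finite_induct)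
  case (insert a A)
  then show ?case using keys_add [of "f a" "sum f A"] by auto
qed auto

lemma ev_sum:
  assumes "finite A" "\<And>a. a \<in> A \<Longrightarrow> f a \<in> carrier (TF n)"
  shows "ev n (sum f A) = (\<lambda>i. \<Oplus>a\<in>A. ev n (f a) i)"
  using assms
proof (induction A)
  case empty
  then show ?case by (simp add: ev_zero)
next
  case (insert a A)
  have "sum f A \<in> carrier (TF n)" by (rule TF_sum) (use insert in auto)
  moreover have "ev n (f a) i \<in> carrier R" "(\<lambda>a. ev n (f a) i) \<in> A \<rightarrow> carrier R" for i
    using ev_closed insert by auto
  ultimately show ?case
    using insert by (simp add: ev_add)
qed

lemma ev_normal_form:
  assumes s: "\<And>b. b \<in> B n \<Longrightarrow> s b \<in> carrier S"
  shows "ev n (\<Sum>b\<in>B n. frag_of (b, s b)) i = (if fst i \<in> {n} \<times> B n then s (snd (fst i)) (snd i) else \<zero>)"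
proof -
  have "ev n (\<Sum>b\<in>B n. frag_of (b, s b)) i = (\<Oplus>b\<in>B n. ev n (frag_of (b, s b)) i)"
    by (subst ev_sum) (use s C.basis_carrier in simp_all)
  also have "\<dots> = (\<Oplus>b\<in>B n. if snd (fst i) = b then (if fst (fst i) = n then s b (snd i) else \<zero>) else \<zero>)"
    by (rule finsum_cong' [OF refl])
      (use s S_carrier [OF s] C.basis_carrier in \<open>auto simp: ev_frag star_basis prod_eq_iff\<close>)
  also have "\<dots> = (if fst i \<in> {n} \<times> B n then s (snd (fst i)) (snd i) else \<zero>)"
  proof (cases "snd (fst i) \<in> B n")
    case True
    then show ?thesis
      using finsum_singleton [of "snd (fst i)" "B n" "\<lambda>b. if fst (fst i) = n then s b (snd i) else \<zero>"]
        S_carrier [OF s] by (auto simp: mem_Times_iff)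
  next
    case False
    then have "(\<Oplus>b\<in>B n. if snd (fst i) = b then (if fst (fst i) = n then s b (snd i) else \<zero>) else \<zero>) = \<zero>"
      by (intro add.finprod_one_eqI) auto
    with False show ?thesis by (simp add: mem_Times_iff)
  qed
  finally show ?thesis .
qed

lemma normal_form_TF:
  "(\<And>b. b \<in> B n \<Longrightarrow> s b \<in> carrier S) \<Longrightarrow> (\<Sum>b\<in>B n. frag_of (b, s b)) \<in> carrier (TF n)"
  by (rule TF_sum) (simp add: C.basis_carrier)

text \<open>Freeness of \<open>C n\<close> yields injectivity modulo relations: in a normal form the
  coefficient of each basis element can be read off from the evaluation, so that a normal form with
  zero evaluation has zero coefficients.\<close>

lemma ev_eq_zero_iff:
  assumes w: "w \<in> carrier (TF n)"
  shows "ev n w = (\<lambda>i. \<zero>) \<longleftrightarrow> w \<in> Rel n"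
proof
  assume ev: "ev n w = (\<lambda>i. \<zero>)"
  obtain s where s: "\<And>b. b \<in> B n \<Longrightarrow> s b \<in> carrier S" and r: "w - (\<Sum>b\<in>B n. frag_of (b, s b)) \<in> Rel n"
    using tensor_normal_form [OF w] by blast
  let ?v = "\<Sum>b\<in>B n. frag_of (b, s b)"
  have v: "?v \<in> carrier (TF n)" using s by (rule normal_form_TF)
  have z0: "\<zero> \<ominus> ev n ?v i = \<zero>" for i
    using fun_cong [OF ev_Rel [OF r], of i] fun_cong [OF ev_diff [OF w v], of i] ev by simp
  then have z: "ev n ?v i = \<zero>" for i
    using diff_eq_zero_iff [OF zero_closed ev_closed [OF v, of i]] z0 [of i] by simp
  have "s b = (\<lambda>\<sigma>. \<zero>)" if "b \<in> B n" for b
  proof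
    fix \<sigma>
    show "s b \<sigma> = \<zero>"
      using z [of "((n, b), \<sigma>)"] ev_normal_form [where i = "((n, b), \<sigma>)" and n = n and s = s] s that by simp
  qed
  then have "?v = (\<Sum>b\<in>B n. frag_of (b, \<lambda>\<sigma>. \<zero>))" by simp
  also have "\<dots> \<in> Rel n"
    by (intro Rel_sum Rel_frag_zero_right C.basis_carrier)
  finally have vR: "?v \<in> Rel n" .
  show "w \<in> Rel n"
    using Rel_add [OF r vR] by simp
qed (rule ev_Rel)

lemma ev_surj:
  assumes z: "z \<in> V n"
  obtains w where "w \<in> carrier (TF n)" "ev n w = z"
proof
  let ?s = "\<lambda>b \<sigma>. z ((n, b), \<sigma>)"
  have hz: "\<forall>i. z i \<in> Rg (snd i)" "\<forall>i. z i \<noteq> \<zero> \<longrightarrow> fst i \<in> {n} \<times> B n"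
    using z by (simp_all add: V_def hvec_def)
  have s: "?s b \<in> carrier S" for b
    unfolding carrier_S
  proof
    show "\<forall>\<sigma>. z ((n, b), \<sigma>) \<in> Rg \<sigma>"
      using hz(1) by (metis snd_conv)
  qed (use z in \<open>simp add: V_def\<close>)
  show "(\<Sum>b\<in>B n. frag_of (b, ?s b)) \<in> carrier (TF n)"
    by (rule normal_form_TF) (rule s)
  show "ev n (\<Sum>b\<in>B n. frag_of (b, ?s b)) = z"
  proof
    fix i
    have "ev n (\<Sum>b\<in>B n. frag_of (b, ?s b)) i = (if fst i \<in> {n} \<times> B n then z ((n, snd (fst i)), snd i) else \<zero>)"
      by (rule ev_normal_form) (rule s)
    also have "\<dots> = z i"
    proof (cases "fst i \<in> {n} \<times> B n")
      case True
      then have "((n, snd (fst i)), snd i) = i" by (auto simp: prod_eq_iff)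
      with True show ?thesis by simp
    next
      case False
      then have "z i = \<zero>" using hz(2) by blast
      with False show ?thesis by simp
    qed
    finally show "ev n (\<Sum>b\<in>B n. frag_of (b, ?s b)) i = z i" .
  qed
qed

lemma Rel_normal: "Rel n \<lhd> TF n"
  by (rule comm_group.subgroup_imp_normal [OF TF_comm_group Rel_subgroup])

lemma TG_comm_group: "comm_group (TG n)"
  unfolding tensor_group_def by (rule comm_group.abelian_FactGroup [OF TF_comm_group Rel_subgroup])

abbreviation cos where "cos n w \<equiv> Rel n #>\<^bsub>TF n\<^esub> w"

lemma carrier_TG: "carrier (TG n) = cos n ` carrier (TF n)"
  by (auto simp: tensor_group_def FactGroup_def RCOSETS_def)

lemma one_TG: "one (TG n) = Rel n"
  by (simp add: tensor_group_def FactGroup_def)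

lemma cos_eq_iff:
  assumes "w \<in> carrier (TF n)" "w' \<in> carrier (TF n)"
  shows "cos n w = cos n w' \<longleftrightarrow> w - w' \<in> Rel n"
proof
  interpret comm_group "TF n" by (rule TF_comm_group)
  assume "cos n w = cos n w'"
  then have "w \<in> cos n w'" using rcos_self [OF assms(1) Rel_subgroup] by simp
  then obtain r where "r \<in> Rel n" "w = r + w'" by (auto simp: r_coset_def)
  then show "w - w' \<in> Rel n" by simp
next
  interpret comm_group "TF n" by (rule TF_comm_group)
  assume r: "w - w' \<in> Rel n"
  have "w \<in> cos n w'" using r by (auto simp: r_coset_def intro!: bexI [OF _ r])
  then show "cos n w = cos n w'"
    using repr_independence [OF _ assms(2) Rel_subgroup] by simp
qed

lemma cos_eq_Rel_iff:
  assumes "w \<in> carrier (TF n)"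
  shows "cos n w = Rel n \<longleftrightarrow> w \<in> Rel n"
proof -
  interpret comm_group "TF n" by (rule TF_comm_group)
  have "cos n 0 = Rel n" by (auto simp: r_coset_def)
  then show ?thesis using cos_eq_iff [OF assms, of 0] by simp
qed

text \<open>Deduced from injectivity of the evaluation and its compatibility with the differential,
  which spares a check on the generators of the relations.\<close>

lemma TE_Rel:
  assumes "w \<in> Rel n" shows "TE n w \<in> Rel (n - 1)"
proof -
  have "ev (n - 1) (TE n w) = (\<lambda>i. \<zero>)"
    using ev_TE [OF Rel_TF [OF assms]] ev_Rel [OF assms] D_zero by simp
  then show ?thesis
    using ev_eq_zero_iff [OF TE_in_TF [OF Rel_TF [OF assms]]] by blast
qed

text \<open>\<open>tensor_map\<close> takes the only element of an image. By \<open>TE_Rel\<close>,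
  all representatives of a coset are sent to the same coset, so this image is indeed a
  singleton.\<close>

lemma TD_cos:
  assumes w: "w \<in> carrier (TF n)"
  shows "TD n (cos n w) = cos (n - 1) (TE n w)"
proof -
  have "(\<lambda>z. cos (n - 1) (TE n z)) ` cos n w = {cos (n - 1) (TE n w)}"
  proof -
    have "cos (n - 1) (TE n (r + w)) = cos (n - 1) (TE n w)" if r: "r \<in> Rel n" for r
    proof -
      have "r + w \<in> carrier (TF n)" using Rel_TF [OF r] w keys_add [of r w] by auto
      moreover have "TE n (r + w) - TE n w \<in> Rel (n - 1)"
        using TE_Rel [OF r] by (simp add: frag_extend_add)
      ultimately show ?thesis
        using cos_eq_iff [OF TE_in_TF TE_in_TF [OF w]] by blast
    qed
    moreover have "cos n w = (\<lambda>r. r + w) ` Rel n" by (auto simp: r_coset_def)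
    ultimately show ?thesis using Rel_zero [of n] by auto
  qed
  then show ?thesis
    unfolding tensor_map_def by simp
qed

lemma TD_hom: "TD n \<in> hom (TG n) (TG (n - 1))"
proof (rule homI)
  fix X assume "X \<in> carrier (TG n)"
  then show "TD n X \<in> carrier (TG (n - 1))"
    using TE_in_TF TD_cos by (auto simp: carrier_TG simp del: TF_simps)
next
  fix X Y assume "X \<in> carrier (TG n)" "Y \<in> carrier (TG n)"
  then obtain v w where v: "v \<in> carrier (TF n)" "X = cos n v" and w: "w \<in> carrier (TF n)" "Y = cos n w"
    by (auto simp: carrier_TG simp del: TF_simps)
  have m: "cos n v \<otimes>\<^bsub>TG n\<^esub> cos n w = cos n (v + w)" if "v \<in> carrier (TF n)" "w \<in> carrier (TF n)" for n v w
    using normal.rcos_sum [OF Rel_normal that] by (simp add: tensor_group_def FactGroup_def)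
  have "v + w \<in> carrier (TF n)" using v w keys_add [of v w] by auto
  then show "TD n (X \<otimes>\<^bsub>TG n\<^esub> Y) = TD n X \<otimes>\<^bsub>TG (n - 1)\<^esub> TD n Y"
    using v w m TE_in_TF by (simp add: TD_cos frag_extend_add del: TF_simps)
qed

text \<open>Cycles and boundaries among cosets are translated through the evaluation, which is
  injective modulo relations, maps onto \<open>V\<close> and carries the tensored differential to
  \<open>Dm\<close>.\<close>

lemma tensor_homology_trivial_iff:
  "trivial_group (homology_group (\<lambda>k. TG k) (\<lambda>k. TD k) n) \<longleftrightarrow>
     (\<forall>z\<in>V n. Dm z = (\<lambda>i. \<zero>) \<longrightarrow> (\<exists>y\<in>V (n + 1). z = Dm y))"
proof -
  interpret G: group_hom "TG n" "TG (n - 1)" "TD n"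
    by (intro group_hom.intro group_hom_axioms.intro TD_hom comm_group.axioms(2) [OF TG_comm_group])
  have "TD (n + 1) \<in> hom (TG (n + 1)) (TG n)" using TD_hom [of "n + 1"] by simp
  then interpret G': group_hom "TG (n + 1)" "TG n" "TD (n + 1)"
    by (intro group_hom.intro group_hom_axioms.intro comm_group.axioms(2) [OF TG_comm_group])
  let ?K = "kernel (TG n) (TG (n - 1)) (TD n)" and ?I = "TD (n + 1) ` carrier (TG (n + 1))"
  have K: "X \<in> ?K \<longleftrightarrow> (\<exists>w\<in>carrier (TF n). X = cos n w \<and> Dm (ev n w) = (\<lambda>i. \<zero>))" for X
  proof -
    have "TD n (cos n w) = Rel (n - 1) \<longleftrightarrow> Dm (ev n w) = (\<lambda>i. \<zero>)" if "w \<in> carrier (TF n)" for w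
      using ev_eq_zero_iff [OF TE_in_TF [OF that]] cos_eq_Rel_iff [OF TE_in_TF [OF that]]
      by (simp add: TD_cos [OF that] ev_TE [OF that] del: TF_simps)
    then show ?thesis
      unfolding kernel_def carrier_TG one_TG by blast
  qed
  have I: "X \<in> ?I \<longleftrightarrow> (\<exists>w\<in>carrier (TF (n + 1)). X = cos n (TE (n + 1) w))" for X
    using TD_cos [of _ "n + 1"] by (auto simp: carrier_TG simp del: TF_simps)
  have TE1: "TE (n + 1) w \<in> carrier (TF n)" "ev n (TE (n + 1) w) = Dm (ev (n + 1) w)"
    if "w \<in> carrier (TF (n + 1))" for w
    using TE_in_TF [OF that] ev_TE [OF that] by simp_all
  \<comment> \<open>Supplies the inclusion of boundaries in cycles that
    \<open>trivial_factor_iff\<close> asks for.\<close>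
  have DD: "Dm (Dm (ev (n + 1) w)) = (\<lambda>i. \<zero>)" if w: "w \<in> carrier (TF (n + 1))" for w
    using w
  proof (induction rule: TF_induct)
    case zero
    then show ?case by (simp add: ev_zero D_zero)
  next
    case (gen x s)
    have "d (n + 1 - 1) (d (n + 1) x) = \<zero>\<^bsub>C (n + 1 - 2)\<^esub>"
      using complex gen(1) unfolding chain_complex_def by blast
    then have dd: "d n (d (n + 1) x) = \<zero>\<^bsub>C (n - 1)\<^esub>" by simp
    have "Dm (Dm (ev (n + 1) (frag_of (x, s)))) = star R (vec (n - 1) \<zero>\<^bsub>C (n - 1)\<^esub>) s"
      using gen d_closed [OF gen(1)] by (simp add: ev_frag D_star dd)
    also have "\<dots> = (\<lambda>i. \<zero>)"
      using S_carrier [OF gen(2)] by (simp add: star_def mv_def fun_eq_iff)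
    finally show ?case .
  next
    case (diff w w')
    have e: "ev (n - 1) (TE n (TE (n + 1) w)) = Dm (Dm (ev (n + 1) w))" if "w \<in> carrier (TF (n + 1))" for w
      using ev_TE [OF TE1(1) [OF that]] TE1(2) [OF that] by simp
    have "Dm (Dm (ev (n + 1) (w - w'))) = ev (n - 1) (TE n (TE (n + 1) (w - w')))"
    proof (rule e [symmetric])
      show "w - w' \<in> carrier (TF (n + 1))"
        using diff(1,2) keys_diff [of w w'] by auto
    qed
    also have "\<dots> = (\<lambda>i. \<zero>)"
      using diff e [of w] e [of w'] ev_diff [OF TE_in_TF [OF TE1(1)] TE_in_TF [OF TE1(1)], of w w']
      by (simp add: frag_extend_diff a_minus_def del: TF_simps)
    finally show ?case .
  qed
  have IK: "?I \<subseteq> ?K"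
  proof
    fix X assume "X \<in> ?I"
    then obtain w where w: "w \<in> carrier (TF (n + 1))" "X = cos n (TE (n + 1) w)"
      using I by blast
    show "X \<in> ?K"
      unfolding K by (rule bexI [OF _ TE1(1) [OF w(1)]]) (simp add: w(2) TE1(2) [OF w(1)] DD [OF w(1)])
  qed
  have "trivial_group (homology_group (\<lambda>k. TG k) (\<lambda>k. TD k) n) \<longleftrightarrow> ?K \<subseteq> ?I"
    unfolding homology_group_def
    by (rule trivial_factor_iff [OF TG_comm_group G.subgroup_kernel G'.img_is_subgroup IK])
  also have "\<dots> \<longleftrightarrow> (\<forall>w\<in>carrier (TF n). Dm (ev n w) = (\<lambda>i. \<zero>) \<longrightarrow>
      (\<exists>w'\<in>carrier (TF (n + 1)). cos n w = cos n (TE (n + 1) w')))"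
  proof -
    have "(\<forall>X. (\<exists>w\<in>F. X = f w \<and> P w) \<longrightarrow> Q X) \<longleftrightarrow> (\<forall>w\<in>F. P w \<longrightarrow> Q (f w))"
      for F :: "'x set" and f :: "'x \<Rightarrow> 'y" and P Q by blast
    then show ?thesis by (simp only: subset_iff K I)
  qed
  also have "\<dots> \<longleftrightarrow> (\<forall>w\<in>carrier (TF n). Dm (ev n w) = (\<lambda>i. \<zero>) \<longrightarrow>
      (\<exists>w'\<in>carrier (TF (n + 1)). ev n w = Dm (ev (n + 1) w')))"
  proof -
    have "cos n w = cos n (TE (n + 1) w') \<longleftrightarrow> ev n w = Dm (ev (n + 1) w')"
      if w: "w \<in> carrier (TF n)" "w' \<in> carrier (TF (n + 1))" for w w'
    proof -
      have "w - TE (n + 1) w' \<in> carrier (TF n)"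
        using w TE1(1) [OF w(2)] keys_diff [of w "TE (n + 1) w'"] by auto
      then have "cos n w = cos n (TE (n + 1) w') \<longleftrightarrow> (\<lambda>i. ev n w i \<ominus> Dm (ev (n + 1) w') i) = (\<lambda>i. \<zero>)"
        using cos_eq_iff [OF w(1) TE1(1) [OF w(2)]] ev_eq_zero_iff [of "w - TE (n + 1) w'" n]
          ev_diff [OF w(1) TE1(1) [OF w(2)]] TE1(2) [OF w(2)] by simp
      also have "\<dots> \<longleftrightarrow> ev n w = Dm (ev (n + 1) w')"
        using ev_closed [OF w(1)] ev_closed [OF TE1(1) [OF w(2)]] TE1(2) [OF w(2)]
        by (simp add: fun_eq_iff diff_eq_zero_iff)
      finally show ?thesis .
    qed
    then have "(\<exists>w'\<in>carrier (TF (n + 1)). cos n w = cos n (TE (n + 1) w')) \<longleftrightarrow>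
        (\<exists>w'\<in>carrier (TF (n + 1)). ev n w = Dm (ev (n + 1) w'))" if "w \<in> carrier (TF n)" for w
      using that by (intro bex_cong refl)
    then show ?thesis by (intro ball_cong refl) simp
  qed
  also have "\<dots> \<longleftrightarrow> (\<forall>z\<in>V n. Dm z = (\<lambda>i. \<zero>) \<longrightarrow> (\<exists>y\<in>V (n + 1). z = Dm y))"
  proof -
    have V: "V m = ev m ` carrier (TF m)" for m
    proof (intro equalityI subsetI)
      fix z assume "z \<in> V m"
      then show "z \<in> ev m ` carrier (TF m)" by (rule ev_surj) (auto simp del: TF_simps)
    qed (use ev_in_V in blast)
    show ?thesis unfolding V by (simp only: ball_simps bex_simps)
  qed
  finally show ?thesis .
qed

lemma novikov_acyclic_iff:
  "novikov_acyclic R Rg C d \<S> \<longleftrightarrow>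
     (\<forall>n. \<forall>z\<in>V n. Dm z = (\<lambda>i. \<zero>) \<longrightarrow> (\<exists>y\<in>V (n + 1). z = Dm y))"
  unfolding novikov_acyclic_def tensor_acyclic_def
  using tensor_homology_trivial_iff by blast

end

subsection \<open>Contractions over Novikov rings\<close>

text \<open>The index set \<open>J\<close> mixes all chain degrees; this records by how much a
  kernel shifts them.\<close>

definition has_degree :: "('a, 'm) ring_scheme \<Rightarrow> int \<Rightarrow> (int \<times> 'b \<Rightarrow> int \<times> 'b \<Rightarrow> int \<times> int \<Rightarrow> 'a) \<Rightarrow> bool" where
  "has_degree R k a \<longleftrightarrow> (\<forall>j' j \<tau>. a j' j \<tau> \<noteq> \<zero>\<^bsub>R\<^esub> \<longrightarrow> fst j' = fst j + k)"

context based_complex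
begin

definition contraction :: "(int \<times> int) set \<Rightarrow> (int \<times> 'b \<Rightarrow> int \<times> 'b \<Rightarrow> int \<times> int \<Rightarrow> 'a) \<Rightarrow> bool" where
  "contraction T g \<longleftrightarrow> kernel_on J T g \<and> has_degree R 1 g \<and>
     (\<forall>j\<in>J. \<forall>i. Dm (col g j) i \<oplus> mv R (tker g) (col Dk j) i = (if i = (j, 0) then \<one> else \<zero>))"

lemma has_degree_kern: "rhom k \<phi> \<Longrightarrow> has_degree R k (kern k \<phi>)"
  by (auto simp: has_degree_def kern_def vec_def)

lemma hvec_at_mv:
  assumes a: "kernel_on J T a" and k: "has_degree R k a" and z: "hvec_at n z"
  shows "hvec_at (n + k) (mv R (tker a) z)"
  unfolding hvec_def
proof (intro conjI allI impI)
  have hvec: "hvec J (mv R (tker a) z)" by (rule hvec_mv [OF a hvec_at_hvec [OF z]])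
  fix i
  show "mv R (tker a) z i \<in> Rg (snd i)" using hvec by (simp add: hvec_def)
  assume nz: "mv R (tker a) z i \<noteq> \<zero>"
  then have "fst i \<in> J" using hvec by (simp add: hvec_def)
  then have 1: "snd (fst i) \<in> B (fst (fst i))" using in_J [of "fst (fst i)" "snd (fst i)"] by simp
  obtain m where m: "tker a i m \<noteq> \<zero>" "z m \<noteq> \<zero>"
    using tker_nonzeroD [OF a z nz] by blast
  have "fst m \<in> {n} \<times> B n" using z m(2) by (simp add: hvec_def)
  moreover have "fst (fst i) = fst (fst m) + k"
    using k m(1) unfolding has_degree_def tker_def by blast
  ultimately show "fst i \<in> {n + k} \<times> B (n + k)"
    using 1 by (auto simp: mem_Times_iff)
qed

lemma vec_basis: "b \<in> B n \<Longrightarrow> vec n b i = (if i = ((n, b), 0) then \<one> else \<zero>)"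
  by (cases i) (auto simp: vec_def C.co_basis comp_one)

lemma D_row:
  obtains N where "finite N" "kernel_on J N Dk" "has_degree R (-1) Dk"
  using kernel_on_kern [OF rhom_d] has_degree_kern [OF rhom_d] by metis

lemma d_d: "x \<in> carrier (C n) \<Longrightarrow> d (n - 1) (d n x) = \<zero>\<^bsub>C (n - 2)\<^esub>"
  using complex by (simp add: chain_complex_def)

lemma D_hom: "Dm \<in> carrier (vec_group R) \<rightarrow> carrier (vec_group R)"
  using D_closed by simp

lemmas D_vec_group = additive_finsum [OF vec_group_group vec_group_group D_hom]

lemma D_minus:
  assumes "\<And>i. z i \<in> carrier R"
  shows "Dm (\<lambda>i. \<ominus> z i) = (\<lambda>i. \<ominus> Dm z i)"
proof -
  have "Dm (\<ominus>\<^bsub>vec_group R\<^esub> z) = \<ominus>\<^bsub>vec_group R\<^esub> (Dm z)"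
    by (rule D_vec_group(3)) (use assms D_add in \<open>simp_all add: fun_eq_iff\<close>)
  then show ?thesis
    using vec_group_minus [of z] vec_group_minus [of "Dm z"] assms D_closed by simp
qed

lemma D_diff:
  assumes "\<And>i. z i \<in> carrier R" "\<And>i. w i \<in> carrier R"
  shows "Dm (\<lambda>i. z i \<ominus> w i) = (\<lambda>i. Dm z i \<ominus> Dm w i)"
  using D_minus [of w] D_add [of z "\<lambda>i. \<ominus> w i"] assms by (simp add: a_minus_def fun_eq_iff)

lemma DD_zero:
  assumes "hvec J z"
  shows "Dm (Dm z) = (\<lambda>i. \<zero>)"
proof
  fix i
  obtain N where N: "finite N" "kernel_on J N Dk" using kernel_on_kern [OF rhom_d] .
  have z: "kernel_comp Dk Dk j' j \<tau> = \<zero>" for j' j \<tau>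
  proof (cases "snd j \<in> B (fst j)")
    case True
    let ?b = "snd j" and ?n = "fst j"
    have "kernel_comp Dk Dk j' j \<tau> = Dm (vec (?n - 1) (d ?n ?b)) (j', \<tau>)"
      using col_kern [OF True, of "-1" d] by (simp add: kernel_comp_def)
    also have "\<dots> = \<zero>"
      using D_vec [OF d_closed [OF C.basis_carrier [OF True]]] d_d [OF C.basis_carrier [OF True]] by simp
    finally show ?thesis .
  next
    case False
    then have "col Dk j = (\<lambda>i. \<zero>)" by (simp add: col_def kern_def fun_eq_iff)
    then show ?thesis using tker_carrier [OF N(2)] by (simp add: kernel_comp_def mv_def)
  qed
  have "Dm (Dm z) i = mv R (tker (kernel_comp Dk Dk)) z i"
    by (rule tker_mv_mv [OF N(2,2) assms pairs_finite_left [OF N(1) loc_finite_finite [OF N(1)]]])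
  also have "\<dots> = \<zero>"
    using hvec_carrier [OF assms] by (simp add: mv_def tker_def z)
  finally show "Dm (Dm z) i = \<zero>" .
qed

lemma contraction_apply:
  assumes g: "contraction T g" and z: "hvec J z" "loc_finite T z"
  shows "Dm (mv R (tker g) z) i \<oplus> mv R (tker g) (Dm z) i = z i"
proof -
  obtain N where N: "finite N" "kernel_on J N Dk" using kernel_on_kern [OF rhom_d] .
  let ?t = "\<lambda>(j'::int \<times> 'b) (j::int \<times> 'b) (\<tau>::int \<times> int). \<zero>"
  have t: "kernel_on J {} ?t" using finite_J by (simp add: kernel_on_def)
  have gt: "kernel_on J T g" using g by (simp add: contraction_def)
  have t0: "col ?t j i = \<zero>" "mv R (tker ?t) z i = \<zero>" for i j
    using hvec_carrier [OF z(1)] by (simp_all add: col_def tker_def mv_def)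
  have cl: "Dm w i \<in> carrier R" "mv R (tker g) w i \<in> carrier R" if "hvec J w" for w i
    using hvec_carrier [OF hvec_mv [OF N(2) that]] hvec_carrier [OF hvec_mv [OF gt that]] by auto
  have "Dm (mv R (tker g) z) i \<oplus> mv R (tker g) (Dm z) i \<oplus> mv R (tker ?t) z i = z i"
  proof (rule contraction_lift [OF N(2,1) gt t finite.emptyI subset_refl _ z])
    fix j i assume "j \<in> J"
    then have "Dm (col g j) i \<oplus> mv R (tker g) (col Dk j) i = (if i = (j, 0) then \<one> else \<zero>)"
      using g by (simp add: contraction_def)
    then show "Dm (col g j) i \<oplus> mv R (tker g) (col Dk j) i \<oplus> col ?t j i = (if i = (j, 0) then \<one> else \<zero>)"
      using t0 by simp
  qed
  then show ?thesis
    using t0 cl [OF hvec_mv [OF gt z(1)]] cl [OF hvec_mv [OF N(2) z(1)]] by simp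
qed

end

context novikov_coefficients
begin

lemma V_degs: assumes "z \<in> V n" shows "degs z \<in> \<S>"
proof -
  have U: "finite F \<Longrightarrow> (\<Union>j\<in>F. {\<sigma>. z (j, \<sigma>) \<noteq> \<zero>}) \<in> \<S>" for F
  proof (induction F rule: finite_induct)
    case empty
    then show ?case using good by (simp add: good_supports_def)
  next
    case (insert j F)
    then show ?case using assms by (simp add: V_def union_S)
  qed
  have "degs z \<subseteq> (\<Union>j\<in>{n} \<times> B n. {\<sigma>. z (j, \<sigma>) \<noteq> \<zero>})"
  proof
    fix \<sigma> assume "\<sigma> \<in> degs z"
    then obtain j where j: "z (j, \<sigma>) \<noteq> \<zero>" by (rule degsE)
    have "hvec_at n z" using assms by (rule V_hvec_at)
    then have "j \<in> {n} \<times> B n" using j unfolding hvec_def by (metis fst_conv)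
    then show "\<sigma> \<in> (\<Union>j\<in>{n} \<times> B n. {\<sigma>. z (j, \<sigma>) \<noteq> \<zero>})" using j by blast
  qed
  then show ?thesis by (rule subset_S [OF U, rotated]) simp
qed

lemma V_I:
  assumes "hvec_at n z" "degs z \<in> \<S>" shows "z \<in> V n"
proof -
  have "{\<sigma>. z (j, \<sigma>) \<noteq> \<zero>} \<subseteq> degs z" for j
    using degsI [of z "(j, _)"] by auto
  then show ?thesis
    using assms subset_S by (auto simp: V_def)
qed

text \<open>The usual construction of a contraction of an exact bounded complex of free modules, one
  chain degree at a time. For a basis element b of degree \<open>n\<close>, the family b - g d b is
  a cycle; any \<open>y\<close> that bounds it becomes the new column of the contraction at
  b.\<close>

lemma contraction_step:
  assumes exact: "\<And>n z. z \<in> V n \<Longrightarrow> Dm z = (\<lambda>i. \<zero>) \<Longrightarrow> \<exists>y\<in>V (n + 1). z = Dm y"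
    and unit: "{0} \<in> \<S>"
    and T: "T \<in> \<S>" and g: "kernel_on J T g" "has_degree R 1 g"
    and col: "\<And>j i. j \<in> J \<Longrightarrow> fst j < n \<Longrightarrow>
      Dm (col g j) i \<oplus> mv R (tker g) (col Dk j) i = (if i = (j, 0) then \<one> else \<zero>)"
  shows "\<exists>T'\<in>\<S>. \<exists>g'. kernel_on J T' g' \<and> has_degree R 1 g' \<and> (\<forall>j\<in>J. \<forall>i. fst j < n + 1 \<longrightarrow>
      Dm (col g' j) i \<oplus> mv R (tker g') (col Dk j) i = (if i = (j, 0) then \<one> else \<zero>))"
proof -
  obtain N where N: "finite N" "kernel_on J N Dk" "has_degree R (-1) Dk" by (rule D_row)
  define v where "v b = vec (n - 1) (d n b)" for b
  define q where "q b = (\<lambda>i. vec n b i \<ominus> mv R (tker g) (v b) i)" for b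
  have bc: "b \<in> carrier (C n)" if "b \<in> B n" for b using C.basis_carrier [OF that] .
  have hvec_v: "hvec_at (n - 1) (v b)" "finite (degs (v b))" "Dm (vec n b) = v b" if "b \<in> B n" for b
    using hvec_at_vec [OF d_closed [OF bc [OF that]]] finite_degs_vec [OF d_closed [OF bc [OF that]]] D_vec [OF bc [OF that]]
    by (simp_all add: v_def)
  have hvec_gv: "hvec_at n (mv R (tker g) (v b))" if "b \<in> B n" for b
    using hvec_at_mv [OF g hvec_v(1) [OF that]] by simp
  \<comment> \<open>In chain degree \<open>n - 1\<close> the contraction identity is already known,
    and d b is a cycle, so D g d b = d b.\<close>
  have Dgv: "Dm (mv R (tker g) (v b)) = v b" if b: "b \<in> B n" for b
  proof
    fix i
    let ?t = "\<lambda>(j'::int \<times> 'b) (j::int \<times> 'b) (\<tau>::int \<times> int). \<zero>"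
    have t: "kernel_on J {} ?t" using finite_J by (simp add: kernel_on_def)
    have t0: "col ?t j i = \<zero>" "mv R (tker ?t) (v b) i = \<zero>" for i j
      using hvec_carrier [OF hvec_v(1) [OF b]] by (simp_all add: col_def tker_def mv_def)
    have sub: "{n - 1} \<times> B (n - 1) \<subseteq> J" by (auto simp: in_J)
    have gm: "mv R (tker g) (Dm (v b)) i = \<zero>"
    proof -
      have "Dm (v b) = (\<lambda>i. \<zero>)"
        using DD_zero [OF hvec_at_hvec [OF hvec_at_vec [OF bc [OF b]]]] hvec_v(3) [OF b] by simp
      then show ?thesis using tker_carrier [OF g(1)] by (simp add: mv_def)
    qed
    have "Dm (mv R (tker g) (v b)) i \<oplus> mv R (tker g) (Dm (v b)) i \<oplus> mv R (tker ?t) (v b) i = v b i"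
    proof (rule contraction_lift [OF N(2,1) g(1) t finite.emptyI sub _ hvec_v(1) [OF b] loc_finite_finite_degs [OF hvec_v(2) [OF b]]])
      fix j i assume j: "j \<in> {n - 1} \<times> B (n - 1)"
      then have "j \<in> J" "fst j < n" using sub by auto
      then have "Dm (col g j) i \<oplus> mv R (tker g) (col Dk j) i = (if i = (j, 0) then \<one> else \<zero>)"
        by (rule col)
      then show "Dm (col g j) i \<oplus> mv R (tker g) (col Dk j) i \<oplus> col ?t j i = (if i = (j, 0) then \<one> else \<zero>)"
        using t0 by simp
    qed
    then show "Dm (mv R (tker g) (v b)) i = v b i"
      using gm t0 D_closed [of "mv R (tker g) (v b)" i] hvec_carrier [OF hvec_gv [OF b]] by simp
  qed
  have qV: "q b \<in> V n" if b: "b \<in> B n" for b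
  proof -
    \<comment> \<open>The coordinate family of a basis element lives in degree 0; this is where
      \<open>unit\<close> is used to place it in \<open>V n\<close>.\<close>
    have "degs (vec n b) \<subseteq> {0}"
      using vec_basis [OF b] by (auto simp: degs_def split: if_splits)
    then have 1: "vec n b \<in> V n"
      using V_I [OF hvec_at_vec [OF bc [OF b]]] subset_S [OF unit] by blast
    have "degs (mv R (tker g) (v b)) \<subseteq> {\<alpha> + \<beta> | \<alpha> \<beta>. \<alpha> \<in> degs (v b) \<and> \<beta> \<in> T}"
    proof
      fix \<sigma> assume "\<sigma> \<in> degs (mv R (tker g) (v b))"
      then obtain \<kappa> where "\<kappa> \<in> degs (v b)" "\<sigma> - \<kappa> \<in> T"
        using degs_mv [OF g(1) hvec_at_hvec [OF hvec_v(1) [OF b]]] by blast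
      then show "\<sigma> \<in> {\<alpha> + \<beta> | \<alpha> \<beta>. \<alpha> \<in> degs (v b) \<and> \<beta> \<in> T}"
        by (intro CollectI exI [of _ \<kappa>] exI [of _ "\<sigma> - \<kappa>"]) simp
    qed
    then have 2: "mv R (tker g) (v b) \<in> V n"
      using V_I [OF hvec_gv [OF b]] subset_S [OF shift_S [OF T hvec_v(2) [OF b]]] by blast
    show ?thesis
      using V_add [OF 1 V_minus [OF 2]] by (simp add: q_def a_minus_def)
  qed
  have Dq: "Dm (q b) = (\<lambda>i. \<zero>)" if b: "b \<in> B n" for b
  proof -
    have "Dm (q b) = (\<lambda>i. Dm (vec n b) i \<ominus> Dm (mv R (tker g) (v b)) i)"
      unfolding q_def by (rule D_diff) (use bc [OF b] hvec_carrier [OF hvec_gv [OF b]] in simp_all)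
    also have "\<dots> = (\<lambda>i. \<zero>)"
      using Dgv [OF b] hvec_v(3) [OF b] hvec_carrier [OF hvec_v(1) [OF b]]
      by (simp add: a_minus_def r_neg)
    finally show ?thesis .
  qed
  have "\<forall>b\<in>B n. \<exists>y. y \<in> V (n + 1) \<and> q b = Dm y"
    using exact [OF qV Dq] by blast
  then obtain y where y: "\<And>b. b \<in> B n \<Longrightarrow> y b \<in> V (n + 1)" "\<And>b. b \<in> B n \<Longrightarrow> q b = Dm (y b)"
    by metis
  \<comment> \<open>Only the columns in chain degree \<open>n\<close> are replaced, so that the
    identities established in lower degrees persist.\<close>
  define g' where "g' j' j \<tau> = (if fst j = n \<and> snd j \<in> B n then y (snd j) (j', \<tau>) else g j' j \<tau>)" for j' j \<tau>
  define T' where "T' = T \<union> (\<Union>b\<in>B n. degs (y b))"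
  have "(\<Union>b\<in>F. degs (y b)) \<in> \<S>" if "finite F" "F \<subseteq> B n" for F
    using that
  proof (induction F rule: finite_induct)
    case empty
    then show ?case using good by (simp add: good_supports_def)
  next
    case (insert b F)
    then show ?case using V_degs [OF y(1), of b] union_S by simp
  qed
  then have T': "T' \<in> \<S>" unfolding T'_def using union_S [OF T] by simp
  have hy: "y b i \<in> Rg (snd i)" "y b i \<noteq> \<zero> \<Longrightarrow> fst i \<in> {n + 1} \<times> B (n + 1)" if "b \<in> B n" for b i
    using V_hvec_at [OF y(1) [OF that]] by (simp_all add: hvec_def)
  have g': "kernel_on J T' g'"
    unfolding kernel_on_def
  proof (intro conjI allI impI)
    fix j' j \<tau>
    show "finite J" by (rule finite_J)
    show "g' j' j \<tau> \<in> Rg \<tau>"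
      using hy(1) [of "snd j" "(j', \<tau>)"] g(1) by (simp add: g'_def kernel_on_def)
    assume nz: "g' j' j \<tau> \<noteq> \<zero>"
    have "j' \<in> J \<and> j \<in> J \<and> \<tau> \<in> T'"
    proof (cases "fst j = n \<and> snd j \<in> B n")
      case True
      then have y0: "y (snd j) (j', \<tau>) \<noteq> \<zero>" using nz by (simp add: g'_def)
      then have "j' \<in> {n + 1} \<times> B (n + 1)" using hy(2) [of "snd j" "(j', \<tau>)"] True by simp
      moreover have "\<tau> \<in> degs (y (snd j))" using degsI [of "y (snd j)", OF y0] by simp
      ultimately have "snd j' \<in> B (fst j')" "snd j \<in> B (fst j)" "\<tau> \<in> T'"
        using True by (auto simp: T'_def mem_Times_iff)
      then show ?thesis
        using in_J [of "fst j" "snd j"] in_J [of "fst j'" "snd j'"] by simp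
    next
      case False
      then have "g j' j \<tau> \<noteq> \<zero>" using nz by (auto simp: g'_def)
      then show ?thesis using g(1) by (simp add: kernel_on_def T'_def)
    qed
    then show "j' \<in> J" "j \<in> J" "\<tau> \<in> T'" by auto
  qed
  have deg: "has_degree R 1 g'"
    unfolding has_degree_def
  proof (intro allI impI)
    fix j' j \<tau> assume nz: "g' j' j \<tau> \<noteq> \<zero>"
    show "fst j' = fst j + 1"
    proof (cases "fst j = n \<and> snd j \<in> B n")
      case True
      then have "y (snd j) (j', \<tau>) \<noteq> \<zero>" using nz by (simp add: g'_def)
      then show ?thesis using hy(2) [of "snd j" "(j', \<tau>)"] True by auto
    next
      case False
      then have "g j' j \<tau> \<noteq> \<zero>" using nz by (auto simp: g'_def)
      then show ?thesis using g(2) unfolding has_degree_def by blast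
    qed
  qed
  have same: "mv R (tker g') z = mv R (tker g) z" if z: "hvec_at m z" "m < n" for m z
  proof
    fix i
    have "tker g' i k \<otimes> z k = tker g i k \<otimes> z k" for k
    proof (cases "z k = \<zero>")
      case True
      then show ?thesis using tker_carrier [OF g'] tker_carrier [OF g(1)] by simp
    next
      case False
      then have "fst (fst k) = m" using z(1) by (auto simp: hvec_def)
      then show ?thesis using z(2) by (simp add: tker_def g'_def)
    qed
    then show "mv R (tker g') z i = mv R (tker g) z i" by (simp add: mv_def)
  qed
  have id': "Dm (col g' j) i \<oplus> mv R (tker g') (col Dk j) i = (if i = (j, 0) then \<one> else \<zero>)"
    if j: "j \<in> J" "fst j < n + 1" for j i
  proof -
    have jB: "snd j \<in> B (fst j)" using j(1) in_J [of "fst j" "snd j"] by simp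
    have cD: "col Dk j = vec (fst j - 1) (d (fst j) (snd j))"
      using col_kern [OF jB, of "-1" d] by simp
    have hc: "hvec_at (fst j - 1) (col Dk j)"
      unfolding cD by (rule hvec_at_vec [OF d_closed [OF C.basis_carrier [OF jB]]])
    have s: "mv R (tker g') (col Dk j) = mv R (tker g) (col Dk j)"
      by (rule same [OF hc]) (use j in simp)
    show ?thesis
    proof (cases "fst j = n")
      case True
      let ?b = "snd j"
      have b: "?b \<in> B n" using jB True by simp
      have "col g' j = y ?b"
        using True b by (simp add: col_def g'_def fun_eq_iff)
      then have "Dm (col g' j) i = q ?b i" using y(2) [OF b] by simp
      moreover have "mv R (tker g') (col Dk j) i = mv R (tker g) (v ?b) i"
        using s cD True by (simp add: v_def)
      moreover have "q ?b i \<oplus> mv R (tker g) (v ?b) i = vec n ?b i"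
        using vec_carrier [OF bc [OF b], of i] hvec_carrier [OF hvec_gv [OF b], of i]
        by (simp add: q_def a_minus_def a_assoc l_neg)
      moreover have "vec n ?b i = (if i = (j, 0) then \<one> else \<zero>)"
        using vec_basis [OF b] True by (metis prod.collapse)
      ultimately show ?thesis by simp
    next
      case False
      then have "fst j < n" using j(2) by simp
      moreover have "col g' j = col g j"
        using False by (simp add: col_def g'_def fun_eq_iff)
      ultimately show ?thesis using col [OF j(1)] s by simp
    qed
  qed
  show ?thesis
    using T' g' deg id' by blast
qed

lemma contraction_exists:
  assumes ac: "novikov_acyclic R Rg C d \<S>" and unit: "{0} \<in> \<S>"
  obtains T g where "T \<in> \<S>" "contraction T g"
proof -
  have exact: "\<exists>y\<in>V (n + 1). z = Dm y" if "z \<in> V n" "Dm z = (\<lambda>i. \<zero>)" for n z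
    using ac that unfolding novikov_acyclic_iff by blast
  \<comment> \<open>Inserting 0 covers the case of an empty \<open>J\<close>.\<close>
  define lo where "lo = Min (insert 0 (fst ` J))"
  define hi where "hi = Max (insert 0 (fst ` J))"
  have lo: "lo \<le> fst j" and hi: "fst j \<le> hi" if "j \<in> J" for j
    using that finite_J by (auto simp: lo_def hi_def)
  have "\<exists>T\<in>\<S>. \<exists>g. kernel_on J T g \<and> has_degree R 1 g \<and> (\<forall>j\<in>J. \<forall>i. fst j < lo + int k \<longrightarrow>
      Dm (col g j) i \<oplus> mv R (tker g) (col Dk j) i = (if i = (j, 0) then \<one> else \<zero>))" for k
  proof (induction k)
    case 0
    have "kernel_on J {} (\<lambda>j' j \<tau>. \<zero>)" "has_degree R 1 (\<lambda>j' j \<tau>. \<zero>)" "{} \<in> \<S>"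
      using finite_J good by (simp_all add: kernel_on_def has_degree_def good_supports_def)
    moreover have "\<not> fst j < lo + int 0" if "j \<in> J" for j using lo [OF that] by simp
    ultimately show ?case by blast
  next
    case (Suc k)
    then obtain T g where "T \<in> \<S>" "kernel_on J T g" "has_degree R 1 g" "\<And>j i. j \<in> J \<Longrightarrow> fst j < lo + int k \<Longrightarrow>
      Dm (col g j) i \<oplus> mv R (tker g) (col Dk j) i = (if i = (j, 0) then \<one> else \<zero>)"
      by blast
    note step = contraction_step [OF exact unit this]
    have "lo + int (Suc k) = lo + int k + 1" by simp
    with step show ?case by (simp only:)
  qed
  from this [of "nat (hi - lo + 1)"] obtain T g where "T \<in> \<S>" "kernel_on J T g" "has_degree R 1 g"
    and c: "\<And>j i. j \<in> J \<Longrightarrow> fst j < lo + int (nat (hi - lo + 1)) \<Longrightarrow>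
      Dm (col g j) i \<oplus> mv R (tker g) (col Dk j) i = (if i = (j, 0) then \<one> else \<zero>)"
    by blast
  moreover have "fst j < lo + int (nat (hi - lo + 1))" if "j \<in> J" for j
    using lo [OF that] hi [OF that] by simp
  ultimately have "contraction T g" unfolding contraction_def by blast
  with \<open>T \<in> \<S>\<close> show ?thesis by (rule that)
qed

end

subsection \<open>Supports\<close>

lemma supports_y_iff:
  assumes "\<delta> = 1 \<or> \<delta> = -1"
  shows "T \<in> supports_y \<delta> \<longleftrightarrow> (\<exists>n::nat. \<forall>\<sigma>\<in>T. - int n \<le> \<delta> * snd \<sigma>) \<and> (\<forall>b. finite {a. (a, b) \<in> T})"
proof -
  have "T \<subseteq> {(a, \<delta> * b) | a b. b \<ge> - int n} \<longleftrightarrow> (\<forall>\<sigma>\<in>T. - int n \<le> \<delta> * snd \<sigma>)" for n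
  proof
    assume *: "\<forall>\<sigma>\<in>T. - int n \<le> \<delta> * snd \<sigma>"
    show "T \<subseteq> {(a, \<delta> * b) | a b. b \<ge> - int n}"
    proof
      fix \<sigma> assume "\<sigma> \<in> T"
      then show "\<sigma> \<in> {(a, \<delta> * b) | a b. b \<ge> - int n}"
        using * assms by (intro CollectI exI [of _ "fst \<sigma>"] exI [of _ "\<delta> * snd \<sigma>"]) (auto simp: prod_eq_iff)
    qed
  next
    assume "T \<subseteq> {(a, \<delta> * b) | a b. b \<ge> - int n}"
    then show "\<forall>\<sigma>\<in>T. - int n \<le> \<delta> * snd \<sigma>"
      using assms by (auto dest!: subsetD)
  qed
  then show ?thesis by (auto simp: supports_y_def)
qed

lemma supports_x_iff:
  assumes "\<epsilon> = 1 \<or> \<epsilon> = -1"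
  shows "T \<in> supports_x \<epsilon> \<longleftrightarrow> (\<exists>n::nat. \<forall>\<sigma>\<in>T. - int n \<le> \<epsilon> * fst \<sigma>) \<and> (\<forall>a. finite {b. (a, b) \<in> T})"
proof -
  have "T \<subseteq> {(\<epsilon> * a, b) | a b. a \<ge> - int n} \<longleftrightarrow> (\<forall>\<sigma>\<in>T. - int n \<le> \<epsilon> * fst \<sigma>)" for n
  proof
    assume *: "\<forall>\<sigma>\<in>T. - int n \<le> \<epsilon> * fst \<sigma>"
    show "T \<subseteq> {(\<epsilon> * a, b) | a b. a \<ge> - int n}"
    proof
      fix \<sigma> assume "\<sigma> \<in> T"
      then show "\<sigma> \<in> {(\<epsilon> * a, b) | a b. a \<ge> - int n}"
        using * assms by (intro CollectI exI [of _ "\<epsilon> * fst \<sigma>"] exI [of _ "snd \<sigma>"]) (auto simp: prod_eq_iff)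
    qed
  next
    assume "T \<subseteq> {(\<epsilon> * a, b) | a b. a \<ge> - int n}"
    then show "\<forall>\<sigma>\<in>T. - int n \<le> \<epsilon> * fst \<sigma>"
      using assms by (auto dest!: subsetD)
  qed
  then show ?thesis by (auto simp: supports_x_def)
qed

lemma supports_xy_iff:
  assumes "\<epsilon> = 1 \<or> \<epsilon> = -1" "\<delta> = 1 \<or> \<delta> = -1"
  shows "T \<in> supports_xy \<epsilon> \<delta> \<longleftrightarrow> (\<exists>n::nat. \<forall>\<sigma>\<in>T. - int n \<le> \<epsilon> * fst \<sigma> \<and> - int n \<le> \<delta> * snd \<sigma>)"
proof -
  have "T \<subseteq> {(\<epsilon> * a, \<delta> * b) | a b. a \<ge> - int n \<and> b \<ge> - int n} \<longleftrightarrow>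
      (\<forall>\<sigma>\<in>T. - int n \<le> \<epsilon> * fst \<sigma> \<and> - int n \<le> \<delta> * snd \<sigma>)" for n
  proof
    assume *: "\<forall>\<sigma>\<in>T. - int n \<le> \<epsilon> * fst \<sigma> \<and> - int n \<le> \<delta> * snd \<sigma>"
    show "T \<subseteq> {(\<epsilon> * a, \<delta> * b) | a b. a \<ge> - int n \<and> b \<ge> - int n}"
    proof
      fix \<sigma> assume "\<sigma> \<in> T"
      then show "\<sigma> \<in> {(\<epsilon> * a, \<delta> * b) | a b. a \<ge> - int n \<and> b \<ge> - int n}"
        using * assms by (intro CollectI exI [of _ "\<epsilon> * fst \<sigma>"] exI [of _ "\<delta> * snd \<sigma>"]) (auto simp: prod_eq_iff)
    qed
  next
    assume "T \<subseteq> {(\<epsilon> * a, \<delta> * b) | a b. a \<ge> - int n \<and> b \<ge> - int n}"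
    then show "\<forall>\<sigma>\<in>T. - int n \<le> \<epsilon> * fst \<sigma> \<and> - int n \<le> \<delta> * snd \<sigma>"
      using assms by (auto dest!: subsetD)
  qed
  then show ?thesis by (auto simp: supports_xy_def)
qed

lemma finite_bound:
  fixes N :: "(int \<times> int) set"
  assumes "finite N"
  obtains L :: nat where "\<And>\<sigma>. \<sigma> \<in> N \<Longrightarrow> \<bar>fst \<sigma>\<bar> \<le> int L \<and> \<bar>snd \<sigma>\<bar> \<le> int L"
proof -
  have "\<exists>L::nat. \<forall>\<sigma>\<in>N. \<bar>fst \<sigma>\<bar> \<le> int L \<and> \<bar>snd \<sigma>\<bar> \<le> int L"
    using assms
  proof (induction N rule: finite_induct)
    case (insert \<tau> N)
    then obtain L :: nat where L: "\<forall>\<sigma>\<in>N. \<bar>fst \<sigma>\<bar> \<le> int L \<and> \<bar>snd \<sigma>\<bar> \<le> int L" by blast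
    have "\<bar>fst \<sigma>\<bar> \<le> int (L + nat \<bar>fst \<tau>\<bar> + nat \<bar>snd \<tau>\<bar>) \<and> \<bar>snd \<sigma>\<bar> \<le> int (L + nat \<bar>fst \<tau>\<bar> + nat \<bar>snd \<tau>\<bar>)"
      if "\<sigma> \<in> insert \<tau> N" for \<sigma>
    proof (cases "\<sigma> = \<tau>")
      case False
      then have "\<bar>fst \<sigma>\<bar> \<le> int L \<and> \<bar>snd \<sigma>\<bar> \<le> int L" using L that by blast
      then show ?thesis by linarith
    qed auto
    then show ?case by blast
  qed simp
  then show ?thesis using that by blast
qed

lemma finite_box: "finite {\<sigma> :: int \<times> int. \<bar>fst \<sigma>\<bar> \<le> M \<and> \<bar>snd \<sigma>\<bar> \<le> M}"
proof (rule finite_subset)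
  show "{\<sigma> :: int \<times> int. \<bar>fst \<sigma>\<bar> \<le> M \<and> \<bar>snd \<sigma>\<bar> \<le> M} \<subseteq> {-M..M} \<times> {-M..M}"
    by (auto simp: mem_Times_iff)
qed simp

lemma supports_swap:
  assumes "\<epsilon> = 1 \<or> \<epsilon> = -1"
  shows "T \<in> supports_x \<epsilon> \<longleftrightarrow> prod.swap ` T \<in> supports_y \<epsilon>"
proof -
  have "{a. (a, b) \<in> prod.swap ` T} = {a. (b, a) \<in> T}" for b by auto
  then show ?thesis
    unfolding supports_x_iff [OF assms] supports_y_iff [OF assms] by simp
qed

lemma good_supports_y:
  assumes "\<delta> = 1 \<or> \<delta> = -1" shows "good_supports (supports_y \<delta>)"
  unfolding good_supports_def
proof (intro conjI ballI allI impI)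
  note iff = supports_y_iff [OF assms]
  show "{} \<in> supports_y \<delta>" by (simp add: iff)
  fix T assume T: "T \<in> supports_y \<delta>"
  then obtain n :: nat where n: "\<And>\<sigma>. \<sigma> \<in> T \<Longrightarrow> - int n \<le> \<delta> * snd \<sigma>" and fin: "\<And>b. finite {a. (a, b) \<in> T}"
    by (auto simp: iff)
  show "T' \<in> supports_y \<delta>" if "T' \<subseteq> T" for T'
    unfolding iff
  proof (intro conjI allI exI [of _ n] ballI)
    show "finite {a. (a, b) \<in> T'}" for b
      by (rule finite_subset [OF _ fin [of b]]) (use that in auto)
  qed (use n that in blast)
  show "T \<union> T' \<in> supports_y \<delta>" if T': "T' \<in> supports_y \<delta>" for T'
  proof -
    obtain n' :: nat where n': "\<And>\<sigma>. \<sigma> \<in> T' \<Longrightarrow> - int n' \<le> \<delta> * snd \<sigma>" and fin': "\<And>b. finite {a. (a, b) \<in> T'}"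
      using T' unfolding iff by blast
    show ?thesis
      unfolding iff
    proof (intro conjI allI exI [of _ "n + n'"] ballI)
      show "finite {a. (a, b) \<in> T \<union> T'}" for b
        by (rule finite_subset [OF _ finite_UnI [OF fin [of b] fin' [of b]]]) auto
      show "- int (n + n') \<le> \<delta> * snd \<sigma>" if "\<sigma> \<in> T \<union> T'" for \<sigma>
        using that
      proof
        assume "\<sigma> \<in> T" then show ?thesis using n [of \<sigma>] by linarith
      next
        assume "\<sigma> \<in> T'" then show ?thesis using n' [of \<sigma>] by linarith
      qed
    qed
  qed
  show "{\<alpha> + \<beta> | \<alpha> \<beta>. \<alpha> \<in> N \<and> \<beta> \<in> T} \<in> supports_y \<delta>" if N: "finite N" for N
  proof -
    obtain L :: nat where L: "\<And>\<sigma>. \<sigma> \<in> N \<Longrightarrow> \<bar>fst \<sigma>\<bar> \<le> int L \<and> \<bar>snd \<sigma>\<bar> \<le> int L"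
      using finite_bound [OF N] by blast
    show ?thesis
      unfolding iff
    proof (intro conjI allI exI [of _ "n + L"] ballI)
      fix b
      have "{a. (a, b) \<in> {\<alpha> + \<beta> | \<alpha> \<beta>. \<alpha> \<in> N \<and> \<beta> \<in> T}} \<subseteq> (\<Union>\<alpha>\<in>N. (\<lambda>a. fst \<alpha> + a) ` {a. (a, b - snd \<alpha>) \<in> T})"
      proof
        fix a assume "a \<in> {a. (a, b) \<in> {\<alpha> + \<beta> | \<alpha> \<beta>. \<alpha> \<in> N \<and> \<beta> \<in> T}}"
        then obtain \<alpha> \<beta> where "\<alpha> \<in> N" "\<beta> \<in> T" "(a, b) = \<alpha> + \<beta>" by blast
        then have "\<alpha> \<in> N" "a = fst \<alpha> + fst \<beta>" "(fst \<beta>, b - snd \<alpha>) \<in> T"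
          by (auto simp: plus_prod_def)
        then show "a \<in> (\<Union>\<alpha>\<in>N. (\<lambda>a. fst \<alpha> + a) ` {a. (a, b - snd \<alpha>) \<in> T})" by blast
      qed
      then show "finite {a. (a, b) \<in> {\<alpha> + \<beta> | \<alpha> \<beta>. \<alpha> \<in> N \<and> \<beta> \<in> T}}"
        by (rule finite_subset) (intro finite_UN_I N finite_imageI fin)
    next
      fix \<sigma> assume "\<sigma> \<in> {\<alpha> + \<beta> | \<alpha> \<beta>. \<alpha> \<in> N \<and> \<beta> \<in> T}"
      then obtain \<alpha> \<beta> where ab: "\<alpha> \<in> N" "\<beta> \<in> T" "\<sigma> = \<alpha> + \<beta>" by blast
      have "- int L \<le> \<delta> * snd \<alpha>" using L [OF ab(1)] assms by auto
      moreover have "\<delta> * snd \<sigma> = \<delta> * snd \<alpha> + \<delta> * snd \<beta>" using ab(3) by (simp add: algebra_simps)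
      ultimately show "- int (n + L) \<le> \<delta> * snd \<sigma>" using n [OF ab(2)] by linarith
    qed
  qed
qed

lemma good_supports_x:
  assumes "\<epsilon> = 1 \<or> \<epsilon> = -1" shows "good_supports (supports_x \<epsilon>)"
  unfolding good_supports_def
proof (intro conjI ballI allI impI)
  note g = good_supports_y [OF assms, unfolded good_supports_def] and sw = supports_swap [OF assms]
  show "{} \<in> supports_x \<epsilon>" using g by (simp add: sw)
  fix T assume T: "T \<in> supports_x \<epsilon>"
  show "T' \<in> supports_x \<epsilon>" if "T' \<subseteq> T" for T'
    using g T image_mono [OF that, of prod.swap] unfolding sw by blast
  show "T \<union> T' \<in> supports_x \<epsilon>" if "T' \<in> supports_x \<epsilon>" for T'
    using g T that unfolding sw image_Un by blast
  show "{\<alpha> + \<beta> | \<alpha> \<beta>. \<alpha> \<in> N \<and> \<beta> \<in> T} \<in> supports_x \<epsilon>" if N: "finite N" for N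
  proof -
    have "prod.swap ` {\<alpha> + \<beta> | \<alpha> \<beta>. \<alpha> \<in> N \<and> \<beta> \<in> T} \<subseteq> {\<alpha> + \<beta> | \<alpha> \<beta>. \<alpha> \<in> prod.swap ` N \<and> \<beta> \<in> prod.swap ` T}"
    proof
      fix \<sigma> assume "\<sigma> \<in> prod.swap ` {\<alpha> + \<beta> | \<alpha> \<beta>. \<alpha> \<in> N \<and> \<beta> \<in> T}"
      then obtain \<alpha> \<beta> where "\<alpha> \<in> N" "\<beta> \<in> T" "\<sigma> = prod.swap (\<alpha> + \<beta>)" by blast
      then show "\<sigma> \<in> {\<alpha> + \<beta> | \<alpha> \<beta>. \<alpha> \<in> prod.swap ` N \<and> \<beta> \<in> prod.swap ` T}"
        by (intro CollectI exI [of _ "prod.swap \<alpha>"] exI [of _ "prod.swap \<beta>"]) (auto simp: plus_prod_def)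
    qed
    moreover have "{\<alpha> + \<beta> | \<alpha> \<beta>. \<alpha> \<in> prod.swap ` N \<and> \<beta> \<in> prod.swap ` T} \<in> supports_y \<epsilon>"
      using g T N unfolding sw by blast
    ultimately show ?thesis using g unfolding sw by blast
  qed
qed

lemma good_supports_xy:
  assumes "\<epsilon> = 1 \<or> \<epsilon> = -1" "\<delta> = 1 \<or> \<delta> = -1" shows "good_supports (supports_xy \<epsilon> \<delta>)"
  unfolding good_supports_def
proof (intro conjI ballI allI impI)
  note iff = supports_xy_iff [OF assms]
  show "{} \<in> supports_xy \<epsilon> \<delta>" by (simp add: iff)
  fix T assume T: "T \<in> supports_xy \<epsilon> \<delta>"
  then obtain n :: nat where n: "\<And>\<sigma>. \<sigma> \<in> T \<Longrightarrow> - int n \<le> \<epsilon> * fst \<sigma> \<and> - int n \<le> \<delta> * snd \<sigma>"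
    by (auto simp: iff)
  show "T' \<in> supports_xy \<epsilon> \<delta>" if "T' \<subseteq> T" for T'
    unfolding iff by (intro exI [of _ n]) (use n that in blast)
  show "T \<union> T' \<in> supports_xy \<epsilon> \<delta>" if T': "T' \<in> supports_xy \<epsilon> \<delta>" for T'
  proof -
    obtain n' :: nat where n': "\<And>\<sigma>. \<sigma> \<in> T' \<Longrightarrow> - int n' \<le> \<epsilon> * fst \<sigma> \<and> - int n' \<le> \<delta> * snd \<sigma>"
      using T' unfolding iff by blast
    show ?thesis
      unfolding iff
    proof (intro exI [of _ "n + n'"] ballI)
      show "- int (n + n') \<le> \<epsilon> * fst \<sigma> \<and> - int (n + n') \<le> \<delta> * snd \<sigma>" if "\<sigma> \<in> T \<union> T'" for \<sigma>
        using that
      proof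
        assume "\<sigma> \<in> T" then show ?thesis using n [of \<sigma>] by linarith
      next
        assume "\<sigma> \<in> T'" then show ?thesis using n' [of \<sigma>] by linarith
      qed
    qed
  qed
  show "{\<alpha> + \<beta> | \<alpha> \<beta>. \<alpha> \<in> N \<and> \<beta> \<in> T} \<in> supports_xy \<epsilon> \<delta>" if N: "finite N" for N
  proof -
    obtain L :: nat where L: "\<And>\<sigma>. \<sigma> \<in> N \<Longrightarrow> \<bar>fst \<sigma>\<bar> \<le> int L \<and> \<bar>snd \<sigma>\<bar> \<le> int L"
      using finite_bound [OF N] by blast
    show ?thesis
      unfolding iff
    proof (intro exI [of _ "n + L"] ballI)
      fix \<sigma> assume "\<sigma> \<in> {\<alpha> + \<beta> | \<alpha> \<beta>. \<alpha> \<in> N \<and> \<beta> \<in> T}"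
      then obtain \<alpha> \<beta> where ab: "\<alpha> \<in> N" "\<beta> \<in> T" "\<sigma> = \<alpha> + \<beta>" by blast
      have "- int L \<le> \<epsilon> * fst \<alpha>" "- int L \<le> \<delta> * snd \<alpha>" using L [OF ab(1)] assms by auto
      moreover have "\<epsilon> * fst \<sigma> = \<epsilon> * fst \<alpha> + \<epsilon> * fst \<beta>" "\<delta> * snd \<sigma> = \<delta> * snd \<alpha> + \<delta> * snd \<beta>"
        using ab(3) by (simp_all add: algebra_simps)
      ultimately show "- int (n + L) \<le> \<epsilon> * fst \<sigma> \<and> - int (n + L) \<le> \<delta> * snd \<sigma>"
        using n [OF ab(2)] by linarith
    qed
  qed
qed

lemma zero_support:
  assumes "\<epsilon> = 1 \<or> \<epsilon> = -1" "\<delta> = 1 \<or> \<delta> = -1"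
  shows "{0} \<in> supports_y \<epsilon>" "{0} \<in> supports_x \<epsilon>" "{0} \<in> supports_xy \<epsilon> \<delta>"
  by (auto simp: supports_y_iff [OF assms(1)] supports_x_iff [OF assms(1)] supports_xy_iff [OF assms] zero_prod_def)

section \<open>Half strips along the x-axis\<close>

definition half_strip :: "int \<Rightarrow> int \<Rightarrow> (int \<times> int) set" where
  "half_strip \<epsilon> M = {\<sigma>. \<epsilon> * fst \<sigma> \<le> M \<and> \<bar>snd \<sigma>\<bar> \<le> M}"

text \<open>The half strip runs off to infinity in the direction of x^-e for e =
  \<open>\<epsilon>\<close>. The condition does two things for kernels with these supports: their
  composite is defined, since each degree has finitely many decompositions, and it has finitely many
  degrees in every such half strip.\<close>

definition strip_ok :: "int \<Rightarrow> (int \<times> int) set \<Rightarrow> (int \<times> int) set \<Rightarrow> bool" where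
  "strip_ok \<epsilon> T1 T2 \<longleftrightarrow> (\<forall>M. finite {(\<alpha>, \<beta>). \<alpha> \<in> T1 \<and> \<beta> \<in> T2 \<and> \<alpha> + \<beta> \<in> half_strip \<epsilon> M})"

lemma strip_ok_commute:
  assumes "strip_ok \<epsilon> T1 T2" shows "strip_ok \<epsilon> T2 T1"
  unfolding strip_ok_def
proof
  fix M
  have "{(\<alpha>, \<beta>). \<alpha> \<in> T2 \<and> \<beta> \<in> T1 \<and> \<alpha> + \<beta> \<in> half_strip \<epsilon> M} \<subseteq>
      prod.swap ` {(\<alpha>, \<beta>). \<alpha> \<in> T1 \<and> \<beta> \<in> T2 \<and> \<alpha> + \<beta> \<in> half_strip \<epsilon> M}"
  proof
    fix p assume "p \<in> {(\<alpha>, \<beta>). \<alpha> \<in> T2 \<and> \<beta> \<in> T1 \<and> \<alpha> + \<beta> \<in> half_strip \<epsilon> M}"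
    then have "prod.swap p \<in> {(\<alpha>, \<beta>). \<alpha> \<in> T1 \<and> \<beta> \<in> T2 \<and> \<alpha> + \<beta> \<in> half_strip \<epsilon> M}"
      by (simp add: case_prod_beta add.commute)
    then show "p \<in> prod.swap ` {(\<alpha>, \<beta>). \<alpha> \<in> T1 \<and> \<beta> \<in> T2 \<and> \<alpha> + \<beta> \<in> half_strip \<epsilon> M}"
      by (rule rev_image_eqI) simp
  qed
  then show "finite {(\<alpha>, \<beta>). \<alpha> \<in> T2 \<and> \<beta> \<in> T1 \<and> \<alpha> + \<beta> \<in> half_strip \<epsilon> M}"
    by (rule finite_subset) (use assms in \<open>simp add: strip_ok_def\<close>)
qed

lemma finite_box_pairs:
  fixes P :: "((int \<times> int) \<times> (int \<times> int)) set"
  assumes "\<And>\<alpha> \<beta>. (\<alpha>, \<beta>) \<in> P \<Longrightarrow> \<bar>fst \<alpha>\<bar> \<le> M \<and> \<bar>snd \<alpha>\<bar> \<le> M \<and> \<bar>fst \<beta>\<bar> \<le> M \<and> \<bar>snd \<beta>\<bar> \<le> M"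
  shows "finite P"
proof (rule finite_subset)
  let ?Q = "{\<sigma> :: int \<times> int. \<bar>fst \<sigma>\<bar> \<le> M \<and> \<bar>snd \<sigma>\<bar> \<le> M}"
  show "P \<subseteq> ?Q \<times> ?Q"
  proof
    fix p assume "p \<in> P"
    then show "p \<in> ?Q \<times> ?Q" using assms [of "fst p" "snd p"] by (simp add: mem_Times_iff)
  qed
qed (simp add: finite_box)

text \<open>Both second coordinates are bounded below after the sign \<open>\<delta>\<close>, and
  their sum is bounded, so both are bounded. As \<open>T1\<close> is finite in each row, this bounds
  the first coordinate of \<open>\<alpha>\<close>, and then that of \<open>\<beta>\<close> from
  above; from below it is bounded by the shape of \<open>T2\<close>.\<close>

lemma strip_ok_y_xy:
  assumes e: "\<epsilon> = 1 \<or> \<epsilon> = -1" "\<delta> = 1 \<or> \<delta> = -1"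
    and T1: "T1 \<in> supports_y \<delta>" and T2: "T2 \<in> supports_xy \<epsilon> \<delta>"
  shows "strip_ok \<epsilon> T1 T2"
  unfolding strip_ok_def
proof
  fix M
  obtain n :: nat where n: "\<And>\<sigma>. \<sigma> \<in> T1 \<Longrightarrow> - int n \<le> \<delta> * snd \<sigma>" and fin: "\<And>b. finite {a. (a, b) \<in> T1}"
    using T1 unfolding supports_y_iff [OF e(2)] by blast
  obtain k :: nat where k: "\<And>\<sigma>. \<sigma> \<in> T2 \<Longrightarrow> - int k \<le> \<epsilon> * fst \<sigma> \<and> - int k \<le> \<delta> * snd \<sigma>"
    using T2 unfolding supports_xy_iff [OF e] by blast
  define K where "K = \<bar>M\<bar> + int n + int k"
  have "finite (\<Union>b\<in>{-K..K}. (\<lambda>a. (a, b)) ` {a. (a, b) \<in> T1})"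
    using fin by blast
  then obtain L :: nat where L: "\<And>\<sigma>. \<sigma> \<in> (\<Union>b\<in>{-K..K}. (\<lambda>a. (a, b)) ` {a. (a, b) \<in> T1}) \<Longrightarrow>
      \<bar>fst \<sigma>\<bar> \<le> int L \<and> \<bar>snd \<sigma>\<bar> \<le> int L"
    using finite_bound by blast
  show "finite {(\<alpha>, \<beta>). \<alpha> \<in> T1 \<and> \<beta> \<in> T2 \<and> \<alpha> + \<beta> \<in> half_strip \<epsilon> M}"
  proof (rule finite_box_pairs)
    fix \<alpha> \<beta> assume "(\<alpha>, \<beta>) \<in> {(\<alpha>, \<beta>). \<alpha> \<in> T1 \<and> \<beta> \<in> T2 \<and> \<alpha> + \<beta> \<in> half_strip \<epsilon> M}"
    then have ab: "\<alpha> \<in> T1" "\<beta> \<in> T2" "\<epsilon> * (fst \<alpha> + fst \<beta>) \<le> M" "\<bar>snd \<alpha> + snd \<beta>\<bar> \<le> M"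
      by (simp_all add: half_strip_def)
    have s: "\<bar>snd \<alpha>\<bar> \<le> K" "\<bar>snd \<beta>\<bar> \<le> K"
      using n [OF ab(1)] k [OF ab(2)] ab(4) e unfolding K_def by (auto simp: abs_le_iff)
    then have "\<alpha> \<in> (\<Union>b\<in>{-K..K}. (\<lambda>a. (a, b)) ` {a. (a, b) \<in> T1})"
      using ab(1) by (intro UN_I [of "snd \<alpha>"] image_eqI [of _ _ "fst \<alpha>"]) auto
    then have "\<bar>fst \<alpha>\<bar> \<le> int L" using L by blast
    moreover have "\<bar>fst \<beta>\<bar> \<le> K + \<bar>fst \<alpha>\<bar>"
      using k [OF ab(2)] ab(3) e unfolding K_def by (auto simp: abs_le_iff algebra_simps)
    ultimately show "\<bar>fst \<alpha>\<bar> \<le> K + int L \<and> \<bar>snd \<alpha>\<bar> \<le> K + int L \<and> \<bar>fst \<beta>\<bar> \<le> K + int L \<and> \<bar>snd \<beta>\<bar> \<le> K + int L"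
      using s by linarith
  qed
qed

text \<open>Here the first coordinates are bounded at once: each from below after the sign
  \<open>\<epsilon>\<close>, and their sum from above. As \<open>T1\<close> is finite in each
  column, the second coordinate of \<open>\<alpha>\<close> is bounded; the width of the strip then
  bounds that of \<open>\<beta>\<close>.\<close>

lemma strip_ok_x_xy:
  assumes e: "\<epsilon> = 1 \<or> \<epsilon> = -1" "\<delta> = 1 \<or> \<delta> = -1"
    and T1: "T1 \<in> supports_x \<epsilon>" and T2: "T2 \<in> supports_xy \<epsilon> \<delta>"
  shows "strip_ok \<epsilon> T1 T2"
  unfolding strip_ok_def
proof
  fix M
  obtain n :: nat where n: "\<And>\<sigma>. \<sigma> \<in> T1 \<Longrightarrow> - int n \<le> \<epsilon> * fst \<sigma>" and fin: "\<And>a. finite {b. (a, b) \<in> T1}"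
    using T1 unfolding supports_x_iff [OF e(1)] by blast
  obtain k :: nat where k: "\<And>\<sigma>. \<sigma> \<in> T2 \<Longrightarrow> - int k \<le> \<epsilon> * fst \<sigma> \<and> - int k \<le> \<delta> * snd \<sigma>"
    using T2 unfolding supports_xy_iff [OF e] by blast
  define K where "K = \<bar>M\<bar> + int n + int k"
  have "finite (\<Union>a\<in>{-K..K}. (\<lambda>b. (a, b)) ` {b. (a, b) \<in> T1})"
    using fin by blast
  then obtain L :: nat where L: "\<And>\<sigma>. \<sigma> \<in> (\<Union>a\<in>{-K..K}. (\<lambda>b. (a, b)) ` {b. (a, b) \<in> T1}) \<Longrightarrow>
      \<bar>fst \<sigma>\<bar> \<le> int L \<and> \<bar>snd \<sigma>\<bar> \<le> int L"
    using finite_bound by blast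
  show "finite {(\<alpha>, \<beta>). \<alpha> \<in> T1 \<and> \<beta> \<in> T2 \<and> \<alpha> + \<beta> \<in> half_strip \<epsilon> M}"
  proof (rule finite_box_pairs)
    fix \<alpha> \<beta> assume "(\<alpha>, \<beta>) \<in> {(\<alpha>, \<beta>). \<alpha> \<in> T1 \<and> \<beta> \<in> T2 \<and> \<alpha> + \<beta> \<in> half_strip \<epsilon> M}"
    then have ab: "\<alpha> \<in> T1" "\<beta> \<in> T2" "\<epsilon> * (fst \<alpha> + fst \<beta>) \<le> M" "\<bar>snd \<alpha> + snd \<beta>\<bar> \<le> M"
      by (simp_all add: half_strip_def)
    have s: "\<bar>fst \<alpha>\<bar> \<le> K" "\<bar>fst \<beta>\<bar> \<le> K"
      using n [OF ab(1)] k [OF ab(2)] ab(3) e unfolding K_def by (auto simp: abs_le_iff algebra_simps)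
    then have "\<alpha> \<in> (\<Union>a\<in>{-K..K}. (\<lambda>b. (a, b)) ` {b. (a, b) \<in> T1})"
      using ab(1) by (intro UN_I [of "fst \<alpha>"] image_eqI [of _ _ "snd \<alpha>"]) auto
    then have "\<bar>snd \<alpha>\<bar> \<le> int L" using L by blast
    moreover have "\<bar>snd \<beta>\<bar> \<le> K + \<bar>snd \<alpha>\<bar>"
      using ab(4) unfolding K_def by linarith
    ultimately show "\<bar>fst \<alpha>\<bar> \<le> K + int L \<and> \<bar>snd \<alpha>\<bar> \<le> K + int L \<and> \<bar>fst \<beta>\<bar> \<le> K + int L \<and> \<bar>snd \<beta>\<bar> \<le> K + int L"
      using s by linarith
  qed
qed

subsection \<open>Gluing contractions along two cuts\<close>

text \<open>The library sets up the method \<open>algebra\<close> for rings only.\<close>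

lemmas (in abelian_group) abelian_group_simprules
  [algebra abelian_group "zero G" "add G" "a_inv G" "a_minus G"] =
  a_closed zero_closed a_inv_closed minus_closed a_assoc l_zero l_neg a_comm minus_eq
  r_zero r_neg r_neg2 r_neg1 minus_add minus_minus a_lcomm

text \<open>Here \<open>p\<close> and \<open>q\<close> play the role of projections onto half planes: \<open>a1\<close>, \<open>a2\<close> are the values
  of two contractions, \<open>t1\<close>, \<open>t2\<close> those of two homotopies between them, and primes denote the values
  on the boundary of \<open>c\<close>. The commutators of \<open>p\<close> and \<open>q\<close> with \<open>D\<close> are supported near the two
  cutting lines, so that the error term lives near their intersection.\<close>

lemma (in abelian_group) glue_identity:
  assumes D: "D \<in> carrier G \<rightarrow> carrier G" "\<And>x y. x \<in> carrier G \<Longrightarrow> y \<in> carrier G \<Longrightarrow> D (x \<oplus> y) = D x \<oplus> D y"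
    and p: "p \<in> carrier G \<rightarrow> carrier G" "\<And>x y. x \<in> carrier G \<Longrightarrow> y \<in> carrier G \<Longrightarrow> p (x \<oplus> y) = p x \<oplus> p y"
    and q: "q \<in> carrier G \<rightarrow> carrier G" "\<And>x y. x \<in> carrier G \<Longrightarrow> y \<in> carrier G \<Longrightarrow> q (x \<oplus> y) = q x \<oplus> q y"
    and a: "a1 \<in> carrier G" "a2 \<in> carrier G" "a1' \<in> carrier G" "a2' \<in> carrier G"
    and t: "t1 \<in> carrier G" "t2 \<in> carrier G" "t1' \<in> carrier G" "t2' \<in> carrier G" and c: "c \<in> carrier G"
    and DD: "\<And>x. x \<in> {p (q t1 \<oplus> (t2 \<ominus> q t2)), q t1 \<oplus> (t2 \<ominus> q t2)} \<Longrightarrow> D (D x) = \<zero>"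
    and h1: "D a1 \<oplus> a1' = c" and h2: "D a2 \<oplus> a2' = c"
    and h3: "D t1 \<ominus> t1' = a2 \<ominus> a1" and h4: "D t2 \<ominus> t2' = a2 \<ominus> a1"
    and A: "\<And>x. A x = D (p x) \<ominus> p (D x)" and Q: "\<And>x. Q x = D (q x) \<ominus> q (D x)"
    and H: "\<And>a1 a2 t1 t2. H a1 a2 t1 t2 = p a1 \<oplus> (a2 \<ominus> p a2) \<ominus> A (q t1 \<oplus> (t2 \<ominus> q t2))"
  shows "D (H a1 a2 t1 t2) \<oplus> H a1' a2' t1' t2' = c \<oplus> A (Q (t1 \<ominus> t2))"
proof -
  have cl: "D x \<in> carrier G" "p x \<in> carrier G" "q x \<in> carrier G" if "x \<in> carrier G" for x
    using D(1) p(1) q(1) that by auto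
  note Dh = additive_finsum [OF abelian_group_axioms abelian_group_axioms D(1) D(2)]
  note ph = additive_finsum [OF abelian_group_axioms abelian_group_axioms p(1) p(2)]
  note qh = additive_finsum [OF abelian_group_axioms abelian_group_axioms q(1) q(2)]
  have Dm: "D (x \<ominus> y) = D x \<ominus> D y" "p (x \<ominus> y) = p x \<ominus> p y" "q (x \<ominus> y) = q x \<ominus> q y"
    if "x \<in> carrier G" "y \<in> carrier G" for x y
    using Dh(4) ph(4) qh(4) that by auto
  have Acl: "A x \<in> carrier G" if "x \<in> carrier G" for x using that cl by (simp add: A)
  have Aadd: "A (x \<oplus> y) = A x \<oplus> A y" if "x \<in> carrier G" "y \<in> carrier G" for x y
  proof -
    have "A (x \<oplus> y) = (D (p x) \<oplus> D (p y)) \<ominus> (p (D x) \<oplus> p (D y))"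
      using that cl by (simp add: A D(2) p(2))
    then show ?thesis
      unfolding A using cl(1) [OF cl(2) [OF that(1)]] cl(1) [OF cl(2) [OF that(2)]]
        cl(2) [OF cl(1) [OF that(1)]] cl(2) [OF cl(1) [OF that(2)]] by algebra
  qed
  have "A \<in> carrier G \<rightarrow> carrier G" using Acl by auto
  note Ah = additive_finsum [OF abelian_group_axioms abelian_group_axioms this Aadd]
  have Am: "A (x \<ominus> y) = A x \<ominus> A y" if "x \<in> carrier G" "y \<in> carrier G" for x y
    using Ah(4) that by auto
  define u where "u = q t1 \<oplus> (t2 \<ominus> q t2)"
  define u' where "u' = q t1' \<oplus> (t2' \<ominus> q t2')"
  have ucl: "u \<in> carrier G" "u' \<in> carrier G" using t cl by (simp_all add: u_def u'_def)
  have Dt: "D t1 = t1' \<oplus> (a2 \<ominus> a1)" "D t2 = t2' \<oplus> (a2 \<ominus> a1)"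
  proof -
    have "D t1 = t1' \<oplus> (D t1 \<ominus> t1')" "D t2 = t2' \<oplus> (D t2 \<ominus> t2')"
      using cl t by algebra+
    then show "D t1 = t1' \<oplus> (a2 \<ominus> a1)" "D t2 = t2' \<oplus> (a2 \<ominus> a1)"
      unfolding h3 h4 .
  qed
  \<comment> \<open>\<open>A\<close> is the commutator of D and p. Since D squares to zero on
    \<open>u\<close> and on \<open>p u\<close>, it anticommutes with D on \<open>u\<close>.\<close>
  have DA: "D (A u) = \<ominus> A (D u)"
  proof -
    have 1: "D (D (p u)) = \<zero>" "D (D u) = \<zero>" using DD by (simp_all add: u_def)
    have p0: "p \<zero> = \<zero>" by (rule ph(1))
    have "D (A u) = \<zero> \<ominus> D (p (D u))" unfolding A using Dm(1) cl ucl 1 by simp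
    moreover have "A (D u) = D (p (D u)) \<ominus> \<zero>" unfolding A using 1 p0 by simp
    moreover have "\<ominus> \<zero> = \<zero>" using minus_equality [of \<zero> \<zero>] by simp
    ultimately show ?thesis using cl ucl by (simp add: a_minus_def)
  qed
  \<comment> \<open>\<open>u\<close> interpolates by q between two homotopies with the same ends.
    Its defect is that common difference \<open>a2 \<ominus> a1\<close>, corrected by the commutator
    of D and q applied to \<open>t1 \<ominus> t2\<close>.\<close>
  have Du: "D u = u' \<oplus> (a2 \<ominus> a1) \<oplus> Q (t1 \<ominus> t2)"
  proof -
    have "Q (t1 \<ominus> t2) = (D (q t1) \<ominus> D (q t2)) \<ominus> (q (D t1) \<ominus> q (D t2))"
      unfolding Q using Dm t cl by simp
    also have "q (D t1) = q t1' \<oplus> (q a2 \<ominus> q a1)"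
      unfolding Dt using q(2) Dm(3) t a by simp
    also have "q (D t2) = q t2' \<oplus> (q a2 \<ominus> q a1)"
      unfolding Dt using q(2) Dm(3) t a by simp
    finally have Qe: "Q (t1 \<ominus> t2) = (D (q t1) \<ominus> D (q t2)) \<ominus> (q t1' \<oplus> (q a2 \<ominus> q a1) \<ominus> (q t2' \<oplus> (q a2 \<ominus> q a1)))" .
    have "D u = D (q t1) \<oplus> (t2' \<oplus> (a2 \<ominus> a1) \<ominus> D (q t2))"
      unfolding u_def using D(2) Dm(1) cl t Dt by simp
    then show ?thesis
      unfolding Qe u'_def using t a cl(2,3) cl(1) [OF cl(3) [OF t(1)]] cl(1) [OF cl(3) [OF t(2)]]
        cl(3) [OF t(1)] cl(3) [OF t(2)] cl(3) [OF t(3)] cl(3) [OF t(4)] cl(3) [OF a(1)] cl(3) [OF a(2)]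
      by algebra
  qed
  have Qcl: "Q (t1 \<ominus> t2) \<in> carrier G" using cl t by (simp add: Q)
  have Da: "D a1 = c \<ominus> a1'" "D a2 = c \<ominus> a2'"
  proof -
    have "D a1 = D a1 \<oplus> a1' \<ominus> a1'" "D a2 = D a2 \<oplus> a2' \<ominus> a2'"
      using cl a by algebra+
    then show "D a1 = c \<ominus> a1'" "D a2 = c \<ominus> a2'" unfolding h1 h2 .
  qed
  \<comment> \<open>The anticommutation turns the correction term into A (D u). Its part A (a2 - a1)
    then cancels the defect caused by cutting \<open>a1\<close> and \<open>a2\<close> along
    p.\<close>
  have "D (H a1 a2 t1 t2) = D (p a1) \<oplus> (D a2 \<ominus> D (p a2)) \<oplus> A (D u)"
  proof -
    have "D (H a1 a2 t1 t2) = D (p a1) \<oplus> (D a2 \<ominus> D (p a2)) \<ominus> D (A u)"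
      unfolding H u_def [symmetric] using D(2) Dm(1) cl a Acl ucl by simp
    then show ?thesis using DA cl ucl Acl by (simp add: a_minus_def)
  qed
  also have "A (D u) = A u' \<oplus> (A a2 \<ominus> A a1) \<oplus> A (Q (t1 \<ominus> t2))"
    unfolding Du using Aadd Am ucl a Qcl by simp
  also have "A a1 = D (p a1) \<ominus> (p c \<ominus> p a1')"
    unfolding A Da using Dm(2) c a by simp
  also have "A a2 = D (p a2) \<ominus> (p c \<ominus> p a2')"
    unfolding A Da using Dm(2) c a by simp
  finally have DH: "D (H a1 a2 t1 t2) = D (p a1) \<oplus> (c \<ominus> a2' \<ominus> D (p a2)) \<oplus>
      (A u' \<oplus> (D (p a2) \<ominus> (p c \<ominus> p a2') \<ominus> (D (p a1) \<ominus> (p c \<ominus> p a1'))) \<oplus> A (Q (t1 \<ominus> t2)))"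
    unfolding Da(2) .
  have H': "H a1' a2' t1' t2' = p a1' \<oplus> (a2' \<ominus> p a2') \<ominus> A u'"
    unfolding H u'_def ..
  show ?thesis
    unfolding DH H' using a c Acl [OF ucl(2)] Acl [OF Qcl] cl(2) [OF a(1)] cl(2) [OF a(2)] cl(2) [OF a(3)]
      cl(2) [OF a(4)] cl(2) [OF c] cl(1) [OF cl(2) [OF a(1)]] cl(1) [OF cl(2) [OF a(2)]]
    by algebra
qed

definition restr ::
    "('a, 'm) ring_scheme \<Rightarrow> (int \<times> int) set \<Rightarrow> ('j \<times> (int \<times> int) \<Rightarrow> 'a) \<Rightarrow> 'j \<times> (int \<times> int) \<Rightarrow> 'a" where
  "restr R P z i = (if snd i \<in> P then z i else \<zero>\<^bsub>R\<^esub>)"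

section \<open>R_0-linear maps on coordinate families, and products of contractions\<close>

context based_complex
begin

text \<open>By \<open>vec_tot\<close> these are exactly the coordinate families of elements of
  \<open>C n\<close>.\<close>

definition finite_hvec_at :: "int \<Rightarrow> ((int \<times> 'b) \<times> (int \<times> int) \<Rightarrow> 'a) \<Rightarrow> bool" where
  "finite_hvec_at n z \<longleftrightarrow> hvec_at n z \<and> finite (degs z)"

text \<open>Linearity is over R_0 only, because \<open>restr\<close> does not respect multiplication
  by elements of nonzero degree. Arguments have finite support but values need not: the contractions
  have infinitely many degrees.\<close>

definition klin where
  "klin k F \<longleftrightarrow> (\<forall>n z. finite_hvec_at n z \<longrightarrow> hvec_at (n + k) (F z) \<and>
     (\<forall>a\<in>Rg 0. F (\<lambda>i. z i \<otimes> a) = (\<lambda>i. F z i \<otimes> a)) \<and>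
     (\<forall>w. finite_hvec_at n w \<longrightarrow> F (\<lambda>i. z i \<oplus> w i) = (\<lambda>i. F z i \<oplus> F w i)))"

lemma klinD:
  assumes "klin k F" "finite_hvec_at n z"
  shows "hvec_at (n + k) (F z)" "a \<in> Rg 0 \<Longrightarrow> F (\<lambda>i. z i \<otimes> a) = (\<lambda>i. F z i \<otimes> a)"
    "finite_hvec_at n w \<Longrightarrow> F (\<lambda>i. z i \<oplus> w i) = (\<lambda>i. F z i \<oplus> F w i)"
  using assms unfolding klin_def by blast+

lemma klin_closed: "klin k F \<Longrightarrow> finite_hvec_at n z \<Longrightarrow> F z i \<in> carrier R"
  using klinD(1) hvec_carrier by blast

lemma klin_mv_comp:
  assumes g: "kernel_on J T g" "has_degree R l g" and F: "klin k F"
    and ok: "\<And>n z. finite_hvec_at n z \<Longrightarrow> loc_finite T (F z)"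
  shows "klin (k + l) (\<lambda>z. mv R (tker g) (F z))"
  unfolding klin_def
proof (intro allI impI conjI ballI)
  fix n z assume z: "finite_hvec_at n z"
  note Fz = klinD(1) [OF F z]
  show "hvec_at (n + (k + l)) (mv R (tker g) (F z))"
    using hvec_at_mv [OF g Fz] by (simp add: add.assoc)
  show "mv R (tker g) (F (\<lambda>i. z i \<otimes> a)) = (\<lambda>i. mv R (tker g) (F z) i \<otimes> a)" if a: "a \<in> Rg 0" for a
  proof
    fix i
    show "mv R (tker g) (F (\<lambda>i. z i \<otimes> a)) i = mv R (tker g) (F z) i \<otimes> a"
      unfolding klinD(2) [OF F z a]
      by (rule mv_rmult) (simp_all add: tker_carrier [OF g(1)] hvec_carrier [OF Fz] Rg_carrier [OF a]
          row_finite [OF g(1) ok [OF z]])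
  qed
  show "mv R (tker g) (F (\<lambda>i. z i \<oplus> w i)) = (\<lambda>i. mv R (tker g) (F z) i \<oplus> mv R (tker g) (F w) i)"
    if w: "finite_hvec_at n w" for w
  proof
    fix i
    show "mv R (tker g) (F (\<lambda>i. z i \<oplus> w i)) i = mv R (tker g) (F z) i \<oplus> mv R (tker g) (F w) i"
      unfolding klinD(3) [OF F z w]
      by (rule mv_add) (simp_all add: tker_carrier [OF g(1)] hvec_carrier [OF Fz]
          hvec_carrier [OF klinD(1) [OF F w]] row_finite [OF g(1) ok [OF z]] row_finite [OF g(1) ok [OF w]])
  qed
qed

lemma klin_id: "klin 0 (\<lambda>z. z)"
  by (simp add: klin_def finite_hvec_at_def)

lemma klin_mv:
  assumes "kernel_on J T g" "has_degree R l g" shows "klin l (mv R (tker g))"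
  using klin_mv_comp [OF assms klin_id loc_finite_finite_degs] by (simp add: finite_hvec_at_def)

lemma klin_D: "klin k F \<Longrightarrow> klin (k - 1) (\<lambda>z. Dm (F z))"
proof -
  assume F: "klin k F"
  obtain N where N: "finite N" "kernel_on J N Dk" "has_degree R (-1) Dk" by (rule D_row)
  show ?thesis
    using klin_mv_comp [OF N(2,3) F loc_finite_finite [OF N(1)]] by simp
qed

lemma klin_add:
  assumes F: "klin k F" and G: "klin k G"
  shows "klin k (\<lambda>z i. F z i \<oplus> G z i)"
  unfolding klin_def
proof (intro allI impI conjI ballI)
  fix n z assume z: "finite_hvec_at n z"
  note c = klin_closed [OF F] klin_closed [OF G]
  show "hvec_at (n + k) (\<lambda>i. F z i \<oplus> G z i)"
    by (rule hvec_add [OF klinD(1) [OF F z] klinD(1) [OF G z]])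
  show "(\<lambda>i. F (\<lambda>i. z i \<otimes> a) i \<oplus> G (\<lambda>i. z i \<otimes> a) i) = (\<lambda>i. (F z i \<oplus> G z i) \<otimes> a)" if a: "a \<in> Rg 0" for a
    unfolding klinD(2) [OF F z a] klinD(2) [OF G z a] using c [OF z] Rg_carrier [OF a] by (simp add: l_distr)
  show "(\<lambda>i. F (\<lambda>i. z i \<oplus> w i) i \<oplus> G (\<lambda>i. z i \<oplus> w i) i) = (\<lambda>i. F z i \<oplus> G z i \<oplus> (F w i \<oplus> G w i))" if w: "finite_hvec_at n w" for w
    unfolding klinD(3) [OF F z w] klinD(3) [OF G z w] using c [OF z] c [OF w] by (simp add: a_ac)
qed

lemma klin_minus:
  assumes F: "klin k F"
  shows "klin k (\<lambda>z i. \<ominus> F z i)"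
  unfolding klin_def
proof (intro allI impI conjI ballI)
  fix n z assume z: "finite_hvec_at n z"
  note c = klin_closed [OF F]
  show "hvec_at (n + k) (\<lambda>i. \<ominus> F z i)"
    by (rule hvec_minus [OF klinD(1) [OF F z]])
  show "(\<lambda>i. \<ominus> F (\<lambda>i. z i \<otimes> a) i) = (\<lambda>i. \<ominus> F z i \<otimes> a)" if a: "a \<in> Rg 0" for a
    unfolding klinD(2) [OF F z a] using c [OF z] Rg_carrier [OF a] by (simp add: l_minus)
  show "(\<lambda>i. \<ominus> F (\<lambda>i. z i \<oplus> w i) i) = (\<lambda>i. \<ominus> F z i \<oplus> \<ominus> F w i)" if w: "finite_hvec_at n w" for w
    unfolding klinD(3) [OF F z w] using c [OF z] c [OF w] by (simp add: minus_add)
qed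

lemma klin_diff:
  assumes "klin k F" "klin k G"
  shows "klin k (\<lambda>z i. F z i \<ominus> G z i)"
  using klin_add [OF assms(1) klin_minus [OF assms(2)]] by (simp add: a_minus_def)

lemma hvec_restr: "hvec X z \<Longrightarrow> hvec X (restr R P z)"
  by (simp add: hvec_def restr_def)

lemma klin_restr:
  assumes F: "klin k F"
  shows "klin k (\<lambda>z. restr R P (F z))"
  unfolding klin_def
proof (intro allI impI conjI ballI)
  fix n z assume z: "finite_hvec_at n z"
  show "hvec_at (n + k) (restr R P (F z))"
    by (rule hvec_restr [OF klinD(1) [OF F z]])
  show "restr R P (F (\<lambda>i. z i \<otimes> a)) = (\<lambda>i. restr R P (F z) i \<otimes> a)" if a: "a \<in> Rg 0" for a
    unfolding klinD(2) [OF F z a] using Rg_carrier [OF a] by (simp add: restr_def fun_eq_iff)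
  show "restr R P (F (\<lambda>i. z i \<oplus> w i)) = (\<lambda>i. restr R P (F z) i \<oplus> restr R P (F w) i)" if w: "finite_hvec_at n w" for w
    unfolding klinD(3) [OF F z w] by (simp add: restr_def fun_eq_iff)
qed

lemma half_strip_translate:
  assumes e: "\<epsilon> = 1 \<or> \<epsilon> = -1" and "\<sigma> \<in> half_strip \<epsilon> M"
  shows "\<sigma> - \<kappa> \<in> half_strip \<epsilon> (M + \<bar>fst \<kappa>\<bar> + \<bar>snd \<kappa>\<bar>)"
proof -
  have "\<epsilon> * fst \<sigma> \<le> M" "\<bar>snd \<sigma>\<bar> \<le> M" using assms(2) by (simp_all add: half_strip_def)
  moreover have "\<epsilon> * fst (\<sigma> - \<kappa>) \<le> \<epsilon> * fst \<sigma> + \<bar>fst \<kappa>\<bar>" using e by auto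
  moreover have "\<bar>snd (\<sigma> - \<kappa>)\<bar> \<le> \<bar>snd \<sigma>\<bar> + \<bar>snd \<kappa>\<bar>" by simp
  ultimately show ?thesis unfolding half_strip_def by (simp only: mem_Collect_eq) linarith
qed

lemma strip_ok_fibre:
  assumes "strip_ok \<epsilon> T1 T2" and e: "\<epsilon> = 1 \<or> \<epsilon> = -1"
  shows "finite {(\<alpha>, \<beta>). \<alpha> \<in> T1 \<and> \<beta> \<in> T2 \<and> \<alpha> + \<beta> = \<sigma>}"
proof (rule finite_subset)
  let ?M = "\<bar>fst \<sigma>\<bar> + \<bar>snd \<sigma>\<bar>"
  have "\<sigma> \<in> half_strip \<epsilon> ?M" using e by (auto simp: half_strip_def)
  then show "{(\<alpha>, \<beta>). \<alpha> \<in> T1 \<and> \<beta> \<in> T2 \<and> \<alpha> + \<beta> = \<sigma>} \<subseteq>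
      {(\<alpha>, \<beta>). \<alpha> \<in> T1 \<and> \<beta> \<in> T2 \<and> \<alpha> + \<beta> \<in> half_strip \<epsilon> ?M}" by blast
  show "finite {(\<alpha>, \<beta>). \<alpha> \<in> T1 \<and> \<beta> \<in> T2 \<and> \<alpha> + \<beta> \<in> half_strip \<epsilon> ?M}"
    using assms(1) by (simp add: strip_ok_def)
qed

text \<open>Makes a kernel on \<open>T1\<close> applicable to the result of a kernel on
  \<open>T2\<close>: the ways to reach \<open>\<sigma>\<close> from a degree \<open>\<kappa>\<close>
  of \<open>z\<close> are the decompositions of \<open>\<sigma> - \<kappa>\<close>.\<close>

lemma loc_finite_strip:
  assumes s: "strip_ok \<epsilon> T1 T2" and e: "\<epsilon> = 1 \<or> \<epsilon> = -1"
    and g: "kernel_on J T2 g" and z: "hvec J z" "finite (degs z)"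
  shows "loc_finite T1 (mv R (tker g) z)"
  unfolding loc_finite_def
proof
  fix \<sigma>
  let ?P = "\<lambda>\<kappa>. {(\<alpha>, \<beta>). \<alpha> \<in> T1 \<and> \<beta> \<in> T2 \<and> \<alpha> + \<beta> = \<sigma> - \<kappa>}"
  have "{\<kappa> \<in> degs (mv R (tker g) z). \<sigma> - \<kappa> \<in> T1} \<subseteq> (\<Union>\<kappa>\<in>degs z. (\<lambda>p. \<kappa> + snd p) ` ?P \<kappa>)"
  proof
    fix \<mu> assume "\<mu> \<in> {\<kappa> \<in> degs (mv R (tker g) z). \<sigma> - \<kappa> \<in> T1}"
    then have \<mu>: "\<mu> \<in> degs (mv R (tker g) z)" "\<sigma> - \<mu> \<in> T1" by auto
    obtain \<kappa> where \<kappa>: "\<kappa> \<in> degs z" "\<mu> - \<kappa> \<in> T2" using degs_mv [OF g z(1) \<mu>(1)] .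
    have "(\<sigma> - \<mu>, \<mu> - \<kappa>) \<in> ?P \<kappa>" using \<mu> \<kappa> by simp
    then have "\<mu> \<in> (\<lambda>p. \<kappa> + snd p) ` ?P \<kappa>" by (rule rev_image_eqI) simp
    then show "\<mu> \<in> (\<Union>\<kappa>\<in>degs z. (\<lambda>p. \<kappa> + snd p) ` ?P \<kappa>)" using \<kappa>(1) by blast
  qed
  then show "finite {\<kappa> \<in> degs (mv R (tker g) z). \<sigma> - \<kappa> \<in> T1}"
    by (rule finite_subset) (intro finite_UN_I z(2) finite_imageI strip_ok_fibre [OF s e])
qed

text \<open>Subtracting a degree of \<open>z\<close> from a point of the half strip leads to a
  somewhat larger half strip, for which \<open>strip_ok\<close> gives finiteness; \<open>z\<close>
  has only finitely many degrees.\<close>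

lemma strip_finite:
  assumes s: "strip_ok \<epsilon> T1 T2" and e: "\<epsilon> = 1 \<or> \<epsilon> = -1"
    and g: "kernel_on J T1 g1" "kernel_on J T2 g2" and z: "hvec J z" "finite (degs z)"
  shows "finite (degs (mv R (tker g1) (mv R (tker g2) z)) \<inter> half_strip \<epsilon> M)"
proof -
  let ?P = "\<lambda>\<kappa>. {(\<alpha>, \<beta>). \<alpha> \<in> T1 \<and> \<beta> \<in> T2 \<and> \<alpha> + \<beta> \<in> half_strip \<epsilon> (M + \<bar>fst \<kappa>\<bar> + \<bar>snd \<kappa>\<bar>)}"
  have "degs (mv R (tker g1) (mv R (tker g2) z)) \<inter> half_strip \<epsilon> M \<subseteq> (\<Union>\<kappa>\<in>degs z. (\<lambda>p. fst p + snd p + \<kappa>) ` ?P \<kappa>)"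
  proof
    fix \<sigma> assume "\<sigma> \<in> degs (mv R (tker g1) (mv R (tker g2) z)) \<inter> half_strip \<epsilon> M"
    then have \<sigma>: "\<sigma> \<in> degs (mv R (tker g1) (mv R (tker g2) z))" "\<sigma> \<in> half_strip \<epsilon> M" by auto
    obtain \<mu> where \<mu>: "\<mu> \<in> degs (mv R (tker g2) z)" "\<sigma> - \<mu> \<in> T1"
      using degs_mv [OF g(1) hvec_mv [OF g(2) z(1)] \<sigma>(1)] .
    obtain \<kappa> where \<kappa>: "\<kappa> \<in> degs z" "\<mu> - \<kappa> \<in> T2" using degs_mv [OF g(2) z(1) \<mu>(1)] .
    have "(\<sigma> - \<mu>, \<mu> - \<kappa>) \<in> ?P \<kappa>"
      using \<mu> \<kappa> half_strip_translate [OF e \<sigma>(2), of \<kappa>] by simp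
    then have "\<sigma> \<in> (\<lambda>p. fst p + snd p + \<kappa>) ` ?P \<kappa>" by (rule rev_image_eqI) simp
    then show "\<sigma> \<in> (\<Union>\<kappa>\<in>degs z. (\<lambda>p. fst p + snd p + \<kappa>) ` ?P \<kappa>)" using \<kappa>(1) by blast
  qed
  moreover have "finite (?P \<kappa>)" for \<kappa> using s by (simp add: strip_ok_def)
  ultimately show ?thesis
    using z(2) by (elim finite_subset) blast
qed

text \<open>Two contractions of the same complex are homotopic through their product: D g1 g2 z = g2
  z - g1 D g2 z by the first contraction, and D g2 z = z - g2 D z by the second.\<close>

lemma contraction_product:
  assumes g: "contraction T1 g1" "contraction T2 g2"
    and s: "strip_ok \<epsilon> T1 T2" and e: "\<epsilon> = 1 \<or> \<epsilon> = -1" and z: "hvec J z" "finite (degs z)"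
  shows "Dm (mv R (tker g1) (mv R (tker g2) z)) i \<ominus> mv R (tker g1) (mv R (tker g2) (Dm z)) i
    = mv R (tker g2) z i \<ominus> mv R (tker g1) z i"
proof -
  obtain N where N: "finite N" "kernel_on J N Dk" "has_degree R (-1) Dk" by (rule D_row)
  have t: "kernel_on J T1 g1" "kernel_on J T2 g2" using g by (simp_all add: contraction_def)
  let ?w = "mv R (tker g2) z" and ?v = "mv R (tker g2) (Dm z)"
  have Dz: "hvec J (Dm z)" by (rule hvec_mv [OF N(2) z(1)])
  have fDz: "finite (degs (Dm z))"
  proof (rule finite_subset)
    show "degs (Dm z) \<subseteq> (\<lambda>(\<alpha>, \<beta>). \<alpha> + \<beta>) ` (N \<times> degs z)"
    proof
      fix \<sigma> assume "\<sigma> \<in> degs (Dm z)"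
      then obtain \<kappa> where "\<kappa> \<in> degs z" "\<sigma> - \<kappa> \<in> N" using degs_mv [OF N(2) z(1)] by blast
      then show "\<sigma> \<in> (\<lambda>(\<alpha>, \<beta>). \<alpha> + \<beta>) ` (N \<times> degs z)"
        by (intro image_eqI [of _ _ "(\<sigma> - \<kappa>, \<kappa>)"]) auto
    qed
  qed (use N z in blast)
  have w: "hvec J ?w" "loc_finite T1 ?w" by (rule hvec_mv [OF t(2) z(1)], rule loc_finite_strip [OF s e t(2) z])
  have v: "hvec J ?v" "loc_finite T1 ?v" by (rule hvec_mv [OF t(2) Dz], rule loc_finite_strip [OF s e t(2) Dz fDz])
  have "Dm ?w i \<oplus> ?v i = z i" for i
    by (rule contraction_apply [OF g(2) z(1) loc_finite_finite_degs [OF z(2)]])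
  then have zw: "z = (\<lambda>i. Dm ?w i \<oplus> ?v i)" by simp
  have Dw: "hvec J (Dm ?w)" by (rule hvec_mv [OF N(2) w(1)])
  \<comment> \<open>The support of \<open>Dm ?w\<close> may be infinite, but its degrees occur in
    \<open>z\<close> or in \<open>?v\<close>, and for these two local finiteness is known.\<close>
  have okDw: "loc_finite T1 (Dm ?w)"
    unfolding loc_finite_def
  proof
    fix \<sigma>
    have "degs (Dm ?w) \<subseteq> degs z \<union> degs ?v"
    proof
      fix \<sigma> assume "\<sigma> \<in> degs (Dm ?w)"
      then obtain j where j: "Dm ?w (j, \<sigma>) \<noteq> \<zero>" by (rule degsE)
      have "z (j, \<sigma>) \<noteq> \<zero> \<or> ?v (j, \<sigma>) \<noteq> \<zero>"
        using fun_cong [OF zw, of "(j, \<sigma>)"] j hvec_carrier [OF Dw, of "(j, \<sigma>)"] by auto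
      then show "\<sigma> \<in> degs z \<union> degs ?v" using degsI [of z "(j, \<sigma>)"] degsI [of ?v "(j, \<sigma>)"] by auto
    qed
    then have "{\<kappa> \<in> degs (Dm ?w). \<sigma> - \<kappa> \<in> T1} \<subseteq> {\<kappa> \<in> degs z. \<sigma> - \<kappa> \<in> T1} \<union> {\<kappa> \<in> degs ?v. \<sigma> - \<kappa> \<in> T1}" by blast
    then show "finite {\<kappa> \<in> degs (Dm ?w). \<sigma> - \<kappa> \<in> T1}"
      by (rule finite_subset) (use z(2) loc_finiteD [OF v(2)] in simp)
  qed
  have 1: "mv R (tker g1) z i = mv R (tker g1) (Dm ?w) i \<oplus> mv R (tker g1) ?v i"
    by (subst zw, rule mv_add) (simp_all add: tker_carrier [OF t(1)] hvec_carrier [OF Dw] hvec_carrier [OF v(1)]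
        row_finite [OF t(1) okDw] row_finite [OF t(1) v(2)])
  have 2: "Dm (mv R (tker g1) ?w) i \<oplus> mv R (tker g1) (Dm ?w) i = ?w i"
    by (rule contraction_apply [OF g(1) w])
  have c: "mv R (tker g1) (Dm ?w) i \<in> carrier R" "mv R (tker g1) ?v i \<in> carrier R"
      "Dm (mv R (tker g1) ?w) i \<in> carrier R"
    using hvec_carrier [OF hvec_mv [OF t(1) Dw]] hvec_carrier [OF hvec_mv [OF t(1) v(1)]]
      hvec_carrier [OF hvec_mv [OF N(2) hvec_mv [OF t(1) w(1)]]] by auto
  show ?thesis
    unfolding 1 2 [symmetric] using c by algebra
qed

end

section \<open>Homotopies along the half strips and the glued contraction\<close>

context based_complex
begin

text \<open>The degrees of the kernel are bounded on one side in the second coordinate, and the half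
  plane bounds them on the other; the rows of the support are finite.\<close>

lemma supports_y_half_finite:
  assumes e: "\<delta> = 1 \<or> \<delta> = -1" and T: "T \<in> supports_y \<delta>" and g: "kernel_on J T g" and z: "hvec J z" "finite (degs z)"
  shows "finite {\<sigma> \<in> degs (mv R (tker g) z). \<delta> * snd \<sigma> \<le> 0}"
proof -
  obtain n :: nat where n: "\<And>\<sigma>. \<sigma> \<in> T \<Longrightarrow> - int n \<le> \<delta> * snd \<sigma>" and fin: "\<And>b. finite {a. (a, b) \<in> T}"
    using T unfolding supports_y_iff [OF e] by blast
  let ?K = "\<lambda>\<kappa>. int n + \<bar>snd \<kappa>\<bar>"
  let ?F = "\<lambda>\<kappa>. \<Union>b\<in>{-?K \<kappa>..?K \<kappa>}. (\<lambda>a. (a, b)) ` {a. (a, b) \<in> T}"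
  have "{\<sigma> \<in> degs (mv R (tker g) z). \<delta> * snd \<sigma> \<le> 0} \<subseteq> (\<Union>\<kappa>\<in>degs z. (\<lambda>\<tau>. \<tau> + \<kappa>) ` ?F \<kappa>)"
  proof
    fix \<sigma> assume "\<sigma> \<in> {\<sigma> \<in> degs (mv R (tker g) z). \<delta> * snd \<sigma> \<le> 0}"
    then have \<sigma>: "\<sigma> \<in> degs (mv R (tker g) z)" "\<delta> * snd \<sigma> \<le> 0" by auto
    obtain \<kappa> where \<kappa>: "\<kappa> \<in> degs z" "\<sigma> - \<kappa> \<in> T" using degs_mv [OF g z(1) \<sigma>(1)] .
    have "- ?K \<kappa> \<le> snd (\<sigma> - \<kappa>)" "snd (\<sigma> - \<kappa>) \<le> ?K \<kappa>"
      using n [OF \<kappa>(2)] \<sigma>(2) e by auto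
    then have "\<sigma> - \<kappa> \<in> ?F \<kappa>"
      using \<kappa>(2) by (intro UN_I [of "snd (\<sigma> - \<kappa>)"] image_eqI [of _ _ "fst (\<sigma> - \<kappa>)"])
        (simp_all only: prod.collapse atLeastAtMost_iff mem_Collect_eq)
    then have "\<sigma> \<in> (\<lambda>\<tau>. \<tau> + \<kappa>) ` ?F \<kappa>" by (rule rev_image_eqI) simp
    with \<kappa>(1) show "\<sigma> \<in> (\<Union>\<kappa>\<in>degs z. (\<lambda>\<tau>. \<tau> + \<kappa>) ` ?F \<kappa>)" by blast
  qed
  then show ?thesis
    by (rule finite_subset) (intro finite_UN_I z(2) finite_imageI fin finite_atLeastAtMost_int)
qed

text \<open>Entries of the differential between two indices on the same side of \<open>P\<close>
  contribute equally to both terms, so only entries that cross the boundary of \<open>P\<close> can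
  produce a nonzero value.\<close>

lemma restr_commutator:
  assumes w: "hvec J w" and nz: "Dm (restr R P w) i \<ominus> restr R P (Dm w) i \<noteq> \<zero>"
  shows "\<exists>m. tker Dk i m \<noteq> \<zero> \<and> w m \<noteq> \<zero> \<and> (snd m \<in> P) \<noteq> (snd i \<in> P)"
proof (rule ccontr)
  assume *: "\<not> ?thesis"
  obtain N where N: "finite N" "kernel_on J N Dk" using kernel_on_kern [OF rhom_d] .
  have wc: "w m \<in> carrier R" for m using hvec_carrier [OF w] .
  have "Dm (restr R P w) i = (if snd i \<in> P then Dm w i else \<zero>)"
  proof -
    have "tker Dk i m \<otimes> restr R P w m = (if snd i \<in> P then tker Dk i m \<otimes> w m else \<zero>)" for m
    proof (cases "tker Dk i m = \<zero> \<or> w m = \<zero>")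
      case True
      then show ?thesis using wc [of m] tker_carrier [OF N(2), of i m] by (auto simp: restr_def)
    next
      case False
      then have "(snd m \<in> P) = (snd i \<in> P)" using * by blast
      then show ?thesis using tker_carrier [OF N(2), of i m] by (simp add: restr_def)
    qed
    then show ?thesis by (simp add: mv_def)
  qed
  then have "Dm (restr R P w) i \<ominus> restr R P (Dm w) i = \<zero>"
    using D_closed [of w i] wc by (simp add: restr_def a_minus_def r_neg)
  then show False using nz by simp
qed

lemma finite_hvec_at_hvec: "finite_hvec_at n z \<Longrightarrow> hvec J z" "finite_hvec_at n z \<Longrightarrow> finite (degs z)" "finite_hvec_at n z \<Longrightarrow> hvec_at n z"
  by (auto simp: finite_hvec_at_def hvec_at_hvec)

lemma finite_degs_mv:
  assumes g: "kernel_on J N g" "finite N" and z: "hvec J z" "finite (degs z)"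
  shows "finite (degs (mv R (tker g) z))"
proof (rule finite_subset)
  show "degs (mv R (tker g) z) \<subseteq> (\<lambda>(\<alpha>, \<beta>). \<alpha> + \<beta>) ` (N \<times> degs z)"
  proof
    fix \<sigma> assume "\<sigma> \<in> degs (mv R (tker g) z)"
    then obtain \<kappa> where "\<kappa> \<in> degs z" "\<sigma> - \<kappa> \<in> N" using degs_mv [OF g(1) z(1)] by blast
    then show "\<sigma> \<in> (\<lambda>(\<alpha>, \<beta>). \<alpha> + \<beta>) ` (N \<times> degs z)"
      by (intro image_eqI [of _ _ "(\<sigma> - \<kappa>, \<kappa>)"]) auto
  qed
qed (use g z in blast)

lemma finite_hvec_at_D: "finite_hvec_at n z \<Longrightarrow> finite_hvec_at (n - 1) (Dm z)"
proof -
  assume z: "finite_hvec_at n z"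
  obtain N where N: "finite N" "kernel_on J N Dk" "has_degree R (-1) Dk" by (rule D_row)
  show "finite_hvec_at (n - 1) (Dm z)"
    using hvec_at_mv [OF N(2,3) finite_hvec_at_hvec(3) [OF z]] finite_degs_mv [OF N(2,1) finite_hvec_at_hvec(1,2) [OF z]]
    by (simp add: finite_hvec_at_def)
qed

lemma klin_product:
  assumes g: "contraction T1 g1" "contraction T2 g2" and s: "strip_ok \<epsilon> T1 T2" and e: "\<epsilon> = 1 \<or> \<epsilon> = -1"
  shows "klin 2 (\<lambda>z. mv R (tker g1) (mv R (tker g2) z))"
proof -
  have t: "kernel_on J T1 g1" "has_degree R 1 g1" "kernel_on J T2 g2" "has_degree R 1 g2"
    using g by (simp_all add: contraction_def)
  have "klin (1 + 1) (\<lambda>z. mv R (tker g1) (mv R (tker g2) z))"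
    by (rule klin_mv_comp [OF t(1,2) klin_mv [OF t(3,4)]])
      (rule loc_finite_strip [OF s e t(3) finite_hvec_at_hvec(1,2)])
  then show ?thesis by simp
qed

lemma degs_add: "degs (\<lambda>i. z i \<oplus> w i) \<subseteq> degs z \<union> degs w"
proof
  fix \<sigma> assume "\<sigma> \<in> degs (\<lambda>i. z i \<oplus> w i)"
  then obtain j where "z (j, \<sigma>) \<oplus> w (j, \<sigma>) \<noteq> \<zero>" by (rule degsE)
  then have "z (j, \<sigma>) \<noteq> \<zero> \<or> w (j, \<sigma>) \<noteq> \<zero>" by auto
  then show "\<sigma> \<in> degs z \<union> degs w" using degsI [of z "(j, \<sigma>)"] degsI [of w "(j, \<sigma>)"] by auto
qed

text \<open>A and B are joined through three intermediate rings, in the cyclic order y, (x^e, y),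
  x^e, (x^e, y^-1), y^-1 with e = \<open>\<epsilon>\<close>. Consecutive supports satisfy
  \<open>strip_ok\<close>, those of A and B in general do not.\<close>

lemma homotopy_along_strip:
  assumes e: "\<epsilon> = 1 \<or> \<epsilon> = -1"
    and A: "contraction TA gA" "TA \<in> supports_y 1" and B: "contraction TB gB" "TB \<in> supports_y (-1)"
    and X: "contraction TX gX" "TX \<in> supports_x \<epsilon>"
    and P: "contraction TP gP" "TP \<in> supports_xy \<epsilon> 1" and Q: "contraction TQ gQ" "TQ \<in> supports_xy \<epsilon> (-1)"
  obtains t where "klin 2 t" "\<And>n z M. finite_hvec_at n z \<Longrightarrow> finite (degs (t z) \<inter> half_strip \<epsilon> M)"
    "\<And>n z i. finite_hvec_at n z \<Longrightarrow> Dm (t z) i \<ominus> t (Dm z) i = mv R (tker gB) z i \<ominus> mv R (tker gA) z i"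
proof -
  let ?m = "\<lambda>g z. mv R (tker g) z"
  \<comment> \<open>Each summand is a homotopy between consecutive contractions, and the differences
    telescope.\<close>
  define t where "t z = (\<lambda>i. ?m gA (?m gP z) i \<oplus> (?m gP (?m gX z) i \<oplus> (?m gX (?m gQ z) i \<oplus> ?m gQ (?m gB z) i)))" for z
  have pm: "(1::int) = 1 \<or> (1::int) = -1" "(-1::int) = 1 \<or> (-1::int) = -1" by auto
  have s: "strip_ok \<epsilon> TA TP" "strip_ok \<epsilon> TP TX" "strip_ok \<epsilon> TX TQ" "strip_ok \<epsilon> TQ TB"
    using strip_ok_y_xy [OF e pm(1) A(2) P(2)] strip_ok_x_xy [OF e pm(1) X(2) P(2)]
      strip_ok_x_xy [OF e pm(2) X(2) Q(2)] strip_ok_y_xy [OF e pm(2) B(2) Q(2)]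
    by (auto intro: strip_ok_commute)
  have kernel_on: "kernel_on J TA gA" "kernel_on J TB gB" "kernel_on J TX gX" "kernel_on J TP gP" "kernel_on J TQ gQ"
    using A B X P Q by (simp_all add: contraction_def)
  note k = klin_product [OF A(1) P(1) s(1) e] klin_product [OF P(1) X(1) s(2) e]
    klin_product [OF X(1) Q(1) s(3) e] klin_product [OF Q(1) B(1) s(4) e]
  have kt: "klin 2 t"
    unfolding t_def by (intro klin_add k)
  have fin: "finite (degs (t z) \<inter> half_strip \<epsilon> M)" if z: "finite_hvec_at n z" for n z M
  proof -
    note z = finite_hvec_at_hvec(1,2) [OF z]
    have "degs (t z) \<subseteq> degs (?m gA (?m gP z)) \<union> (degs (?m gP (?m gX z)) \<union> (degs (?m gX (?m gQ z)) \<union> degs (?m gQ (?m gB z))))"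
      unfolding t_def
      using degs_add [of "?m gA (?m gP z)" "\<lambda>i. ?m gP (?m gX z) i \<oplus> (?m gX (?m gQ z) i \<oplus> ?m gQ (?m gB z) i)"]
        degs_add [of "?m gP (?m gX z)" "\<lambda>i. ?m gX (?m gQ z) i \<oplus> ?m gQ (?m gB z) i"]
        degs_add [of "?m gX (?m gQ z)" "?m gQ (?m gB z)"] by blast
    then have "degs (t z) \<inter> half_strip \<epsilon> M \<subseteq> (degs (?m gA (?m gP z)) \<inter> half_strip \<epsilon> M) \<union> ((degs (?m gP (?m gX z)) \<inter> half_strip \<epsilon> M)
        \<union> ((degs (?m gX (?m gQ z)) \<inter> half_strip \<epsilon> M) \<union> (degs (?m gQ (?m gB z)) \<inter> half_strip \<epsilon> M)))" by blast
    then show ?thesis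
      by (rule finite_subset) (intro finite_UnI strip_finite [OF s(1) e kernel_on(1,4) z]
        strip_finite [OF s(2) e kernel_on(4,3) z] strip_finite [OF s(3) e kernel_on(3,5) z] strip_finite [OF s(4) e kernel_on(5,2) z])
  qed
  have hom: "Dm (t z) i \<ominus> t (Dm z) i = ?m gB z i \<ominus> ?m gA z i" if z: "finite_hvec_at n z" for n z i
  proof -
    note z' = finite_hvec_at_hvec(1,2) [OF z]
    note c1 = klin_closed [OF k(1) z] and c2 = klin_closed [OF k(2) z]
      and c3 = klin_closed [OF k(3) z] and c4 = klin_closed [OF k(4) z]
    note Dz = finite_hvec_at_D [OF z]
    have "Dm (t z) i = Dm (?m gA (?m gP z)) i \<oplus> (Dm (?m gP (?m gX z)) i \<oplus> (Dm (?m gX (?m gQ z)) i \<oplus> Dm (?m gQ (?m gB z)) i))"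
      unfolding t_def using c1 c2 c3 c4 by (simp add: D_add)
    moreover have "Dm (?m gA (?m gP z)) i \<ominus> ?m gA (?m gP (Dm z)) i = ?m gP z i \<ominus> ?m gA z i"
      by (rule contraction_product [OF A(1) P(1) s(1) e z'])
    moreover have "Dm (?m gP (?m gX z)) i \<ominus> ?m gP (?m gX (Dm z)) i = ?m gX z i \<ominus> ?m gP z i"
      by (rule contraction_product [OF P(1) X(1) s(2) e z'])
    moreover have "Dm (?m gX (?m gQ z)) i \<ominus> ?m gX (?m gQ (Dm z)) i = ?m gQ z i \<ominus> ?m gX z i"
      by (rule contraction_product [OF X(1) Q(1) s(3) e z'])
    moreover have "Dm (?m gQ (?m gB z)) i \<ominus> ?m gQ (?m gB (Dm z)) i = ?m gB z i \<ominus> ?m gQ z i"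
      by (rule contraction_product [OF Q(1) B(1) s(4) e z'])
    moreover have "(x1 \<oplus> (x2 \<oplus> (x3 \<oplus> x4))) \<ominus> (y1 \<oplus> (y2 \<oplus> (y3 \<oplus> y4))) =
        (x1 \<ominus> y1) \<oplus> ((x2 \<ominus> y2) \<oplus> ((x3 \<ominus> y3) \<oplus> (x4 \<ominus> y4)))"
      if "x1 \<in> carrier R" "x2 \<in> carrier R" "x3 \<in> carrier R" "x4 \<in> carrier R"
        "y1 \<in> carrier R" "y2 \<in> carrier R" "y3 \<in> carrier R" "y4 \<in> carrier R" for x1 x2 x3 x4 y1 y2 y3 y4
      using that by algebra
    moreover have "(x2 \<ominus> x1) \<oplus> ((x3 \<ominus> x2) \<oplus> ((x4 \<ominus> x3) \<oplus> (x5 \<ominus> x4))) = x5 \<ominus> x1"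
      if "x1 \<in> carrier R" "x2 \<in> carrier R" "x3 \<in> carrier R" "x4 \<in> carrier R" "x5 \<in> carrier R" for x1 x2 x3 x4 x5
      using that by algebra
    ultimately show ?thesis
      unfolding t_def [of "Dm z"]
      using D_closed [of "?m gA (?m gP z)" i, OF c1] D_closed [of "?m gP (?m gX z)" i, OF c2]
        D_closed [of "?m gX (?m gQ z)" i, OF c3] D_closed [of "?m gQ (?m gB z)" i, OF c4]
        klin_closed [OF k(1) Dz, of i] klin_closed [OF k(2) Dz, of i] klin_closed [OF k(3) Dz, of i]
        klin_closed [OF k(4) Dz, of i] hvec_carrier [OF hvec_mv [OF kernel_on(1) z'(1)], of i]
        hvec_carrier [OF hvec_mv [OF kernel_on(2) z'(1)], of i] hvec_carrier [OF hvec_mv [OF kernel_on(3) z'(1)], of i]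
        hvec_carrier [OF hvec_mv [OF kernel_on(4) z'(1)], of i] hvec_carrier [OF hvec_mv [OF kernel_on(5) z'(1)], of i]
      by simp
  qed
  show ?thesis using that kt fin hom by blast
qed

text \<open>\<open>H\<close> has the form treated in \<open>glue_identity\<close>, with the lower
  half plane for p and the left half plane for q. Every piece is finite where it is kept:
  \<open>gA\<close> below the x-axis, \<open>gB\<close> above it, and the commutator term near it,
  because \<open>u\<close> uses \<open>t1\<close> on the left and \<open>t2\<close> on the right.
  The bound \<open>M\<close> depends on the differential only.\<close>

lemma glued_contraction:
  assumes A: "contraction TA gA" "TA \<in> supports_y 1" and B: "contraction TB gB" "TB \<in> supports_y (-1)"
    and t1: "klin 2 t1" "\<And>n z M. finite_hvec_at n z \<Longrightarrow> finite (degs (t1 z) \<inter> half_strip 1 M)"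
    "\<And>n z i. finite_hvec_at n z \<Longrightarrow> Dm (t1 z) i \<ominus> t1 (Dm z) i = mv R (tker gB) z i \<ominus> mv R (tker gA) z i"
    and t2: "klin 2 t2" "\<And>n z M. finite_hvec_at n z \<Longrightarrow> finite (degs (t2 z) \<inter> half_strip (-1) M)"
    "\<And>n z i. finite_hvec_at n z \<Longrightarrow> Dm (t2 z) i \<ominus> t2 (Dm z) i = mv R (tker gB) z i \<ominus> mv R (tker gA) z i"
  obtains H and M :: int where "klin 1 H" "\<And>n z. finite_hvec_at n z \<Longrightarrow> finite (degs (H z))"
    "\<And>n z i. finite_hvec_at n z \<Longrightarrow> Dm (H z) i \<oplus> H (Dm z) i \<ominus> z i \<noteq> \<zero> \<Longrightarrow>
      \<bar>fst (snd i)\<bar> \<le> M \<and> \<bar>snd (snd i)\<bar> \<le> M"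
proof -
  obtain N where N: "finite N" "kernel_on J N Dk" "has_degree R (-1) Dk" by (rule D_row)
  obtain L :: nat where L: "\<And>\<sigma>. \<sigma> \<in> N \<Longrightarrow> \<bar>fst \<sigma>\<bar> \<le> int L \<and> \<bar>snd \<sigma>\<bar> \<le> int L"
    using finite_bound [OF N(1)] by blast
  let ?P = "{\<sigma> :: int \<times> int. snd \<sigma> \<le> 0}" and ?Q = "{\<sigma> :: int \<times> int. fst \<sigma> \<le> 0}"
  define p :: "((int \<times> 'b) \<times> (int \<times> int) \<Rightarrow> 'a) \<Rightarrow> (int \<times> 'b) \<times> (int \<times> int) \<Rightarrow> 'a"
    where "p = restr R ?P"
  define q :: "((int \<times> 'b) \<times> (int \<times> int) \<Rightarrow> 'a) \<Rightarrow> (int \<times> 'b) \<times> (int \<times> int) \<Rightarrow> 'a"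
    where "q = restr R ?Q"
  have kernel_on: "kernel_on J TA gA" "has_degree R 1 gA" "kernel_on J TB gB" "has_degree R 1 gB" using A B by (simp_all add: contraction_def)
  define u where "u z = (\<lambda>i. q (t1 z) i \<oplus> (t2 z i \<ominus> q (t2 z) i))" for z
  define comm where "comm w = (\<lambda>i. Dm (p w) i \<ominus> p (Dm w) i)" for w
  define H where "H z = (\<lambda>i. p (mv R (tker gA) z) i \<oplus> (mv R (tker gB) z i \<ominus> p (mv R (tker gB) z) i) \<ominus> comm (u z) i)" for z
  have ku: "klin 2 u"
    unfolding u_def q_def by (intro klin_add klin_diff klin_restr t1 t2)
  have kc: "klin 1 (\<lambda>z. comm (u z))"
    using klin_diff [OF klin_D [OF klin_restr [OF ku]] klin_restr [OF klin_D [OF ku]]]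
    by (simp add: comm_def p_def)
  have kH: "klin 1 H"
    unfolding H_def p_def by (intro klin_add klin_diff klin_restr klin_mv [OF kernel_on(1,2)] klin_mv [OF kernel_on(3,4)])
      (use kc in \<open>simp add: p_def\<close>)
  \<comment> \<open>An entry of the differential spans at most \<open>L\<close> in each coordinate,
    so both ends of an entry that crosses an axis are within \<open>L\<close> of it.\<close>
  have side: "\<bar>snd (snd m)\<bar> \<le> int L" "\<bar>snd (snd i)\<bar> \<le> int L"
    if "tker Dk i m \<noteq> \<zero>" "(snd m \<in> ?P) \<noteq> (snd i \<in> ?P)" for i m
    using kernel_on_nonzeroD [OF N(2) that(1)] L [of "snd i - snd m"] that(2) by (auto simp: abs_le_iff)
  have sideQ: "\<bar>fst (snd i)\<bar> \<le> int L"
    if "tker Dk i m \<noteq> \<zero>" "(snd m \<in> ?Q) \<noteq> (snd i \<in> ?Q)" for i m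
    using kernel_on_nonzeroD [OF N(2) that(1)] L [of "snd i - snd m"] that(2) by (auto simp: abs_le_iff)
  have finH: "finite (degs (H z))" if z: "finite_hvec_at n z" for n z
  proof -
    let ?F1 = "{\<sigma> \<in> degs (mv R (tker gA) z). 1 * snd \<sigma> \<le> 0}"
    let ?F2 = "{\<sigma> \<in> degs (mv R (tker gB) z). -1 * snd \<sigma> \<le> 0}"
    let ?F3 = "(degs (t1 z) \<inter> half_strip 1 (int L)) \<union> (degs (t2 z) \<inter> half_strip (-1) (int L))"
    \<comment> \<open>The first two sets hold the two cut contractions. In the commutator term the
      differential is applied to values of \<open>u\<close> in the strip of width \<open>L\<close>,
      which lie in \<open>?F3\<close>.\<close>
    let ?F = "?F1 \<union> ?F2 \<union> (\<lambda>(\<alpha>, \<beta>). \<alpha> + \<beta>) ` (N \<times> ?F3)"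
    note z' = finite_hvec_at_hvec(1,2) [OF z]
    have "finite ?F1" "finite ?F2"
      using supports_y_half_finite [OF _ A(2) kernel_on(1) z'] supports_y_half_finite [OF _ B(2) kernel_on(3) z'] by auto
    moreover have "finite ?F3" using t1(2) [OF z] t2(2) [OF z] by blast
    ultimately have "finite ?F" using N(1) by blast
    moreover have "degs (H z) \<subseteq> ?F"
    proof
      fix \<sigma> assume "\<sigma> \<in> degs (H z)"
      then obtain j where nz: "H z (j, \<sigma>) \<noteq> \<zero>" by (rule degsE)
      let ?i = "(j, \<sigma>)"
      have c: "mv R (tker gB) z ?i \<in> carrier R" using hvec_carrier [OF hvec_mv [OF kernel_on(3) z'(1)]] .
      have "p (mv R (tker gA) z) ?i \<noteq> \<zero> \<or> mv R (tker gB) z ?i \<ominus> p (mv R (tker gB) z) ?i \<noteq> \<zero> \<or> comm (u z) ?i \<noteq> \<zero>"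
        using nz by (auto simp: H_def a_minus_def)
      then consider "p (mv R (tker gA) z) ?i \<noteq> \<zero>" | "mv R (tker gB) z ?i \<ominus> p (mv R (tker gB) z) ?i \<noteq> \<zero>"
        | "comm (u z) ?i \<noteq> \<zero>" by blast
      then show "\<sigma> \<in> ?F"
      proof cases
        case 1
        then have "\<sigma> \<in> ?F1"
          using degsI [of "mv R (tker gA) z" ?i] by (auto simp: p_def restr_def split: if_splits)
        then show ?thesis by blast
      next
        case 2
        have "mv R (tker gB) z ?i \<noteq> \<zero>" "\<not> snd \<sigma> \<le> 0"
          using 2 c by (auto simp: p_def restr_def a_minus_def r_neg split: if_splits)
        then have "\<sigma> \<in> ?F2"
          using degsI [of "mv R (tker gB) z" ?i] by auto
        then show ?thesis by blast
      next
        case 3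
        have hu: "hvec J (u z)" using hvec_at_hvec [OF klinD(1) [OF ku z]] .
        obtain m where m: "tker Dk ?i m \<noteq> \<zero>" "u z m \<noteq> \<zero>" "(snd m \<in> ?P) \<noteq> (snd ?i \<in> ?P)"
          using restr_commutator [OF hu] 3 unfolding comm_def p_def by blast
        have sm: "\<bar>snd (snd m)\<bar> \<le> int L" by (rule side(1) [OF m(1,3)])
        have c2: "t2 z m \<in> carrier R" "t1 z m \<in> carrier R"
          using klin_closed [OF t2(1) z] klin_closed [OF t1(1) z] by auto
        have "snd m \<in> ?F3"
        proof (cases "fst (snd m) \<le> 0")
          case True
          then have "t1 z m \<noteq> \<zero>"
            using m(2) c2 by (auto simp: u_def q_def restr_def a_minus_def r_neg)
          then show ?thesis
            using degsI [of "t1 z" m] True sm by (simp add: half_strip_def)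
        next
          case False
          then have "t2 z m \<noteq> \<zero>"
            using m(2) c2 by (auto simp: u_def q_def restr_def a_minus_def)
          then show ?thesis
            using degsI [of "t2 z" m] False sm by (simp add: half_strip_def)
        qed
        moreover have "\<sigma> - snd m \<in> N" using kernel_on_nonzeroD [OF N(2) m(1)] by simp
        ultimately have "\<sigma> \<in> (\<lambda>(\<alpha>, \<beta>). \<alpha> + \<beta>) ` (N \<times> ?F3)"
          by (intro image_eqI [of _ _ "(\<sigma> - snd m, snd m)"]) (simp_all del: Un_iff)
        then show ?thesis by blast
      qed
    qed
    ultimately show ?thesis by (rule finite_subset [rotated])
  qed
  have err: "\<bar>fst (snd i)\<bar> \<le> 2 * int L \<and> \<bar>snd (snd i)\<bar> \<le> 2 * int L"
    if z: "finite_hvec_at n z" and nz: "Dm (H z) i \<oplus> H (Dm z) i \<ominus> z i \<noteq> \<zero>" for n z i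
  proof -
    interpret vec_group: abelian_group "vec_group R :: ((int \<times> 'b) \<times> (int \<times> int) \<Rightarrow> 'a) ring" by (rule vec_group_group)
    let ?vd = "\<lambda>x y. x \<ominus>\<^bsub>vec_group R\<^esub> y"
    let ?A = "\<lambda>x. ?vd (Dm (p x)) (p (Dm x))" and ?Qc = "\<lambda>x. ?vd (Dm (q x)) (q (Dm x))"
    let ?H = "\<lambda>a1 a2 t1 t2. ?vd (p a1 \<oplus>\<^bsub>vec_group R\<^esub> ?vd a2 (p a2)) (?A (q t1 \<oplus>\<^bsub>vec_group R\<^esub> ?vd t2 (q t2)))"
    note z' = finite_hvec_at_hvec(1,2) [OF z] and Dz = finite_hvec_at_D [OF z]
    note Dz' = finite_hvec_at_hvec(1,2) [OF Dz]
    have pc: "p x i \<in> carrier R" "q x i \<in> carrier R" if "\<And>i. x i \<in> carrier R" for x i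
      using that by (simp_all add: p_def q_def restr_def)
    have ac: "mv R (tker gA) y i \<in> carrier R" "mv R (tker gB) y i \<in> carrier R" if "finite_hvec_at n y" for n y i
      using hvec_carrier [OF hvec_mv [OF kernel_on(1) finite_hvec_at_hvec(1) [OF that]]] hvec_carrier [OF hvec_mv [OF kernel_on(3) finite_hvec_at_hvec(1) [OF that]]] by auto
    have tc: "t1 y i \<in> carrier R" "t2 y i \<in> carrier R" "u y i \<in> carrier R" if "finite_hvec_at n y" for n y i
      using klin_closed [OF t1(1) that] klin_closed [OF t2(1) that] klin_closed [OF ku that] by auto
    have uu: "q (t1 y) \<oplus>\<^bsub>vec_group R\<^esub> ?vd (t2 y) (q (t2 y)) = u y" if "finite_hvec_at n y" for n y
      using vec_group_diff [of "q (t2 y)" "t2 y"] pc(2) [OF tc(2) [OF that]] by (simp add: u_def)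
    have HH: "H y = ?H (mv R (tker gA) y) (mv R (tker gB) y) (t1 y) (t2 y)" if y: "finite_hvec_at n y" for n y
    proof -
      have "?A (u y) = comm (u y)"
        using vec_group_diff [of "p (Dm (u y))" "Dm (p (u y))"] pc(1) [OF D_closed [OF tc(3) [OF y]]] by (simp add: comm_def)
      moreover have "comm (u y) i \<in> carrier R" for i
        using klin_closed [OF kc y] .
      moreover have "?vd (mv R (tker gB) y) (p (mv R (tker gB) y)) = (\<lambda>i. mv R (tker gB) y i \<ominus> p (mv R (tker gB) y) i)"
        by (rule vec_group_diff) (rule pc(1) [OF ac(2) [OF y]])
      ultimately show ?thesis
        unfolding uu [OF y] H_def by (simp add: vec_group_diff)
    qed
    have hJ: "hvec J (u z)" "hvec J (p (u z))"
      using hvec_at_hvec [OF klinD(1) [OF ku z]] hvec_restr by (auto simp: p_def)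
    have "Dm (?H (mv R (tker gA) z) (mv R (tker gB) z) (t1 z) (t2 z)) \<oplus>\<^bsub>vec_group R\<^esub>
        ?H (mv R (tker gA) (Dm z)) (mv R (tker gB) (Dm z)) (t1 (Dm z)) (t2 (Dm z)) =
        z \<oplus>\<^bsub>vec_group R\<^esub> ?A (?Qc (?vd (t1 z) (t2 z)))"
    proof (rule vec_group.glue_identity [where H = ?H and A = ?A and Q = ?Qc])
      show "Dm \<in> carrier (vec_group R) \<rightarrow> carrier (vec_group R)" by (rule D_hom)
      show "p \<in> carrier (vec_group R) \<rightarrow> carrier (vec_group R)" "q \<in> carrier (vec_group R) \<rightarrow> carrier (vec_group R)"
        using pc by auto
      show "Dm (x \<oplus>\<^bsub>vec_group R\<^esub> y) = Dm x \<oplus>\<^bsub>vec_group R\<^esub> Dm y" if "x \<in> carrier (vec_group R)" "y \<in> carrier (vec_group R)" for x y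
        using that D_add [of x y] by (simp add: fun_eq_iff)
      show "p (x \<oplus>\<^bsub>vec_group R\<^esub> y) = p x \<oplus>\<^bsub>vec_group R\<^esub> p y" "q (x \<oplus>\<^bsub>vec_group R\<^esub> y) = q x \<oplus>\<^bsub>vec_group R\<^esub> q y" for x y
        by (simp_all add: p_def q_def restr_def fun_eq_iff)
      show "Dm (Dm x) = \<zero>\<^bsub>vec_group R\<^esub>" if "x \<in> {p (q (t1 z) \<oplus>\<^bsub>vec_group R\<^esub> ?vd (t2 z) (q (t2 z))), q (t1 z) \<oplus>\<^bsub>vec_group R\<^esub> ?vd (t2 z) (q (t2 z))}" for x
        using that unfolding uu [OF z] using DD_zero hJ by auto
      show "Dm (mv R (tker gA) z) \<oplus>\<^bsub>vec_group R\<^esub> mv R (tker gA) (Dm z) = z"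
        using contraction_apply [OF A(1) z'(1) loc_finite_finite_degs [OF z'(2)]] by (simp add: fun_eq_iff)
      show "Dm (mv R (tker gB) z) \<oplus>\<^bsub>vec_group R\<^esub> mv R (tker gB) (Dm z) = z"
        using contraction_apply [OF B(1) z'(1) loc_finite_finite_degs [OF z'(2)]] by (simp add: fun_eq_iff)
      show "?vd (Dm (t1 z)) (t1 (Dm z)) = ?vd (mv R (tker gB) z) (mv R (tker gA) z)"
        using t1(3) [OF z] tc(1) [OF Dz] ac(1) [OF z] by (simp add: vec_group_diff)
      show "?vd (Dm (t2 z)) (t2 (Dm z)) = ?vd (mv R (tker gB) z) (mv R (tker gA) z)"
        using t2(3) [OF z] tc(2) [OF Dz] ac(1) [OF z] by (simp add: vec_group_diff)
    qed (use ac [OF z] ac [OF Dz] tc [OF z] tc [OF Dz] hvec_carrier [OF z'(1)] in simp_all)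
    then have e: "Dm (H z) \<oplus>\<^bsub>vec_group R\<^esub> H (Dm z) = z \<oplus>\<^bsub>vec_group R\<^esub> ?A (?Qc (?vd (t1 z) (t2 z)))"
      unfolding HH [OF z] HH [OF Dz] .
    define s where "s = (\<lambda>i. t1 z i \<ominus> t2 z i)"
    define w where "w = (\<lambda>i. Dm (q s) i \<ominus> q (Dm s) i)"
    have hs: "hvec_at (n + 2) s"
      using klinD(1) [OF klin_diff [OF t1(1) t2(1)] z] by (simp add: s_def)
    have sc: "s i \<in> carrier R" for i using hvec_carrier [OF hs] .
    have hw: "hvec J w"
    proof -
      have "hvec J (Dm (q s))" "hvec J (q (Dm s))"
        unfolding q_def by (intro hvec_mv [OF N(2)] hvec_restr hvec_at_hvec [OF hs])+
      from hvec_add [OF this(1) hvec_minus [OF this(2)]] show ?thesis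
        by (simp add: w_def a_minus_def)
    qed
    have ww: "?Qc (?vd (t1 z) (t2 z)) = w"
      using vec_group_diff [of "t2 z" "t1 z"] tc(2) [OF z] vec_group_diff [of "q (Dm s)" "Dm (q s)"] pc(2) [OF D_closed [OF sc]]
      by (simp add: w_def s_def)
    have Aw: "?A w = comm w"
      using vec_group_diff [of "p (Dm w)" "Dm (p w)"] pc(1) [OF D_closed [OF hvec_carrier [OF hw]]] by (simp add: comm_def)
    have cw: "comm w i \<in> carrier R" for i
      using D_closed [OF pc(1) [OF hvec_carrier [OF hw]]] pc(1) [OF D_closed [OF hvec_carrier [OF hw]]] by (simp add: comm_def)
    have "Dm (H z) i \<oplus> H (Dm z) i = z i \<oplus> comm w i"
      using fun_cong [OF e, of i] unfolding ww Aw by simp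
    then have "z i \<oplus> comm w i \<ominus> z i \<noteq> \<zero>" using nz by simp
    moreover have "z i \<oplus> comm w i \<ominus> z i = comm w i"
      using hvec_carrier [OF z'(1), of i] cw [of i] by algebra
    ultimately have "comm w i \<noteq> \<zero>" by simp
    then obtain m where m: "tker Dk i m \<noteq> \<zero>" "w m \<noteq> \<zero>" "(snd m \<in> ?P) \<noteq> (snd i \<in> ?P)"
      using restr_commutator [OF hw] unfolding comm_def p_def by blast
    \<comment> \<open>The error is a double commutator. The crossing of the x-axis bounds the second
      coordinate of \<open>i\<close> and the crossing of the y-axis the first coordinate of
      \<open>m\<close>, each by \<open>L\<close>; the step from \<open>m\<close> to \<open>i\<close>
      adds at most \<open>L\<close>, whence the bound \<open>2 * int L\<close>.\<close>
    obtain m' where m': "tker Dk m m' \<noteq> \<zero>" "(snd m' \<in> ?Q) \<noteq> (snd m \<in> ?Q)"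
      using restr_commutator [OF hvec_at_hvec [OF hs]] m(2) unfolding w_def q_def by blast
    have "\<bar>snd (snd i)\<bar> \<le> int L" by (rule side(2) [OF m(1,3)])
    moreover have "\<bar>fst (snd m)\<bar> \<le> int L" by (rule sideQ [OF m'])
    moreover have "\<bar>fst (snd i - snd m)\<bar> \<le> int L"
      using L kernel_on_nonzeroD [OF N(2) m(1)] by blast
    ultimately show ?thesis by simp
  qed
  show ?thesis
    by (rule that [OF kH]) (erule finH, erule err, assumption)
qed

end

subsection \<open>Finite domination over the degree zero component\<close>

text \<open>The free module of rank \<open>l\<close>, realised in the type that
  \<open>finitely_dominated\<close> prescribes. The multiplicative fields are placeholders.\<close>

definition std_module :: "('a, 'm) ring_scheme \<Rightarrow> 'a set \<Rightarrow> nat \<Rightarrow> ('a, nat \<Rightarrow> 'a) rmodule" where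
  "std_module R K l = \<lparr>carrier = {..<l} \<rightarrow>\<^sub>E K, monoid.mult = (\<lambda>x y. x), one = (\<lambda>i\<in>{..<l}. \<zero>\<^bsub>R\<^esub>),
     zero = (\<lambda>i\<in>{..<l}. \<zero>\<^bsub>R\<^esub>), add = (\<lambda>x y. \<lambda>i\<in>{..<l}. x i \<oplus>\<^bsub>R\<^esub> y i),
     rsmult = (\<lambda>x k. \<lambda>i\<in>{..<l}. x i \<otimes>\<^bsub>R\<^esub> k)\<rparr>"

lemma std_module_simps [simp]:
  "carrier (std_module R K l) = {..<l} \<rightarrow>\<^sub>E K" "\<zero>\<^bsub>std_module R K l\<^esub> = (\<lambda>i\<in>{..<l}. \<zero>\<^bsub>R\<^esub>)"
  "x \<oplus>\<^bsub>std_module R K l\<^esub> y = (\<lambda>i\<in>{..<l}. x i \<oplus>\<^bsub>R\<^esub> y i)" "x \<odot>\<^sub>r\<^bsub>std_module R K l\<^esub> k = (\<lambda>i\<in>{..<l}. x i \<otimes>\<^bsub>R\<^esub> k)"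
  by (simp_all add: std_module_def)

context graded_ring
begin

abbreviation Kr where "Kr \<equiv> R\<lparr>carrier := Rg 0\<rparr>"

lemma Rg0_mult [simp, intro]: "a \<in> Rg 0 \<Longrightarrow> b \<in> Rg 0 \<Longrightarrow> a \<otimes> b \<in> Rg 0"
  using Rg_mult [of a 0 b 0] by simp

lemma Rg0_carrier: "a \<in> Rg 0 \<Longrightarrow> a \<in> carrier R" by (rule Rg_carrier)

lemma Kr_ring: "ring Kr"
proof (rule ringI)
  show "abelian_group Kr"
  proof (rule abelian_groupI)
    fix x assume "x \<in> carrier Kr"
    then show "\<exists>y\<in>carrier Kr. y \<oplus>\<^bsub>Kr\<^esub> x = \<zero>\<^bsub>Kr\<^esub>"
      using Rg_minus [of x 0] l_neg [of x] Rg0_carrier [of x] by (intro bexI [of _ "\<ominus> x"]) simp_all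
  qed (use Rg0_carrier in \<open>simp_all add: a_ac\<close>)
  show "monoid Kr"
    by (rule monoidI) (use Rg0_carrier one_Rg in \<open>simp_all add: m_assoc\<close>)
qed (use Rg0_carrier in \<open>simp_all add: l_distr r_distr\<close>)

lemma std_module_entry: "x \<in> {..<l} \<rightarrow>\<^sub>E Rg 0 \<Longrightarrow> i < l \<Longrightarrow> x i \<in> carrier R"
  using Rg0_carrier by (auto simp: PiE_iff)

lemma std_module_group: "abelian_group (std_module R (Rg 0) l)"
proof (rule abelian_groupI)
  fix x assume x: "x \<in> carrier (std_module R (Rg 0) l)"
  show "\<exists>y\<in>carrier (std_module R (Rg 0) l). y \<oplus>\<^bsub>std_module R (Rg 0) l\<^esub> x = \<zero>\<^bsub>std_module R (Rg 0) l\<^esub>"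
  proof (rule bexI [of _ "\<lambda>i\<in>{..<l}. \<ominus> x i"])
    show "(\<lambda>i\<in>{..<l}. \<ominus> x i) \<oplus>\<^bsub>std_module R (Rg 0) l\<^esub> x = \<zero>\<^bsub>std_module R (Rg 0) l\<^esub>"
      using std_module_entry [of x l] x by (auto simp: fun_eq_iff restrict_def l_neg)
    show "(\<lambda>i\<in>{..<l}. \<ominus> x i) \<in> carrier (std_module R (Rg 0) l)"
      using x by (auto simp: PiE_iff)
  qed
  show "\<zero>\<^bsub>std_module R (Rg 0) l\<^esub> \<oplus>\<^bsub>std_module R (Rg 0) l\<^esub> x = x"
    using std_module_entry [of x l] x by (auto simp: fun_eq_iff restrict_def PiE_iff extensional_def)
next
  fix x y z assume xyz: "x \<in> carrier (std_module R (Rg 0) l)" "y \<in> carrier (std_module R (Rg 0) l)" "z \<in> carrier (std_module R (Rg 0) l)"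
  show "x \<oplus>\<^bsub>std_module R (Rg 0) l\<^esub> y \<oplus>\<^bsub>std_module R (Rg 0) l\<^esub> z = x \<oplus>\<^bsub>std_module R (Rg 0) l\<^esub> (y \<oplus>\<^bsub>std_module R (Rg 0) l\<^esub> z)"
    using xyz std_module_entry [of x l] std_module_entry [of y l] std_module_entry [of z l]
    by (auto simp: fun_eq_iff restrict_def a_assoc)
next
  fix x y assume xyz: "x \<in> carrier (std_module R (Rg 0) l)" "y \<in> carrier (std_module R (Rg 0) l)"
  show "x \<oplus>\<^bsub>std_module R (Rg 0) l\<^esub> y = y \<oplus>\<^bsub>std_module R (Rg 0) l\<^esub> x"
    using xyz std_module_entry [of x l] std_module_entry [of y l]
    by (auto simp: fun_eq_iff restrict_def a_comm)
  show "x \<oplus>\<^bsub>std_module R (Rg 0) l\<^esub> y \<in> carrier (std_module R (Rg 0) l)"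
    using xyz by (auto simp: PiE_iff)
qed (auto simp: PiE_iff)

lemma std_module_module: "right_module Kr (std_module R (Rg 0) l)"
proof (intro right_module.intro right_module_axioms.intro Kr_ring std_module_group)
  fix x y r s
  assume x: "x \<in> carrier (std_module R (Rg 0) l)" and r: "r \<in> carrier Kr"
  note e = std_module_entry [of x l] Rg0_carrier [of r]
  show "x \<odot>\<^sub>r\<^bsub>std_module R (Rg 0) l\<^esub> r \<in> carrier (std_module R (Rg 0) l)"
    using x r by (auto simp: PiE_iff)
  {
    assume y: "y \<in> carrier (std_module R (Rg 0) l)"
    show "(x \<oplus>\<^bsub>std_module R (Rg 0) l\<^esub> y) \<odot>\<^sub>r\<^bsub>std_module R (Rg 0) l\<^esub> r =
        x \<odot>\<^sub>r\<^bsub>std_module R (Rg 0) l\<^esub> r \<oplus>\<^bsub>std_module R (Rg 0) l\<^esub> y \<odot>\<^sub>r\<^bsub>std_module R (Rg 0) l\<^esub> r"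
      using e x y r std_module_entry [of y l] by (auto simp: fun_eq_iff restrict_def l_distr)
  }
  {
    assume s: "s \<in> carrier Kr"
    show "x \<odot>\<^sub>r\<^bsub>std_module R (Rg 0) l\<^esub> (r \<oplus>\<^bsub>Kr\<^esub> s) =
        x \<odot>\<^sub>r\<^bsub>std_module R (Rg 0) l\<^esub> r \<oplus>\<^bsub>std_module R (Rg 0) l\<^esub> x \<odot>\<^sub>r\<^bsub>std_module R (Rg 0) l\<^esub> s"
      using e x r s Rg0_carrier [of s] by (auto simp: fun_eq_iff restrict_def r_distr)
    show "x \<odot>\<^sub>r\<^bsub>std_module R (Rg 0) l\<^esub> (r \<otimes>\<^bsub>Kr\<^esub> s) = x \<odot>\<^sub>r\<^bsub>std_module R (Rg 0) l\<^esub> r \<odot>\<^sub>r\<^bsub>std_module R (Rg 0) l\<^esub> s"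
      using e x r s Rg0_carrier [of s] by (auto simp: fun_eq_iff restrict_def m_assoc)
  }
next
  fix x assume x: "x \<in> carrier (std_module R (Rg 0) l)"
  show "x \<odot>\<^sub>r\<^bsub>std_module R (Rg 0) l\<^esub> \<one>\<^bsub>Kr\<^esub> = x"
    using std_module_entry [of x l] x by (auto simp: fun_eq_iff restrict_def PiE_iff extensional_def)
qed

lemma std_module_fg_free: "fg_free Kr (std_module R (Rg 0) l)"
\<comment> \<open>Over the zero ring the standard vectors all coincide and do not form
  \<open>l\<close> distinct elements; there the module is zero and the empty basis serves.\<close>
proof (cases "\<one> = \<zero>")
  case True
  then have K: "Rg 0 = {\<zero>}"
    using one_zeroD Rg0_carrier Rg_zero by blast
  have "bij_betw (\<lambda>c. \<Oplus>\<^bsub>std_module R (Rg 0) l\<^esub>b\<in>{}. b \<odot>\<^sub>r\<^bsub>std_module R (Rg 0) l\<^esub> c b) ({} \<rightarrow>\<^sub>E carrier Kr) (carrier (std_module R (Rg 0) l))"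
  proof -
    have "(\<Oplus>\<^bsub>std_module R (Rg 0) l\<^esub>b\<in>{}. b \<odot>\<^sub>r\<^bsub>std_module R (Rg 0) l\<^esub> c b) = (\<lambda>i\<in>{..<l}. \<zero>)" for c
      using abelian_monoid.finsum_empty [OF abelian_group.axioms(1) [OF std_module_group [of l]]] by simp
    moreover have "carrier (std_module R (Rg 0) l) = {\<lambda>i\<in>{..<l}. \<zero>}"
      by (auto simp: K PiE_iff fun_eq_iff extensional_def)
    ultimately show ?thesis by (simp add: bij_betw_def)
  qed
  then show ?thesis
    unfolding fg_free_def by (intro exI [of _ "{}"]) simp
next
  case False
  interpret std_module: abelian_group "std_module R (Rg 0) l" by (rule std_module_group)
  define e :: "nat \<Rightarrow> nat \<Rightarrow> 'a" where "e k = (\<lambda>i\<in>{..<l}. if i = k then \<one> else \<zero>)" for k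
  have e_in: "e k \<in> carrier (std_module R (Rg 0) l)" for k
    using one_Rg by (auto simp: e_def PiE_iff)
  have e_inj: "inj_on e {..<l}"
  proof (rule inj_onI)
    fix a b assume "a \<in> {..<l}" "b \<in> {..<l}" "e a = e b"
    then have "e a a = e b a" by simp
    then show "a = b" using \<open>a \<in> {..<l}\<close> False by (simp add: e_def split: if_splits)
  qed
  let ?B = "e ` {..<l}"
  let ?F = "\<lambda>c. \<Oplus>\<^bsub>std_module R (Rg 0) l\<^esub>b\<in>?B. b \<odot>\<^sub>r\<^bsub>std_module R (Rg 0) l\<^esub> c b"
  have F: "?F c = (\<lambda>i\<in>{..<l}. c (e i))" if c: "c \<in> ?B \<rightarrow> Rg 0" for c
  proof -
    have cc: "c (e k) \<in> carrier R" if "k < l" for k using c that Rg0_carrier by auto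
    have t: "e k \<odot>\<^sub>r\<^bsub>std_module R (Rg 0) l\<^esub> c (e k) \<in> carrier (std_module R (Rg 0) l)" if "k < l" for k
      using e_in [of k] c that by (auto simp: PiE_iff)
    have "?F c = (\<Oplus>\<^bsub>std_module R (Rg 0) l\<^esub>k\<in>{..<l}. e k \<odot>\<^sub>r\<^bsub>std_module R (Rg 0) l\<^esub> c (e k))"
    proof (rule std_module.finsum_reindex [OF _ e_inj], rule Pi_I)
      fix b assume "b \<in> ?B"
      then obtain k where "b = e k" "k < l" by auto
      then show "b \<odot>\<^sub>r\<^bsub>std_module R (Rg 0) l\<^esub> c b \<in> carrier (std_module R (Rg 0) l)"
        using t [of k] by (simp only:)
    qed
    also have "\<dots> = (\<lambda>i\<in>{..<l}. c (e i))"
    proof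
      fix i
      have cl: "(\<Oplus>\<^bsub>std_module R (Rg 0) l\<^esub>k\<in>{..<l}. e k \<odot>\<^sub>r\<^bsub>std_module R (Rg 0) l\<^esub> c (e k)) \<in> carrier (std_module R (Rg 0) l)"
        by (intro std_module.finsum_closed Pi_I t) simp
      show "(\<Oplus>\<^bsub>std_module R (Rg 0) l\<^esub>k\<in>{..<l}. e k \<odot>\<^sub>r\<^bsub>std_module R (Rg 0) l\<^esub> c (e k)) i = (\<lambda>i\<in>{..<l}. c (e i)) i"
      proof (cases "i < l")
        case True
        have "(\<Oplus>\<^bsub>std_module R (Rg 0) l\<^esub>k\<in>{..<l}. e k \<odot>\<^sub>r\<^bsub>std_module R (Rg 0) l\<^esub> c (e k)) i =
            (\<Oplus>k\<in>{..<l}. (e k \<odot>\<^sub>r\<^bsub>std_module R (Rg 0) l\<^esub> c (e k)) i)"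
        proof (rule additive_finsum(2) [OF std_module_group is_abelian_group, where f = "\<lambda>x. x i"])
          show "(\<lambda>x. x i) \<in> carrier (std_module R (Rg 0) l) \<rightarrow> carrier R"
            using True std_module_entry by auto
          show "e k \<odot>\<^sub>r\<^bsub>std_module R (Rg 0) l\<^esub> c (e k) \<in> carrier (std_module R (Rg 0) l)" if "k \<in> {..<l}" for k
            using t that by blast
        qed (use True in simp)
        also have "\<dots> = (\<Oplus>k\<in>{..<l}. if i = k then c (e k) else \<zero>)"
          by (rule finsum_cong' [OF refl]) (use True cc in \<open>auto simp: e_def\<close>)
        also have "\<dots> = c (e i)"
          by (rule finsum_singleton) (use True cc in auto)
        finally show ?thesis using True by simp
      next
        case False
        then show ?thesis using cl by (auto simp: PiE_iff extensional_def)
      qed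
    qed
    finally show ?thesis .
  qed
  have "bij_betw ?F (?B \<rightarrow>\<^sub>E Rg 0) ({..<l} \<rightarrow>\<^sub>E Rg 0)"
  proof (rule bij_betw_byWitness [where f' = "\<lambda>x. \<lambda>b\<in>?B. x (inv_into {..<l} e b)"])
    show "\<forall>c\<in>?B \<rightarrow>\<^sub>E Rg 0. (\<lambda>b\<in>?B. ?F c (inv_into {..<l} e b)) = c"
    proof
      fix c assume c: "c \<in> ?B \<rightarrow>\<^sub>E Rg 0"
      then have "?F c = (\<lambda>i\<in>{..<l}. c (e i))" by (intro F) auto
      then show "(\<lambda>b\<in>?B. ?F c (inv_into {..<l} e b)) = c"
        using c e_inj by (auto simp: fun_eq_iff PiE_iff extensional_def)
    qed
    show "\<forall>x\<in>{..<l} \<rightarrow>\<^sub>E Rg 0. ?F (\<lambda>b\<in>?B. x (inv_into {..<l} e b)) = x"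
    proof
      fix x assume x: "x \<in> {..<l} \<rightarrow>\<^sub>E Rg 0"
      have "?F (\<lambda>b\<in>?B. x (inv_into {..<l} e b)) = (\<lambda>i\<in>{..<l}. (\<lambda>b\<in>?B. x (inv_into {..<l} e b)) (e i))"
        by (rule F) (use x e_inj in \<open>auto simp: PiE_iff\<close>)
      also have "\<dots> = x"
        using x e_inj by (auto simp: fun_eq_iff PiE_iff extensional_def)
      finally show "?F (\<lambda>b\<in>?B. x (inv_into {..<l} e b)) = x" .
    qed
    show "?F ` (?B \<rightarrow>\<^sub>E Rg 0) \<subseteq> {..<l} \<rightarrow>\<^sub>E Rg 0"
    proof
      fix x assume "x \<in> ?F ` (?B \<rightarrow>\<^sub>E Rg 0)"
      then obtain c where c: "c \<in> ?B \<rightarrow>\<^sub>E Rg 0" "x = ?F c" by blast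
      then have "x = (\<lambda>i\<in>{..<l}. c (e i))" using F [of c] by auto
      then show "x \<in> {..<l} \<rightarrow>\<^sub>E Rg 0" using c by (auto simp: PiE_iff)
    qed
    show "(\<lambda>x. \<lambda>b\<in>?B. x (inv_into {..<l} e b)) ` ({..<l} \<rightarrow>\<^sub>E Rg 0) \<subseteq> ?B \<rightarrow>\<^sub>E Rg 0"
    proof (rule image_subsetI)
      fix x assume x: "x \<in> {..<l} \<rightarrow>\<^sub>E Rg 0"
      have "x (inv_into {..<l} e b) \<in> Rg 0" if "b \<in> ?B" for b
        using PiE_mem [OF x inv_into_into [OF that]] .
      then show "(\<lambda>b\<in>?B. x (inv_into {..<l} e b)) \<in> ?B \<rightarrow>\<^sub>E Rg 0"
        unfolding restrict_PiE_iff by blast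
    qed
  qed
  then show ?thesis
    unfolding fg_free_def using e_in by (intro exI [of _ ?B]) (auto simp del: restrict_PiE_iff)
qed

end

section \<open>Windows and their projectivity over R_0\<close>

context based_complex
begin

definition khom where
  "khom k \<phi> \<longleftrightarrow> (\<forall>n. \<phi> n \<in> rmodule_hom Kr (C n) (C (n + k)))"

lemma khomD:
  assumes "khom k \<phi>" "x \<in> carrier (C n)"
  shows khom_closed: "\<phi> n x \<in> carrier (C (n + k))"
    and khom_add: "y \<in> carrier (C n) \<Longrightarrow> \<phi> n (x \<oplus>\<^bsub>C n\<^esub> y) = \<phi> n x \<oplus>\<^bsub>C (n + k)\<^esub> \<phi> n y"
    and khom_rsmult: "r \<in> Rg 0 \<Longrightarrow> \<phi> n (x \<odot>\<^sub>r\<^bsub>C n\<^esub> r) = \<phi> n x \<odot>\<^sub>r\<^bsub>C (n + k)\<^esub> r"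
  using assms by (auto simp: khom_def rmodule_hom_def Pi_iff)

lemma khom_finsum:
  assumes "khom k \<phi>" "\<And>a. a \<in> A \<Longrightarrow> f a \<in> carrier (C n)"
  shows "\<phi> n (finsum (C n) f A) = (\<Oplus>\<^bsub>C (n + k)\<^esub>a\<in>A. \<phi> n (f a))"
  by (rule additive_finsum(2) [of "C n" "C (n + k)" "\<phi> n"])
    (use assms in \<open>auto simp: C.M.abelian_group_axioms khom_closed khom_add\<close>)

text \<open>The R_0-linear functionals on \<open>C n\<close>, from which the dual bases are
  made.\<close>

definition kfun where
  "kfun n \<psi> \<longleftrightarrow> (\<forall>x\<in>carrier (C n). \<psi> x \<in> Rg 0 \<and> (\<forall>y\<in>carrier (C n). \<psi> (x \<oplus>\<^bsub>C n\<^esub> y) = \<psi> x \<oplus> \<psi> y) \<and>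
     (\<forall>k\<in>Rg 0. \<psi> (x \<odot>\<^sub>r\<^bsub>C n\<^esub> k) = \<psi> x \<otimes> k))"

definition window where
  "window n E = {x \<in> carrier (C n). degs (vec n x) \<subseteq> E}"

lemma comp_rsmult0:
  assumes "a \<in> carrier R" "k \<in> Rg 0" shows "comp (a \<otimes> k) \<sigma> = comp a \<sigma> \<otimes> k"
  using comp_mult_homogeneous [OF assms] by simp

text \<open>A dual basis of the window: \<open>b u\<close> and \<open>v c\<^sub>b\<close> where \<open>\<Sum> u v = 1\<close> with \<open>u \<in> R\<^sub>\<sigma>\<close>,
  \<open>v \<in> R\<^sub>-\<^sub>\<sigma>\<close>.\<close>

lemma window_dual_basis:
  assumes E: "finite E"
  obtains l :: nat and g \<psi> where
    "\<And>i. i < l \<Longrightarrow> g i \<in> window n E" "\<And>i. kfun n (\<psi> i)"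
    "\<And>x. x \<in> window n E \<Longrightarrow> x = (\<Oplus>\<^bsub>C n\<^esub>i\<in>{..<l}. g i \<odot>\<^sub>r\<^bsub>C n\<^esub> \<psi> i x)"
    "B n = {} \<Longrightarrow> l = 0"
proof -
  have "\<exists>m u v. (\<forall>i::nat. u i \<in> Rg \<sigma>) \<and> (\<forall>i::nat. v i \<in> Rg (- \<sigma>)) \<and> (\<Oplus>i\<in>{..<m::nat}. u i \<otimes> v i) = \<one>" for \<sigma>
    using unit_decomposition [of \<sigma>] by metis
  then obtain m u v where uv: "\<And>\<sigma> i::nat. u \<sigma> i \<in> Rg \<sigma>" "\<And>\<sigma> i::nat. v \<sigma> i \<in> Rg (- \<sigma>)"
    "\<And>\<sigma>. (\<Oplus>i\<in>{..<m \<sigma>::nat}. u \<sigma> i \<otimes> v \<sigma> i) = \<one>"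
    by metis
  \<comment> \<open>The decompositions of the unit have different lengths for different degrees.
    Padding with zeros to a common length makes the index set a product.\<close>
  define L where "L = Max (insert 0 (m ` E))"
  have L: "m \<sigma> \<le> L" if "\<sigma> \<in> E" for \<sigma> using that E by (simp add: L_def)
  define u' where "u' \<sigma> i = (if i < m \<sigma> then u \<sigma> i else \<zero>)" for \<sigma> i
  have uc: "u' \<sigma> i \<in> Rg \<sigma>" "u' \<sigma> i \<in> carrier R" "v \<sigma> i \<in> carrier R" for \<sigma> i
    using uv(1) [of \<sigma> i] uv(2) [of \<sigma> i] by (auto simp: u'_def intro: Rg_carrier)
  have unit: "(\<Oplus>i\<in>{..<L}. u' \<sigma> i \<otimes> v \<sigma> i) = \<one>" if "\<sigma> \<in> E" for \<sigma>
  proof -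
    have "(\<Oplus>i\<in>{..<m \<sigma>}. u \<sigma> i \<otimes> v \<sigma> i) = (\<Oplus>i\<in>{..<L}. u' \<sigma> i \<otimes> v \<sigma> i)"
      by (rule add.finprod_mono_neutral_cong_left) (use L [OF that] uc in \<open>auto simp: u'_def\<close>)
    then show ?thesis using uv(3) by simp
  qed
  define X where "X = (B n \<times> E) \<times> {..<L}"
  have finX: "finite X" using E by (simp add: X_def)
  obtain h where h: "bij_betw h {..<card X} X"
    using ex_bij_betw_nat_finite [OF finX] by (auto simp: atLeast0LessThan)
  define G where "G p = fst (fst p) \<odot>\<^sub>r\<^bsub>C n\<^esub> u' (snd (fst p)) (snd p)" for p
  define \<Psi> where "\<Psi> p x = v (snd (fst p)) (snd p) \<otimes> comp (coord R (C n) (B n) x (fst (fst p))) (snd (fst p))" for p x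
  have bc: "b \<in> carrier (C n)" if "b \<in> B n" for b using C.basis_carrier [OF that] .
  have G: "G p \<in> window n E" if p: "p \<in> X" for p
  proof -
    let ?b = "fst (fst p)" and ?\<sigma> = "snd (fst p)"
    have b: "?b \<in> B n" "?\<sigma> \<in> E" using p by (auto simp: X_def mem_Times_iff)
    have c: "G p \<in> carrier (C n)"
      unfolding G_def by (rule C.rsmult_closed [OF bc [OF b(1)] uc(2)])
    have "degs (vec n (G p)) \<subseteq> {?\<sigma>}"
    proof
      fix \<tau> assume "\<tau> \<in> degs (vec n (G p))"
      then obtain j where "vec n (G p) (j, \<tau>) \<noteq> \<zero>" by (rule degsE)
      then have "vec n ?b (j, \<tau> - ?\<sigma>) \<otimes> u' ?\<sigma> (snd p) \<noteq> \<zero>"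
        unfolding G_def vec_rsmult_homogeneous [OF bc [OF b(1)] uc(1)] by simp
      then have "vec n ?b (j, \<tau> - ?\<sigma>) \<noteq> \<zero>"
        using uc(2) [of ?\<sigma> "snd p"] l_null by metis
      then show "\<tau> \<in> {?\<sigma>}" using vec_basis [OF b(1)] by (auto split: if_splits)
    qed
    then show ?thesis using b c by (auto simp: window_def)
  qed
  have cc: "comp (coord R (C n) (B n) x b) \<sigma> \<in> Rg \<sigma>" "comp (coord R (C n) (B n) x b) \<sigma> \<in> carrier R"
    if "x \<in> carrier (C n)" for x b \<sigma>
    using comp_in [OF C.co_closed [OF that]] Rg_carrier by blast+
  have \<Psi>: "kfun n (\<Psi> p)" for p
    unfolding kfun_def
  proof (intro ballI conjI)
    fix x assume x: "x \<in> carrier (C n)"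
    show "\<Psi> p x \<in> Rg 0"
      unfolding \<Psi>_def by (rule Rg_mult' [OF uv(2) cc(1) [OF x]]) simp
    show "\<Psi> p (x \<oplus>\<^bsub>C n\<^esub> y) = \<Psi> p x \<oplus> \<Psi> p y" if "y \<in> carrier (C n)" for y
      using x that cc uc by (simp add: \<Psi>_def C.co_add comp_add r_distr)
    show "\<Psi> p (x \<odot>\<^sub>r\<^bsub>C n\<^esub> k) = \<Psi> p x \<otimes> k" if "k \<in> Rg 0" for k
      using x that cc uc Rg0_carrier [OF that] by (simp add: \<Psi>_def C.co_rsmult comp_rsmult0 m_assoc)
  qed
  have expand: "x = (\<Oplus>\<^bsub>C n\<^esub>p\<in>X. G p \<odot>\<^sub>r\<^bsub>C n\<^esub> \<Psi> p x)" if x: "x \<in> window n E" for x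
  proof -
    let ?c = "\<lambda>b \<sigma>. comp (coord R (C n) (B n) x b) \<sigma>"
    have xc: "x \<in> carrier (C n)" using x by (simp add: window_def)
    have in1: "G p \<odot>\<^sub>r\<^bsub>C n\<^esub> \<Psi> p x = fst (fst p) \<odot>\<^sub>r\<^bsub>C n\<^esub> (u' (snd (fst p)) (snd p) \<otimes> v (snd (fst p)) (snd p) \<otimes> ?c (fst (fst p)) (snd (fst p)))"
      if "fst (fst p) \<in> B n" for p
      unfolding G_def \<Psi>_def using bc [OF that] uc cc [OF xc] by (simp add: C.rsmult_assoc m_assoc)
    have uvc: "u' \<sigma> i \<otimes> v \<sigma> i \<in> carrier R" for \<sigma> i
      using uc by simp
    have trip: "u' \<sigma> i \<otimes> v \<sigma> i \<otimes> ?c b \<sigma> \<in> carrier R" for b \<sigma> i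
      using uvc cc(2) [OF xc] by simp
    define f where "f p = (if fst (fst p) \<in> B n then G p \<odot>\<^sub>r\<^bsub>C n\<^esub> \<Psi> p x else \<zero>\<^bsub>C n\<^esub>)" for p
    have fc: "f p \<in> carrier (C n)" for p
      using bc in1 [of p] uc cc [OF xc] by (simp add: f_def C.rsmult_closed)
    have "(\<Oplus>\<^bsub>C n\<^esub>p\<in>X. G p \<odot>\<^sub>r\<^bsub>C n\<^esub> \<Psi> p x) = finsum (C n) f X"
    proof (rule C.M.finsum_cong' [OF refl])
      show "f \<in> X \<rightarrow> carrier (C n)" by (intro Pi_I fc)
      show "G p \<odot>\<^sub>r\<^bsub>C n\<^esub> \<Psi> p x = f p" if "p \<in> X" for p
        using that by (simp add: f_def X_def mem_Times_iff)
    qed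
    also have "\<dots> = (\<Oplus>\<^bsub>C n\<^esub>q\<in>B n \<times> E. \<Oplus>\<^bsub>C n\<^esub>i\<in>{..<L}. f (q, i))"
      unfolding X_def by (rule C.M.finsum_Times) (use E fc in auto)
    also have "\<dots> = (\<Oplus>\<^bsub>C n\<^esub>b\<in>B n. \<Oplus>\<^bsub>C n\<^esub>\<sigma>\<in>E. \<Oplus>\<^bsub>C n\<^esub>i\<in>{..<L}. f ((b, \<sigma>), i))"
      by (rule C.M.finsum_Times) (use E fc in \<open>auto intro: C.M.finsum_closed\<close>)
    also have "\<dots> = (\<Oplus>\<^bsub>C n\<^esub>b\<in>B n. b \<odot>\<^sub>r\<^bsub>C n\<^esub> coord R (C n) (B n) x b)"
    proof (rule C.M.finsum_cong' [OF refl])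
      fix b assume b: "b \<in> B n"
      have "(\<Oplus>\<^bsub>C n\<^esub>\<sigma>\<in>E. \<Oplus>\<^bsub>C n\<^esub>i\<in>{..<L}. f ((b, \<sigma>), i)) = (\<Oplus>\<^bsub>C n\<^esub>\<sigma>\<in>E. b \<odot>\<^sub>r\<^bsub>C n\<^esub> ?c b \<sigma>)"
      proof (rule C.M.finsum_cong' [OF refl])
        fix \<sigma> assume \<sigma>: "\<sigma> \<in> E"
        have "(\<Oplus>\<^bsub>C n\<^esub>i\<in>{..<L}. f ((b, \<sigma>), i)) = (\<Oplus>\<^bsub>C n\<^esub>i\<in>{..<L}. b \<odot>\<^sub>r\<^bsub>C n\<^esub> (u' \<sigma> i \<otimes> v \<sigma> i \<otimes> ?c b \<sigma>))"
          by (rule C.M.finsum_cong' [OF refl])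
            (simp_all add: b f_def in1 Pi_iff C.rsmult_closed bc trip)
        also have "\<dots> = b \<odot>\<^sub>r\<^bsub>C n\<^esub> (\<Oplus>i\<in>{..<L}. u' \<sigma> i \<otimes> v \<sigma> i \<otimes> ?c b \<sigma>)"
          by (rule C.rsmult_finsum [symmetric]) (simp_all add: b bc trip)
        also have "(\<Oplus>i\<in>{..<L}. u' \<sigma> i \<otimes> v \<sigma> i \<otimes> ?c b \<sigma>) = (\<Oplus>i\<in>{..<L}. u' \<sigma> i \<otimes> v \<sigma> i) \<otimes> ?c b \<sigma>"
          by (rule finsum_ldistr [symmetric]) (simp_all add: uvc cc(2) [OF xc] Pi_iff)
        finally show "(\<Oplus>\<^bsub>C n\<^esub>i\<in>{..<L}. f ((b, \<sigma>), i)) = b \<odot>\<^sub>r\<^bsub>C n\<^esub> ?c b \<sigma>"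
          using unit [OF \<sigma>] cc(2) [OF xc] by simp
      qed (simp add: b bc cc(2) [OF xc] Pi_iff C.rsmult_closed)
      also have "\<dots> = b \<odot>\<^sub>r\<^bsub>C n\<^esub> (\<Oplus>\<sigma>\<in>E. ?c b \<sigma>)"
        by (rule C.rsmult_finsum [symmetric]) (simp_all add: b bc cc(2) [OF xc])
      also have "(\<Oplus>\<sigma>\<in>E. ?c b \<sigma>) = fsum R (?c b)"
      proof (rule fsum_eq_finsum [symmetric, OF E cc(2) [OF xc]])
        fix \<sigma> assume "\<sigma> \<notin> E"
        then have "\<sigma> \<notin> degs (vec n x)" using x by (auto simp: window_def)
        then have "vec n x ((n, b), \<sigma>) = \<zero>" using degsI [of "vec n x" "((n, b), \<sigma>)"] by auto
        then show "?c b \<sigma> = \<zero>" by (simp add: vec_def)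
      qed
      also have "fsum R (?c b) = coord R (C n) (B n) x b"
        using fsum_comp [OF C.co_closed [OF xc]] by simp
      finally show "(\<Oplus>\<^bsub>C n\<^esub>\<sigma>\<in>E. \<Oplus>\<^bsub>C n\<^esub>i\<in>{..<L}. f ((b, \<sigma>), i)) = b \<odot>\<^sub>r\<^bsub>C n\<^esub> coord R (C n) (B n) x b" .
    qed (simp add: bc xc Pi_iff C.rsmult_closed)
    also have "\<dots> = x" by (rule C.co_expand [OF xc])
    finally show ?thesis ..
  qed
  show ?thesis
  proof (rule that [of "card X" "\<lambda>i. G (h i)" "\<lambda>i. \<Psi> (h i)"])
    have hX: "h i \<in> X" if "i < card X" for i using h that by (auto simp: bij_betw_def)
    show "G (h i) \<in> window n E" if "i < card X" for i using G hX that by blast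
    show "kfun n (\<Psi> (h i))" for i by (rule \<Psi>)
    show "x = (\<Oplus>\<^bsub>C n\<^esub>i\<in>{..<card X}. G (h i) \<odot>\<^sub>r\<^bsub>C n\<^esub> \<Psi> (h i) x)" if x: "x \<in> window n E" for x
    proof -
      have xc: "x \<in> carrier (C n)" using x by (simp add: window_def)
      have t: "G p \<odot>\<^sub>r\<^bsub>C n\<^esub> \<Psi> p x \<in> carrier (C n)" if "p \<in> X" for p
        using G [OF that] \<Psi> [of p] xc Rg0_carrier by (auto simp: window_def kfun_def intro!: C.rsmult_closed)
      have "(\<Oplus>\<^bsub>C n\<^esub>p\<in>h ` {..<card X}. G p \<odot>\<^sub>r\<^bsub>C n\<^esub> \<Psi> p x) = (\<Oplus>\<^bsub>C n\<^esub>i\<in>{..<card X}. G (h i) \<odot>\<^sub>r\<^bsub>C n\<^esub> \<Psi> (h i) x)"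
        by (rule C.M.finsum_reindex) (use h t in \<open>auto simp: bij_betw_def\<close>)
      moreover have "h ` {..<card X} = X" using h by (simp add: bij_betw_def)
      ultimately show ?thesis using expand [OF x] by simp
    qed
    \<comment> \<open>An empty basis gives rank zero, which is what keeps the dominating complex
      bounded.\<close>
    show "card X = 0" if "B n = {}" using that by (simp add: X_def)
  qed
qed

end

lemma rmodule_hom_comp:
  "f \<in> rmodule_hom K M N \<Longrightarrow> g \<in> rmodule_hom K N P \<Longrightarrow> (\<lambda>x. g (f x)) \<in> rmodule_hom K M P"
  unfolding rmodule_hom_def by (auto simp: Pi_iff)

section \<open>From a homotopy into windows to finite domination\<close>

context based_complex
begin

lemma window_carrier: "x \<in> window n E \<Longrightarrow> x \<in> carrier (C n)"
  by (simp add: window_def)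

lemma windowI:
  assumes "x \<in> carrier (C n)" "\<And>i. vec n x i \<noteq> \<zero> \<Longrightarrow> snd i \<in> E"
  shows "x \<in> window n E"
proof -
  have "degs (vec n x) \<subseteq> E"
  proof
    fix \<sigma> assume "\<sigma> \<in> degs (vec n x)"
    then obtain j where "vec n x (j, \<sigma>) \<noteq> \<zero>" by (rule degsE)
    then show "\<sigma> \<in> E" using assms(2) [of "(j, \<sigma>)"] by simp
  qed
  then show ?thesis using assms(1) by (simp add: window_def)
qed

lemma windowD: "x \<in> window n E \<Longrightarrow> vec n x i \<noteq> \<zero> \<Longrightarrow> snd i \<in> E"
  using degsI [of "vec n x" i] by (auto simp: window_def)

lemma window_mono: "x \<in> window n E \<Longrightarrow> E \<subseteq> E' \<Longrightarrow> x \<in> window n E'"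
  by (auto simp: window_def)

lemma window_zero: "\<zero>\<^bsub>C n\<^esub> \<in> window n E"
  by (rule windowI) auto

lemma window_add:
  assumes x: "x \<in> window n E" and y: "y \<in> window n E" shows "x \<oplus>\<^bsub>C n\<^esub> y \<in> window n E"
proof (rule windowI)
  note c = window_carrier [OF x] window_carrier [OF y]
  show "x \<oplus>\<^bsub>C n\<^esub> y \<in> carrier (C n)" using c by simp
  fix i assume "vec n (x \<oplus>\<^bsub>C n\<^esub> y) i \<noteq> \<zero>"
  then have "vec n x i \<noteq> \<zero> \<or> vec n y i \<noteq> \<zero>" using c by (auto simp: vec_add)
  then show "snd i \<in> E" using windowD [OF x] windowD [OF y] by blast
qed

lemma window_minus:
  assumes x: "x \<in> window n E" shows "\<ominus>\<^bsub>C n\<^esub> x \<in> window n E"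
proof (rule windowI)
  note c = window_carrier [OF x]
  show "\<ominus>\<^bsub>C n\<^esub> x \<in> carrier (C n)" using c by simp
  fix i assume "vec n (\<ominus>\<^bsub>C n\<^esub> x) i \<noteq> \<zero>"
  then have "vec n x i \<noteq> \<zero>" using c by (auto simp: vec_minus)
  then show "snd i \<in> E" using windowD [OF x] by blast
qed

lemma window_diff: "x \<in> window n E \<Longrightarrow> y \<in> window n E \<Longrightarrow> x \<ominus>\<^bsub>C n\<^esub> y \<in> window n E"
  unfolding a_minus_def by (intro window_add window_minus)

lemma window_finsum: "(\<And>a. a \<in> A \<Longrightarrow> f a \<in> window n E) \<Longrightarrow> finsum (C n) f A \<in> window n E"
  by (rule C.M.finsum_in) (auto intro: window_zero window_add window_carrier)

lemma window_rsmult: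
  assumes x: "x \<in> window n E" and r: "r \<in> carrier R"
  shows "x \<odot>\<^sub>r\<^bsub>C n\<^esub> r \<in> window n {\<alpha> + \<beta> | \<alpha> \<beta>. \<alpha> \<in> E \<and> comp r \<beta> \<noteq> \<zero>}"
proof (rule windowI)
  note c = window_carrier [OF x]
  show "x \<odot>\<^sub>r\<^bsub>C n\<^esub> r \<in> carrier (C n)" using c r by (rule C.rsmult_closed)
  fix i assume "vec n (x \<odot>\<^sub>r\<^bsub>C n\<^esub> r) i \<noteq> \<zero>"
  then have "mv R (\<lambda>i \<kappa>. vec n x (fst i, snd i - \<kappa>)) (comp r) i \<noteq> \<zero>"
    unfolding vec_rsmult [OF c r] star_def .
  then show "snd i \<in> {\<alpha> + \<beta> | \<alpha> \<beta>. \<alpha> \<in> E \<and> comp r \<beta> \<noteq> \<zero>}"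
  proof (rule mv_nonzeroE)
    fix \<kappa> assume nz: "vec n x (fst i, snd i - \<kappa>) \<noteq> \<zero>" "comp r \<kappa> \<noteq> \<zero>"
    have "snd i - \<kappa> \<in> E" using windowD [OF x nz(1)] by simp
    then show ?thesis
      using nz(2) by (intro CollectI exI [of _ "snd i - \<kappa>"] exI [of _ \<kappa>]) simp
  qed (use c r Rg_carrier [OF comp_in [OF r]] in simp_all)
qed

lemma window_rsmult_homogeneous:
  assumes x: "x \<in> window n E" and r: "r \<in> Rg \<mu>"
  shows "x \<odot>\<^sub>r\<^bsub>C n\<^esub> r \<in> window n ((\<lambda>\<sigma>. \<sigma> + \<mu>) ` E)"
proof (rule window_mono [OF window_rsmult [OF x Rg_carrier [OF r]]])
  show "{\<alpha> + \<beta> | \<alpha> \<beta>. \<alpha> \<in> E \<and> comp r \<beta> \<noteq> \<zero>} \<subseteq> (\<lambda>\<sigma>. \<sigma> + \<mu>) ` E"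
    using comp_homogeneous [OF r] by auto
qed

lemma window_rsmult0:
  assumes x: "x \<in> window n E" and r: "r \<in> Rg 0" shows "x \<odot>\<^sub>r\<^bsub>C n\<^esub> r \<in> window n E"
  using window_rsmult_homogeneous [OF x r] by simp

text \<open>The windows form a subcomplex. A dual basis gives maps \<open>j\<close> into a free
  module and \<open>r\<close> back with r j = 1 on the window, so e = j d r is a differential on the
  free modules and \<open>r\<close> is a chain map. The retraction is \<open>r\<close> after j p,
  where p = 1 + d k + k d has values in the windows, and r j p = p is homotopic to the identity by
  \<open>k\<close>.\<close>

lemma finitely_dominatedI:
  assumes k: "khom 1 k" and E: "\<And>n. finite (E n)"
    and dE: "\<And>n x. x \<in> window n (E n) \<Longrightarrow> d n x \<in> window (n - 1) (E (n - 1))"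
    and pE: "\<And>n x. x \<in> carrier (C n) \<Longrightarrow>
      x \<oplus>\<^bsub>C n\<^esub> d (n + 1) (k n x) \<oplus>\<^bsub>C n\<^esub> k (n - 1) (d n x) \<in> window n (E n)"
  shows "finitely_dominated Kr C d"
proof -
  let ?P = "\<lambda>n l g \<psi>. (\<forall>i<l::nat. g i \<in> window n (E n)) \<and> (\<forall>i. kfun n (\<psi> i)) \<and>
    (\<forall>x\<in>window n (E n). x = (\<Oplus>\<^bsub>C n\<^esub>i\<in>{..<l}. g i \<odot>\<^sub>r\<^bsub>C n\<^esub> \<psi> i x)) \<and> (B n = {} \<longrightarrow> l = 0)"
  have "\<exists>l g \<psi>. ?P n l g \<psi>" for n
  proof (rule window_dual_basis [OF E [of n], of n])
    fix l :: nat and g \<psi>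
    assume "\<And>i. i < l \<Longrightarrow> g i \<in> window n (E n)" "\<And>i. kfun n (\<psi> i)"
      "\<And>x. x \<in> window n (E n) \<Longrightarrow> x = (\<Oplus>\<^bsub>C n\<^esub>i\<in>{..<l}. g i \<odot>\<^sub>r\<^bsub>C n\<^esub> \<psi> i x)" "B n = {} \<Longrightarrow> l = 0"
    then show ?thesis by (intro exI [of _ l] exI [of _ g] exI [of _ \<psi>] conjI allI ballI impI)
  qed
  then have "\<forall>n. \<exists>l g \<psi>. ?P n l g \<psi>" by (rule allI)
  from choice [OF this] obtain l where "\<forall>n. \<exists>g \<psi>. ?P n (l n) g \<psi>" by (rule exE)
  from choice [OF this] obtain g where "\<forall>n. \<exists>\<psi>. ?P n (l n) (g n) \<psi>" by (rule exE)
  from choice [OF this] obtain \<psi> where Q': "\<forall>n. ?P n (l n) (g n) (\<psi> n)" by (rule exE)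
  note Q = Q' [THEN spec]
  have g: "g n i \<in> window n (E n)" if "i < l n" for n i
    by (rule Q [of n, THEN conjunct1, THEN spec, THEN mp, OF that])
  have \<psi>: "kfun n (\<psi> n i)" for n i
    by (rule Q [of n, THEN conjunct2, THEN conjunct1, THEN spec])
  have dual: "x = (\<Oplus>\<^bsub>C n\<^esub>i\<in>{..<l n}. g n i \<odot>\<^sub>r\<^bsub>C n\<^esub> \<psi> n i x)" if "x \<in> window n (E n)" for n x
    by (rule Q [of n, THEN conjunct2, THEN conjunct2, THEN conjunct1, THEN bspec, OF that])
  have l0: "l n = 0" if "B n = {}" for n
    by (rule Q [of n, THEN conjunct2, THEN conjunct2, THEN conjunct2, THEN mp, OF that])
  have gc: "g n i \<in> carrier (C n)" if "i < l n" for n i using window_carrier [OF g [OF that]] .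
  let ?D = "\<lambda>n. std_module R (Rg 0) (l n)"
  define r where "r n y = (\<Oplus>\<^bsub>C n\<^esub>i\<in>{..<l n}. g n i \<odot>\<^sub>r\<^bsub>C n\<^esub> y i)" for n y
  define j where "j n x = (\<lambda>i\<in>{..<l n}. \<psi> n i x)" for n x
  define p where "p n x = x \<oplus>\<^bsub>C n\<^esub> d (n + 1) (k n x) \<oplus>\<^bsub>C n\<^esub> k (n - 1) (d n x)" for n x
  have rj: "r n (j n x) = x" if x: "x \<in> window n (E n)" for n x
  proof -
    have xc: "x \<in> carrier (C n)" by (rule window_carrier [OF x])
    have "\<psi> n i x \<in> Rg 0" for i using \<psi> [of n i] xc by (simp add: kfun_def)
    then have "\<psi> n i x \<in> carrier R" for i by (rule Rg0_carrier)
    then have "r n (j n x) = (\<Oplus>\<^bsub>C n\<^esub>i\<in>{..<l n}. g n i \<odot>\<^sub>r\<^bsub>C n\<^esub> \<psi> n i x)"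
      unfolding r_def j_def by (intro C.M.finsum_cong' refl) (simp_all add: Pi_iff gc C.rsmult_closed)
    also have "\<dots> = x" by (rule dual [OF x, symmetric])
    finally show ?thesis .
  qed
  have entry: "y i \<in> Rg 0" "y i \<in> carrier R" if "y \<in> carrier (?D n)" "i < l n" for y n i
    using that Rg0_carrier by (auto simp: PiE_iff)
  have term_in: "g n i \<odot>\<^sub>r\<^bsub>C n\<^esub> y i \<in> window n (E n)" if "y \<in> carrier (?D n)" "i < l n" for y n i
    by (rule window_rsmult0 [OF g [OF that(2)] entry(1) [OF that]])
  have rw: "r n y \<in> window n (E n)" if "y \<in> carrier (?D n)" for n y
    unfolding r_def by (rule window_finsum) (use term_in [OF that] in blast)
  have r_hom: "r n \<in> rmodule_hom Kr (?D n) (C n)" for n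
    unfolding rmodule_hom_def
  proof (intro CollectI conjI ballI)
    show "r n \<in> carrier (?D n) \<rightarrow> carrier (C n)" using window_carrier [OF rw] by blast
    fix x assume x: "x \<in> carrier (?D n)"
    have t: "g n i \<odot>\<^sub>r\<^bsub>C n\<^esub> y i \<in> carrier (C n)" if "i < l n" "y \<in> carrier (?D n)" for i y
      by (rule window_carrier [OF term_in [OF that(2,1)]])
    show "r n (x \<oplus>\<^bsub>?D n\<^esub> y) = r n x \<oplus>\<^bsub>C n\<^esub> r n y" if y: "y \<in> carrier (?D n)" for y
    proof -
      have "r n (x \<oplus>\<^bsub>?D n\<^esub> y) = (\<Oplus>\<^bsub>C n\<^esub>i\<in>{..<l n}. g n i \<odot>\<^sub>r\<^bsub>C n\<^esub> x i \<oplus>\<^bsub>C n\<^esub> g n i \<odot>\<^sub>r\<^bsub>C n\<^esub> y i)"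
        unfolding r_def
      proof (rule C.M.finsum_cong' [OF refl])
        fix i assume "i \<in> {..<l n}"
        then show "g n i \<odot>\<^sub>r\<^bsub>C n\<^esub> (x \<oplus>\<^bsub>?D n\<^esub> y) i = g n i \<odot>\<^sub>r\<^bsub>C n\<^esub> x i \<oplus>\<^bsub>C n\<^esub> g n i \<odot>\<^sub>r\<^bsub>C n\<^esub> y i"
          using entry(2) [OF x] entry(2) [OF y] gc by (simp add: C.rsmult_add_right)
      qed (use t x y in blast)
      also have "\<dots> = r n x \<oplus>\<^bsub>C n\<^esub> r n y"
        unfolding r_def by (rule C.M.finsum_addf) (use t x y in blast)+
      finally show ?thesis .
    qed
    show "r n (x \<odot>\<^sub>r\<^bsub>?D n\<^esub> a) = r n x \<odot>\<^sub>r\<^bsub>C n\<^esub> a" if a: "a \<in> carrier Kr" for a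
    proof -
      have ac: "a \<in> carrier R" using a Rg0_carrier by simp
      have "r n x \<odot>\<^sub>r\<^bsub>C n\<^esub> a = (\<Oplus>\<^bsub>C n\<^esub>i\<in>{..<l n}. g n i \<odot>\<^sub>r\<^bsub>C n\<^esub> x i \<odot>\<^sub>r\<^bsub>C n\<^esub> a)"
        unfolding r_def by (rule C.finsum_rsmult [OF ac]) (use t x in blast)
      also have "\<dots> = r n (x \<odot>\<^sub>r\<^bsub>?D n\<^esub> a)"
        unfolding r_def
        by (rule C.M.finsum_cong' [OF refl]) (use entry(2) [OF x] gc ac in \<open>simp_all add: Pi_iff C.rsmult_assoc C.rsmult_closed\<close>)
      finally show ?thesis ..
    qed
  qed
  have j_hom: "j n \<in> rmodule_hom Kr (C n) (?D n)" for n
    unfolding rmodule_hom_def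
  proof (intro CollectI conjI ballI)
    have \<psi>': "\<psi> n i x \<in> Rg 0" if "x \<in> carrier (C n)" for i x using \<psi> [of n i] that by (simp add: kfun_def)
    then show "j n \<in> carrier (C n) \<rightarrow> carrier (?D n)" by (auto simp: j_def PiE_iff)
    fix x assume x: "x \<in> carrier (C n)"
    show "j n (x \<oplus>\<^bsub>C n\<^esub> y) = j n x \<oplus>\<^bsub>?D n\<^esub> j n y" if y: "y \<in> carrier (C n)" for y
      using \<psi> [of n] x y by (auto simp: j_def kfun_def fun_eq_iff restrict_def)
    show "j n (x \<odot>\<^sub>r\<^bsub>C n\<^esub> a) = j n x \<odot>\<^sub>r\<^bsub>?D n\<^esub> a" if a: "a \<in> carrier Kr" for a
      using \<psi> [of n] x a by (auto simp: j_def kfun_def fun_eq_iff restrict_def)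
  qed
  have d_hom: "d n \<in> rmodule_hom Kr (C n) (C (n - 1))" for n
    using rhom_d Rg0_carrier by (auto simp: rhom_def rmodule_hom_def)
  have kc: "k n x \<in> carrier (C (n + 1))" if "x \<in> carrier (C n)" for n x using khom_closed [OF k that] .
  have dk: "d (n + 1) (k n x) \<in> carrier (C n)" if "x \<in> carrier (C n)" for n x
    using d_closed [OF kc [OF that]] by simp
  have kd: "k (n - 1) (d n x) \<in> carrier (C n)" if "x \<in> carrier (C n)" for n x
    using kc [OF d_closed [OF that]] by simp
  have d_add: "d n (x \<oplus>\<^bsub>C n\<^esub> y) = d n x \<oplus>\<^bsub>C (n - 1)\<^esub> d n y" if "x \<in> carrier (C n)" "y \<in> carrier (C n)" for n x y
    using rhom_add [OF rhom_d that(1,2)] by simp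
  have p_hom: "p n \<in> rmodule_hom Kr (C n) (C n)" for n
    unfolding rmodule_hom_def
  proof (intro CollectI conjI ballI)
    show "p n \<in> carrier (C n) \<rightarrow> carrier (C n)" using dk kd by (simp add: p_def)
    fix x assume x: "x \<in> carrier (C n)"
    show "p n (x \<oplus>\<^bsub>C n\<^esub> y) = p n x \<oplus>\<^bsub>C n\<^esub> p n y" if y: "y \<in> carrier (C n)" for y
    proof -
      have "d (n + 1) (k n (x \<oplus>\<^bsub>C n\<^esub> y)) = d (n + 1) (k n x) \<oplus>\<^bsub>C n\<^esub> d (n + 1) (k n y)"
        using khom_add [OF k x y] d_add [OF kc [OF x] kc [OF y]] by simp
      moreover have "k (n - 1) (d n (x \<oplus>\<^bsub>C n\<^esub> y)) = k (n - 1) (d n x) \<oplus>\<^bsub>C n\<^esub> k (n - 1) (d n y)"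
        using khom_add [OF k d_closed [OF x] d_closed [OF y]] d_add [OF x y] by simp
      ultimately show ?thesis
        unfolding p_def using x y dk [OF x] dk [OF y] kd [OF x] kd [OF y] by (simp add: C.M.a_ac)
    qed
    show "p n (x \<odot>\<^sub>r\<^bsub>C n\<^esub> a) = p n x \<odot>\<^sub>r\<^bsub>C n\<^esub> a" if a: "a \<in> carrier Kr" for a
    proof -
      have a: "a \<in> Rg 0" "a \<in> carrier R" using that Rg0_carrier by simp_all
      have "d (n + 1) (k n (x \<odot>\<^sub>r\<^bsub>C n\<^esub> a)) = d (n + 1) (k n x) \<odot>\<^sub>r\<^bsub>C n\<^esub> a"
        using khom_rsmult [OF k x a(1)] rhom_rsmult [OF rhom_d kc [OF x] a(2)] by simp
      moreover have "k (n - 1) (d n (x \<odot>\<^sub>r\<^bsub>C n\<^esub> a)) = k (n - 1) (d n x) \<odot>\<^sub>r\<^bsub>C n\<^esub> a"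
        using khom_rsmult [OF k d_closed [OF x] a(1)] rhom_rsmult [OF rhom_d x a(2)] by simp
      ultimately show ?thesis
        unfolding p_def using x a dk [OF x] kd [OF x] by (simp add: C.rsmult_add_left)
    qed
  qed
  have d_zero: "d n \<zero>\<^bsub>C n\<^esub> = \<zero>\<^bsub>C (n - 1)\<^esub>" for n
    using rhom_finsum [OF rhom_d, of "{}" "\<lambda>_. undefined" n] by simp
  have k_zero: "k n \<zero>\<^bsub>C n\<^esub> = \<zero>\<^bsub>C (n + 1)\<^esub>" for n
    using khom_finsum [OF k, of "{}" "\<lambda>_. undefined" n] by simp
  have dd: "d (n - 1) (d n x) = \<zero>\<^bsub>C (n - 2)\<^esub>" if "x \<in> carrier (C n)" for n x
    by (rule d_d [OF that])
  have p_chain: "p (n - 1) (d n x) = d n (p n x)" if x: "x \<in> carrier (C n)" for n x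
  proof -
    note c = dk [OF x] kd [OF x] d_closed [OF x]
    have 1: "d n (d (n + 1) (k n x)) = \<zero>\<^bsub>C (n - 1)\<^esub>"
      using dd [OF kc [OF x]] by simp
    have "k (n - 1 - 1) (d (n - 1) (d n x)) = \<zero>\<^bsub>C (n - 1)\<^esub>"
      using dd [OF x] k_zero [of "n - 2"] by simp
    moreover have "d (n - 1 + 1) (k (n - 1) (d n x)) = d n (k (n - 1) (d n x))" by simp
    moreover have "d n (p n x) = d n x \<oplus>\<^bsub>C (n - 1)\<^esub> d n (d (n + 1) (k n x)) \<oplus>\<^bsub>C (n - 1)\<^esub> d n (k (n - 1) (d n x))"
      unfolding p_def using x c by (simp add: d_add)
    ultimately show ?thesis
      unfolding p_def [of "n - 1"] using c d_closed [OF c(2)] 1 by simp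
  qed
  have pc: "p n x \<in> carrier (C n)" if "x \<in> carrier (C n)" for n x
    using dk kd that by (simp add: p_def)
  have pw: "p n x \<in> window n (E n)" if "x \<in> carrier (C n)" for n x
    unfolding p_def by (rule pE [OF that])
  define e where "e n y = j (n - 1) (d n (r n y))" for n y
  have e_hom: "e n \<in> rmodule_hom Kr (?D n) (?D (n - 1))" for n
    unfolding e_def by (intro rmodule_hom_comp [OF rmodule_hom_comp [OF r_hom d_hom] j_hom])
  have rc: "r n y \<in> carrier (C n)" if "y \<in> carrier (?D n)" for n y using window_carrier [OF rw [OF that]] .
  have re: "r (n - 1) (e n y) = d n (r n y)" if "y \<in> carrier (?D n)" for n y
    unfolding e_def by (rule rj [OF dE [OF rw [OF that]]])
  have j_zero: "j n \<zero>\<^bsub>C n\<^esub> = \<zero>\<^bsub>?D n\<^esub>" for n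
    by (rule additive_zero [OF C.M.abelian_group_axioms std_module_group]) (use j_hom [of n] in \<open>auto simp: rmodule_hom_def\<close>)
  have "chain_complex Kr ?D e"
    unfolding chain_complex_def
  proof (intro conjI allI ballI)
    show "right_module Kr (?D n)" for n by (rule std_module_module)
    show "e n \<in> rmodule_hom Kr (?D n) (?D (n - 1))" for n by (rule e_hom)
    fix n y assume y: "y \<in> carrier (?D n)"
    have "e (n - 1) (e n y) = j (n - 1 - 1) (d (n - 1) (d n (r n y)))"
      using re [OF y] by (simp add: e_def [of "n - 1"])
    then show "e (n - 1) (e n y) = \<zero>\<^bsub>?D (n - 2)\<^esub>"
      using dd [OF rc [OF y]] j_zero [of "n - 2"] by simp
  qed
  moreover have "bounded_complex ?D"
    unfolding bounded_complex_def
  proof (rule finite_subset [OF _ finite_degrees])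
    show "{n. carrier (?D n) \<noteq> {\<zero>\<^bsub>?D n\<^esub>}} \<subseteq> {n. B n \<noteq> {}}"
      using l0 by (auto simp: PiE_iff fun_eq_iff extensional_def)
  qed
  moreover have "\<forall>n. fg_free Kr (?D n)" using std_module_fg_free by blast
  moreover have "chain_map Kr C d ?D e (\<lambda>n x. j n (p n x))"
    unfolding chain_map_def
  proof (intro conjI allI ballI)
    show "(\<lambda>x. j n (p n x)) \<in> rmodule_hom Kr (C n) (?D n)" for n
      by (rule rmodule_hom_comp [OF p_hom j_hom])
    fix n x assume x: "x \<in> carrier (C n)"
    show "j (n - 1) (p (n - 1) (d n x)) = e n (j n (p n x))"
      unfolding e_def rj [OF pw [OF x]] p_chain [OF x] ..
  qed
  moreover have "chain_map Kr ?D e C d r"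
    unfolding chain_map_def using r_hom re by blast
  moreover have "chain_homotopic Kr C d C d (\<lambda>n x. r n (j n (p n x))) (\<lambda>n x. x)"
    unfolding chain_homotopic_def
  proof (intro exI [of _ k] conjI allI ballI)
    show "k n \<in> rmodule_hom Kr (C n) (C (n + 1))" for n using k by (simp add: khom_def)
    fix n x assume x: "x \<in> carrier (C n)"
    have "p n x \<ominus>\<^bsub>C n\<^esub> x = d (n + 1) (k n x) \<oplus>\<^bsub>C n\<^esub> k (n - 1) (d n x)"
      unfolding p_def using x dk [OF x] kd [OF x]
      by (simp add: a_minus_def C.M.a_ac C.M.r_neg1 C.M.r_neg2 C.M.r_neg C.M.l_neg)
    then show "r n (j n (p n x)) \<ominus>\<^bsub>C n\<^esub> x = d (n + 1) (k n x) \<oplus>\<^bsub>C n\<^esub> k (n - 1) (d n x)"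
      unfolding rj [OF pw [OF x]] .
  qed
  ultimately show ?thesis
    unfolding finitely_dominated_def by blast
qed

text \<open>With k = - H the map 1 + d k + k d is minus the error of \<open>H\<close>, so it has
  values in a fixed box. What remains is to enlarge the box to windows that the differential
  preserves.\<close>

lemma finitely_dominated_of_glued:
  assumes H: "klin 1 H" "\<And>n z. finite_hvec_at n z \<Longrightarrow> finite (degs (H z))"
    and err: "\<And>n z i. finite_hvec_at n z \<Longrightarrow> Dm (H z) i \<oplus> H (Dm z) i \<ominus> z i \<noteq> \<zero> \<Longrightarrow>
      \<bar>fst (snd i)\<bar> \<le> M \<and> \<bar>snd (snd i)\<bar> \<le> M"
  shows "finitely_dominated Kr C d"
proof -
  obtain N where N: "finite N" "kernel_on J N Dk" "has_degree R (-1) Dk" by (rule D_row)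
  obtain L :: nat where L: "\<And>\<sigma>. \<sigma> \<in> N \<Longrightarrow> \<bar>fst \<sigma>\<bar> \<le> int L \<and> \<bar>snd \<sigma>\<bar> \<le> int L"
    using finite_bound [OF N(1)] by blast
  define k where "k n x = tot (n + 1) (\<lambda>i. \<ominus> H (vec n x) i)" for n x
  note H' = klin_minus [OF H(1)]
  have fv: "finite_hvec_at n (vec n x)" if "x \<in> carrier (C n)" for n x
    using hvec_at_vec [OF that] finite_degs_vec [OF that] by (simp add: finite_hvec_at_def)
  have Hc: "H (vec n x) i \<in> carrier R" if "x \<in> carrier (C n)" for n x i
    using klin_closed [OF H(1) fv [OF that]] .
  have kc: "k n x \<in> carrier (C (n + 1))" if "x \<in> carrier (C n)" for n x
    unfolding k_def by (rule tot_closed) (use Hc [OF that] in simp)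
  have vk: "vec (n + 1) (k n x) = (\<lambda>i. \<ominus> H (vec n x) i)" if x: "x \<in> carrier (C n)" for n x
    unfolding k_def
  proof (rule vec_tot [OF klinD(1) [OF H' fv [OF x]]])
    have "degs (\<lambda>i. \<ominus> H (vec n x) i) \<subseteq> degs (H (vec n x))"
    proof
      fix \<sigma> assume "\<sigma> \<in> degs (\<lambda>i. \<ominus> H (vec n x) i)"
      then obtain j where "\<ominus> H (vec n x) (j, \<sigma>) \<noteq> \<zero>" by (rule degsE)
      then have "H (vec n x) (j, \<sigma>) \<noteq> \<zero>" by auto
      then show "\<sigma> \<in> degs (H (vec n x))" using degsI [of "H (vec n x)" "(j, \<sigma>)"] by simp
    qed
    then show "finite (degs (\<lambda>i. \<ominus> H (vec n x) i))"
      using H(2) [OF fv [OF x]] by (rule finite_subset)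
  qed
  have khom: "khom 1 k"
    unfolding khom_def rmodule_hom_def
  proof (intro allI CollectI conjI ballI)
    show "k n \<in> carrier (C n) \<rightarrow> carrier (C (n + 1))" for n using kc by blast
    fix n x assume x: "x \<in> carrier (C n)"
    show "k n (x \<oplus>\<^bsub>C n\<^esub> y) = k n x \<oplus>\<^bsub>C (n + 1)\<^esub> k n y" if y: "y \<in> carrier (C n)" for y
    proof -
      have xy: "x \<oplus>\<^bsub>C n\<^esub> y \<in> carrier (C n)" using x y by simp
      have "vec n (x \<oplus>\<^bsub>C n\<^esub> y) = (\<lambda>i. vec n x i \<oplus> vec n y i)" using vec_add [OF x y] by auto
      then have "vec (n + 1) (k n (x \<oplus>\<^bsub>C n\<^esub> y)) = (\<lambda>i. \<ominus> H (\<lambda>i. vec n x i \<oplus> vec n y i) i)"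
        using vk [OF xy] by simp
      also have "\<dots> = vec (n + 1) (k n x \<oplus>\<^bsub>C (n + 1)\<^esub> k n y)"
      proof
        fix i show "\<ominus> H (\<lambda>i. vec n x i \<oplus> vec n y i) i = vec (n + 1) (k n x \<oplus>\<^bsub>C (n + 1)\<^esub> k n y) i"
          using fun_cong [OF klinD(3) [OF H' fv [OF x] fv [OF y]], of i] vec_add [OF kc [OF x] kc [OF y]]
            vk [OF x] vk [OF y] by simp
      qed
      finally have "vec (n + 1) (k n (x \<oplus>\<^bsub>C n\<^esub> y)) = vec (n + 1) (k n x \<oplus>\<^bsub>C (n + 1)\<^esub> k n y)" .
      then show ?thesis using vec_eq_iff [of _ "n + 1"] x y kc by simp
    qed
    show "k n (x \<odot>\<^sub>r\<^bsub>C n\<^esub> a) = k n x \<odot>\<^sub>r\<^bsub>C (n + 1)\<^esub> a" if a: "a \<in> carrier Kr" for a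
    proof -
      have a: "a \<in> Rg 0" "a \<in> carrier R" using that Rg0_carrier by simp_all
      have "vec n (x \<odot>\<^sub>r\<^bsub>C n\<^esub> a) = (\<lambda>i. vec n x i \<otimes> a)"
        using vec_rsmult_homogeneous [OF x a(1)] by auto
      then have "vec (n + 1) (k n (x \<odot>\<^sub>r\<^bsub>C n\<^esub> a)) = (\<lambda>i. \<ominus> H (\<lambda>i. vec n x i \<otimes> a) i)"
        using vk [OF C.rsmult_closed [OF x a(2)]] by simp
      also have "\<dots> = vec (n + 1) (k n x \<odot>\<^sub>r\<^bsub>C (n + 1)\<^esub> a)"
      proof
        fix i show "\<ominus> H (\<lambda>i. vec n x i \<otimes> a) i = vec (n + 1) (k n x \<odot>\<^sub>r\<^bsub>C (n + 1)\<^esub> a) i"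
          using fun_cong [OF klinD(2) [OF H' fv [OF x] a(1)], of i] vec_rsmult_homogeneous [OF kc [OF x] a(1)] vk [OF x] by simp
      qed
      finally have "vec (n + 1) (k n (x \<odot>\<^sub>r\<^bsub>C n\<^esub> a)) = vec (n + 1) (k n x \<odot>\<^sub>r\<^bsub>C (n + 1)\<^esub> a)" .
      then show ?thesis
        using vec_eq_iff [of _ "n + 1"] kc [OF x] kc [OF C.rsmult_closed [OF x a(2)]] a(2)
        by (simp add: C.rsmult_closed)
    qed
  qed
  define hi where "hi = Max (insert 0 (fst ` J))"
  have hi: "n \<le> hi" if ne: "B n \<noteq> {}" for n
  proof -
    obtain b where "b \<in> B n" using ne by blast
    then have "n \<in> fst ` J" using in_J [of n b] by force
    then show ?thesis using finite_J by (simp add: hi_def)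
  qed
  \<comment> \<open>The differential lowers the chain degree by one and moves degrees by at most
    \<open>L\<close>. The radius therefore starts at \<open>M\<close> in the highest chain degree
    and grows by \<open>L\<close> with each step down; above \<open>hi\<close> the complex is
    zero.\<close>
  define \<rho> where "\<rho> n = M + int L * max 0 (hi - n)" for n
  define E where "E n = {\<sigma> :: int \<times> int. \<bar>fst \<sigma>\<bar> \<le> \<rho> n \<and> \<bar>snd \<sigma>\<bar> \<le> \<rho> n}" for n
  show ?thesis
  proof (rule finitely_dominatedI [OF khom, of E])
    show "finite (E n)" for n unfolding E_def by (rule finite_box)
    show "d n x \<in> window (n - 1) (E (n - 1))" if x: "x \<in> window n (E n)" for n x
    proof (rule windowI [OF d_closed [OF window_carrier [OF x]]])
      fix i assume nz: "vec (n - 1) (d n x) i \<noteq> \<zero>"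
      note xc = window_carrier [OF x]
      have "Dm (vec n x) i \<noteq> \<zero>" using nz D_vec [OF xc] by simp
      then obtain m where m: "vec n x m \<noteq> \<zero>" "fst m \<in> J" "snd i - snd m \<in> N"
        using tker_nonzeroD [OF N(2) hvec_at_vec [OF xc]] by blast
      have "fst m \<in> {n} \<times> B n" using hvec_at_vec [OF xc] m(1) unfolding hvec_def by blast
      then have n: "n \<le> hi" using hi [of n] by auto
      have "max 0 (hi - (n - 1)) = max 0 (hi - n) + 1" using n by simp
      then have r: "\<rho> (n - 1) = \<rho> n + int L" by (simp add: \<rho>_def algebra_simps)
      have "snd m \<in> E n" by (rule windowD [OF x m(1)])
      moreover have "\<bar>fst (snd i - snd m)\<bar> \<le> int L \<and> \<bar>snd (snd i - snd m)\<bar> \<le> int L" by (rule L [OF m(3)])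
      ultimately show "snd i \<in> E (n - 1)"
        unfolding E_def r by (simp only: mem_Collect_eq fst_diff snd_diff) linarith
    qed
    show "x \<oplus>\<^bsub>C n\<^esub> d (n + 1) (k n x) \<oplus>\<^bsub>C n\<^esub> k (n - 1) (d n x) \<in> window n (E n)" if x: "x \<in> carrier (C n)" for n x
    proof (rule windowI)
      have dk: "d (n + 1) (k n x) \<in> carrier (C n)" using d_closed [OF kc [OF x]] by simp
      have kd: "k (n - 1) (d n x) \<in> carrier (C n)" using kc [OF d_closed [OF x]] by simp
      show "x \<oplus>\<^bsub>C n\<^esub> d (n + 1) (k n x) \<oplus>\<^bsub>C n\<^esub> k (n - 1) (d n x) \<in> carrier (C n)" using x dk kd by simp
      fix i assume nz: "vec n (x \<oplus>\<^bsub>C n\<^esub> d (n + 1) (k n x) \<oplus>\<^bsub>C n\<^esub> k (n - 1) (d n x)) i \<noteq> \<zero>"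
      let ?z = "vec n x"
      have 1: "vec n (d (n + 1) (k n x)) i = \<ominus> Dm (H ?z) i"
        using fun_cong [OF D_vec [OF kc [OF x]], of i] vk [OF x]
          fun_cong [OF D_minus [of "H ?z", OF Hc [OF x]], of i] by simp
      have 2: "vec n (k (n - 1) (d n x)) i = \<ominus> H (Dm ?z) i"
        using fun_cong [OF vk [OF d_closed [OF x]], of i] D_vec [OF x] by simp
      have c: "Dm (H ?z) i \<in> carrier R" "H (Dm ?z) i \<in> carrier R" "?z i \<in> carrier R"
        using D_closed [of "H ?z" i, OF Hc [OF x]] klin_closed [OF H(1) finite_hvec_at_D [OF fv [OF x]]] x by simp_all
      have "Dm (H ?z) i \<oplus> H (Dm ?z) i \<ominus> ?z i \<noteq> \<zero>"
      proof
        assume z: "Dm (H ?z) i \<oplus> H (Dm ?z) i \<ominus> ?z i = \<zero>"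
        have "?z i \<oplus> \<ominus> Dm (H ?z) i \<oplus> \<ominus> H (Dm ?z) i = \<ominus> (Dm (H ?z) i \<oplus> H (Dm ?z) i \<ominus> ?z i)"
          using c by algebra
        then show False using nz z x dk kd by (simp add: vec_add 1 2)
      qed
      from err [OF fv [OF x] this] have "\<bar>fst (snd i)\<bar> \<le> M \<and> \<bar>snd (snd i)\<bar> \<le> M" .
      moreover have "M \<le> \<rho> n" by (simp add: \<rho>_def)
      ultimately show "snd i \<in> E n" unfolding E_def by (simp only: mem_Collect_eq) linarith
    qed
  qed
qed

end

subsection \<open>Pushing a finitely dominated complex\<close>

abbreviation tr :: "int \<times> int \<Rightarrow> (int \<times> int) set \<Rightarrow> (int \<times> int) set" where
  "tr \<tau> E \<equiv> (\<lambda>\<sigma>. \<sigma> + \<tau>) ` E"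

context based_complex
begin

text \<open>A window is finitely generated over R_0 and multiplication by R_0 preserves degrees, so
  the degrees of the images of the generators suffice.\<close>

lemma window_map:
  assumes \<phi>: "khom k \<phi>" and E: "finite E"
  shows "\<exists>E'. finite E' \<and> (\<forall>x\<in>window n E. \<phi> n x \<in> window (n + k) E')"
proof (rule window_dual_basis [OF E, of n])
  fix l :: nat and g \<psi>
  assume g: "\<And>i. i < l \<Longrightarrow> g i \<in> window n E" and \<psi>: "\<And>i. kfun n (\<psi> i)"
    and x: "\<And>x. x \<in> window n E \<Longrightarrow> x = (\<Oplus>\<^bsub>C n\<^esub>i\<in>{..<l}. g i \<odot>\<^sub>r\<^bsub>C n\<^esub> \<psi> i x)"
  let ?E = "\<Union>i\<in>{..<l}. degs (vec (n + k) (\<phi> n (g i)))"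
  have gc: "g i \<in> carrier (C n)" if "i < l" for i using window_carrier [OF g [OF that]] .
  have c: "\<phi> n (g i) \<in> window (n + k) ?E" if "i < l" for i
    using khom_closed [OF \<phi> gc [OF that]] that by (auto simp: window_def)
  show ?thesis
  proof (intro exI [of _ ?E] conjI ballI)
    show "finite ?E"
      using khom_closed [OF \<phi> gc] by (intro finite_UN_I) auto
    fix y assume y: "y \<in> window n E"
    have yc: "y \<in> carrier (C n)" by (rule window_carrier [OF y])
    have \<psi>y: "\<psi> i y \<in> Rg 0" for i using \<psi> [of i] yc by (simp add: kfun_def)
    have "\<phi> n y = \<phi> n (\<Oplus>\<^bsub>C n\<^esub>i\<in>{..<l}. g i \<odot>\<^sub>r\<^bsub>C n\<^esub> \<psi> i y)" using x [OF y] by simp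
    also have "\<dots> = (\<Oplus>\<^bsub>C (n + k)\<^esub>i\<in>{..<l}. \<phi> n (g i \<odot>\<^sub>r\<^bsub>C n\<^esub> \<psi> i y))"
      by (rule khom_finsum [OF \<phi>]) (use gc \<psi>y Rg0_carrier in \<open>auto intro!: C.rsmult_closed\<close>)
    also have "\<dots> \<in> window (n + k) ?E"
    proof (rule window_finsum)
      fix i assume i: "i \<in> {..<l}"
      then have "\<phi> n (g i \<odot>\<^sub>r\<^bsub>C n\<^esub> \<psi> i y) = \<phi> n (g i) \<odot>\<^sub>r\<^bsub>C (n + k)\<^esub> \<psi> i y"
        using khom_rsmult [OF \<phi> gc \<psi>y] by simp
      also have "\<dots> \<in> window (n + k) ?E" by (rule window_rsmult0 [OF c \<psi>y]) (use i in simp)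
      finally show "\<phi> n (g i \<odot>\<^sub>r\<^bsub>C n\<^esub> \<psi> i y) \<in> window (n + k) ?E" .
    qed
    finally show "\<phi> n y \<in> window (n + k) ?E" .
  qed
qed

definition basis_ext where
  "basis_ext n y x = (\<Oplus>\<^bsub>C (n + 1)\<^esub>b\<in>B n. y b \<odot>\<^sub>r\<^bsub>C (n + 1)\<^esub> coord R (C n) (B n) x b)"

lemma basis_ext_hom:
  assumes y: "\<And>b. b \<in> B n \<Longrightarrow> y b \<in> carrier (C (n + 1))"
  shows "basis_ext n y \<in> rmodule_hom R (C n) (C (n + 1))"
  unfolding rmodule_hom_def
proof (intro CollectI conjI ballI)
  have t: "y b \<odot>\<^sub>r\<^bsub>C (n + 1)\<^esub> coord R (C n) (B n) x b \<in> carrier (C (n + 1))" if "b \<in> B n" "x \<in> carrier (C n)" for b x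
    by (rule C.rsmult_closed [OF y [OF that(1)] C.co_closed [OF that(2)]])
  show "basis_ext n y \<in> carrier (C n) \<rightarrow> carrier (C (n + 1))"
    unfolding basis_ext_def by (intro Pi_I C.M.finsum_closed t)
  fix x assume x: "x \<in> carrier (C n)"
  show "basis_ext n y (x \<oplus>\<^bsub>C n\<^esub> z) = basis_ext n y x \<oplus>\<^bsub>C (n + 1)\<^esub> basis_ext n y z" if z: "z \<in> carrier (C n)" for z
  proof -
    have "basis_ext n y (x \<oplus>\<^bsub>C n\<^esub> z) = (\<Oplus>\<^bsub>C (n + 1)\<^esub>b\<in>B n. y b \<odot>\<^sub>r\<^bsub>C (n + 1)\<^esub> coord R (C n) (B n) x b \<oplus>\<^bsub>C (n + 1)\<^esub>
        y b \<odot>\<^sub>r\<^bsub>C (n + 1)\<^esub> coord R (C n) (B n) z b)"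
      unfolding basis_ext_def
      by (rule C.M.finsum_cong' [OF refl]) (use t x z y in \<open>simp_all add: C.co_add C.rsmult_add_right Pi_iff\<close>)
    also have "\<dots> = basis_ext n y x \<oplus>\<^bsub>C (n + 1)\<^esub> basis_ext n y z"
      unfolding basis_ext_def by (rule C.M.finsum_addf) (intro Pi_I t x z, assumption)+
    finally show ?thesis .
  qed
  show "basis_ext n y (x \<odot>\<^sub>r\<^bsub>C n\<^esub> r) = basis_ext n y x \<odot>\<^sub>r\<^bsub>C (n + 1)\<^esub> r" if r: "r \<in> carrier R" for r
  proof -
    have "basis_ext n y x \<odot>\<^sub>r\<^bsub>C (n + 1)\<^esub> r = (\<Oplus>\<^bsub>C (n + 1)\<^esub>b\<in>B n. y b \<odot>\<^sub>r\<^bsub>C (n + 1)\<^esub> coord R (C n) (B n) x b \<odot>\<^sub>r\<^bsub>C (n + 1)\<^esub> r)"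
      unfolding basis_ext_def by (rule C.finsum_rsmult [OF r]) (intro t x, assumption)
    also have "\<dots> = basis_ext n y (x \<odot>\<^sub>r\<^bsub>C n\<^esub> r)"
      unfolding basis_ext_def
      by (rule C.M.finsum_cong' [OF refl]) (use t x y r in \<open>simp_all add: C.co_rsmult C.rsmult_assoc C.rsmult_closed Pi_iff\<close>)
    finally show ?thesis ..
  qed
qed

lemma basis_ext_basis:
  assumes y: "\<And>b. b \<in> B n \<Longrightarrow> y b \<in> carrier (C (n + 1))" and b: "b \<in> B n"
  shows "basis_ext n y b = y b"
proof -
  have "basis_ext n y b = (\<Oplus>\<^bsub>C (n + 1)\<^esub>b'\<in>B n. if b = b' then y b' else \<zero>\<^bsub>C (n + 1)\<^esub>)"
    unfolding basis_ext_def
    by (rule C.M.finsum_cong' [OF refl]) (use y b in \<open>auto simp: C.co_basis C.rsmult_one\<close>)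
  also have "\<dots> = y b"
    by (rule C.M.finsum_singleton) (use y b in auto)
  finally show ?thesis .
qed

text \<open>With 1 = \<Sum> u v, where u has degree \<open>- \<tau>\<close> and v degree
  \<open>\<tau>\<close>, the homotopy is conjugated: x is multiplied by u, \<open>h\<close> is
  applied, and the result is multiplied by v. As d is R-linear, 1 + d h' + h' d is the conjugate of
  1 + d h + h d, and all windows are translated by \<open>\<tau>\<close>.\<close>

lemma translated_homotopy:
  assumes h: "khom 1 h" and F: "\<And>n x. x \<in> carrier (C n) \<Longrightarrow>
      x \<oplus>\<^bsub>C n\<^esub> d (n + 1) (h n x) \<oplus>\<^bsub>C n\<^esub> h (n - 1) (d n x) \<in> window n (F n)"
  shows "\<exists>h'. (\<forall>n. \<forall>x\<in>carrier (C n). h' n x \<in> carrier (C (n + 1)) \<and>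
      x \<oplus>\<^bsub>C n\<^esub> d (n + 1) (h' n x) \<oplus>\<^bsub>C n\<^esub> h' (n - 1) (d n x) \<in> window n (tr \<tau> (F n))) \<and>
    (\<forall>n E E'. (\<forall>x\<in>window n E. h n x \<in> window (n + 1) E') \<longrightarrow>
      (\<forall>x\<in>window n (tr \<tau> E). h' n x \<in> window (n + 1) (tr \<tau> E')))"
proof -
  obtain l :: nat and u v where uv: "\<And>i. u i \<in> Rg (- \<tau>)" "\<And>i. v i \<in> Rg (- (- \<tau>))"
      "(\<Oplus>i\<in>{..<l}. u i \<otimes> v i) = \<one>"
    using unit_decomposition [of "- \<tau>"] by metis
  have u: "u i \<in> carrier R" and v: "v i \<in> Rg \<tau>" "v i \<in> carrier R" for i
    using Rg_carrier [OF uv(1) [of i]] Rg_carrier [OF uv(2) [of i]] uv(2) [of i] by simp_all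
  define h' where "h' n x = (\<Oplus>\<^bsub>C (n + 1)\<^esub>i\<in>{..<l}. h n (x \<odot>\<^sub>r\<^bsub>C n\<^esub> u i) \<odot>\<^sub>r\<^bsub>C (n + 1)\<^esub> v i)" for n x
  have hc: "h n x \<in> carrier (C (n + 1))" if "x \<in> carrier (C n)" for n x by (rule khom_closed [OF h that])
  have xu: "x \<odot>\<^sub>r\<^bsub>C n\<^esub> u i \<in> carrier (C n)" if "x \<in> carrier (C n)" for n x i by (rule C.rsmult_closed [OF that u])
  have hvec: "h n (x \<odot>\<^sub>r\<^bsub>C n\<^esub> u i) \<odot>\<^sub>r\<^bsub>C (n + 1)\<^esub> v i \<in> carrier (C (n + 1))" if "x \<in> carrier (C n)" for n x i
    by (rule C.rsmult_closed [OF hc [OF xu [OF that]] v(2)])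
  show ?thesis
  proof (intro exI [of _ h'] conjI allI ballI impI)
    fix n x assume x: "x \<in> carrier (C n)"
    show "h' n x \<in> carrier (C (n + 1))"
      unfolding h'_def by (intro C.M.finsum_closed Pi_I hvec x)
    let ?p = "\<lambda>y. y \<oplus>\<^bsub>C n\<^esub> d (n + 1) (h n y) \<oplus>\<^bsub>C n\<^esub> h (n - 1) (d n y)"
    have dh: "d (n + 1) (h n y) \<in> carrier (C n)" "h (n - 1) (d n y) \<in> carrier (C n)" if "y \<in> carrier (C n)" for y
      using d_closed [OF hc [OF that]] hc [OF d_closed [OF that]] by simp_all
    have t1: "x \<odot>\<^sub>r\<^bsub>C n\<^esub> u i \<odot>\<^sub>r\<^bsub>C n\<^esub> v i \<in> carrier (C n)"
      "d (n + 1) (h n (x \<odot>\<^sub>r\<^bsub>C n\<^esub> u i)) \<odot>\<^sub>r\<^bsub>C n\<^esub> v i \<in> carrier (C n)"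
      "h (n - 1) (d n (x \<odot>\<^sub>r\<^bsub>C n\<^esub> u i)) \<odot>\<^sub>r\<^bsub>C n\<^esub> v i \<in> carrier (C n)" for i
      by (rule C.rsmult_closed [OF _ v(2)], simp_all add: xu x dh)+
    have e1: "x = (\<Oplus>\<^bsub>C n\<^esub>i\<in>{..<l}. x \<odot>\<^sub>r\<^bsub>C n\<^esub> u i \<odot>\<^sub>r\<^bsub>C n\<^esub> v i)"
    proof -
      have "x = x \<odot>\<^sub>r\<^bsub>C n\<^esub> (\<Oplus>i\<in>{..<l}. u i \<otimes> v i)" using uv(3) x by (simp add: C.rsmult_one)
      also have "\<dots> = (\<Oplus>\<^bsub>C n\<^esub>i\<in>{..<l}. x \<odot>\<^sub>r\<^bsub>C n\<^esub> (u i \<otimes> v i))"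
        by (rule C.rsmult_finsum [OF x]) (simp add: u v)
      also have "\<dots> = (\<Oplus>\<^bsub>C n\<^esub>i\<in>{..<l}. x \<odot>\<^sub>r\<^bsub>C n\<^esub> u i \<odot>\<^sub>r\<^bsub>C n\<^esub> v i)"
        by (rule C.M.finsum_cong' [OF refl]) (simp_all add: x u v C.rsmult_assoc t1 Pi_iff)
      finally show ?thesis .
    qed
    have e2: "d (n + 1) (h' n x) = (\<Oplus>\<^bsub>C n\<^esub>i\<in>{..<l}. d (n + 1) (h n (x \<odot>\<^sub>r\<^bsub>C n\<^esub> u i)) \<odot>\<^sub>r\<^bsub>C n\<^esub> v i)"
    proof -
      have "d (n + 1) (h' n x) = (\<Oplus>\<^bsub>C (n + 1 + -1)\<^esub>i\<in>{..<l}. d (n + 1) (h n (x \<odot>\<^sub>r\<^bsub>C n\<^esub> u i) \<odot>\<^sub>r\<^bsub>C (n + 1)\<^esub> v i))"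
        unfolding h'_def by (rule rhom_finsum [OF rhom_d]) (rule hvec [OF x])
      also have "\<dots> = (\<Oplus>\<^bsub>C n\<^esub>i\<in>{..<l}. d (n + 1) (h n (x \<odot>\<^sub>r\<^bsub>C n\<^esub> u i)) \<odot>\<^sub>r\<^bsub>C n\<^esub> v i)"
        using rhom_rsmult [OF rhom_d hc [OF xu [OF x]] v(2)] by simp
      finally show ?thesis .
    qed
    have e3: "h' (n - 1) (d n x) = (\<Oplus>\<^bsub>C n\<^esub>i\<in>{..<l}. h (n - 1) (d n (x \<odot>\<^sub>r\<^bsub>C n\<^esub> u i)) \<odot>\<^sub>r\<^bsub>C n\<^esub> v i)"
      unfolding h'_def using rhom_rsmult [OF rhom_d x u] by simp
    have "x \<oplus>\<^bsub>C n\<^esub> d (n + 1) (h' n x) \<oplus>\<^bsub>C n\<^esub> h' (n - 1) (d n x) = (\<Oplus>\<^bsub>C n\<^esub>i\<in>{..<l}. ?p (x \<odot>\<^sub>r\<^bsub>C n\<^esub> u i) \<odot>\<^sub>r\<^bsub>C n\<^esub> v i)"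
    proof -
      have "(\<Oplus>\<^bsub>C n\<^esub>i\<in>{..<l}. ?p (x \<odot>\<^sub>r\<^bsub>C n\<^esub> u i) \<odot>\<^sub>r\<^bsub>C n\<^esub> v i) =
        (\<Oplus>\<^bsub>C n\<^esub>i\<in>{..<l}. x \<odot>\<^sub>r\<^bsub>C n\<^esub> u i \<odot>\<^sub>r\<^bsub>C n\<^esub> v i \<oplus>\<^bsub>C n\<^esub> d (n + 1) (h n (x \<odot>\<^sub>r\<^bsub>C n\<^esub> u i)) \<odot>\<^sub>r\<^bsub>C n\<^esub> v i
          \<oplus>\<^bsub>C n\<^esub> h (n - 1) (d n (x \<odot>\<^sub>r\<^bsub>C n\<^esub> u i)) \<odot>\<^sub>r\<^bsub>C n\<^esub> v i)"
        by (rule C.M.finsum_cong' [OF refl]) (simp_all add: Pi_iff t1 C.rsmult_add_left xu x dh v)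
      also have "\<dots> = (\<Oplus>\<^bsub>C n\<^esub>i\<in>{..<l}. x \<odot>\<^sub>r\<^bsub>C n\<^esub> u i \<odot>\<^sub>r\<^bsub>C n\<^esub> v i \<oplus>\<^bsub>C n\<^esub> d (n + 1) (h n (x \<odot>\<^sub>r\<^bsub>C n\<^esub> u i)) \<odot>\<^sub>r\<^bsub>C n\<^esub> v i)
          \<oplus>\<^bsub>C n\<^esub> h' (n - 1) (d n x)"
        unfolding e3 by (rule C.M.finsum_addf) (simp_all add: Pi_iff t1)
      also have "(\<Oplus>\<^bsub>C n\<^esub>i\<in>{..<l}. x \<odot>\<^sub>r\<^bsub>C n\<^esub> u i \<odot>\<^sub>r\<^bsub>C n\<^esub> v i \<oplus>\<^bsub>C n\<^esub> d (n + 1) (h n (x \<odot>\<^sub>r\<^bsub>C n\<^esub> u i)) \<odot>\<^sub>r\<^bsub>C n\<^esub> v i)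
          = (\<Oplus>\<^bsub>C n\<^esub>i\<in>{..<l}. x \<odot>\<^sub>r\<^bsub>C n\<^esub> u i \<odot>\<^sub>r\<^bsub>C n\<^esub> v i) \<oplus>\<^bsub>C n\<^esub> d (n + 1) (h' n x)"
        unfolding e2 by (rule C.M.finsum_addf) (simp_all add: Pi_iff t1)
      finally show ?thesis using e1 by simp
    qed
    also have "\<dots> \<in> window n (tr \<tau> (F n))"
      by (intro window_finsum window_rsmult_homogeneous [OF F v(1)] xu x)
    finally show "x \<oplus>\<^bsub>C n\<^esub> d (n + 1) (h' n x) \<oplus>\<^bsub>C n\<^esub> h' (n - 1) (d n x) \<in> window n (tr \<tau> (F n))" .
  next
    fix n E E' x
    assume hE: "\<forall>x\<in>window n E. h n x \<in> window (n + 1) E'" and x: "x \<in> window n (tr \<tau> E)"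
    have "tr (- \<tau>) (tr \<tau> E) = E" by (simp add: image_image)
    then have "x \<odot>\<^sub>r\<^bsub>C n\<^esub> u i \<in> window n E" for i
      using window_rsmult_homogeneous [OF x uv(1) [of i]] by simp
    then show "h' n x \<in> window (n + 1) (tr \<tau> E')"
      unfolding h'_def using hE by (intro window_finsum window_rsmult_homogeneous [OF _ v(1)]) blast
  qed
qed

text \<open>The error of \<open>G\<close> as a contraction, at an element of chain degree
  \<open>n\<close>.\<close>

definition pushed where
  "pushed G n b = b \<ominus>\<^bsub>C n\<^esub> d (n + 1) (G n b) \<ominus>\<^bsub>C n\<^esub> G (n - 1) (d n b)"

text \<open>For a basis element b of degree \<open>n\<close> put q = b - G d b and let G b = - h' q
  with the translated homotopy h'. Then b - d G b - G d b = (q + d h' q + h' d q) - h' d q. The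
  bracket lies in the translated window \<open>F n\<close>. Moreover d q is the error of G at d b,
  which is controlled by induction and then by \<open>h\<close>.\<close>

lemma push_step:
  assumes h: "khom 1 h" and finF: "\<And>n. finite (F n)" and F: "\<And>n x. x \<in> carrier (C n) \<Longrightarrow>
      x \<oplus>\<^bsub>C n\<^esub> d (n + 1) (h n x) \<oplus>\<^bsub>C n\<^esub> h (n - 1) (d n x) \<in> window n (F n)"
    and E: "finite E" and IH: "\<And>\<tau>. \<exists>G. rhom 1 G \<and> (\<forall>m<n. \<forall>b\<in>B m. pushed G m b \<in> window m (tr \<tau> E))"
  shows "\<exists>E'. finite E' \<and> (\<forall>\<tau>. \<exists>G. rhom 1 G \<and> (\<forall>m<n + 1. \<forall>b\<in>B m. pushed G m b \<in> window m (tr \<tau> E')))"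
proof -
  obtain N where N: "finite N" "kernel_on J N Dk" "has_degree R (-1) Dk" by (rule D_row)
  \<comment> \<open>\<open>E1\<close> allows for the degrees of the coordinates of d b, which lie in
    \<open>N\<close>, and \<open>E2\<close> for the effect of \<open>h\<close>. Both are fixed
    before \<open>\<tau>\<close> is introduced, so the final set does not depend on
    \<open>\<tau>\<close>.\<close>
  define E1 where "E1 = (\<lambda>(\<alpha>, \<beta>). \<alpha> + \<beta>) ` (E \<times> N)"
  have finE1: "finite E1" unfolding E1_def using E N(1) by blast
  obtain E2 where E2: "finite E2" "\<And>x. x \<in> window (n - 1) E1 \<Longrightarrow> h (n - 1) x \<in> window n E2"
    using window_map [OF h finE1, of "n - 1"] by auto
  define E' where "E' = E \<union> F n \<union> E2"
  have "\<exists>G. rhom 1 G \<and> (\<forall>m<n + 1. \<forall>b\<in>B m. pushed G m b \<in> window m (tr \<tau> E'))" for \<tau>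
  proof -
    obtain G where G: "rhom 1 G" "\<And>m b. m < n \<Longrightarrow> b \<in> B m \<Longrightarrow> pushed G m b \<in> window m (tr \<tau> E)"
      using IH [of \<tau>] by blast
    obtain h' where h': "\<And>n x. x \<in> carrier (C n) \<Longrightarrow> h' n x \<in> carrier (C (n + 1))"
      "\<And>n x. x \<in> carrier (C n) \<Longrightarrow>
        x \<oplus>\<^bsub>C n\<^esub> d (n + 1) (h' n x) \<oplus>\<^bsub>C n\<^esub> h' (n - 1) (d n x) \<in> window n (tr \<tau> (F n))"
      "\<And>n E E' x. (\<forall>x\<in>window n E. h n x \<in> window (n + 1) E') \<Longrightarrow> x \<in> window n (tr \<tau> E) \<Longrightarrow>
        h' n x \<in> window (n + 1) (tr \<tau> E')"
      using translated_homotopy [OF h F, of \<tau>] by blast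
    have Gc: "G m x \<in> carrier (C (m + 1))" if "x \<in> carrier (C m)" for m x by (rule rhom_closed [OF G(1) that])
    have Gd: "G (m - 1) (d m x) \<in> carrier (C m)" if "x \<in> carrier (C m)" for m x
      using Gc [OF d_closed [OF that]] by simp
    have dG: "d (m + 1) (G m x) \<in> carrier (C m)" if "x \<in> carrier (C m)" for m x
      using d_closed [OF Gc [OF that]] by simp
    have G0: "G m \<zero>\<^bsub>C m\<^esub> = \<zero>\<^bsub>C (m + 1)\<^esub>" for m
      using rhom_finsum [OF G(1), of "{}" "\<lambda>_. undefined" m] by simp
    have d_diff: "d m (x \<ominus>\<^bsub>C m\<^esub> y) = d m x \<ominus>\<^bsub>C (m - 1)\<^esub> d m y" and d_neg: "d m (\<ominus>\<^bsub>C m\<^esub> x) = \<ominus>\<^bsub>C (m - 1)\<^esub> d m x"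
      if "x \<in> carrier (C m)" "y \<in> carrier (C m)" for m x y
      using additive_diff [OF C.M.abelian_group_axioms C.M.abelian_group_axioms, where f = "d m"]
        additive_minus [OF C.M.abelian_group_axioms C.M.abelian_group_axioms, where f = "d m"]
        rhom_add [OF rhom_d] d_closed that by auto
    define q where "q b = b \<ominus>\<^bsub>C n\<^esub> G (n - 1) (d n b)" for b
    have bc: "b \<in> carrier (C m)" if "b \<in> B m" for b m by (rule C.basis_carrier [OF that])
    have qc: "q b \<in> carrier (C n)" if "b \<in> B n" for b using bc [OF that] Gd by (simp add: q_def)
    \<comment> \<open>The sign compensates for \<open>pushed\<close> subtracting d G while the
      domination adds d h.\<close>
    define y where "y b = \<ominus>\<^bsub>C (n + 1)\<^esub> h' n (q b)" for b
    have hqc: "h' n (q b) \<in> carrier (C (n + 1))" if "b \<in> B n" for b by (rule h'(1) [OF qc [OF that]])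
    have yc: "y b \<in> carrier (C (n + 1))" if "b \<in> B n" for b using hqc [OF that] by (simp add: y_def)
    define G' where "G' m = (if m = n then basis_ext n y else G m)" for m
    have G': "rhom 1 G'"
      unfolding rhom_def G'_def using basis_ext_hom [of n y] yc G(1) by (auto simp: rhom_def)
    have lower: "pushed G' m b = pushed G m b" if "m < n" for m b
      using that by (simp add: pushed_def G'_def)
    \<comment> \<open>The bound is known on basis elements only. Since the error is R-linear, it
      extends to d b, at the price of adding the degrees of the coefficients.\<close>
    have Td: "pushed G (n - 1) (d n b) \<in> window (n - 1) (tr \<tau> E1)" if b: "b \<in> B n" for b
    proof -
      let ?c = "coord R (C (n - 1)) (B (n - 1)) (d n b)"
      have db: "d n b \<in> carrier (C (n - 1))" by (rule d_closed [OF bc [OF b]])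
      define P where "P x = pushed G (n - 1) x" for x
      have Pc: "P x \<in> carrier (C (n - 1))" if "x \<in> carrier (C (n - 1))" for x
        using that dG [OF that] Gd [OF that] by (simp add: P_def pushed_def)
      have Padd: "P (x \<oplus>\<^bsub>C (n - 1)\<^esub> z) = P x \<oplus>\<^bsub>C (n - 1)\<^esub> P z"
        if "x \<in> carrier (C (n - 1))" "z \<in> carrier (C (n - 1))" for x z
      proof -
        have 1: "d (n - 1 + 1) (G (n - 1) (x \<oplus>\<^bsub>C (n - 1)\<^esub> z)) = d (n - 1 + 1) (G (n - 1) x) \<oplus>\<^bsub>C (n - 1)\<^esub> d (n - 1 + 1) (G (n - 1) z)"
          using rhom_add [OF G(1) that] rhom_add [OF rhom_d Gc [OF that(1)] Gc [OF that(2)]] by simp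
        have 2: "G (n - 1 - 1) (d (n - 1) (x \<oplus>\<^bsub>C (n - 1)\<^esub> z)) = G (n - 1 - 1) (d (n - 1) x) \<oplus>\<^bsub>C (n - 1)\<^esub> G (n - 1 - 1) (d (n - 1) z)"
          using rhom_add [OF rhom_d that] rhom_add [OF G(1) d_closed [OF that(1)] d_closed [OF that(2)]] by simp
        show ?thesis
          unfolding P_def pushed_def 1 2
          using that dG [OF that(1)] dG [OF that(2)] Gd [OF that(1)] Gd [OF that(2)]
          by (simp add: a_minus_def C.M.minus_add C.M.a_ac)
      qed
      have Pmul: "P (x \<odot>\<^sub>r\<^bsub>C (n - 1)\<^esub> r) = P x \<odot>\<^sub>r\<^bsub>C (n - 1)\<^esub> r"
        if "x \<in> carrier (C (n - 1))" "r \<in> carrier R" for x r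
      proof -
        have neg: "(\<ominus>\<^bsub>C (n - 1)\<^esub> z) \<odot>\<^sub>r\<^bsub>C (n - 1)\<^esub> r = \<ominus>\<^bsub>C (n - 1)\<^esub> (z \<odot>\<^sub>r\<^bsub>C (n - 1)\<^esub> r)" if "z \<in> carrier (C (n - 1))" for z
          by (rule additive_minus [OF C.M.abelian_group_axioms C.M.abelian_group_axioms, where f = "\<lambda>z. z \<odot>\<^sub>r\<^bsub>C (n - 1)\<^esub> r"])
            (use that \<open>r \<in> carrier R\<close> in \<open>auto simp: C.rsmult_closed C.rsmult_add_left\<close>)
        have 1: "d (n - 1 + 1) (G (n - 1) (x \<odot>\<^sub>r\<^bsub>C (n - 1)\<^esub> r)) = d (n - 1 + 1) (G (n - 1) x) \<odot>\<^sub>r\<^bsub>C (n - 1)\<^esub> r"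
          using rhom_rsmult [OF G(1) that] rhom_rsmult [OF rhom_d Gc [OF that(1)] that(2)] by simp
        have 2: "G (n - 1 - 1) (d (n - 1) (x \<odot>\<^sub>r\<^bsub>C (n - 1)\<^esub> r)) = G (n - 1 - 1) (d (n - 1) x) \<odot>\<^sub>r\<^bsub>C (n - 1)\<^esub> r"
          using rhom_rsmult [OF rhom_d that] rhom_rsmult [OF G(1) d_closed [OF that(1)] that(2)] by simp
        show ?thesis
          unfolding P_def pushed_def 1 2 a_minus_def
          using that dG [OF that(1)] Gd [OF that(1)] by (simp add: C.rsmult_add_left neg)
      qed
      have tc: "b' \<odot>\<^sub>r\<^bsub>C (n - 1)\<^esub> ?c b' \<in> carrier (C (n - 1))" if "b' \<in> B (n - 1)" for b'
        by (rule C.rsmult_closed [OF bc [OF that] C.co_closed [OF db]])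
      have "P (d n b) = P (\<Oplus>\<^bsub>C (n - 1)\<^esub>b'\<in>B (n - 1). b' \<odot>\<^sub>r\<^bsub>C (n - 1)\<^esub> ?c b')"
        using C.co_expand [OF db] by simp
      also have "\<dots> = (\<Oplus>\<^bsub>C (n - 1)\<^esub>b'\<in>B (n - 1). P (b' \<odot>\<^sub>r\<^bsub>C (n - 1)\<^esub> ?c b'))"
        by (rule additive_finsum(2) [OF C.M.abelian_group_axioms C.M.abelian_group_axioms])
          (use Pc Padd tc in auto)
      also have "\<dots> \<in> window (n - 1) (tr \<tau> E1)"
      proof (rule window_finsum)
        fix b' assume b': "b' \<in> B (n - 1)"
        have "P b' \<in> window (n - 1) (tr \<tau> E)" unfolding P_def by (rule G(2) [OF _ b']) simp
        then have "P b' \<odot>\<^sub>r\<^bsub>C (n - 1)\<^esub> ?c b' \<in> window (n - 1) {\<alpha> + \<beta> | \<alpha> \<beta>. \<alpha> \<in> tr \<tau> E \<and> comp (?c b') \<beta> \<noteq> \<zero>}"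
          by (rule window_rsmult [OF _ C.co_closed [OF db]])
        moreover have "{\<alpha> + \<beta> | \<alpha> \<beta>. \<alpha> \<in> tr \<tau> E \<and> comp (?c b') \<beta> \<noteq> \<zero>} \<subseteq> tr \<tau> E1"
        proof
          fix \<sigma> assume "\<sigma> \<in> {\<alpha> + \<beta> | \<alpha> \<beta>. \<alpha> \<in> tr \<tau> E \<and> comp (?c b') \<beta> \<noteq> \<zero>}"
          then obtain \<alpha> \<beta> where ab: "\<sigma> = \<alpha> + \<tau> + \<beta>" "\<alpha> \<in> E" "comp (?c b') \<beta> \<noteq> \<zero>" by blast
          have "Dk (n - 1, b') (n, b) \<beta> \<noteq> \<zero>"
            using ab(3) b by (simp add: kern_def vec_def)
          then have "\<beta> \<in> N" using N(2) unfolding kernel_on_def by blast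
          then have "\<alpha> + \<beta> \<in> E1" unfolding E1_def using ab(2) by (intro image_eqI [of _ _ "(\<alpha>, \<beta>)"]) simp_all
          then show "\<sigma> \<in> tr \<tau> E1" by (rule rev_image_eqI) (simp add: ab(1) algebra_simps)
        qed
        ultimately have "P b' \<odot>\<^sub>r\<^bsub>C (n - 1)\<^esub> ?c b' \<in> window (n - 1) (tr \<tau> E1)" by (rule window_mono)
        then show "P (b' \<odot>\<^sub>r\<^bsub>C (n - 1)\<^esub> ?c b') \<in> window (n - 1) (tr \<tau> E1)"
          using Pmul [OF bc [OF b'] C.co_closed [OF db]] by simp
      qed
      finally show ?thesis unfolding P_def .
    qed
    have top: "pushed G' n b \<in> window n (tr \<tau> E')" if b: "b \<in> B n" for b
    proof -
      \<comment> \<open>In the error at d b the last term is G d d b, which vanishes.\<close>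
      have "d n (q b) = pushed G (n - 1) (d n b)"
      proof -
        have "d (n - 1) (d n b) = \<zero>\<^bsub>C (n - 2)\<^esub>" by (rule d_d [OF bc [OF b]])
        then have "G (n - 1 - 1) (d (n - 1) (d n b)) = \<zero>\<^bsub>C (n - 1)\<^esub>" using G0 [of "n - 2"] by simp
        moreover have "d n (q b) = d n b \<ominus>\<^bsub>C (n - 1)\<^esub> d n (G (n - 1) (d n b))"
          unfolding q_def by (rule d_diff [OF bc [OF b] Gd [OF bc [OF b]]])
        moreover have "d n (G (n - 1) (d n b)) \<in> carrier (C (n - 1))" by (rule d_closed [OF Gd [OF bc [OF b]]])
        ultimately show ?thesis
          using d_closed [OF bc [OF b]] by (simp add: pushed_def a_minus_def)
      qed
      then have dq: "d n (q b) \<in> window (n - 1) (tr \<tau> E1)" using Td [OF b] by simp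
      have "h' (n - 1) (d n (q b)) \<in> window (n - 1 + 1) (tr \<tau> E2)"
        by (rule h'(3) [OF _ dq]) (use E2(2) in simp)
      then have w2: "h' (n - 1) (d n (q b)) \<in> window n (tr \<tau> E2)" by simp
      let ?P = "q b \<oplus>\<^bsub>C n\<^esub> d (n + 1) (h' n (q b)) \<oplus>\<^bsub>C n\<^esub> h' (n - 1) (d n (q b))"
      have w1: "?P \<in> window n (tr \<tau> (F n))" by (rule h'(2) [OF qc [OF b]])
      have dh: "d (n + 1) (h' n (q b)) \<in> carrier (C n)" using d_closed [OF hqc [OF b]] by simp
      have "d (n + 1) (y b) = \<ominus>\<^bsub>C n\<^esub> d (n + 1) (h' n (q b))"
        unfolding y_def using d_neg [OF hqc [OF b] hqc [OF b]] by simp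
      moreover have "G' n b = y b" using basis_ext_basis [of n y, OF yc b] by (simp add: G'_def)
      moreover have "G' (n - 1) = G (n - 1)" by (simp add: G'_def)
      ultimately have "pushed G' n b = b \<oplus>\<^bsub>C n\<^esub> d (n + 1) (h' n (q b)) \<ominus>\<^bsub>C n\<^esub> G (n - 1) (d n b)"
        using dh by (simp add: pushed_def a_minus_def)
      also have "\<dots> = q b \<oplus>\<^bsub>C n\<^esub> d (n + 1) (h' n (q b))"
        using bc [OF b] dh Gd [OF bc [OF b]] by (simp add: q_def a_minus_def C.M.a_ac)
      also have "\<dots> = ?P \<ominus>\<^bsub>C n\<^esub> h' (n - 1) (d n (q b))"
        using qc [OF b] dh window_carrier [OF w2] by (simp add: a_minus_def C.M.a_assoc C.M.r_neg)
      finally have e: "pushed G' n b = ?P \<ominus>\<^bsub>C n\<^esub> h' (n - 1) (d n (q b))" .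
      show ?thesis
        unfolding e by (intro window_diff window_mono [OF w1] window_mono [OF w2]) (auto simp: E'_def)
    qed
    have "pushed G' m b \<in> window m (tr \<tau> E')" if "m < n + 1" "b \<in> B m" for m b
    proof (cases "m = n")
      case True
      then show ?thesis using top that by simp
    next
      case False
      then have "m < n" using that by simp
      then have "pushed G' m b \<in> window m (tr \<tau> E)" using lower G(2) that(2) by simp
      then show ?thesis by (rule window_mono) (auto simp: E'_def)
    qed
    then show ?thesis using G' by blast
  qed
  moreover have "finite E'" unfolding E'_def using E finF E2(1) by blast
  ultimately show ?thesis by blast
qed

lemma pushing:
  assumes h: "khom 1 h" and finF: "\<And>n. finite (F n)" and F: "\<And>n x. x \<in> carrier (C n) \<Longrightarrow>
      x \<oplus>\<^bsub>C n\<^esub> d (n + 1) (h n x) \<oplus>\<^bsub>C n\<^esub> h (n - 1) (d n x) \<in> window n (F n)"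
  obtains E where "finite E" "\<And>\<tau>. \<exists>G. rhom 1 G \<and> (\<forall>n. \<forall>b\<in>B n. pushed G n b \<in> window n (tr \<tau> E))"
proof -
  \<comment> \<open>The induction starts below the complex, where the condition on basis elements is
    empty; 0 is inserted in case \<open>J\<close> is empty.\<close>
  define lo where "lo = Min (insert 0 (fst ` J))"
  define hi where "hi = Max (insert 0 (fst ` J))"
  have lohi: "lo \<le> n \<and> n \<le> hi" if "b \<in> B n" for n b
  proof -
    have "n \<in> fst ` J" using that in_J [of n b] by force
    then show ?thesis using finite_J by (simp add: lo_def hi_def)
  qed
  have "\<exists>E. finite E \<and> (\<forall>\<tau>. \<exists>G. rhom 1 G \<and> (\<forall>m<lo + int k. \<forall>b\<in>B m. pushed G m b \<in> window m (tr \<tau> E)))" for k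
  proof (induction k)
    case 0
    have "rhom 1 (\<lambda>n x. \<zero>\<^bsub>C (n + 1)\<^esub>)"
      unfolding rhom_def rmodule_hom_def by (simp add: C.rsmult_zero_left)
    moreover have "\<forall>m<lo + int 0. \<forall>b\<in>B m. X m b" for X :: "int \<Rightarrow> 'b \<Rightarrow> bool"
    proof (intro allI impI ballI)
      fix m b assume "m < lo + int 0" "b \<in> B m"
      then show "X m b" using lohi [of b m] by simp
    qed
    ultimately show ?case
      by - (rule exI [of _ "{}"], rule conjI, rule finite.emptyI, rule allI,
        rule exI [of _ "\<lambda>n x. \<zero>\<^bsub>C (n + 1)\<^esub>"], rule conjI, assumption, rule meta_spec)
  next
    case (Suc k)
    then obtain E where E: "finite E"
      "\<And>\<tau>. \<exists>G. rhom 1 G \<and> (\<forall>m<lo + int k. \<forall>b\<in>B m. pushed G m b \<in> window m (tr \<tau> E))" by blast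
    have "lo + int (Suc k) = lo + int k + 1" by simp
    with push_step [OF h finF F E] show ?case by (simp only:)
  qed
  from this [of "nat (hi - lo + 1)"] obtain E where E: "finite E"
    "\<And>\<tau>. \<exists>G. rhom 1 G \<and> (\<forall>m<lo + int (nat (hi - lo + 1)). \<forall>b\<in>B m. pushed G m b \<in> window m (tr \<tau> E))" by blast
  have "m < lo + int (nat (hi - lo + 1))" if "b \<in> B m" for m b using lohi [OF that] by simp
  with E show ?thesis using that by meson
qed

text \<open>The map 1 + d h + h d equals g f and factors through \<open>D n\<close>, which is
  finitely generated over R_0. The images of its generators under \<open>g\<close> have finitely
  many degrees, and R_0 does not add any.\<close>

lemma finitely_dominatedE:
  assumes "finitely_dominated Kr C d"
  obtains h F where "khom 1 h" "\<And>n. finite (F n)"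
    "\<And>n x. x \<in> carrier (C n) \<Longrightarrow>
      x \<oplus>\<^bsub>C n\<^esub> d (n + 1) (h n x) \<oplus>\<^bsub>C n\<^esub> h (n - 1) (d n x) \<in> window n (F n)"
proof -
  obtain D :: "int \<Rightarrow> ('a, nat \<Rightarrow> 'a) rmodule" and e f g h where D: "chain_complex Kr D e" "\<forall>n. fg_free Kr (D n)"
    "chain_map Kr C d D e f" "chain_map Kr D e C d g"
    "\<And>n. h n \<in> rmodule_hom Kr (C n) (C (n + 1))"
    "\<And>n x. x \<in> carrier (C n) \<Longrightarrow> g n (f n x) \<ominus>\<^bsub>C n\<^esub> x = d (n + 1) (h n x) \<oplus>\<^bsub>C n\<^esub> h (n - 1) (d n x)"
    using assms unfolding finitely_dominated_def chain_homotopic_def by blast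
  have h: "khom 1 h" using D(5) by (simp add: khom_def)
  have "\<exists>F. finite F \<and> (\<forall>y\<in>carrier (D n). g n y \<in> window n F)" for n
  proof -
    interpret Dn: right_module Kr "D n" using D(1) by (simp add: chain_complex_def)
    obtain Bd where Bd: "finite Bd" "Bd \<subseteq> carrier (D n)"
      "bij_betw (\<lambda>c. \<Oplus>\<^bsub>D n\<^esub>b\<in>Bd. b \<odot>\<^sub>r\<^bsub>D n\<^esub> c b) (Bd \<rightarrow>\<^sub>E Rg 0) (carrier (D n))"
      using D(2) unfolding fg_free_def by auto
    have gh: "g n y \<in> carrier (C n)" "\<And>z. z \<in> carrier (D n) \<Longrightarrow> g n (y \<oplus>\<^bsub>D n\<^esub> z) = g n y \<oplus>\<^bsub>C n\<^esub> g n z"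
      "\<And>a. a \<in> Rg 0 \<Longrightarrow> g n (y \<odot>\<^sub>r\<^bsub>D n\<^esub> a) = g n y \<odot>\<^sub>r\<^bsub>C n\<^esub> a" if "y \<in> carrier (D n)" for y
      using D(4) that by (auto simp: chain_map_def rmodule_hom_def Pi_iff)
    let ?F = "\<Union>b\<in>Bd. degs (vec n (g n b))"
    have gb: "g n b \<in> window n ?F" if "b \<in> Bd" for b
      using gh(1) [of b] Bd(2) that by (auto simp: window_def)
    show ?thesis
    proof (intro exI [of _ ?F] conjI ballI)
      show "finite ?F" using Bd gh(1) by (intro finite_UN_I) auto
      fix y assume "y \<in> carrier (D n)"
      then obtain c where c: "c \<in> Bd \<rightarrow>\<^sub>E Rg 0" "y = (\<Oplus>\<^bsub>D n\<^esub>b\<in>Bd. b \<odot>\<^sub>r\<^bsub>D n\<^esub> c b)"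
        using Bd(3) by (auto simp: bij_betw_def)
      have cb: "c b \<in> Rg 0" "b \<in> carrier (D n)" if "b \<in> Bd" for b using c(1) Bd(2) that by auto
      have "g n y = (\<Oplus>\<^bsub>C n\<^esub>b\<in>Bd. g n (b \<odot>\<^sub>r\<^bsub>D n\<^esub> c b))"
        unfolding c(2)
        by (rule additive_finsum(2) [OF Dn.M.abelian_group_axioms C.M.abelian_group_axioms])
          (use gh cb Dn.rsmult_closed in auto)
      also have "\<dots> \<in> window n ?F"
      proof (rule window_finsum)
        fix b assume b: "b \<in> Bd"
        show "g n (b \<odot>\<^sub>r\<^bsub>D n\<^esub> c b) \<in> window n ?F"
          using window_rsmult0 [OF gb [OF b] cb(1) [OF b]] gh(3) [OF cb(2) [OF b] cb(1) [OF b]] by simp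
      qed
      finally show "g n y \<in> window n ?F" .
    qed
  qed
  then have "\<forall>n. \<exists>F. finite F \<and> (\<forall>y\<in>carrier (D n). g n y \<in> window n F)" by (rule allI)
  from choice [OF this] obtain F where F': "\<forall>n. finite (F n) \<and> (\<forall>y\<in>carrier (D n). g n y \<in> window n (F n))"
    by (rule exE)
  have F: "finite (F n)" "y \<in> carrier (D n) \<Longrightarrow> g n y \<in> window n (F n)" for n y
    using F' [THEN spec, of n] by simp_all
  have "x \<oplus>\<^bsub>C n\<^esub> d (n + 1) (h n x) \<oplus>\<^bsub>C n\<^esub> h (n - 1) (d n x) \<in> window n (F n)" if x: "x \<in> carrier (C n)" for n x
  proof -
    have fx: "f n x \<in> carrier (D n)"
      using D(3) x by (auto simp: chain_map_def rmodule_hom_def Pi_iff)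
    have dh: "d (n + 1) (h n x) \<in> carrier (C n)" "h (n - 1) (d n x) \<in> carrier (C n)"
      using d_closed [OF khom_closed [OF h x]] khom_closed [OF h d_closed [OF x]] by simp_all
    have gf: "g n (f n x) \<in> carrier (C n)" by (rule window_carrier [OF F(2) [OF fx]])
    have "x \<oplus>\<^bsub>C n\<^esub> (g n (f n x) \<ominus>\<^bsub>C n\<^esub> x) = g n (f n x)"
      unfolding a_minus_def C.M.a_comm [OF gf C.M.a_inv_closed [OF x]] by (rule C.M.r_neg2 [OF x gf])
    then have "x \<oplus>\<^bsub>C n\<^esub> d (n + 1) (h n x) \<oplus>\<^bsub>C n\<^esub> h (n - 1) (d n x) = g n (f n x)"
      unfolding D(6) [OF x] using x dh by (simp add: C.M.a_assoc)
    then show ?thesis using F(2) [OF fx] by simp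
  qed
  with h F(1) show ?thesis using that by blast
qed

end

subsection \<open>The geometric series\<close>

context based_complex
begin

lemma pushed_kernel:
  assumes G: "rhom 1 G" and w: "\<And>n b. b \<in> B n \<Longrightarrow> pushed G n b \<in> window n E"
  shows "kernel_on J E (kern 0 (pushed G))" "has_degree R 0 (kern 0 (pushed G))"
    and "j \<in> J \<Longrightarrow> Dm (col (kern 1 G) j) i \<oplus> mv R (tker (kern 1 G)) (col Dk j) i \<oplus> col (kern 0 (pushed G)) j i
      = (if i = (j, 0) then \<one> else \<zero>)"
proof -
  show "kernel_on J E (kern 0 (pushed G))"
    unfolding kernel_on_def
  proof (intro conjI allI impI)
    fix j' j \<tau>
    show "finite J" by (rule finite_J)
    have hvec: "hvec_at (fst j) (vec (fst j) (pushed G (fst j) (snd j)))" if "snd j \<in> B (fst j)"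
      by (rule hvec_at_vec [OF window_carrier [OF w [OF that]]])
    show "kern 0 (pushed G) j' j \<tau> \<in> Rg \<tau>"
    proof (cases "snd j \<in> B (fst j)")
      case True
      then have "vec (fst j) (pushed G (fst j) (snd j)) i \<in> Rg (snd i)" for i
        using hvec unfolding hvec_def by blast
      from this [of "(j', \<tau>)"] show ?thesis using True by (simp add: kern_def)
    next
      case False
      then show ?thesis by (simp add: kern_def)
    qed
    assume nz: "kern 0 (pushed G) j' j \<tau> \<noteq> \<zero>"
    have j: "snd j \<in> B (fst j)"
    proof (rule ccontr)
      assume "snd j \<notin> B (fst j)"
      then show False using nz by (simp add: kern_def)
    qed
    have v: "vec (fst j) (pushed G (fst j) (snd j)) (j', \<tau>) \<noteq> \<zero>" using nz j by (simp add: kern_def)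
    show "j \<in> J" using j in_J [of "fst j" "snd j"] by simp
    have "fst (j', \<tau>) \<in> J" using hvec_at_hvec [OF hvec [OF j]] v unfolding hvec_def by blast
    then show "j' \<in> J" by simp
    show "\<tau> \<in> E" using windowD [OF w [OF j] v] by simp
  qed
  show "has_degree R 0 (kern 0 (pushed G))"
    by (auto simp: has_degree_def kern_def vec_def)
  assume "j \<in> J"
  then obtain n b where j: "j = (n, b)" and b: "b \<in> B n" using in_J by (cases j) auto
  have bc: "b \<in> carrier (C n)" by (rule C.basis_carrier [OF b])
  have Gb: "G n b \<in> carrier (C (n + 1))" by (rule rhom_closed [OF G bc])
  have dG: "d (n + 1) (G n b) \<in> carrier (C n)" using d_closed [OF Gb] by simp
  have Gd: "G (n - 1) (d n b) \<in> carrier (C n)" using rhom_closed [OF G d_closed [OF bc]] by simp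
  have 1: "Dm (col (kern 1 G) j) = vec n (d (n + 1) (G n b))"
    using D_vec [OF Gb] col_kern [OF b, of 1 G] by (simp add: j)
  have 2: "mv R (tker (kern 1 G)) (col Dk j) = vec n (G (n - 1) (d n b))"
    using kern_vec [OF G d_closed [OF bc]] col_kern [OF b, of "-1" d] by (simp add: j)
  have 3: "col (kern 0 (pushed G)) j = vec n (pushed G n b)"
    using col_kern [OF b, of 0 "pushed G"] by (simp add: j)
  have "vec n (pushed G n b) i = vec n b i \<ominus> vec n (d (n + 1) (G n b)) i \<ominus> vec n (G (n - 1) (d n b)) i"
    using bc dG Gd by (simp add: pushed_def vec_diff)
  moreover have "vec n b i = (if i = (j, 0) then \<one> else \<zero>)" using vec_basis [OF b, of i] by (simp only: j)
  moreover have "x \<oplus> y \<oplus> (z \<ominus> x \<ominus> y) = z" if "x \<in> carrier R" "y \<in> carrier R" "z \<in> carrier R" for x y z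
    using that by algebra
  ultimately show "Dm (col (kern 1 G) j) i \<oplus> mv R (tker (kern 1 G)) (col Dk j) i \<oplus> col (kern 0 (pushed G)) j i
      = (if i = (j, 0) then \<one> else \<zero>)"
    unfolding 1 2 3 using vec_carrier [OF bc, of i] vec_carrier [OF dG, of i] vec_carrier [OF Gd, of i] by simp
qed

end

text \<open>The powers of a kernel with degrees in \<open>N\<close>, applied to a family with
  degrees in \<open>T\<close>, all have their degrees in \<open>T'\<close>. This keeps the sum of a
  geometric series in the given ring.\<close>

definition absorbing :: "(int \<times> int) set \<Rightarrow> (int \<times> int) set set \<Rightarrow> bool" where
  "absorbing N \<S> \<longleftrightarrow> (\<forall>T\<in>\<S>. \<exists>T'\<in>\<S>. T \<subseteq> T' \<and> (\<forall>\<nu>\<in>N. \<forall>\<sigma>\<in>T'. \<nu> + \<sigma> \<in> T'))"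

lemma int_lower_bound:
  fixes f :: "'c \<Rightarrow> int"
  assumes "finite N" obtains m where "\<And>x. x \<in> N \<Longrightarrow> m \<le> f x"
  using bdd_below_finite [OF finite_imageI [OF assms, of f]] by (auto simp: bdd_below_def)

context novikov_coefficients
begin

text \<open>A cycle \<open>z\<close> is the boundary of \<open>\<Sum>\<^sub>k g (t\<^sup>k z)\<close>; the series converges since \<open>t\<close> raises \<open>lev\<close>.\<close>

lemma acyclic_of_contracting_error:
  fixes lev :: "int \<times> int \<Rightarrow> int"
  assumes g: "kernel_on J N1 g" "finite N1" "has_degree R 1 g"
    and t: "kernel_on J N2 t" "finite N2" "has_degree R 0 t"
    and col: "\<And>j i. j \<in> J \<Longrightarrow> Dm (col g j) i \<oplus> mv R (tker g) (col Dk j) i \<oplus> col t j i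
        = (if i = (j, 0) then \<one> else \<zero>)"
    and add: "\<And>\<alpha> \<beta>. lev (\<alpha> + \<beta>) = lev \<alpha> + lev \<beta>"
    and N2: "\<And>\<nu>. \<nu> \<in> N2 \<Longrightarrow> 1 \<le> lev \<nu>" and abs: "absorbing N2 \<S>"
    and bound: "\<And>T. T \<in> \<S> \<Longrightarrow> \<exists>n. \<forall>\<sigma>\<in>T. n \<le> lev \<sigma>"
  shows "novikov_acyclic R Rg C d \<S>"
  unfolding novikov_acyclic_iff
proof (intro allI ballI impI)
  fix n z assume z: "z \<in> V n" and Dz: "Dm z = (\<lambda>i. \<zero>)"
  obtain N where N: "finite N" "kernel_on J N Dk" "has_degree R (-1) Dk" by (rule D_row)
  have levd: "lev \<alpha> = lev \<beta> + lev (\<alpha> - \<beta>)" for \<alpha> \<beta> using add [of \<beta> "\<alpha> - \<beta>"] by simp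
  obtain T' where T': "T' \<in> \<S>" "degs z \<subseteq> T'" "\<And>\<nu> \<sigma>. \<nu> \<in> N2 \<Longrightarrow> \<sigma> \<in> T' \<Longrightarrow> \<nu> + \<sigma> \<in> T'"
    using abs V_degs [OF z] unfolding absorbing_def by meson
  obtain n0 where n0: "\<And>\<sigma>. \<sigma> \<in> T' \<Longrightarrow> n0 \<le> lev \<sigma>" using bound [OF T'(1)] by blast
  obtain m where m: "\<And>\<sigma>. \<sigma> \<in> N1 \<Longrightarrow> m \<le> lev \<sigma>" using int_lower_bound [OF g(2)] by blast
  obtain l where l: "\<And>\<sigma>. \<sigma> \<in> N \<Longrightarrow> l \<le> lev \<sigma>" using int_lower_bound [OF N(1)] by blast
  define r where "r k = (mv R (tker t) ^^ k) z" for k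
  define w where "w k = mv R (tker g) (r k)" for k
  have r_Suc: "r (Suc k) = mv R (tker t) (r k)" and r_0: "r 0 = z" for k by (simp_all add: r_def)
  have hr: "hvec_at n (r k)" for k
  proof (induction k)
    case 0
    then show ?case using V_hvec_at [OF z] by (simp add: r_0)
  next
    case (Suc k)
    then show ?case using hvec_at_mv [OF t(1,3) Suc] by (simp add: r_Suc)
  qed
  note hrJ = hvec_at_hvec [OF hr]
  \<comment> \<open>Two separate controls on the powers: the support stays in the fixed set
    \<open>T'\<close>, and the level rises by at least 1 with each power.\<close>
  have sr: "\<sigma> \<in> T' \<and> n0 + int k \<le> lev \<sigma>" if "\<sigma> \<in> degs (r k)" for k \<sigma>
    using that
  proof (induction k arbitrary: \<sigma>)
    case 0
    then have "\<sigma> \<in> T'" using T'(2) by (auto simp: r_0)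
    then show ?case using n0 by simp
  next
    case (Suc k)
    then obtain \<kappa> where \<kappa>: "\<kappa> \<in> degs (r k)" "\<sigma> - \<kappa> \<in> N2"
      using degs_mv [OF t(1) hrJ, of \<sigma> k] unfolding r_Suc by blast
    have "\<kappa> \<in> T'" "n0 + int k \<le> lev \<kappa>" using Suc.IH [OF \<kappa>(1)] by simp_all
    then show ?case using T'(3) [OF \<kappa>(2)] N2 [OF \<kappa>(2)] levd [of \<sigma> \<kappa>] by fastforce
  qed
  have hw: "hvec_at (n + 1) (w k)" for k unfolding w_def by (rule hvec_at_mv [OF g(1,3) hr])
  have sw: "\<exists>\<kappa>. \<sigma> - \<kappa> \<in> N1 \<and> \<kappa> \<in> T' \<and> n0 + int k \<le> lev \<kappa>" if \<sigma>: "\<sigma> \<in> degs (w k)" for k \<sigma>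
  proof -
    obtain \<kappa> where "\<kappa> \<in> degs (r k)" "\<sigma> - \<kappa> \<in> N1"
      using degs_mv [OF g(1) hrJ, of \<sigma> k] \<sigma> unfolding w_def by blast
    then show ?thesis using sr [of \<kappa> k] by blast
  qed
  have eq: "Dm (w k) i \<oplus> mv R (tker g) (Dm (r k)) i \<oplus> r (Suc k) i = r k i" for k i
    unfolding w_def r_Suc
    by (rule contraction_lift [OF N(2,1) g(1) t(1,2) subset_refl col hrJ loc_finite_finite [OF g(2)]])
  have g0: "mv R (tker g) (\<lambda>i. \<zero>) = (\<lambda>i. \<zero>)"
    using tker_carrier [OF g(1)] by (simp add: mv_def fun_eq_iff)
  have rc: "r k i \<in> carrier R" and wc: "w k i \<in> carrier R" and Dwc: "Dm (w k) i \<in> carrier R" for k i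
    using hvec_carrier [OF hr] hvec_carrier [OF hw] D_closed [of "w k"] hvec_carrier [OF hw] by simp_all
  \<comment> \<open>By induction: if r k is a cycle, then the contraction identity gives r (k+1) = r
    k - D (w k), which is again a cycle. No commutation of \<open>t\<close> with D is
    invoked.\<close>
  have Dr: "Dm (r k) = (\<lambda>i. \<zero>)" for k
  proof (induction k)
    case 0
    then show ?case using Dz by (simp add: r_0)
  next
    case (Suc k)
    have "r (Suc k) i = r k i \<ominus> Dm (w k) i" for i
    proof -
      have "y = x \<ominus> u" if "u \<oplus> \<zero> \<oplus> y = x" "u \<in> carrier R" "y \<in> carrier R" for x y u
        using that(2,3) unfolding that(1) [symmetric] by algebra
      then show ?thesis using eq [of k i] Dwc rc unfolding Suc g0 by blast
    qed
    then have "r (Suc k) = (\<lambda>i. r k i \<ominus> Dm (w k) i)" by (rule ext)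
    then have "Dm (r (Suc k)) = (\<lambda>i. Dm (r k) i \<ominus> Dm (Dm (w k)) i)"
      using D_diff [of "r k" "Dm (w k)"] rc Dwc by simp
    then show ?case using Suc DD_zero [OF hvec_at_hvec [OF hw]] by (simp add: a_minus_def)
  qed
  have Dw: "Dm (w k) i \<oplus> r (Suc k) i = r k i" for k i
    using eq [of k i] Dwc [of k i] unfolding Dr g0 by simp
  \<comment> \<open>The partial sums of the series; they satisfy D (p k) = z - r k.\<close>
  define p where "p = rec_nat (\<lambda>i. \<zero>) (\<lambda>k q i. q i \<oplus> w k i)"
  have p: "p 0 = (\<lambda>i. \<zero>)" "p (Suc k) = (\<lambda>i. p k i \<oplus> w k i)" for k by (simp_all add: p_def)
  have hp: "hvec_at (n + 1) (p k)" for k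
    by (induction k) (simp_all add: p hvec_zero hvec_add hw)
  have pc: "p k i \<in> carrier R" for k i by (rule hvec_carrier [OF hp])
  have Dp: "Dm (p k) i \<oplus> r k i = z i" for k i
  proof (induction k)
    case 0
    have "Dm (\<lambda>i. \<zero>) i = \<zero>" using tker_carrier [OF N(2)] by (simp add: mv_def)
    then show ?case using rc [of 0] by (simp add: p r_0)
  next
    case (Suc k)
    have "Dm (p (Suc k)) i = Dm (p k) i \<oplus> Dm (w k) i"
      unfolding p by (rule D_add) (rule pc wc)+
    then show ?case
      using Suc Dw [of k i] Dwc [of k i] rc [of "Suc k" i] D_closed [of "p k" i, OF pc]
      by (simp add: a_assoc)
  qed
  \<comment> \<open>In degree \<open>\<sigma>\<close> the terms from \<open>K \<sigma>\<close> on
    vanish: the k-th term has level at least n0 + k before \<open>g\<close> is applied, and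
    \<open>g\<close> lowers the level by at most - m.\<close>
  define K where "K \<sigma> = nat (lev \<sigma> - n0 - m + 1)" for \<sigma>
  have w0: "w k i = \<zero>" if "K (snd i) \<le> k" for k i
  proof (rule ccontr)
    assume "w k i \<noteq> \<zero>"
    then have "snd i \<in> degs (w k)" by (rule degsI)
    then obtain \<kappa> where "snd i - \<kappa> \<in> N1" "n0 + int k \<le> lev \<kappa>" using sw by blast
    then show False using m [of "snd i - \<kappa>"] levd [of "snd i" \<kappa>] that unfolding K_def by linarith
  qed
  define y where "y i = p (K (snd i)) i" for i
  have py: "p k i = y i" if "K (snd i) \<le> k" for k i
    using that
  proof (induction k rule: dec_induct)
    case base
    then show ?case by (simp add: y_def)
  next
    case (step k)
    then show ?case using w0 [of i k] pc [of k i] by (simp add: p)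
  qed
  have hy: "hvec_at (n + 1) y"
    using hp unfolding hvec_def y_def by blast
  have spp: "\<sigma> \<in> {\<alpha> + \<beta> | \<alpha> \<beta>. \<alpha> \<in> N1 \<and> \<beta> \<in> T'}" if "p k (j, \<sigma>) \<noteq> \<zero>" for k j \<sigma>
    using that
  proof (induction k)
    case 0
    then show ?case by (simp add: p)
  next
    case (Suc k)
    show ?case
    proof (cases "p k (j, \<sigma>) = \<zero>")
      case True
      then have "w k (j, \<sigma>) \<noteq> \<zero>" using Suc.prems by (auto simp: p)
      then have "\<sigma> \<in> degs (w k)" using degsI [of "w k" "(j, \<sigma>)"] by simp
      then obtain \<kappa> where "\<sigma> - \<kappa> \<in> N1" "\<kappa> \<in> T'" using sw by blast
      then show ?thesis by (intro CollectI exI [of _ "\<sigma> - \<kappa>"] exI [of _ \<kappa>]) simp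
    qed (rule Suc.IH)
  qed
  have "degs y \<subseteq> {\<alpha> + \<beta> | \<alpha> \<beta>. \<alpha> \<in> N1 \<and> \<beta> \<in> T'}"
  proof
    fix \<sigma> assume "\<sigma> \<in> degs y"
    then obtain j where "y (j, \<sigma>) \<noteq> \<zero>" by (rule degsE)
    then show "\<sigma> \<in> {\<alpha> + \<beta> | \<alpha> \<beta>. \<alpha> \<in> N1 \<and> \<beta> \<in> T'}" unfolding y_def by (rule spp)
  qed
  then have "degs y \<in> \<S>" by (rule subset_S [OF shift_S [OF T'(1) g(2)]])
  then have yV: "y \<in> V (n + 1)" by (rule V_I [OF hy])
  have "Dm y i = z i" for i
  proof -
    \<comment> \<open>The first summand makes the partial sum final at every index that the
      differential can reach from the row \<open>i\<close>, and the second makes the remainder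
      \<open>r k\<close> vanish at \<open>i\<close>.\<close>
    define k where "k = nat (lev (snd i) - l - n0 - m + 1) + nat (lev (snd i) - n0 + 1)"
    have "tker Dk i q \<otimes> y q = tker Dk i q \<otimes> p k q" for q
    proof (cases "tker Dk i q = \<zero>")
      case True
      then show ?thesis using pc [of k q] hvec_carrier [OF hy, of q] by simp
    next
      case False
      then have "snd i - snd q \<in> N" using kernel_on_nonzeroD [OF N(2)] by blast
      then have "l \<le> lev (snd i - snd q)" by (rule l)
      then have "K (snd q) \<le> k" using levd [of "snd i" "snd q"] unfolding K_def k_def by linarith
      then show ?thesis using py by simp
    qed
    then have "Dm y i = Dm (p k) i" by (simp add: mv_def)
    moreover have "r k i = \<zero>"
    proof (rule ccontr)
      assume "r k i \<noteq> \<zero>"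
      then have "n0 + int k \<le> lev (snd i)" using sr [OF degsI] by blast
      then show False unfolding k_def by linarith
    qed
    ultimately show ?thesis using Dp [of k i] D_closed [of "p k" i, OF pc] by simp
  qed
  then have "z = Dm y" by (simp add: fun_eq_iff)
  then show "\<exists>y\<in>V (n + 1). z = Dm y" using yV by blast
qed

end

text \<open>The union of the sets T + k N works. Each addition of \<open>N\<close> raises the level
  by at least 1, so only finitely many k contribute to a given row, and each contributes finitely
  many degrees.\<close>

lemma absorbing_y:
  assumes \<delta>: "\<delta> = 1 \<or> \<delta> = -1" and N: "finite N" "\<And>\<nu>. \<nu> \<in> N \<Longrightarrow> 1 \<le> \<delta> * snd \<nu>"
  shows "absorbing N (supports_y \<delta>)"
  unfolding absorbing_def
proof
  note iff = supports_y_iff [OF \<delta>]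
  fix T assume T: "T \<in> supports_y \<delta>"
  then obtain n :: nat where n: "\<And>\<sigma>. \<sigma> \<in> T \<Longrightarrow> - int n \<le> \<delta> * snd \<sigma>" unfolding iff by blast
  define U where "U k = ((\<lambda>T. {\<alpha> + \<beta> | \<alpha> \<beta>. \<alpha> \<in> N \<and> \<beta> \<in> T}) ^^ k) T" for k
  have U: "U 0 = T" "U (Suc k) = {\<alpha> + \<beta> | \<alpha> \<beta>. \<alpha> \<in> N \<and> \<beta> \<in> U k}" for k
    by (simp_all add: U_def)
  have US: "U k \<in> supports_y \<delta>" for k
  proof (induction k)
    case 0
    then show ?case using T by (simp add: U)
  next
    case (Suc k)
    then show ?case
      using good_supports_y [OF \<delta>] N(1) unfolding U good_supports_def by blast
  qed
  have Ub: "int k - int n \<le> \<delta> * snd \<sigma>" if "\<sigma> \<in> U k" for k \<sigma>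
    using that
  proof (induction k arbitrary: \<sigma>)
    case 0
    then show ?case using n by (simp add: U)
  next
    case (Suc k)
    then obtain \<alpha> \<beta> where ab: "\<sigma> = \<alpha> + \<beta>" "\<alpha> \<in> N" "\<beta> \<in> U k" unfolding U by blast
    have "\<delta> * snd \<sigma> = \<delta> * snd \<alpha> + \<delta> * snd \<beta>" by (simp add: ab(1) algebra_simps)
    then show ?case using Suc.IH [OF ab(3)] N(2) [OF ab(2)] by simp
  qed
  have "(\<Union>k. U k) \<in> supports_y \<delta>"
    unfolding iff
  proof (intro conjI exI [of _ n] ballI allI)
    show "- int n \<le> \<delta> * snd \<sigma>" if \<sigma>: "\<sigma> \<in> (\<Union>k. U k)" for \<sigma>
    proof -
      obtain k where "\<sigma> \<in> U k" using \<sigma> by blast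
      then show ?thesis using Ub [of \<sigma> k] by linarith
    qed
    fix b
    have "{a. (a, b) \<in> (\<Union>k. U k)} \<subseteq> (\<Union>k\<in>{..nat (\<delta> * b + int n)}. {a. (a, b) \<in> U k})"
    proof
      fix a assume "a \<in> {a. (a, b) \<in> (\<Union>k. U k)}"
      then obtain k where k: "(a, b) \<in> U k" by blast
      then have "k \<le> nat (\<delta> * b + int n)" using Ub [OF k] by simp
      then show "a \<in> (\<Union>k\<in>{..nat (\<delta> * b + int n)}. {a. (a, b) \<in> U k})" using k by blast
    qed
    then show "finite {a. (a, b) \<in> (\<Union>k. U k)}"
    proof (rule finite_subset)
      have "finite {a. (a, b) \<in> U k}" for k using US [of k] unfolding iff by blast
      then show "finite (\<Union>k\<in>{..nat (\<delta> * b + int n)}. {a. (a, b) \<in> U k})" by (intro finite_UN_I finite_atMost)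
    qed
  qed
  moreover have "T \<subseteq> (\<Union>k. U k)" using U(1) by blast
  moreover have "\<nu> + \<sigma> \<in> (\<Union>k. U k)" if \<nu>: "\<nu> \<in> N" and \<sigma>: "\<sigma> \<in> (\<Union>k. U k)" for \<nu> \<sigma>
  proof -
    obtain k where "\<sigma> \<in> U k" using \<sigma> by blast
    then have "\<nu> + \<sigma> \<in> U (Suc k)" unfolding U using \<nu> by blast
    then show ?thesis by blast
  qed
  then have "\<forall>\<nu>\<in>N. \<forall>\<sigma>\<in>(\<Union>k. U k). \<nu> + \<sigma> \<in> (\<Union>k. U k)" by (intro ballI)
  ultimately show "\<exists>T'\<in>supports_y \<delta>. T \<subseteq> T' \<and> (\<forall>\<nu>\<in>N. \<forall>\<sigma>\<in>T'. \<nu> + \<sigma> \<in> T')" by (intro bexI [of _ "(\<Union>k. U k)"] conjI)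
qed

text \<open>Exchanging the two coordinates reduces this to \<open>absorbing_y\<close>.\<close>

lemma absorbing_x:
  assumes \<epsilon>: "\<epsilon> = 1 \<or> \<epsilon> = -1" and N: "finite N" "\<And>\<nu>. \<nu> \<in> N \<Longrightarrow> 1 \<le> \<epsilon> * fst \<nu>"
  shows "absorbing N (supports_x \<epsilon>)"
  unfolding absorbing_def
proof
  note sw = supports_swap [OF \<epsilon>]
  fix T assume "T \<in> supports_x \<epsilon>"
  then have T: "prod.swap ` T \<in> supports_y \<epsilon>" using sw by blast
  have "absorbing (prod.swap ` N) (supports_y \<epsilon>)"
  proof (rule absorbing_y [OF \<epsilon>])
    show "1 \<le> \<epsilon> * snd \<nu>" if "\<nu> \<in> prod.swap ` N" for \<nu> using that N(2) by auto
  qed (use N(1) in simp)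
  from bspec [OF this [unfolded absorbing_def] T]
  obtain T' where T': "T' \<in> supports_y \<epsilon>" "prod.swap ` T \<subseteq> T'"
    "\<forall>\<nu>\<in>prod.swap ` N. \<forall>\<sigma>\<in>T'. \<nu> + \<sigma> \<in> T'"
    by (elim bexE conjE)
  have "prod.swap ` T' \<in> supports_x \<epsilon>" using T'(1) unfolding sw by (simp add: image_image)
  moreover have "T \<subseteq> prod.swap ` T'"
  proof
    fix \<sigma> assume "\<sigma> \<in> T"
    then have "prod.swap \<sigma> \<in> T'" using T'(2) by blast
    then show "\<sigma> \<in> prod.swap ` T'" by (intro image_eqI [of _ _ "prod.swap \<sigma>"]) simp_all
  qed
  moreover have "\<nu> + \<sigma> \<in> prod.swap ` T'" if \<nu>: "\<nu> \<in> N" and \<sigma>: "\<sigma> \<in> prod.swap ` T'" for \<nu> \<sigma>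
  proof -
    obtain \<sigma>' where s: "\<sigma>' \<in> T'" "\<sigma> = prod.swap \<sigma>'" using \<sigma> by blast
    have "prod.swap \<nu> + \<sigma>' \<in> T'" by (rule bspec [OF bspec [OF T'(3) imageI [OF \<nu>]] s(1)])
    then show ?thesis
      by (rule rev_image_eqI) (simp add: s(2) prod_eq_iff)
  qed
  then have "\<forall>\<nu>\<in>N. \<forall>\<sigma>\<in>(prod.swap ` T'). \<nu> + \<sigma> \<in> (prod.swap ` T')" by (intro ballI)
  ultimately show "\<exists>T'\<in>supports_x \<epsilon>. T \<subseteq> T' \<and> (\<forall>\<nu>\<in>N. \<forall>\<sigma>\<in>T'. \<nu> + \<sigma> \<in> T')" by (intro bexI [of _ "(prod.swap ` T')"] conjI)
qed

text \<open>A translated quadrant that contains \<open>T\<close> is itself an admissible support and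
  is stable under the translations in \<open>N\<close>.\<close>

lemma absorbing_xy:
  assumes e: "\<epsilon> = 1 \<or> \<epsilon> = -1" "\<delta> = 1 \<or> \<delta> = -1"
    and N: "\<And>\<nu>. \<nu> \<in> N \<Longrightarrow> 1 \<le> \<epsilon> * fst \<nu> \<and> 1 \<le> \<delta> * snd \<nu>"
  shows "absorbing N (supports_xy \<epsilon> \<delta>)"
  unfolding absorbing_def
proof
  note iff = supports_xy_iff [OF e]
  fix T assume "T \<in> supports_xy \<epsilon> \<delta>"
  then obtain n :: nat where n: "\<And>\<sigma>. \<sigma> \<in> T \<Longrightarrow> - int n \<le> \<epsilon> * fst \<sigma> \<and> - int n \<le> \<delta> * snd \<sigma>"
    unfolding iff by blast
  let ?Q = "{\<sigma>. - int n \<le> \<epsilon> * fst \<sigma> \<and> - int n \<le> \<delta> * snd \<sigma>}"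
  have "?Q \<in> supports_xy \<epsilon> \<delta>" unfolding iff by blast
  moreover have "T \<subseteq> ?Q" using n by blast
  moreover have "\<nu> + \<sigma> \<in> ?Q" if "\<nu> \<in> N" "\<sigma> \<in> ?Q" for \<nu> \<sigma>
  proof -
    have "\<epsilon> * fst (\<nu> + \<sigma>) = \<epsilon> * fst \<nu> + \<epsilon> * fst \<sigma>" "\<delta> * snd (\<nu> + \<sigma>) = \<delta> * snd \<nu> + \<delta> * snd \<sigma>"
      by (simp_all add: algebra_simps)
    moreover have "- int n \<le> \<epsilon> * fst \<sigma> \<and> - int n \<le> \<delta> * snd \<sigma>" using that(2) by simp
    ultimately show ?thesis using N [OF that(1)] unfolding mem_Collect_eq by linarith
  qed
  then have "\<forall>\<nu>\<in>N. \<forall>\<sigma>\<in>?Q. \<nu> + \<sigma> \<in> ?Q" by (intro ballI)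
  ultimately show "\<exists>T'\<in>supports_xy \<epsilon> \<delta>. T \<subseteq> T' \<and> (\<forall>\<nu>\<in>N. \<forall>\<sigma>\<in>T'. \<nu> + \<sigma> \<in> T')" by (intro bexI [of _ "?Q"] conjI)
qed

subsection \<open>Finite domination and Novikov homology\<close>

context based_complex
begin

lemma novikov_coefficientsI: "good_supports \<S> \<Longrightarrow> novikov_coefficients R Rg C d B \<S>"
  by (rule novikov_coefficients.intro [OF based_complex_axioms novikov_coefficients_axioms.intro])

text \<open>The level of the geometric series argument is a linear form; its coefficients
  \<open>p\<close> and \<open>q\<close> are chosen according to the directions in which the ring is
  completed.\<close>

lemma acyclic_of_pushed:
  fixes p q :: int
  assumes G: "rhom 1 G" "\<And>n b. b \<in> B n \<Longrightarrow> pushed G n b \<in> window n N" and N: "finite N"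
    and good: "good_supports \<S>" and abs: "absorbing N \<S>"
    and N1: "\<And>\<nu>. \<nu> \<in> N \<Longrightarrow> 1 \<le> p * fst \<nu> + q * snd \<nu>"
    and bound: "\<And>T. T \<in> \<S> \<Longrightarrow> \<exists>n. \<forall>\<sigma>\<in>T. n \<le> p * fst \<sigma> + q * snd \<sigma>"
  shows "novikov_acyclic R Rg C d \<S>"
proof -
  interpret novikov_coefficients R Rg C d B \<S> by (rule novikov_coefficientsI [OF good])
  obtain N' where N': "finite N'" "kernel_on J N' (kern 1 G)" using kernel_on_kern [OF G(1)] .
  note k = pushed_kernel [OF G]
  show ?thesis
    by (rule acyclic_of_contracting_error [OF N'(2,1) has_degree_kern [OF G(1)] k(1) N k(2) k(3) _ _ abs,
        where lev = "\<lambda>\<sigma>. p * fst \<sigma> + q * snd \<sigma>"])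
      (use N1 bound in \<open>simp_all add: algebra_simps\<close>)
qed

lemma finitely_dominated_imp_acyclic:
  assumes fd: "finitely_dominated Kr C d" and e: "\<epsilon> = 1 \<or> \<epsilon> = -1" "\<delta> = 1 \<or> \<delta> = -1"
  shows "novikov_acyclic R Rg C d (supports_y \<delta>)" "novikov_acyclic R Rg C d (supports_x \<epsilon>)"
    "novikov_acyclic R Rg C d (supports_xy \<epsilon> \<delta>)"
proof -
  obtain h F where h: "khom 1 h" "\<And>n. finite (F n)"
    "\<And>n x. x \<in> carrier (C n) \<Longrightarrow>
      x \<oplus>\<^bsub>C n\<^esub> d (n + 1) (h n x) \<oplus>\<^bsub>C n\<^esub> h (n - 1) (d n x) \<in> window n (F n)"
    by (rule finitely_dominatedE [OF fd]) blast
  obtain E where E: "finite E" "\<And>\<tau>. \<exists>G. rhom 1 G \<and> (\<forall>n. \<forall>b\<in>B n. pushed G n b \<in> window n (tr \<tau> E))"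
    by (rule pushing [OF h]) blast+
  obtain L :: nat where L: "\<And>\<sigma>. \<sigma> \<in> E \<Longrightarrow> \<bar>fst \<sigma>\<bar> \<le> int L \<and> \<bar>snd \<sigma>\<bar> \<le> int L"
    using finite_bound [OF E(1)] by blast
  \<comment> \<open>\<open>E\<close> lies in the box of radius \<open>L\<close>, so a shift by
    \<open>L + 1\<close> in both directions makes every degree at least 1 in the signed coordinates.
    The same \<open>G\<close> then serves all three rings.\<close>
  let ?\<tau> = "(\<epsilon> * (int L + 1), \<delta> * (int L + 1))"
  let ?N = "tr ?\<tau> E"
  obtain G where G: "rhom 1 G" "\<And>n b. b \<in> B n \<Longrightarrow> pushed G n b \<in> window n ?N"
    using E(2) [of ?\<tau>] by blast
  have finN: "finite ?N" using E(1) by simp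
  have N: "1 \<le> \<epsilon> * fst \<nu> \<and> 1 \<le> \<delta> * snd \<nu>" if \<nu>: "\<nu> \<in> ?N" for \<nu>
  proof -
    obtain \<sigma> where s: "\<sigma> \<in> E" "\<nu> = \<sigma> + ?\<tau>" using \<nu> by (rule imageE)
    have "\<epsilon> * fst \<nu> = \<epsilon> * fst \<sigma> + (int L + 1)" "\<delta> * snd \<nu> = \<delta> * snd \<sigma> + (int L + 1)"
      using e by (auto simp: s(2))
    moreover have "- int L \<le> \<epsilon> * fst \<sigma>" "- int L \<le> \<delta> * snd \<sigma>" using e L [OF s(1)] by auto
    ultimately show ?thesis by linarith
  qed
  show "novikov_acyclic R Rg C d (supports_y \<delta>)"
  proof (rule acyclic_of_pushed [OF G finN good_supports_y [OF e(2)], where p = 0 and q = \<delta>])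
    show "absorbing ?N (supports_y \<delta>)" by (rule absorbing_y [OF e(2) finN]) (use N in blast)
    show "1 \<le> 0 * fst \<nu> + \<delta> * snd \<nu>" if "\<nu> \<in> ?N" for \<nu> using N [OF that] by simp
    show "\<exists>n. \<forall>\<sigma>\<in>T. n \<le> 0 * fst \<sigma> + \<delta> * snd \<sigma>" if "T \<in> supports_y \<delta>" for T
      using that unfolding supports_y_iff [OF e(2)] by auto
  qed
  show "novikov_acyclic R Rg C d (supports_x \<epsilon>)"
  proof (rule acyclic_of_pushed [OF G finN good_supports_x [OF e(1)], where p = \<epsilon> and q = 0])
    show "absorbing ?N (supports_x \<epsilon>)" by (rule absorbing_x [OF e(1) finN]) (use N in blast)
    show "1 \<le> \<epsilon> * fst \<nu> + 0 * snd \<nu>" if "\<nu> \<in> ?N" for \<nu> using N [OF that] by simp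
    show "\<exists>n. \<forall>\<sigma>\<in>T. n \<le> \<epsilon> * fst \<sigma> + 0 * snd \<sigma>" if "T \<in> supports_x \<epsilon>" for T
      using that unfolding supports_x_iff [OF e(1)] by auto
  qed
  show "novikov_acyclic R Rg C d (supports_xy \<epsilon> \<delta>)"
  proof (rule acyclic_of_pushed [OF G finN good_supports_xy [OF e], where p = \<epsilon> and q = \<delta>])
    show "absorbing ?N (supports_xy \<epsilon> \<delta>)" by (rule absorbing_xy [OF e]) (rule N)
    show "1 \<le> \<epsilon> * fst \<nu> + \<delta> * snd \<nu>" if "\<nu> \<in> ?N" for \<nu> using N [OF that] by simp
    show "\<exists>n. \<forall>\<sigma>\<in>T. n \<le> \<epsilon> * fst \<sigma> + \<delta> * snd \<sigma>" if T: "T \<in> supports_xy \<epsilon> \<delta>" for T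
    proof -
      obtain n :: nat where n: "\<And>\<sigma>. \<sigma> \<in> T \<Longrightarrow> - int n \<le> \<epsilon> * fst \<sigma> \<and> - int n \<le> \<delta> * snd \<sigma>"
        using T unfolding supports_xy_iff [OF e] by blast
      then have "- int n - int n \<le> \<epsilon> * fst \<sigma> + \<delta> * snd \<sigma>" if "\<sigma> \<in> T" for \<sigma>
        using n [OF that] by linarith
      then show ?thesis by blast
    qed
  qed
qed

lemma finitely_dominated_iff_acyclic:
  "finitely_dominated Kr C d \<longleftrightarrow>
    (\<forall>\<epsilon>\<in>{1, -1}. novikov_acyclic R Rg C d (supports_y \<epsilon>) \<and> novikov_acyclic R Rg C d (supports_x \<epsilon>) \<and>
      (\<forall>\<delta>\<in>{1, -1}. novikov_acyclic R Rg C d (supports_xy \<epsilon> \<delta>)))"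
proof
  assume fd: "finitely_dominated Kr C d"
  then show "\<forall>\<epsilon>\<in>{1, -1}. novikov_acyclic R Rg C d (supports_y \<epsilon>) \<and> novikov_acyclic R Rg C d (supports_x \<epsilon>) \<and>
      (\<forall>\<delta>\<in>{1, -1}. novikov_acyclic R Rg C d (supports_xy \<epsilon> \<delta>))"
    using finitely_dominated_imp_acyclic by simp
next
  assume ac: "\<forall>\<epsilon>\<in>{1, -1}. novikov_acyclic R Rg C d (supports_y \<epsilon>) \<and> novikov_acyclic R Rg C d (supports_x \<epsilon>) \<and>
      (\<forall>\<delta>\<in>{1, -1}. novikov_acyclic R Rg C d (supports_xy \<epsilon> \<delta>))"
  have s: "1 = (1::int) \<or> 1 = (-1::int)" "-1 = (1::int) \<or> -1 = (-1::int)" by simp_all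
  have con: "\<exists>T g. contraction T g \<and> T \<in> \<S>"
    if "novikov_acyclic R Rg C d \<S>" "good_supports \<S>" "{0} \<in> \<S>" for \<S>
    using novikov_coefficients.contraction_exists [OF novikov_coefficientsI [OF that(2)] that(1,3)] by metis
  have y: "\<exists>T g. contraction T g \<and> T \<in> supports_y \<delta>" if "\<delta> = 1 \<or> \<delta> = -1" for \<delta>
    by (rule con [OF _ good_supports_y [OF that] zero_support(1) [OF that that]]) (use ac that in blast)
  have x: "\<exists>T g. contraction T g \<and> T \<in> supports_x \<epsilon>" if "\<epsilon> = 1 \<or> \<epsilon> = -1" for \<epsilon>
    by (rule con [OF _ good_supports_x [OF that] zero_support(2) [OF that that]]) (use ac that in blast)
  have xy: "\<exists>T g. contraction T g \<and> T \<in> supports_xy \<epsilon> \<delta>" if "\<epsilon> = 1 \<or> \<epsilon> = -1" "\<delta> = 1 \<or> \<delta> = -1" for \<epsilon> \<delta>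
    by (rule con [OF _ good_supports_xy [OF that] zero_support(3) [OF that]]) (use ac that in blast)
  obtain TA gA where A: "contraction TA gA" "TA \<in> supports_y 1" using y [OF s(1)] by blast
  obtain TB gB where B: "contraction TB gB" "TB \<in> supports_y (-1)" using y [OF s(2)] by blast
  have t: "\<exists>t. klin 2 t \<and> (\<forall>n z M. finite_hvec_at n z \<longrightarrow> finite (degs (t z) \<inter> half_strip \<epsilon> M)) \<and>
    (\<forall>n z i. finite_hvec_at n z \<longrightarrow> Dm (t z) i \<ominus> t (Dm z) i = mv R (tker gB) z i \<ominus> mv R (tker gA) z i)"
    if e: "\<epsilon> = 1 \<or> \<epsilon> = -1" for \<epsilon>
  proof -
    obtain TX gX where X: "contraction TX gX" "TX \<in> supports_x \<epsilon>" using x [OF e] by blast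
    obtain TP gP where P: "contraction TP gP" "TP \<in> supports_xy \<epsilon> 1" using xy [OF e s(1)] by blast
    obtain TQ gQ where Q: "contraction TQ gQ" "TQ \<in> supports_xy \<epsilon> (-1)" using xy [OF e s(2)] by blast
    show ?thesis
      by (rule homotopy_along_strip [OF e A B X P Q], rule exI) (intro conjI allI impI, assumption+)
  qed
  obtain t1 where t1: "klin 2 t1" "\<And>n z M. finite_hvec_at n z \<Longrightarrow> finite (degs (t1 z) \<inter> half_strip 1 M)"
    "\<And>n z i. finite_hvec_at n z \<Longrightarrow> Dm (t1 z) i \<ominus> t1 (Dm z) i = mv R (tker gB) z i \<ominus> mv R (tker gA) z i"
    using t [OF s(1)] by blast
  obtain t2 where t2: "klin 2 t2" "\<And>n z M. finite_hvec_at n z \<Longrightarrow> finite (degs (t2 z) \<inter> half_strip (-1) M)"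
    "\<And>n z i. finite_hvec_at n z \<Longrightarrow> Dm (t2 z) i \<ominus> t2 (Dm z) i = mv R (tker gB) z i \<ominus> mv R (tker gA) z i"
    using t [OF s(2)] by blast
  show "finitely_dominated Kr C d"
  proof (rule glued_contraction [OF A B t1 t2])
    fix H and M :: int
    assume 1: "klin 1 H" and 2: "\<And>n z. finite_hvec_at n z \<Longrightarrow> finite (degs (H z))"
      and 3: "\<And>n z i. finite_hvec_at n z \<Longrightarrow> Dm (H z) i \<oplus> H (Dm z) i \<ominus> z i \<noteq> \<zero> \<Longrightarrow>
        \<bar>fst (snd i)\<bar> \<le> M \<and> \<bar>snd (snd i)\<bar> \<le> M"
    show ?thesis by (rule finitely_dominated_of_glued [OF 1 2 3])
  qed
qed

end

lemma based_complex_exists: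
  assumes R: "strongly_graded_ring R Rg" and C: "chain_complex R C d" "bounded_complex C" "\<And>n. fg_free R (C n)"
  shows "\<exists>B. based_complex R Rg C d B"
proof -
  have "\<exists>Bn. is_basis R (C n) Bn \<and> (carrier (C n) = {\<zero>\<^bsub>C n\<^esub>} \<longrightarrow> Bn = {})" for n
  proof (cases "carrier (C n) = {\<zero>\<^bsub>C n\<^esub>}")
    \<comment> \<open>Over the zero ring a zero module also has a nonempty basis. Choosing the empty
      one makes the bases empty outside finitely many chain degrees.\<close>
    case True
    have "bij_betw (\<lambda>c. \<Oplus>\<^bsub>C n\<^esub>b\<in>{}. b \<odot>\<^sub>r\<^bsub>C n\<^esub> c b) ({} \<rightarrow>\<^sub>E carrier R) (carrier (C n))"
    proof -
      interpret right_module R "C n" using C(1) by (simp add: chain_complex_def)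
      show ?thesis using True by (simp add: bij_betw_def)
    qed
    then show ?thesis unfolding is_basis_def by blast
  next
    case False
    then show ?thesis using C(3) [of n] unfolding fg_free_def is_basis_def by blast
  qed
  then obtain B where B: "\<And>n. is_basis R (C n) (B n)" "\<And>n. carrier (C n) = {\<zero>\<^bsub>C n\<^esub>} \<Longrightarrow> B n = {}"
    by metis
  have "{n. B n \<noteq> {}} \<subseteq> {n. carrier (C n) \<noteq> {\<zero>\<^bsub>C n\<^esub>}}" using B(2) by blast
  then have "finite {n. B n \<noteq> {}}"
    using C(2) unfolding bounded_complex_def by (rule finite_subset)
  then have "based_complex R Rg C d B"
    by (intro based_complex.intro based_complex_axioms.intro R C(1) B(1))
  then show ?thesis by blast
qed

theorem theorem1p2p1:
  fixes R :: "('a, 'm) ring_scheme"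
    and Rg :: "int \<times> int \<Rightarrow> 'a set"
    and C :: "int \<Rightarrow> ('a, 'b, 'n) rmodule_scheme"
    and d :: "int \<Rightarrow> 'b \<Rightarrow> 'b"
  assumes "strongly_graded_ring R Rg"
    and "chain_complex R C d"
    and "bounded_complex C"
    and "\<And>n. fg_free R (C n)"
  shows "finitely_dominated (R\<lparr>carrier := Rg (0, 0)\<rparr>) C d \<longleftrightarrow>
      novikov_acyclic R Rg C d (supports_y 1) \<and>
      novikov_acyclic R Rg C d (supports_y (-1)) \<and>
      novikov_acyclic R Rg C d (supports_x 1) \<and>
      novikov_acyclic R Rg C d (supports_x (-1)) \<and>
      novikov_acyclic R Rg C d (supports_xy 1 1) \<and>
      novikov_acyclic R Rg C d (supports_xy (-1) (-1)) \<and>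
      novikov_acyclic R Rg C d (supports_xy 1 (-1)) \<and>
      novikov_acyclic R Rg C d (supports_xy (-1) 1)"
proof -
  obtain B where "based_complex R Rg C d B" using based_complex_exists [OF assms] by blast
  then interpret based_complex R Rg C d B .
  show ?thesis
    using finitely_dominated_iff_acyclic unfolding zero_prod_def by auto
qed

end
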